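(* Let $(X,d,\mu)$ be a space of homogeneous type with $\mu(X)=\infty$ and $\mu(\{x\})=0$ for every $x\in X$. Let $p\in(1,\infty)$, let $\lambda_1,\lambda_2\in A_p$, and put $\nu:=\lambda_1^{1/p}\lambda_2^{-1/p}$. Suppose $b\in \mathrm{BMO}_\nu(X)$. For a sparse family $\mathcal S$ of dyadic cubes let $\mathcal T_{\mathcal S,b}$ be the Bloom sparse operator $$\mathcal T_{\mathcal S,b}(f)(x)=\sum_{Q\in\mathcal S}|b(x)-b_Q|\,f_Q\,\chi_Q(x),\qquad f\in L^1_{\rm loc}(X).$$ (i) If $b\in \mathrm{VMO}_\nu(X)$, then for every $0<\eta<1$ and for every $\eta$-sparse family $\mathcal S$ in $X$, the operator $\mathcal T_{\mathcal S,b}$ is compact from $L^p_{\lambda_1}(X)$ to $L^p_{\lambda_2}(X)$. (ii) If for every $0<\eta<1$ and for every $\eta$-sparse family $\mathcal S$ in $X$, the operator $\mathcal T_{\mathcal S,b}$ is compact from $L^p_{\lambda_1}(X)$ to $L^p_{\lambda_2}(X)$, then $b\in \mathrm{VMO}_\nu(X)$.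
   Context: Space of homogeneous type: $X$ is a set with a quasi-metric $d:X\times X\to[0,\infty)$ (symmetric, $d(x,y)=0$ iff $x=y$, and $d(x,y)\le A_0[d(x,z)+d(z,y)]$ for a constant $A_0\ge1$) and a nonzero measure $\mu$ that is doubling: $\mu(B(x,2r))\le C_\mu\,\mu(B(x,r))<\infty$ for all $x\in X$, $r>0$, where $B(x,r)=\{y: d(x,y)<r\}$. Notation: $f_E=\frac1{\mu(E)}\int_E f\,d\mu$; for a weight $w$ (nonnegative locally integrable function), $w(E)=\int_E w\,d\mu$ and $L^p_w(X)$ is the $L^p$ space with respect to $w\,d\mu$; $r(B)$ is the radius of the ball $B$. $A_p$ ($1<p<\infty$): $w\in A_p$ iff $\sup_B\big(\frac1{\mu(B)}\int_B w\,d\mu\big)\big(\frac1{\mu(B)}\int_B w^{-1/(p-1)}d\mu\big)^{p-1}<\infty$, supremum over all balls. $\mathrm{BMO}_\nu(X)$: the functions $b\in L^1_{\rm loc}(X)$ with $\sup_B\frac1{\nu(B)}\int_B|b-b_B|\,d\mu<\infty$, supremum over all balls. $\mathrm{VMO}_\nu(X)$: the functions $b\in \mathrm{BMO}_\nu(X)$ such that (a) $\lim_{a\to0}\sup_{r(B)=a}\frac1{\nu(B)}\int_B|b-b_B|\,d\mu=0$; (b) $\lim_{a\to\infty}\sup_{r(B)=a}\frac1{\nu(B)}\int_B|b-b_B|\,d\mu=0$; (c) $\lim_{a\to\infty}\sup_{d(x_0,B)>a}\frac1{\nu(B)}\int_B|b-b_B|\,d\mu=0$, where the suprema are over balls $B\subset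 X$, $x_0\in X$ is a fixed point and $d(x_0,B)=\inf_{x\in B}d(x,x_0)$. System of dyadic cubes with parameters $\delta\in(0,1)$, $0<c_1\le C_1<\infty$: a countable family $\mathcal D=\bigcup_{k\in\mathbb Z}\mathcal D_k$, $\mathcal D_k=\{Q^k_\alpha\}_\alpha$, of Borel sets such that: for each $k$, $X$ is the disjoint union of the $Q^k_\alpha$; if $\ell\ge k$ then either $Q^\ell_\beta\subseteq Q^k_\alpha$ or $Q^\ell_\beta\cap Q^k_\alpha=\emptyset$; for each $(k,\alpha)$ and $\ell\le k$ there is a unique $\beta$ with $Q^k_\alpha\subseteq Q^\ell_\beta$; each $Q^k_\alpha$ is the union of at most $M$ (a fixed constant) cubes of $\mathcal D_{k+1}$; $B(x^k_\alpha,c_1\delta^k)\subseteq Q^k_\alpha\subseteq B(x^k_\alpha,C_1\delta^k)=:B(Q^k_\alpha)$ for some center $x^k_\alpha\in Q^k_\alpha$; and if $\ell\ge k$ and $Q^\ell_\beta\subseteq Q^k_\alpha$ then $B(Q^\ell_\beta)\subseteq B(Q^k_\alpha)$. $\eta$-sparse family in $X$ ($0<\eta<1$): a collection $\mathcal S\subset\mathcal D$, for an arbitrary system of dyadic cubes $\mathcal D$ on $X$, such that for each $Q\in\mathcal S$ there is a measurable $E_Q\subset Q$ with $\mu(E_Q)\ge\eta\,\mu(Q)$, and the sets $\{E_Q\}_{Q\in\mathcal S}$ have finite overlap (i.e. $\sum_{Q\in\mathcal S}\chi_{E_Q}$ is bounded by a constant). *)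

theory Defs
  imports "HOL-Analysis.Analysis"
begin

section \<open>Spaces of homogeneous type\<close>

text \<open>The underlying set $X$ is the space of the measure \<open>M\<close>. A quasi-metric ball need not be open.\<close>

definition qball :: "'a measure \<Rightarrow> ('a \<Rightarrow> 'a \<Rightarrow> real) \<Rightarrow> 'a \<Rightarrow> real \<Rightarrow> 'a set" where
  "qball M d x r = {y \<in> space M. d x y < r}"

definition qopen :: "'a measure \<Rightarrow> ('a \<Rightarrow> 'a \<Rightarrow> real) \<Rightarrow> 'a set \<Rightarrow> bool" where
  "qopen M d U \<longleftrightarrow> U \<subseteq> space M \<and> (\<forall>x\<in>U. \<exists>r>0. qball M d x r \<subseteq> U)"

definition qborel :: "'a measure \<Rightarrow> ('a \<Rightarrow> 'a \<Rightarrow> real) \<Rightarrow> 'a set set" where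
  "qborel M d = sigma_sets (space M) {U. qopen M d U}"

text \<open>
  The measure is defined (at least) on the Borel sets and the balls, and every measurable set is
  Borel up to a null set. This covers Borel measures (when the balls are Borel) as well as their
  completions.
\<close>

locale homogeneous_type =
  fixes M :: "'a measure" and d :: "'a \<Rightarrow> 'a \<Rightarrow> real" and A\<^sub>0 C\<^sub>\<mu> :: real
  assumes d_nonneg: "x \<in> space M \<Longrightarrow> y \<in> space M \<Longrightarrow> 0 \<le> d x y"
    and d_sym: "x \<in> space M \<Longrightarrow> y \<in> space M \<Longrightarrow> d x y = d y x"
    and d_eq_0_iff: "x \<in> space M \<Longrightarrow> y \<in> space M \<Longrightarrow> d x y = 0 \<longleftrightarrow> x = y"
    and A0_ge_1: "1 \<le> A\<^sub>0"
    and d_triangle: "x \<in> space M \<Longrightarrow> y \<in> space M \<Longrightarrow> z \<in> space M \<Longrightarrow>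
      d x y \<le> A\<^sub>0 * (d x z + d z y)"
    and qborel_sets: "qborel M d \<subseteq> sets M"
    and qball_sets: "x \<in> space M \<Longrightarrow> 0 < r \<Longrightarrow> qball M d x r \<in> sets M"
    and regular: "A \<in> sets M \<Longrightarrow> \<exists>B\<in>qborel M d. (A - B) \<union> (B - A) \<in> null_sets M"
    and nonzero: "emeasure M (space M) \<noteq> 0"
    and doubling: "x \<in> space M \<Longrightarrow> 0 < r \<Longrightarrow>
      emeasure M (qball M d x (2 * r)) \<le> ennreal C\<^sub>\<mu> * emeasure M (qball M d x r)"
    and finite_qball: "x \<in> space M \<Longrightarrow> 0 < r \<Longrightarrow> emeasure M (qball M d x r) < \<infinity>"

section \<open>Averages, weights and function spaces\<close>

definition avg :: "'a measure \<Rightarrow> 'a set \<Rightarrow> ('a \<Rightarrow> 'b::{banach, second_countable_topology}) \<Rightarrow> 'b" where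
  "avg M E f = (1 / measure M E) *\<^sub>R (LINT x:E|M. f x)"

text \<open>Local integrability means integrability on every ball.\<close>

definition L1_loc :: "'a measure \<Rightarrow> ('a \<Rightarrow> 'a \<Rightarrow> real) \<Rightarrow>
    ('a \<Rightarrow> 'b::{banach, second_countable_topology}) set" where
  "L1_loc M d = {f. \<forall>x\<in>space M. \<forall>r>0. set_integrable M (qball M d x r) f}"

definition weight :: "'a measure \<Rightarrow> ('a \<Rightarrow> 'a \<Rightarrow> real) \<Rightarrow> ('a \<Rightarrow> real) \<Rightarrow> bool" where
  "weight M d w \<longleftrightarrow> w \<in> L1_loc M d \<and> (\<forall>x\<in>space M. 0 \<le> w x)"

text \<open>
  Finiteness of the supremum is spelled out: the integrals of $w^{-1/(p-1)}$ over balls are finite,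
  and the products are bounded. Positivity almost everywhere must be stated separately because
  $0^{-1/(p-1)}$ is $\infty$, whereas \<open>0 powr a\<close> is \<open>0\<close>.
\<close>

definition Ap :: "'a measure \<Rightarrow> ('a \<Rightarrow> 'a \<Rightarrow> real) \<Rightarrow> real \<Rightarrow> ('a \<Rightarrow> real) set" where
  "Ap M d p = {w. weight M d w \<and> (AE x in M. 0 < w x) \<and>
     (\<lambda>x. w x powr (- 1 / (p - 1))) \<in> L1_loc M d \<and>
     bdd_above {avg M (qball M d x r) w *
                avg M (qball M d x r) (\<lambda>y. w y powr (- 1 / (p - 1))) powr (p - 1)
                | x r. x \<in> space M \<and> 0 < r}}"

definition osc :: "'a measure \<Rightarrow> ('a \<Rightarrow> real) \<Rightarrow>
    ('a \<Rightarrow> 'b::{banach, second_countable_topology}) \<Rightarrow> 'a set \<Rightarrow> real" where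
  "osc M \<nu> b B = (1 / (LINT x:B|M. \<nu> x)) * (LINT x:B|M. norm (b x - avg M B b))"

definition BMO :: "'a measure \<Rightarrow> ('a \<Rightarrow> 'a \<Rightarrow> real) \<Rightarrow> ('a \<Rightarrow> real) \<Rightarrow>
    ('a \<Rightarrow> 'b::{banach, second_countable_topology}) set" where
  "BMO M d \<nu> = {b \<in> L1_loc M d.
     bdd_above {osc M \<nu> b (qball M d x r) | x r. x \<in> space M \<and> 0 < r}}"

text \<open>
  The real-valued suprema are taken over sets that are bounded because \<open>b\<close> is in \<open>BMO M d \<nu>\<close>, and
  nonempty when $X$ is unbounded, which follows from $\mu(X)=\infty$.
\<close>

definition VMO :: "'a measure \<Rightarrow> ('a \<Rightarrow> 'a \<Rightarrow> real) \<Rightarrow> 'a \<Rightarrow> ('a \<Rightarrow> real) \<Rightarrow>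
    ('a \<Rightarrow> 'b::{banach, second_countable_topology}) set" where
  "VMO M d x\<^sub>0 \<nu> = {b \<in> BMO M d \<nu>.
     ((\<lambda>a. SUP x\<in>space M. osc M \<nu> b (qball M d x a)) \<longlongrightarrow> 0) (at_right 0) \<and>
     ((\<lambda>a. SUP x\<in>space M. osc M \<nu> b (qball M d x a)) \<longlongrightarrow> 0) at_top \<and>
     ((\<lambda>a. SUP (x, r)\<in>{(x, r). x \<in> space M \<and> 0 < r \<and> a < (INF y\<in>qball M d x r. d y x\<^sub>0)}.
         osc M \<nu> b (qball M d x r)) \<longlongrightarrow> 0) at_top}"

section \<open>Dyadic cubes and sparse families\<close>

text \<open>
  \<open>D k\<close> is the set of cubes of generation \<open>k\<close>, and \<open>c k Q\<close> is the centre of \<open>Q\<close> as a cube of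
  generation \<open>k\<close>; the same set may be a cube of several generations.
\<close>

definition dyadic_system :: "'a measure \<Rightarrow> ('a \<Rightarrow> 'a \<Rightarrow> real) \<Rightarrow> real \<Rightarrow> real \<Rightarrow> real \<Rightarrow> nat \<Rightarrow>
    (int \<Rightarrow> 'a set \<Rightarrow> 'a) \<Rightarrow> (int \<Rightarrow> 'a set set) \<Rightarrow> bool" where
  "dyadic_system M d \<delta> c\<^sub>1 C\<^sub>1 N c D \<longleftrightarrow>
     0 < \<delta> \<and> \<delta> < 1 \<and> 0 < c\<^sub>1 \<and> c\<^sub>1 \<le> C\<^sub>1 \<and>
     (\<forall>k. countable (D k) \<and> D k \<subseteq> qborel M d \<and> disjoint (D k) \<and> \<Union>(D k) = space M) \<and>
     (\<forall>k l. k \<le> l \<longrightarrow> (\<forall>Q\<in>D k. \<forall>R\<in>D l. R \<subseteq> Q \<or> R \<inter> Q = {})) \<and>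
     (\<forall>k l. l \<le> k \<longrightarrow> (\<forall>Q\<in>D k. \<exists>!R. R \<in> D l \<and> Q \<subseteq> R)) \<and>
     (\<forall>k. \<forall>Q\<in>D k. \<exists>F\<subseteq>D (k + 1). finite F \<and> card F \<le> N \<and> Q = \<Union>F) \<and>
     (\<forall>k. \<forall>Q\<in>D k. c k Q \<in> Q \<and> qball M d (c k Q) (c\<^sub>1 * \<delta> powi k) \<subseteq> Q \<and>
        Q \<subseteq> qball M d (c k Q) (C\<^sub>1 * \<delta> powi k)) \<and>
     (\<forall>k l. k \<le> l \<longrightarrow> (\<forall>Q\<in>D k. \<forall>R\<in>D l. R \<subseteq> Q \<longrightarrow>
        qball M d (c l R) (C\<^sub>1 * \<delta> powi l) \<subseteq> qball M d (c k Q) (C\<^sub>1 * \<delta> powi k)))"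

definition sparse_family :: "'a measure \<Rightarrow> ('a \<Rightarrow> 'a \<Rightarrow> real) \<Rightarrow> real \<Rightarrow> 'a set set \<Rightarrow> bool" where
  "sparse_family M d \<eta> S \<longleftrightarrow>
     (\<exists>\<delta> c\<^sub>1 C\<^sub>1 N c D. dyadic_system M d \<delta> c\<^sub>1 C\<^sub>1 N c D \<and> S \<subseteq> (\<Union>k. D k)) \<and>
     (\<exists>E. (\<forall>Q\<in>S. E Q \<in> sets M \<and> E Q \<subseteq> Q \<and> \<eta> * measure M Q \<le> measure M (E Q)) \<and>
        (\<exists>K. \<forall>x\<in>space M. finite {Q \<in> S. x \<in> E Q} \<and> card {Q \<in> S. x \<in> E Q} \<le> K))"

section \<open>The Bloom sparse operator and compactness\<close>

text \<open>
  The unconditional sum \<open>infsum\<close> is \<open>0\<close> at points where the series does not converge absolutely.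
\<close>

definition bloom_sparse :: "'a measure \<Rightarrow> 'a set set \<Rightarrow>
    ('a \<Rightarrow> 'b::{banach, second_countable_topology}) \<Rightarrow>
    ('a \<Rightarrow> 'c::{banach, second_countable_topology}) \<Rightarrow> 'a \<Rightarrow> 'c" where
  "bloom_sparse M S b f x =
     (\<Sum>\<^sub>\<infinity>Q\<in>S. (norm (b x - avg M Q b) * indicat_real Q x) *\<^sub>R avg M Q f)"

text \<open>Elements of $L^p_w$ are represented by functions, not by classes modulo null sets.\<close>

definition Lp :: "'a measure \<Rightarrow> real \<Rightarrow> ('a \<Rightarrow> real) \<Rightarrow>
    ('a \<Rightarrow> 'b::{banach, second_countable_topology}) set" where
  "Lp M p w = {f \<in> borel_measurable M. integrable (density M (\<lambda>x. ennreal (w x))) (\<lambda>x. norm (f x) powr p)}"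

definition Lp_norm :: "'a measure \<Rightarrow> real \<Rightarrow> ('a \<Rightarrow> real) \<Rightarrow>
    ('a \<Rightarrow> 'b::{banach, second_countable_topology}) \<Rightarrow> real" where
  "Lp_norm M p w f = (LINT x|density M (\<lambda>x. ennreal (w x)). norm (f x) powr p) powr (1 / p)"

definition compact_Lp_op :: "'a measure \<Rightarrow> real \<Rightarrow> ('a \<Rightarrow> real) \<Rightarrow> ('a \<Rightarrow> real) \<Rightarrow>
    (('a \<Rightarrow> 'b::{banach, second_countable_topology}) \<Rightarrow>
     ('a \<Rightarrow> 'b::{banach, second_countable_topology})) \<Rightarrow> bool" where
  "compact_Lp_op M p w\<^sub>1 w\<^sub>2 T \<longleftrightarrow>
     (\<forall>f\<in>Lp M p w\<^sub>1. T f \<in> Lp M p w\<^sub>2) \<and>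
     (\<forall>F :: nat \<Rightarrow> 'a \<Rightarrow> 'b.
        (\<forall>n. F n \<in> Lp M p w\<^sub>1) \<longrightarrow> bounded (range (\<lambda>n. Lp_norm M p w\<^sub>1 (F n))) \<longrightarrow>
        (\<exists>r g. strict_mono (r :: nat \<Rightarrow> nat) \<and> g \<in> Lp M p w\<^sub>2 \<and>
           (\<lambda>n. Lp_norm M p w\<^sub>2 (\<lambda>x. T (F (r n)) x - g x)) \<longlonglongrightarrow> 0))"

end

theory Submission
 imports Defs "HOL-Library.Diagonal_Subsequence"
begin

text \<open>
Write $f_Q$ for the mean of $f$ over a cube $Q$ and $\mathrm{osc}(Q)$ for the weighted oscillation
$\nu(Q)^{-1}\int_Q |b-b_Q|\,d\mu$.

Compactness of the sparse operator. It suffices that the operator is, in norm, a limit of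
operators given by finite subfamilies, because each summand $f\mapsto |b-b_Q|\,f_Q\chi_Q$ has rank
one (lemma \<open>compact_from_tails\<close>). If $b$ is in VMO then only finitely many cubes of a
dyadic system have oscillation above a given $\varepsilon$ (\<open>finite_large_osc\<close>). The
tail is controlled by a two-weight estimate that is quantitative in the oscillation
(\<open>bloom_main\<close>): a Calderon-Zygmund stopping argument enlarges the sparse family so
that $|b-b_Q|$ is dominated on $Q$ by the sum of the mean oscillations over the members of the
enlarged family between the point and $Q$; interchanging the sums leaves a composition of two
sparse operators, the first on $L^p_{\lambda_1}$ and the second on $L^p_{\lambda_2}$, with $\nu$
between them. Sparse operators are bounded on $A_p$-weighted spaces by the Carleson embedding,
which rests on the dyadic maximal inequality. The finitely many cubes $R$ of large oscillation
enter only through the sums of $f_Q$ over those $Q$ in the tail that contain $R$, and these are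
small because, for the weight $\sigma_1$ dual to $\lambda_1$, the quotients
$\sigma_1(Q)^{1/q}/\mu(Q)$ are summable along the chain of such $Q$
(\<open>tail_sum_bound\<close>).

Necessity of VMO. If $b$ is in BMO but not in VMO, there are balls of oscillation at least a fixed
$\varepsilon>0$ whose radii tend to $0$, or for which the sum of the radius and the distance from
$x_0$ to the centre tends to infinity. After passing to a subsequence the centres that belong to
one scale are separated, so that one dyadic system contains a cube around each ball
(\<open>dyadic_system_with_centers\<close>), still of large oscillation. Let $\sigma$ be the
weight dual to $\lambda_2$. Either the $\sigma$-measure of the overlaps tends to zero, or the
$\sigma$-measures tend to infinity; in both cases a further subsequence has pairwise disjoint
parts $E_j\subseteq Q_j$ that carry all but a small share of $\sigma(Q_j)$. By the $A_p$ condition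
the family is sparse. Normalised indicators of the cubes are mapped to functions whose
$L^p_{\lambda_2}$ norms over the disjoint sets $E_j$ stay away from zero: the oscillation on
$Q_j\setminus E_j$ is negligible by Hoelder and the $L^p$ bound for $|b-b_Q|$
(\<open>John_Nirenberg\<close>). Such a sequence has no convergent subsequence.
\<close>

section \<open>Weighted norms, duality and the dyadic maximal inequality\<close>

text \<open>
Along a chain the running maximum of $a$ changes from one set to the next larger one, so the
differences telescope. This linearises the maximal function in the proof of Doob's inequality.
\<close>
lemma chain_telescope_Max:
 fixes a :: "'a set => real" and \<phi> :: "real => real"
 assumes "finite C" and "!!Q R. Q : C ==> R : C ==> Q \<subseteq> R | R \<subseteq> Q"
 shows "(\<Sum>Q\<in>C. \<phi> (Max (insert 0 (a ` {R\<in>C. Q \<subseteq> R}))) - \<phi> (Max (insert 0 (a ` {R\<in>C. Q \<subset> R}))))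
  = \<phi> (Max (insert 0 (a ` C))) - \<phi> 0"
 using assms
proof (induction "card C" arbitrary: C)
 case 0
 then show ?case by simp
next
 case (Suc n)
 have ne: "C ~= {}" using Suc by auto
 obtain Q0 where Q0: "Q0 : C" "!!R. R : C ==> R \<subseteq> Q0 ==> R = Q0"
  using finite_has_minimal[OF Suc.prems(1) ne] by metis
 have Q0min: "Q0 \<subseteq> R" if "R : C" for R using Q0 Suc.prems(2) that by blast
 define C' where "C' = C - {Q0}"
 have fin': "finite C'" and card': "n = card C'"
  using Suc Q0 by (auto simp: C'_def)
 have tot': "Q \<subseteq> R | R \<subseteq> Q" if "Q : C'" "R : C'" for Q R using Suc.prems(2) that by (auto simp: C'_def)
 have eq1: "{R\<in>C. Q \<subseteq> R} = {R\<in>C'. Q \<subseteq> R}" if "Q : C'" for Q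
  using that Q0min Q0 by (auto simp: C'_def)
 have eq2: "{R\<in>C. Q \<subset> R} = {R\<in>C'. Q \<subset> R}" if "Q : C'" for Q
  using that Q0min Q0 by (auto simp: C'_def)
 have eq3: "{R\<in>C. Q0 \<subseteq> R} = C" using Q0min by auto
 have eq4: "{R\<in>C. Q0 \<subset> R} = C'" using Q0min Q0 by (auto simp: C'_def)
 let ?g = "%C Q. \<phi> (Max (insert 0 (a ` {R\<in>C. Q \<subseteq> R}))) - \<phi> (Max (insert 0 (a ` {R\<in>C. Q \<subset> R})))"
 have "(\<Sum>Q\<in>C. ?g C Q) = ?g C Q0 + (\<Sum>Q\<in>C'. ?g C Q)"
  unfolding C'_def using sum.remove[OF Suc.prems(1) Q0(1)] by blast
 also have "(\<Sum>Q\<in>C'. ?g C Q) = (\<Sum>Q\<in>C'. ?g C' Q)"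
  by (intro sum.cong refl) (simp only: eq1 eq2)
 also have "... = \<phi> (Max (insert 0 (a ` C'))) - \<phi> 0"
  using Suc.hyps(1)[OF card' fin' tot'] by blast
 finally show ?case by (simp only: eq3 eq4)
qed

text \<open>
A bound for a weighted $L^p$ norm, stated with nonnegative integrals so that finiteness is part of
the assertion.
\<close>
definition WL :: "'a measure => real => ('a => real) => ('a => real) => real => bool" where
 "WL M p w f A \<longleftrightarrow> 0 <= A & f : borel_measurable M \<and>
   (\<integral>\<^sup>+x. ennreal (\<bar>f x\<bar> powr p * w x) \<partial>M) <= ennreal (A powr p)"

text \<open>
The exponents and the weights $w$, $\sigma=w^{-q/p}$ of dual spaces, in the symmetric form
$w^{1/p}\sigma^{1/q}=1$.
\<close>
definition dual_w :: "'a measure => real => real => ('a => real) => ('a => real) => bool" where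
 "dual_w M p q w sg \<longleftrightarrow> 1 < p & 1 < q & 1/p + 1/q = 1 \<and>
   w : borel_measurable M & sg : borel_measurable M \<and>
   (\<forall>x\<in>space M. 0 <= w x & 0 <= sg x) \<and>
   (AE x in M. 0 < w x & 0 < sg x & w x powr (1/p) * sg x powr (1/q) = 1)"

lemma dual_w_sym: "dual_w M p q w sg ==> dual_w M q p sg w"
 unfolding dual_w_def by (auto simp: add.commute mult.commute)

lemma conj_exp:
 fixes p q :: real
 assumes "1 < p" "1 < q" "1/p + 1/q = 1"
 shows "p * q = p + q" "(p - 1) * q = p" "q / p = q - 1" "q = p / (p - 1)" "p / q = p - 1"
proof -
 show "p * q = p + q" using assms by (simp add: field_simps)
 then show "(p - 1) * q = p" by (simp add: algebra_simps)
 then show "q = p / (p - 1)" using assms by (simp add: field_simps)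
 show "q / p = q - 1" using assms \<open>p * q = p + q\<close> by (simp add: field_simps)
 show "p / q = p - 1" using assms \<open>p * q = p + q\<close> by (simp add: field_simps)
qed

lemma WL_zero_AE:
 assumes "WL M p w f 0" "w : borel_measurable M" "AE x in M. 0 < w x"
 shows "AE x in M. f x = 0"
proof -
 have [measurable]: "f : borel_measurable M" "w : borel_measurable M" using assms by (auto simp: WL_def)
 have "(\<integral>\<^sup>+x. ennreal (\<bar>f x\<bar> powr p * w x) \<partial>M) = 0" using assms by (auto simp: WL_def)
 then have "AE x in M. ennreal (\<bar>f x\<bar> powr p * w x) = 0"
  by (subst (asm) nn_integral_0_iff_AE) auto
 with assms(3) show ?thesis
  by eventually_elim (auto simp: ennreal_eq_0_iff mult_le_0_iff)
qed

lemma Holder_weighted: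
 assumes dw: "dual_w M p q w sg" and f: "WL M p w f A" and g: "WL M q sg g B"
 shows "(\<integral>\<^sup>+x. ennreal \<bar>f x * g x\<bar> \<partial>M) <= ennreal (A * B)"
proof -
 have [measurable]: "f : borel_measurable M" "g : borel_measurable M"
   "w : borel_measurable M" "sg : borel_measurable M"
  using assms by (auto simp: WL_def dual_w_def)
 have pq: "1 < p" "1 < q" "1/p + 1/q = 1" using dw by (auto simp: dual_w_def)
 have AB: "0 <= A" "0 <= B" using f g by (auto simp: WL_def)
 have ae: "AE x in M. 0 < w x & 0 < sg x & w x powr (1/p) * sg x powr (1/q) = 1"
  using dw by (auto simp: dual_w_def)
 show ?thesis
 proof (cases "A = 0 | B = 0")
  case True
  have "AE x in M. f x * g x = 0"
   using True
  proof
   assume "A = 0"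
   then have "AE x in M. f x = 0" using WL_zero_AE[of M p w f] f ae by auto
   then show ?thesis by eventually_elim auto
  next
   assume "B = 0"
   then have "AE x in M. g x = 0" using WL_zero_AE[of M q sg g] g ae by auto
   then show ?thesis by eventually_elim auto
  qed
  then have "AE x in M. ennreal \<bar>f x * g x\<bar> = 0" by eventually_elim simp
  then have "(\<integral>\<^sup>+x. ennreal \<bar>f x * g x\<bar> \<partial>M) = (\<integral>\<^sup>+x. 0 \<partial>M)"
   by (rule nn_integral_cong_AE)
  then show ?thesis by simp
 next
  case False
  then have A: "0 < A" and B: "0 < B" using AB by auto
  define c d where "c = A * B / (p * A powr p)" and "d = A * B / (q * B powr q)"
  have cd: "0 <= c" "0 <= d" using A B pq by (auto simp: c_def d_def)
  have "(\<integral>\<^sup>+x. ennreal \<bar>f x * g x\<bar> \<partial>M) \<le>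
   (\<integral>\<^sup>+x. ennreal c * ennreal (\<bar>f x\<bar> powr p * w x) + ennreal d * ennreal (\<bar>g x\<bar> powr q * sg x) \<partial>M)"
  proof (intro nn_integral_mono_AE, use ae in eventually_elim)
   case (elim x)
   let ?u = "\<bar>f x\<bar> * w x powr (1/p) / A" and ?v = "\<bar>g x\<bar> * sg x powr (1/q) / B"
   have "?u * ?v <= ?u powr p / p + ?v powr q / q"
    using Youngs_inequality[of p q ?u ?v] pq A B elim by auto
   also have "?u powr p = \<bar>f x\<bar> powr p * w x / A powr p"
    using elim A pq by (simp add: powr_divide powr_mult powr_powr)
   also have "?v powr q = \<bar>g x\<bar> powr q * sg x / B powr q"
    using elim B pq by (simp add: powr_divide powr_mult powr_powr)
   finally have le: "?u * ?v <= \<bar>f x\<bar> powr p * w x / A powr p / p + \<bar>g x\<bar> powr q * sg x / B powr q / q" .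
   have "\<bar>f x * g x\<bar> = A * B * (?u * ?v)"
    using elim A B by (simp add: abs_mult field_simps)
   also have "... <= A * B * (\<bar>f x\<bar> powr p * w x / A powr p / p + \<bar>g x\<bar> powr q * sg x / B powr q / q)"
    using le A B by (intro mult_left_mono) auto
   also have "... = c * (\<bar>f x\<bar> powr p * w x) + d * (\<bar>g x\<bar> powr q * sg x)"
    by (simp add: c_def d_def field_simps)
   finally show ?case using cd elim
    by (simp add: ennreal_mult[symmetric] ennreal_plus[symmetric] ennreal_leI del: ennreal_plus)
  qed
  also have "... = ennreal c * (\<integral>\<^sup>+x. ennreal (\<bar>f x\<bar> powr p * w x) \<partial>M) + ennreal d * (\<integral>\<^sup>+x. ennreal (\<bar>g x\<bar> powr q * sg x) \<partial>M)"
   by (subst nn_integral_add) (auto simp: nn_integral_cmult)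
  also have "... <= ennreal c * ennreal (A powr p) + ennreal d * ennreal (B powr q)"
   using f g by (intro add_mono mult_left_mono) (auto simp: WL_def)
  also have "... = ennreal (c * A powr p + d * B powr q)"
   using cd by (simp add: ennreal_mult[symmetric] ennreal_plus[symmetric] del: ennreal_plus)
  also have "c * A powr p + d * B powr q = A * B / p + A * B / q"
   using A B pq by (simp add: c_def d_def)
  also have "... = A * B * (1/p + 1/q)" by (simp add: distrib_left)
  also have "... = A * B" using pq by simp
  finally show ?thesis .
 qed
qed

lemma dual_w_one: "1 < p ==> 1 < q ==> 1/p + 1/q = 1 ==> dual_w M p q (%_. 1) (%_. 1)"
 by (auto simp: dual_w_def)

lemma Holder_sum:
 fixes a b :: "'i => real"
 assumes pq: "1 < p" "1 < q" "1/p + 1/q = 1" and fin: "finite F" and AB: "0 <= A" "0 <= B"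
  and a: "!!i. i : F ==> 0 <= a i" and b: "!!i. i : F ==> 0 <= b i"
  and sa: "(\<Sum>i\<in>F. a i powr p) <= A powr p" and sb: "(\<Sum>i\<in>F. b i powr q) <= B powr q"
 shows "(\<Sum>i\<in>F. a i * b i) <= A * B"
proof -
 have "WL (count_space F) p (%_. 1) a A"
  unfolding WL_def using AB a sa fin
  by (auto simp: nn_integral_count_space_finite sum_ennreal ennreal_leI cong: sum.cong)
 moreover have "WL (count_space F) q (%_. 1) b B"
  unfolding WL_def using AB b sb fin
  by (auto simp: nn_integral_count_space_finite sum_ennreal ennreal_leI cong: sum.cong)
 ultimately have "(\<integral>\<^sup>+x. ennreal \<bar>a x * b x\<bar> \<partial>count_space F) <= ennreal (A * B)"
  using Holder_weighted dual_w_one pq by blast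
 moreover have "(\<integral>\<^sup>+x. ennreal \<bar>a x * b x\<bar> \<partial>count_space F) = ennreal (\<Sum>i\<in>F. a i * b i)"
  using fin a b by (simp add: nn_integral_count_space_finite sum_ennreal abs_mult cong: sum.cong)
 ultimately show ?thesis using AB by (simp add: ennreal_le_iff)
qed

lemma dual_w_powr:
 assumes "dual_w M p q w sg"
 shows "AE x in M. w x powr q * sg x = w x & sg x = w x powr (- (q / p))"
proof -
 have pq: "1 < p" "1 < q" "1/p + 1/q = 1" using assms by (auto simp: dual_w_def)
 have "AE x in M. 0 < w x & 0 < sg x & w x powr (1/p) * sg x powr (1/q) = 1"
  using assms by (auto simp: dual_w_def)
 then show ?thesis
 proof eventually_elim
  case (elim x)
  then have pos: "0 < w x" "0 < sg x" by auto
  have "1 = (w x powr (1/p) * sg x powr (1/q)) powr q" using elim by simp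
  also have "... = w x powr (q/p) * sg x" using pos pq(2) by (simp add: powr_mult powr_powr)
  finally have 1: "w x powr (q/p) * sg x = 1" by simp
  then have s: "sg x = w x powr (- (q / p))" using elim by (simp add: powr_minus field_simps)
  have "w x powr q * sg x = w x powr (q + - (q/p))" using elim unfolding s by (simp only: powr_add)
  also have "q + - (q/p) = 1" using conj_exp[OF pq] by simp
  finally show ?case using s elim by simp
 qed
qed

text \<open>
Test with $g=G^{p-1}w$, for which the bilinear form is the $p$-th power of the norm of $G$ and the
dual norm of $g$ is its $(p-1)$-st power. Finiteness of the norm of $G$ allows division.
\<close>
lemma WL_dual:
 assumes dw: "dual_w M p q w sg" and G: "G : borel_measurable M" "!!x. x : space M ==> 0 <= G x"
  and fin: "(\<integral>\<^sup>+x. ennreal (G x powr p * w x) \<partial>M) < \<infinity>" and C: "0 <= C"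
  and bd: "!!g B. WL M q sg g B ==> (!!x. x : space M ==> 0 <= g x) ==>
    (\<integral>\<^sup>+x. ennreal (G x * g x) \<partial>M) <= ennreal (C * B)"
 shows "WL M p w G C"
proof -
 have [measurable]: "G : borel_measurable M"
   "w : borel_measurable M" "sg : borel_measurable M"
  using assms by (auto simp: dual_w_def)
 have pq: "1 < p" "1 < q" "1/p + 1/q = 1" using dw by (auto simp: dual_w_def)
 define I where "I = enn2real (\<integral>\<^sup>+x. ennreal (G x powr p * w x) \<partial>M)"
 have I: "(\<integral>\<^sup>+x. ennreal (G x powr p * w x) \<partial>M) = ennreal I" "0 <= I"
  using fin by (auto simp: I_def ennreal_enn2real_if less_top)
 define g where "g x = G x powr (p - 1) * w x" for x
 have [measurable]: "g : borel_measurable M" unfolding g_def by measurable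
 have g0: "0 <= g x" if "x : space M" for x using dw that by (auto simp: g_def dual_w_def)
 have "(\<integral>\<^sup>+x. ennreal (\<bar>g x\<bar> powr q * sg x) \<partial>M) = (\<integral>\<^sup>+x. ennreal (G x powr p * w x) \<partial>M)"
 proof (intro nn_integral_cong_AE, use dual_w_powr[OF dw] AE_space in eventually_elim)
  case (elim x)
  have "\<bar>g x\<bar> powr q * sg x = G x powr ((p-1)*q) * (w x powr q * sg x)"
   using g0[OF elim(2)] dw elim(2) G(2)[OF elim(2)] unfolding g_def dual_w_def
   by (simp add: powr_mult powr_powr)
  also have "... = G x powr p * w x" by (simp only: conjunct1[OF elim(1)] conj_exp(2)[OF pq])
  finally show ?case by simp
 qed
 then have "(\<integral>\<^sup>+x. ennreal (\<bar>g x\<bar> powr q * sg x) \<partial>M) = ennreal I" using I by simp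
 then have "WL M q sg g (I powr (1/q))" using pq I(2) by (simp add: WL_def powr_powr)
 from bd[OF this g0] have "(\<integral>\<^sup>+x. ennreal (G x * g x) \<partial>M) <= ennreal (C * I powr (1/q))" .
 moreover have "(\<integral>\<^sup>+x. ennreal (G x * g x) \<partial>M) = (\<integral>\<^sup>+x. ennreal (G x powr p * w x) \<partial>M)"
 proof (intro nn_integral_cong)
  fix x assume "x : space M"
  then have "G x * G x powr (p - 1) = G x powr p" using G(2)[of x] pq
   by (cases "G x = 0") (auto simp: powr_mult_base)
  then show "ennreal (G x * g x) = ennreal (G x powr p * w x)" by (simp add: g_def flip: mult.assoc)
 qed
 ultimately have "I <= C * I powr (1/q)" using I C by (simp add: ennreal_le_iff)
 have "I <= C powr p"
 proof (cases "I = 0")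
  case False
  then have I0: "0 < I" using I by simp
  have "I powr (1/p) * I powr (1/q) = I" using I0 pq by (simp flip: powr_add)
  then have "I powr (1/p) * I powr (1/q) <= C * I powr (1/q)" using \<open>I <= C * I powr (1/q)\<close> by simp
  then have "I powr (1/p) <= C" using I0 by simp
  then have "(I powr (1/p)) powr p <= C powr p" using pq by (intro powr_mono2) auto
  then show ?thesis using I0 pq by (simp add: powr_powr)
 qed simp
 then show ?thesis using I C G unfolding WL_def
  by (auto simp: ennreal_leI cong: nn_integral_cong_simp)
qed

lemma powr_diff_le:
 fixes s t :: real
 assumes pq: "1 < p" "1 < q" "1/p + 1/q = 1" and st: "0 <= s" "0 <= t"
 shows "t powr p - s powr p <= q * t * (t powr (p-1) - s powr (p-1))"
proof -
 have "t * s powr (p-1) <= t powr p / p + (s powr (p-1)) powr q / q"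
  using pq st by (intro Youngs_inequality) auto
 also have "(s powr (p-1)) powr q = s powr p" using conj_exp[OF pq] by (simp add: powr_powr)
 finally have "q * (t * s powr (p-1)) <= q * (t powr p / p + s powr p / q)"
  using pq by (intro mult_left_mono) auto
 also have "... = (q/p) * t powr p + s powr p" using pq by (simp add: algebra_simps)
 also have "q/p = q - 1" by (rule conj_exp[OF pq])
 finally have *: "q * (t * s powr (p-1)) <= (q - 1) * t powr p + s powr p" .
 have "t * t powr (p-1) = t powr p" using st pq by (cases "t = 0") (auto simp: powr_mult_base)
 moreover have "q * t * (t powr (p-1) - s powr (p-1)) = q * (t * t powr (p-1)) - q * (t * s powr (p-1))"
  by (simp add: algebra_simps)
 ultimately have "q * t * (t powr (p-1) - s powr (p-1)) = q * t powr p - q * (t * s powr (p-1))"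
  by (simp only:)
 moreover have "(q - 1) * t powr p = q * t powr p - t powr p" by (simp add: algebra_simps)
 ultimately show ?thesis using * by linarith
qed

text \<open>
For a finite laminar family the maximal function to the power $p$ is a telescoping sum over the
sets that contain the point. Estimating each difference by \<open>powr_diff_le\<close> gives an
integral of $h$ times a power of the maximal function, to which Hoelder is applied.
\<close>
lemma Doob_finite_laminar:
 fixes a :: "'a set => real" and h :: "'a => real"
 assumes pq: "1 < p" "1 < q" "1/p + 1/q = 1"
  and fin: "finite F" and sets: "F \<subseteq> sets N" and finm: "!!Q. Q : F ==> emeasure N Q < \<infinity>"
  and lam: "!!Q R. Q : F ==> R : F ==> Q \<subseteq> R | R \<subseteq> Q | Q \<inter> R = {}"
  and a: "!!Q. Q : F ==> 0 <= a Q"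
  and ah: "!!Q. Q : F ==> ennreal (a Q) * emeasure N Q <= (\<integral>\<^sup>+x\<in>Q. ennreal (h x) \<partial>N)"
  and h0: "!!x. x : space N ==> 0 <= h x" and h: "WL N p (%_. 1) h A"
 shows "WL N p (%_. 1) (%x. Max (insert 0 (a ` {Q\<in>F. x : Q}))) (q * A)"
proof -
 define m where "m x = Max (insert 0 (a ` {Q\<in>F. x : Q}))" for x
 define m1 where "m1 Q = Max (insert 0 (a ` {R\<in>F. Q \<subseteq> R}))" for Q
 define m2 where "m2 Q = Max (insert 0 (a ` {R\<in>F. Q \<subset> R}))" for Q
 have [measurable]: "h : borel_measurable N" using h by (simp add: WL_def)
 have A: "0 <= A" using h by (simp add: WL_def)
 have m0: "0 <= m x" for x unfolding m_def using fin by (intro Max_ge) auto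
 have m20: "0 <= m2 Q" for Q unfolding m2_def using fin by (intro Max_ge) auto
 have m12: "m2 Q <= m1 Q" for Q unfolding m1_def m2_def using fin by (intro Max_mono) auto
 have m10: "0 <= m1 Q" for Q using m12 m20 order_trans by blast
 have tel: "(\<Sum>Q\<in>{Q\<in>F. x : Q}. \<phi> (m1 Q) - \<phi> (m2 Q)) = \<phi> (m x) - \<phi> 0" for x and \<phi> :: "real => real"
 proof -
  let ?C = "{Q\<in>F. x : Q}"
  have "(\<Sum>Q\<in>?C. \<phi> (m1 Q) - \<phi> (m2 Q)) =
   (\<Sum>Q\<in>?C. \<phi> (Max (insert 0 (a ` {R\<in>?C. Q \<subseteq> R}))) - \<phi> (Max (insert 0 (a ` {R\<in>?C. Q \<subset> R}))))"
  proof (intro sum.cong refl)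
   fix Q assume "Q : ?C"
   then have "{R\<in>?C. Q \<subseteq> R} = {R\<in>F. Q \<subseteq> R}" "{R\<in>?C. Q \<subset> R} = {R\<in>F. Q \<subset> R}" by auto
   then show "\<phi> (m1 Q) - \<phi> (m2 Q) = \<phi> (Max (insert 0 (a ` {R\<in>?C. Q \<subseteq> R}))) - \<phi> (Max (insert 0 (a ` {R\<in>?C. Q \<subset> R})))"
    by (simp only: m1_def m2_def)
  qed
  also have "... = \<phi> (m x) - \<phi> 0"
   unfolding m_def using fin lam by (intro chain_telescope_Max) auto
  finally show ?thesis .
 qed
 have tel': "(\<Sum>Q\<in>F. indicator Q x * (m1 Q powr r - m2 Q powr r)) = m x powr r" if "0 < r" for x r
 proof -
  have "(\<Sum>Q\<in>F. indicator Q x * (m1 Q powr r - m2 Q powr r)) = (\<Sum>Q\<in>{Q\<in>F. x : Q}. m1 Q powr r - m2 Q powr r)"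
   unfolding sum.inter_filter[OF fin] by (intro sum.cong) (auto simp: indicator_def)
  then show ?thesis using tel[of "%t. t powr r" x] that by simp
 qed
 have key: "(m1 Q powr p - m2 Q powr p) <= q * a Q * (m1 Q powr (p-1) - m2 Q powr (p-1))" if "Q : F" for Q
 proof (cases "m1 Q = m2 Q")
  case False
  then have lt: "m2 Q < m1 Q" using m12[of Q] by simp
  have "{R\<in>F. Q \<subseteq> R} = insert Q {R\<in>F. Q \<subset> R}" using that by auto
  then have "insert 0 (a ` {R\<in>F. Q \<subseteq> R}) = insert (a Q) (insert 0 (a ` {R\<in>F. Q \<subset> R}))" by auto
  then have "m1 Q = max (a Q) (m2 Q)" unfolding m1_def m2_def using fin
   by (simp only:) (rule Max_insert, auto)
  then have "m1 Q = a Q" using lt by auto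
  then show ?thesis using powr_diff_le[OF pq m20[of Q] m10[of Q]] by simp
 qed simp
 have mono: "0 <= m1 Q powr r - m2 Q powr r" if "0 < r" for Q r
  using m12[of Q] m20[of Q] that by (simp add: powr_mono2)
 have [measurable]: "m : borel_measurable N"
 proof -
  have "m x = (\<Sum>Q\<in>F. indicator Q x * (m1 Q - m2 Q))" for x
  proof -
   have "(\<Sum>Q\<in>F. indicator Q x * (m1 Q - m2 Q)) = (\<Sum>Q\<in>{Q\<in>F. x : Q}. m1 Q - m2 Q)"
    unfolding sum.inter_filter[OF fin] by (intro sum.cong) (auto simp: indicator_def)
   then show ?thesis using tel[of "%t. t" x] by simp
  qed
  then have "m = (%x. \<Sum>Q\<in>F. indicator Q x * (m1 Q - m2 Q))" by auto
  also have "... : borel_measurable N"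
  proof (intro borel_measurable_sum)
   fix Q assume "Q : F"
   then have [measurable]: "Q : sets N" using sets by auto
   show "(%x. indicator Q x * (m1 Q - m2 Q)) : borel_measurable N" by measurable
  qed
  finally show ?thesis .
 qed
 have Qm[measurable]: "Q : sets N" if "Q : F" for Q using that sets by auto
 have expand: "(\<integral>\<^sup>+x. ennreal (g x) * ennreal (m x powr r) \<partial>N) = (\<Sum>Q\<in>F. ennreal (m1 Q powr r - m2 Q powr r) * (\<integral>\<^sup>+x\<in>Q. ennreal (g x) \<partial>N))"
  if r: "0 < r" and [measurable]: "g : borel_measurable N" for r g
 proof -
  have "(\<integral>\<^sup>+x. ennreal (g x) * ennreal (m x powr r) \<partial>N) =
    (\<integral>\<^sup>+x. (\<Sum>Q\<in>F. ennreal (m1 Q powr r - m2 Q powr r) * (ennreal (g x) * indicator Q x)) \<partial>N)"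
  proof (intro nn_integral_cong)
   fix x
   have "ennreal (m x powr r) = (\<Sum>Q\<in>F. ennreal (indicator Q x * (m1 Q powr r - m2 Q powr r)))"
    unfolding tel'[OF r, symmetric] using mono[OF r] by (intro sum_ennreal[symmetric]) auto
   also have "... = (\<Sum>Q\<in>F. ennreal (m1 Q powr r - m2 Q powr r) * indicator Q x)"
    by (intro sum.cong) (auto simp: indicator_def)
   finally show "ennreal (g x) * ennreal (m x powr r) = (\<Sum>Q\<in>F. ennreal (m1 Q powr r - m2 Q powr r) * (ennreal (g x) * indicator Q x))"
    by (simp add: sum_distrib_left mult_ac)
  qed
  also have "... = (\<Sum>Q\<in>F. (\<integral>\<^sup>+x. ennreal (m1 Q powr r - m2 Q powr r) * (ennreal (g x) * indicator Q x) \<partial>N))"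
   by (intro nn_integral_sum) (auto intro!: borel_measurable_times_ennreal Qm)
  also have "... = (\<Sum>Q\<in>F. ennreal (m1 Q powr r - m2 Q powr r) * (\<integral>\<^sup>+x\<in>Q. ennreal (g x) \<partial>N))"
   by (intro sum.cong nn_integral_cmult) auto
  finally show ?thesis .
 qed
 have p0: "0 < p" "0 < p - 1" using pq by auto
 have I1: "(\<integral>\<^sup>+x. ennreal (m x powr p) \<partial>N) = (\<Sum>Q\<in>F. ennreal (m1 Q powr p - m2 Q powr p) * emeasure N Q)"
  using expand[OF p0(1), of "%_. 1"] by (simp cong: sum.cong)
 have Ifin: "(\<integral>\<^sup>+x. ennreal (m x powr p) \<partial>N) < \<infinity>"
  unfolding I1 using finm fin by (auto simp: ennreal_mult_less_top)
 define I where "I = enn2real (\<integral>\<^sup>+x. ennreal (m x powr p) \<partial>N)"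
 have I: "(\<integral>\<^sup>+x. ennreal (m x powr p) \<partial>N) = ennreal I" "0 <= I"
  using Ifin by (auto simp: I_def ennreal_enn2real_if less_top)
 have "ennreal I <= (\<Sum>Q\<in>F. ennreal q * (ennreal (m1 Q powr (p-1) - m2 Q powr (p-1)) * (\<integral>\<^sup>+x\<in>Q. ennreal (h x) \<partial>N)))"
  unfolding I(1)[symmetric] I1
 proof (intro sum_mono)
  fix Q assume Q: "Q : F"
  have "ennreal (m1 Q powr p - m2 Q powr p) <= ennreal (q * a Q * (m1 Q powr (p-1) - m2 Q powr (p-1)))"
   using key[OF Q] by (rule ennreal_leI)
  also have "... = ennreal q * (ennreal (m1 Q powr (p-1) - m2 Q powr (p-1)) * ennreal (a Q))"
   using pq a[OF Q] mono[OF p0(2), of Q] by (simp add: ennreal_mult mult_ac)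
  finally have "ennreal (m1 Q powr p - m2 Q powr p) * emeasure N Q \<le>
   ennreal q * (ennreal (m1 Q powr (p-1) - m2 Q powr (p-1)) * ennreal (a Q)) * emeasure N Q"
   by (rule mult_right_mono) simp
  also have "... = ennreal q * (ennreal (m1 Q powr (p-1) - m2 Q powr (p-1)) * (ennreal (a Q) * emeasure N Q))"
   by (simp add: mult_ac)
  also have "... <= ennreal q * (ennreal (m1 Q powr (p-1) - m2 Q powr (p-1)) * (\<integral>\<^sup>+x\<in>Q. ennreal (h x) \<partial>N))"
   using ah[OF Q] by (intro mult_left_mono) auto
  finally show "ennreal (m1 Q powr p - m2 Q powr p) * emeasure N Q <= ..." .
 qed
 also have "... = ennreal q * (\<integral>\<^sup>+x. ennreal (h x) * ennreal (m x powr (p-1)) \<partial>N)"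
  using expand[OF p0(2), of h] by (simp add: sum_distrib_left)
 also have "(\<integral>\<^sup>+x. ennreal (h x) * ennreal (m x powr (p-1)) \<partial>N) = (\<integral>\<^sup>+x. ennreal \<bar>h x * m x powr (p-1)\<bar> \<partial>N)"
  using h0 by (intro nn_integral_cong) (auto simp: ennreal_mult)
 also have "... <= ennreal (A * I powr (1/q))"
 proof (rule Holder_weighted[OF dual_w_one[OF pq] h])
  have "(\<bar>m x powr (p-1)\<bar> powr q) = m x powr p" for x using conj_exp[OF pq] by (simp add: powr_powr)
  then show "WL N q (%_. 1) (%x. m x powr (p-1)) (I powr (1/q))"
   unfolding WL_def using I pq by (simp add: powr_powr)
 qed
 finally have "ennreal I <= ennreal q * ennreal (A * I powr (1/q))" by (simp add: mult_left_mono)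
 also have "... = ennreal (q * A * I powr (1/q))" using pq A by (simp add: ennreal_mult mult.assoc)
 finally have IC: "I <= q * A * I powr (1/q)" using pq A by (simp add: ennreal_le_iff)
 have "I <= (q * A) powr p"
 proof (cases "I = 0")
  case False
  then have I0: "0 < I" using I by simp
  have "I powr (1/p) * I powr (1/q) = I" using I0 pq by (simp flip: powr_add)
  then have "I powr (1/p) * I powr (1/q) <= (q * A) * I powr (1/q)" using IC by simp
  then have "I powr (1/p) <= q * A" using I0 by simp
  then have "(I powr (1/p)) powr p <= (q * A) powr p" using pq by (intro powr_mono2) auto
  then show ?thesis using I0 pq by (simp add: powr_powr)
 qed simp
 then show ?thesis unfolding WL_def m_def[symmetric] using I A pq m0 by (auto simp: ennreal_leI)
qed

section \<open>Dyadic lattices and convergence of conditional means\<close>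

lemma nn_integral_disjoint_mono:
 assumes "countable \<G>" and sets: "\<G> \<subseteq> sets M" and disj: "disjoint \<G>"
  and [measurable]: "u : borel_measurable M" "v : borel_measurable M"
  and le: "!!R. R : \<G> ==> (\<integral>\<^sup>+x\<in>R. u x \<partial>M) <= (\<integral>\<^sup>+x\<in>R. v x \<partial>M)"
 shows "(\<integral>\<^sup>+x\<in>\<Union>\<G>. u x \<partial>M) <= (\<integral>\<^sup>+x\<in>\<Union>\<G>. v x \<partial>M)"
proof -
 have eq: "(\<integral>\<^sup>+x\<in>\<Union>\<G>. w x \<partial>M) = (\<integral>\<^sup>+R. (\<integral>\<^sup>+x\<in>R. w x \<partial>M) \<partial>count_space \<G>)"
  if [measurable]: "w : borel_measurable M" for w
 proof -
  have U: "\<Union>\<G> : sets M" using assms(1) sets by (intro sets.countable_Union) auto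
  have "(\<integral>\<^sup>+x\<in>\<Union>\<G>. w x \<partial>M) = emeasure (density M w) (\<Union>\<G>)"
   using U by (simp add: emeasure_density)
  also have "... = emeasure (density M w) (\<Union>((%R. R) ` \<G>))" by simp
  also have "... = (\<integral>\<^sup>+R. emeasure (density M w) R \<partial>count_space \<G>)"
   using sets assms(1) disj by (intro emeasure_UN_countable) (auto simp: disjoint_def disjoint_family_on_def)
  also have "... = (\<integral>\<^sup>+R. (\<integral>\<^sup>+x\<in>R. w x \<partial>M) \<partial>count_space \<G>)"
   using sets by (intro nn_integral_cong) (auto simp: emeasure_density)
  finally show ?thesis .
 qed
 show ?thesis unfolding eq[OF assms(4)] eq[OF assms(5)]
  by (rule nn_integral_mono) (simp add: le)
qed

lemma LIMSEQ_null_le: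
 fixes f g :: "nat => real"
 assumes "!!n. 0 <= f n" "!!n. f n <= g n" "g \<longlonglongrightarrow> 0"
 shows "f \<longlonglongrightarrow> 0"
 using tendsto_sandwich[of "%_. 0" f sequentially g 0] assms by auto

text \<open>
Everything about dyadic cubes that does not involve the quasi-metric. The last assumption replaces
the Lebesgue differentiation theorem.
\<close>
locale dyadic_lattice =
 fixes M :: "'a measure" and D :: "int => 'a set set" and Cd :: real
 assumes countable_D: "countable (D k)"
  and D_sets: "D k \<subseteq> sets M"
  and D_disjoint: "Q : D k ==> R : D k ==> x : Q ==> x : R ==> Q = R"
  and D_cover: "\<Union>(D k) = space M"
  and D_nested: "k <= l ==> Q : D k ==> R : D l ==> R \<subseteq> Q | R \<inter> Q = {}"
  and D_pos: "Q : D k ==> 0 < measure M Q"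
  and D_fin: "Q : D k ==> emeasure M Q < \<infinity>"
  and D_parent: "R : D (k + 1) ==> Q : D k ==> R \<subseteq> Q ==> measure M Q <= Cd * measure M R"
  and D_children: "Q : D k ==> finite {R : D (k + 1). R \<subseteq> Q}"
  and D_ancestor: "l <= k ==> Q : D k ==> \<exists>R\<in>D l. Q \<subseteq> R"
  and Cd_ge_1: "1 <= Cd"
  and D_generate: "A : sets M ==> \<exists>B\<in>sigma_sets (space M) (\<Union>k. D k). (A - B) \<union> (B - A) : null_sets M"
begin

definition cubes :: "'a set set" where "cubes = (\<Union>k. D k)"

definition cell :: "int => 'a => 'a set" where "cell k x = (THE Q. Q : D k & x : Q)"

definition E :: "int => ('a => real) => 'a => real" where "E k h x = avg M (cell k x) h"

lemma cell_unique: "Q : D k ==> x : Q ==> cell k x = Q"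
 unfolding cell_def using D_disjoint by (intro the_equality) auto

lemma cell: assumes "x : space M" shows "cell k x : D k" "x : cell k x"
proof -
 obtain Q where "Q : D k" "x : Q" using assms D_cover[of k] by auto
 then show "cell k x : D k" "x : cell k x" using cell_unique[of Q k x] by auto
qed

lemma cubes_sets: "Q : cubes ==> Q : sets M"
 and cubes_pos: "Q : cubes ==> 0 < measure M Q"
 and cubes_fin: "Q : cubes ==> emeasure M Q < \<infinity>"
 and cubes_countable: "countable cubes"
 and DI: "Q : D k ==> Q : cubes"
 unfolding cubes_def using D_sets D_pos D_fin countable_D by auto

lemma cubes_emeasure: "Q : cubes ==> emeasure M Q = ennreal (measure M Q)"
 by (metis cubes_fin emeasure_eq_ennreal_measure infinity_ennreal_def less_irrefl)

lemma cubes_laminar: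
 assumes "Q : cubes" "R : cubes" shows "Q \<subseteq> R | R \<subseteq> Q | Q \<inter> R = {}"
proof -
 obtain k l where kl: "Q : D k" "R : D l" using assms by (auto simp: cubes_def)
 show ?thesis
  using D_nested[of k l Q R] D_nested[of l k R Q] kl by (cases "k <= l") auto
qed

lemma cubes_ne: "Q : cubes ==> Q ~= {}"
 using cubes_pos[of Q] by auto

lemma cell_subset: "Q : D k ==> k <= l ==> x : Q ==> cell l x \<subseteq> Q"
 using D_nested[of k l Q "cell l x"] cell[of x l] D_sets[of k] sets.sets_into_space[of Q M] by auto

lemma D_isdisjoint: "disjoint (D k)"
 unfolding disjoint_def using D_disjoint by (auto simp: disjoint_iff)

lemma cell_measurable: "cell k : measurable M (count_space (D k))"
proof (subst measurable_count_space_eq_countable[OF countable_D], safe)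
 show "x : space M ==> cell k x : D k" for x by (rule cell(1))
 fix Q assume Q: "Q : D k"
 have "cell k -` {Q} \<inter> space M = Q"
 proof (intro set_eqI iffI)
  fix x assume "x : cell k -` {Q} \<inter> space M"
  then show "x : Q" using cell(2)[of x k] by auto
 next
  fix x assume "x : Q"
  moreover have "Q \<subseteq> space M" using Q D_cover[of k] by auto
  ultimately show "x : cell k -` {Q} \<inter> space M" using cell_unique[OF Q] by auto
 qed
 then show "cell k -` {Q} \<inter> space M : sets M" using Q D_sets by auto
qed

lemma E_measurable[measurable]: "E k h : borel_measurable M"
 unfolding E_def by (rule measurable_compose[OF cell_measurable]) auto

lemma set_integrable_cube:
 fixes h :: "'a => 'b::{banach, second_countable_topology}"
 shows "integrable M h ==> Q : cubes ==> set_integrable M Q h"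
 unfolding set_integrable_def using cubes_sets by (intro integrable_mult_indicator) auto

lemma avg_const_on:
 assumes "Q : cubes" "!!x. x : Q ==> h x = (c::real)"
 shows "avg M Q h = c"
proof -
 have "(LINT x:Q|M. h x) = (LINT x:Q|M. c)" using assms cubes_sets by (intro set_lebesgue_integral_cong) auto
 also have "... = measure M Q * c" using assms cubes_sets[of Q] by (simp add: set_lebesgue_integral_def)
 finally show ?thesis using cubes_pos[of Q] assms by (simp add: avg_def)
qed

lemma nn_integral_E:
 assumes h: "integrable M h"
 shows "(\<integral>\<^sup>+x. ennreal \<bar>E k h x\<bar> \<partial>M) <= (\<integral>\<^sup>+x. ennreal \<bar>h x\<bar> \<partial>M)"
proof -
 have [measurable]: "h : borel_measurable M" using h by auto
 have "(\<integral>\<^sup>+x\<in>\<Union>(D k). ennreal \<bar>E k h x\<bar> \<partial>M) <= (\<integral>\<^sup>+x\<in>\<Union>(D k). ennreal \<bar>h x\<bar> \<partial>M)"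
 proof (rule nn_integral_disjoint_mono[OF countable_D D_sets D_isdisjoint])
  fix Q assume Q: "Q : D k"
  then have Qc: "Q : cubes" and [measurable]: "Q : sets M" using DI cubes_sets by auto
  have int: "set_integrable M Q h" using set_integrable_cube[OF h Qc] .
  have "(\<integral>\<^sup>+x\<in>Q. ennreal \<bar>E k h x\<bar> \<partial>M) = (\<integral>\<^sup>+x\<in>Q. ennreal \<bar>avg M Q h\<bar> \<partial>M)"
   using cell_unique[OF Q] by (intro nn_integral_cong) (auto simp: E_def indicator_def)
  also have "... = ennreal (\<bar>avg M Q h\<bar> * measure M Q)"
   using cubes_emeasure[OF Qc] by (simp add: nn_integral_cmult_indicator ennreal_mult)
  also have "\<bar>avg M Q h\<bar> * measure M Q = \<bar>LINT x:Q|M. h x\<bar>"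
   using cubes_pos[OF Qc] by (simp add: avg_def abs_mult)
  also have "... <= (LINT x:Q|M. \<bar>h x\<bar>)"
   using set_integral_norm_bound[OF int] by simp
  also have "ennreal (LINT x:Q|M. \<bar>h x\<bar>) = (\<integral>\<^sup>+x\<in>Q. ennreal \<bar>h x\<bar> \<partial>M)"
   using int set_integrable_abs[OF int]
   by (subst nn_integral_set_ennreal, subst nn_integral_eq_integral)
     (auto simp: set_integrable_def set_lebesgue_integral_def mult.commute abs_mult)
  finally show "(\<integral>\<^sup>+x\<in>Q. ennreal \<bar>E k h x\<bar> \<partial>M) <= (\<integral>\<^sup>+x\<in>Q. ennreal \<bar>h x\<bar> \<partial>M)"
   by (simp add: ennreal_leI)
 qed auto
 then show ?thesis by (simp add: D_cover cong: nn_integral_cong_simp)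
qed

lemma integrable_E: "integrable M h ==> integrable M (E k h)"
 using nn_integral_E[of h k] unfolding integrable_iff_bounded by auto

lemma integral_E:
 assumes "integrable M h"
 shows "(LINT x|M. \<bar>E k h x\<bar>) <= (LINT x|M. \<bar>h x\<bar>)"
proof -
 have "ennreal (LINT x|M. \<bar>E k h x\<bar>) <= ennreal (LINT x|M. \<bar>h x\<bar>)"
  using nn_integral_E[OF assms, of k] integrable_E[OF assms, of k] assms
  by (simp add: nn_integral_eq_integral)
 then show ?thesis by (simp add: ennreal_le_iff)
qed

lemma E_add:
 assumes "integrable M g" "integrable M h" "x : space M"
 shows "E k (%x. g x + h x) x = E k g x + E k h x"
proof -
 have Q: "cell k x : cubes" using cell(1)[OF assms(3)] by (rule DI)
 have "(LINT y:cell k x|M. g y + h y) = (LINT y:cell k x|M. g y) + (LINT y:cell k x|M. h y)"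
  using set_integrable_cube[OF _ Q] assms by (intro set_integral_add(2)) auto
 then show ?thesis unfolding E_def avg_def by (simp add: add_divide_distrib)
qed

lemma E_cmult:
 shows "E k (%x. c * h x) x = c * E k h x"
 unfolding E_def avg_def by simp

text \<open>
Convergence of the conditional means in $L^1$. The functions with this property form a closed
subspace, which makes it easier to establish than convergence almost everywhere.
\<close>
definition Econv :: "('a => real) => bool" where
 "Econv h \<longleftrightarrow> integrable M h & (%n::nat. LINT x|M. \<bar>E (int n) h x - h x\<bar>) \<longlonglongrightarrow> 0"

lemma Econv_add:
 assumes "Econv g" "Econv h" shows "Econv (%x. g x + h x)"
 unfolding Econv_def
proof
 have g: "integrable M g" and h: "integrable M h" using assms by (auto simp: Econv_def)
 then show "integrable M (%x. g x + h x)" by auto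
 have le: "(LINT x|M. \<bar>E (int n) (%x. g x + h x) x - (g x + h x)\<bar>) \<le>
  (LINT x|M. \<bar>E (int n) g x - g x\<bar>) + (LINT x|M. \<bar>E (int n) h x - h x\<bar>)" for n
 proof -
  have "(LINT x|M. \<bar>E (int n) (%x. g x + h x) x - (g x + h x)\<bar>) \<le>
   (LINT x|M. \<bar>E (int n) g x - g x\<bar> + \<bar>E (int n) h x - h x\<bar>)"
   using g h integrable_E[of g] integrable_E[of h] integrable_E[of "%x. g x + h x"]
   by (intro integral_mono) (auto simp: E_add[OF g h])
  then show ?thesis using g h integrable_E[of g] integrable_E[of h] by (simp add: Bochner_Integration.integral_add)
 qed
 have lim: "(%n. (LINT x|M. \<bar>E (int n) g x - g x\<bar>) + (LINT x|M. \<bar>E (int n) h x - h x\<bar>)) \<longlonglongrightarrow> 0"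
  using tendsto_add[of _ 0 sequentially _ 0] assms unfolding Econv_def by fastforce
 have nonneg: "0 <= (LINT x|M. \<bar>E (int n) (%x. g x + h x) x - (g x + h x)\<bar>)" for n
  by (intro integral_nonneg_AE AE_I2) auto
 show "(%n::nat. LINT x|M. \<bar>E (int n) (%x. g x + h x) x - (g x + h x)\<bar>) \<longlonglongrightarrow> 0"
  by (rule LIMSEQ_null_le[OF nonneg le lim])
qed

lemma Econv_cmult:
 assumes "Econv h" shows "Econv (%x. c * h x)"
proof -
 have "(LINT x|M. \<bar>E (int n) (%x. c * h x) x - c * h x\<bar>) = \<bar>c\<bar> * (LINT x|M. \<bar>E (int n) h x - h x\<bar>)" for n
 proof -
  have "\<bar>E (int n) (%x. c * h x) x - c * h x\<bar> = \<bar>c\<bar> * \<bar>E (int n) h x - h x\<bar>" for x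
   unfolding E_cmult by (simp add: abs_mult flip: right_diff_distrib)
  then show ?thesis by simp
 qed
 moreover have "(%n. \<bar>c\<bar> * (LINT x|M. \<bar>E (int n) h x - h x\<bar>)) \<longlonglongrightarrow> 0"
  using assms unfolding Econv_def by (intro tendsto_mult_right_zero) auto
 ultimately show ?thesis using assms unfolding Econv_def by simp
qed

lemma Econv_diff: "Econv g ==> Econv h ==> Econv (%x. g x - h x)"
 using Econv_add[of g "%x. (-1) * h x"] Econv_cmult[of h "-1"] by simp

lemma Econv_limit:
 assumes s: "!!i. Econv (s i)" and h: "integrable M h"
  and lim: "(%i::nat. LINT x|M. \<bar>s i x - h x\<bar>) \<longlonglongrightarrow> 0"
 shows "Econv h"
 unfolding Econv_def
proof (intro conjI h)
 have si: "integrable M (s i)" for i using s by (simp add: Econv_def)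
 show "(%n::nat. LINT x|M. \<bar>E (int n) h x - h x\<bar>) \<longlonglongrightarrow> 0"
 proof (rule LIMSEQ_I)
  fix e :: real assume e: "0 < e"
  obtain i where i: "norm ((LINT x|M. \<bar>s i x - h x\<bar>) - 0) < e / 4"
   using LIMSEQ_D[OF lim, of "e/4"] e by auto
  have lim_i: "(%n. LINT x|M. \<bar>E (int n) (s i) x - s i x\<bar>) \<longlonglongrightarrow> 0" using s[of i] by (simp add: Econv_def)
  obtain N where N: "!!n. n >= N ==> norm ((LINT x|M. \<bar>E (int n) (s i) x - s i x\<bar>) - 0) < e / 4"
   using LIMSEQ_D[OF lim_i, of "e/4"] e by auto
  show "\<exists>N. \<forall>n\<ge>N. norm ((LINT x|M. \<bar>E (int n) h x - h x\<bar>) - 0) < e"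
  proof (intro exI allI impI)
   fix n assume n: "n >= N"
   let ?d = "%x. h x - s i x"
   have d: "integrable M ?d" using h si by auto
   have Ed: "E (int n) h x = E (int n) ?d x + E (int n) (s i) x" if "x : space M" for x
    using E_add[OF d si[of i] that, of "int n"] by simp
   have "(LINT x|M. \<bar>E (int n) h x - h x\<bar>) \<le>
    (LINT x|M. \<bar>E (int n) ?d x\<bar> + \<bar>E (int n) (s i) x - s i x\<bar> + \<bar>s i x - h x\<bar>)"
    using h si d integrable_E[OF h] integrable_E[OF si] integrable_E[OF d]
    by (intro integral_mono) (auto simp: Ed)
   also have "... = (LINT x|M. \<bar>E (int n) ?d x\<bar>) + (LINT x|M. \<bar>E (int n) (s i) x - s i x\<bar>) + (LINT x|M. \<bar>s i x - h x\<bar>)"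
    using h si d integrable_E[OF h] integrable_E[OF si] integrable_E[OF d]
    by (simp add: Bochner_Integration.integral_add)
   also have "(LINT x|M. \<bar>E (int n) ?d x\<bar>) <= (LINT x|M. \<bar>?d x\<bar>)" by (rule integral_E[OF d])
   also have "(LINT x|M. \<bar>?d x\<bar>) = (LINT x|M. \<bar>s i x - h x\<bar>)" by (simp add: abs_minus_commute)
   finally show "norm ((LINT x|M. \<bar>E (int n) h x - h x\<bar>) - 0) < e"
    using i N[OF n] e by (simp add: abs_less_iff)
  qed
 qed
qed

lemma Econv_cong_AE:
 assumes "Econv h" "integrable M g" "AE x in M. g x = h x"
 shows "Econv g"
proof (rule Econv_limit[of "%_. h"])
 have "(LINT x|M. \<bar>h x - g x\<bar>) = (LINT x|M. 0)"
  using assms by (intro integral_cong_AE) (auto simp: Econv_def)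
 then show "(%i::nat. LINT x|M. \<bar>h x - g x\<bar>) \<longlonglongrightarrow> 0" by simp
qed (use assms in auto)

lemma integrable_indicator_sub:
 assumes "T : cubes" "A : sets M" shows "integrable M (indicator (A \<inter> T) :: 'a => real)"
 using assms cubes_sets[of T] cubes_fin[of T] emeasure_mono[of "A \<inter> T" T M]
 by (intro integrable_real_indicator) (auto simp: le_less_trans)

text \<open>
From the generation of $R$ on, the conditional mean of the indicator of $R$ is that indicator.
\<close>
lemma Econv_cube:
 assumes "R : cubes" shows "Econv (indicator R)"
 unfolding Econv_def
proof
 show "integrable M (indicator R :: 'a => real)"
  using assms cubes_sets[of R] cubes_fin[of R] by (intro integrable_real_indicator) auto
 obtain k where k: "R : D k" using assms by (auto simp: cubes_def)
 have "E (int n) (indicator R) x = indicator R x" if n: "k <= int n" and x: "x : space M" for n x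
  unfolding E_def
 proof (rule avg_const_on)
  show "cell (int n) x : cubes" using cell[OF x] DI by blast
  have "cell (int n) x \<subseteq> R | cell (int n) x \<inter> R = {}"
   using D_nested[OF n k, of "cell (int n) x"] cell[OF x, of "int n"] by blast
  then show "y : cell (int n) x ==> indicator R y = (indicator R x :: real)" for y
   using cell[OF x, of "int n"] by (auto simp: indicator_def)
 qed
 then have "(LINT x|M. \<bar>E (int n) (indicator R) x - indicator R x\<bar>) = 0" if "k <= int n" for n
  using that by (simp cong: Bochner_Integration.integral_cong)
 moreover have "\<forall>\<^sub>F n in sequentially. k <= int n"
  by (rule eventually_sequentiallyI[of "nat k"]) auto
 ultimately show "(%n::nat. LINT x|M. \<bar>E (int n) (indicator R) x - indicator R x\<bar>) \<longlonglongrightarrow> 0"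
  by (intro tendsto_eventually) (auto elim: eventually_mono)
qed

lemma Econv_zero: "Econv (%_. 0)"
 by (simp add: Econv_def E_def avg_def set_lebesgue_integral_def)

lemma Econv_empty: "Econv (indicator {})"
proof -
 have "(indicator {} :: 'a => real) = (%_. 0)" by (simp add: indicator_def fun_eq_iff)
 then show ?thesis using Econv_zero by simp
qed

text \<open>
Dynkin's theorem: cubes are laminar, hence stable under intersection; complements in $T$ are
differences of functions, and disjoint unions are limits to which \<open>Econv_limit\<close>
applies.
\<close>
lemma Econv_Borel:
 assumes T: "T : cubes" and B: "B : sigma_sets (space M) cubes"
 shows "Econv (indicator (B \<inter> T))"
proof -
 let ?G = "insert {} cubes"
 have Int: "Int_stable ?G"
 proof (unfold Int_stable_def, intro ballI)
  fix A B assume AB: "A : ?G" "B : ?G"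
  show "A \<inter> B : ?G"
  proof (cases "A = {} | B = {}")
   case False
   then have "A \<subseteq> B | B \<subseteq> A | A \<inter> B = {}" using AB cubes_laminar[of A B] by blast
   then show ?thesis using AB by (metis Int_absorb1 Int_absorb2 insertI1)
  qed auto
 qed
 have sub: "?G \<subseteq> Pow (space M)" using cubes_sets sets.sets_into_space by blast
 have B': "B : sigma_sets (space M) ?G" using B sigma_sets_mono'[of cubes ?G] by blast
 have Gsets: "A : sets M" if "A : sigma_sets (space M) ?G" for A
  using that cubes_sets sets.sigma_sets_subset[of ?G M] by auto
 show ?thesis using Int sub B'
 proof (induction rule: sigma_sets_induct_disjoint)
  case (basic A)
  then have "A \<inter> T = {} | A \<inter> T : cubes" using cubes_laminar[of A T] T by (auto simp: Int_absorb1 Int_absorb2)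
  then show ?case
  proof
   assume "A \<inter> T = {}"
   then show ?thesis by (simp only: Econv_empty)
  qed (rule Econv_cube)
 next
  case empty
  show ?case by (simp only: Econv_empty Int_empty_left)
 next
  case (compl A)
  have "(indicator ((space M - A) \<inter> T) :: 'a => real) = (%x. indicator T x - indicator (A \<inter> T) x)"
   using sets.sets_into_space[OF cubes_sets[OF T]] by (auto simp: indicator_def fun_eq_iff)
  then show ?case using Econv_diff[OF Econv_cube[OF T] compl(2)] by simp
 next
  case (union A)
  have [measurable]: "A i : sets M" for i using union(2) Gsets by blast
  have [measurable]: "T : sets M" using T cubes_sets by auto
  let ?s = "%n x. (\<Sum>i<n. indicator (A i \<inter> T) x :: real)"
  let ?h = "indicator ((\<Union>i. A i) \<inter> T) :: 'a => real"
  have Es: "Econv (?s n)" for n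
  proof (induction n)
   case (Suc n)
   show ?case using Econv_add[OF Suc union(3)[of n]] by simp
  qed (use Econv_zero in simp)
  have ih: "integrable M ?h" using integrable_indicator_sub[OF T, of "\<Union>i. A i"] by auto
  have seq: "?s n x = indicator ((\<Union>i<n. A i) \<inter> T) x" for n x
  proof -
   have "indicator ((\<Union>i<n. A i) \<inter> T) x = (indicator (\<Union>i<n. A i \<inter> T) x :: real)" by (auto simp: indicator_def)
   also have "... = ?s n x"
    using union(1) by (intro indicator_UN_disjoint) (auto simp: disjoint_family_on_def)
   finally show ?thesis by simp
  qed
  have "(%n. LINT x|M. \<bar>?s n x - ?h x\<bar>) \<longlonglongrightarrow> (LINT x|M. 0)"
  proof (rule integral_dominated_convergence[where w="indicator T"])
   show "integrable M (indicator T :: 'a => real)" using integrable_indicator_sub[OF T, of T] cubes_sets[OF T] by simp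
   show "AE x in M. (%n. \<bar>?s n x - ?h x\<bar>) \<longlonglongrightarrow> 0"
   proof (intro AE_I2 tendsto_eventually)
    fix x
    show "\<forall>\<^sub>F n in sequentially. \<bar>?s n x - ?h x\<bar> = 0"
    proof (cases "x : (\<Union>i. A i)")
     case True
     then obtain i where i: "x : A i" by auto
     have "\<bar>?s n x - ?h x\<bar> = 0" if "Suc i <= n" for n
      unfolding seq using i that by (auto simp: indicator_def)
     then show ?thesis by (rule eventually_sequentiallyI)
    next
     case False
     then have "\<bar>?s n x - ?h x\<bar> = 0" for n unfolding seq by (auto simp: indicator_def)
     then show ?thesis by (intro always_eventually allI)
    qed
   qed
   show "AE x in M. norm \<bar>?s n x - ?h x\<bar> <= indicator T x" for n
    unfolding seq by (intro AE_I2) (auto simp: indicator_def)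
  qed auto
  then show ?case using Econv_limit[of ?s ?h] Es ih by simp
 qed
qed

lemma Econv_sets:
 assumes T: "T : cubes" and A: "A : sets M"
 shows "Econv (indicator (A \<inter> T))"
proof -
 obtain B where B: "B : sigma_sets (space M) cubes" "(A - B) \<union> (B - A) : null_sets M"
  using D_generate[OF A] unfolding cubes_def by auto
 have "AE x in M. x \<notin> (A - B) \<union> (B - A)" using AE_not_in[OF B(2)] .
 then have "AE x in M. indicator (A \<inter> T) x = (indicator (B \<inter> T) x :: real)"
  by eventually_elim (auto simp: indicator_def)
 then show ?thesis using Econv_cong_AE[OF Econv_Borel[OF T B(1)] integrable_indicator_sub[OF T A]] by blast
qed

lemma Econv_integrable:
 assumes T: "T : cubes" and h: "integrable M h"
 shows "Econv (%x. indicator T x * h x)"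
 using h
proof (induction rule: integrable_induct)
 case (base A c)
 have "(%x. indicator T x * (indicator A x *\<^sub>R c)) = (%x. c * indicator (A \<inter> T) x)"
  by (auto simp: indicator_def)
 then show ?case using Econv_cmult[OF Econv_sets[OF T base(1)]] by simp
next
 case (add f g)
 then show ?case using Econv_add[of "%x. indicator T x * f x" "%x. indicator T x * g x"] by (simp add: distrib_left)
next
 case (lim f s)
 have [measurable]: "T : sets M" using T cubes_sets by auto
 have [measurable]: "s i : borel_measurable M" "f : borel_measurable M" for i using lim by auto
 have "(%i. LINT x|M. \<bar>indicator T x * s i x - indicator T x * f x\<bar>) \<longlonglongrightarrow> (LINT x|M. 0)"
 proof (rule integral_dominated_convergence[where w="%x. 3 * \<bar>f x\<bar>"])
  show "AE x in M. (%n. \<bar>indicator T x * s n x - indicator T x * f x\<bar>) \<longlonglongrightarrow> 0"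
  proof (intro AE_I2)
   fix x assume "x : space M"
   then have "(%n. \<bar>indicator T x * s n x - indicator T x * f x\<bar>) \<longlonglongrightarrow> \<bar>indicator T x * f x - indicator T x * f x\<bar>"
    by (intro tendsto_intros lim(2))
   then show "(%n. \<bar>indicator T x * s n x - indicator T x * f x\<bar>) \<longlonglongrightarrow> 0" by simp
  qed
  show "AE x in M. norm \<bar>indicator T x * s n x - indicator T x * f x\<bar> <= 3 * \<bar>f x\<bar>" for n
  proof (intro AE_I2)
   fix x assume "x : space M"
   then show "norm \<bar>indicator T x * s n x - indicator T x * f x\<bar> <= 3 * \<bar>f x\<bar>"
    using lim(3)[of x n] by (auto simp: indicator_def)
  qed
 qed (use lim in auto)
 then have l0: "(%i. LINT x|M. \<bar>indicator T x * s i x - indicator T x * f x\<bar>) \<longlonglongrightarrow> 0" by simp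
 have int: "integrable M (%x. indicator T x * f x)"
  using integrable_mult_indicator[of T M f] lim(4) cubes_sets[OF T] by simp
 show ?case by (rule Econv_limit[of "%i x. indicator T x * s i x", OF lim(5) int l0])
qed

text \<open>
Convergence in $L^1$ gives convergence almost everywhere along a subsequence, which is all that a
pointwise domination needs.
\<close>
lemma E_convergence:
 assumes S: "finite S" "S \<subseteq> cubes" and h: "!!Q. Q : S ==> set_integrable M Q (h Q)"
 shows "\<exists>r. strict_mono (r::nat=>nat) & (AE x in M. \<forall>Q\<in>S. x : Q --> (%n. E (int (r n)) (h Q) x) \<longlonglongrightarrow> h Q x)"
proof -
 let ?g = "%Q x. indicator Q x * h Q x"
 have g: "Econv (?g Q)" if "Q : S" for Q
 proof -
  have "integrable M (?g Q)" using h[OF that] by (simp add: set_integrable_def)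
  moreover have "(%x. indicator Q x * ?g Q x) = ?g Q" by (auto simp: indicator_def)
  ultimately show ?thesis using Econv_integrable[of Q "?g Q"] that S by auto
 qed
 let ?u = "%n x. \<Sum>Q\<in>S. \<bar>E (int n) (?g Q) x - ?g Q x\<bar>"
 have int: "integrable M (%x. \<bar>E (int n) (?g Q) x - ?g Q x\<bar>)" if "Q : S" for n Q
  using g[OF that] integrable_E unfolding Econv_def by auto
 have "(LINT x|M. norm (?u n x)) = (\<Sum>Q\<in>S. LINT x|M. \<bar>E (int n) (?g Q) x - ?g Q x\<bar>)" for n
  using int by (subst Bochner_Integration.integral_sum[symmetric]) (auto simp: sum_nonneg)
 moreover have "(%n. \<Sum>Q\<in>S. LINT x|M. \<bar>E (int n) (?g Q) x - ?g Q x\<bar>) \<longlonglongrightarrow> (\<Sum>Q\<in>S. 0)"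
  using g unfolding Econv_def by (intro tendsto_sum) auto
 ultimately have "(%n. LINT x|M. norm (?u n x)) \<longlonglongrightarrow> 0" by simp
 from tendsto_L1_AE_subseq[OF _ this] int obtain r where r: "strict_mono (r::nat=>nat)"
  "AE x in M. (%n. ?u (r n) x) \<longlonglongrightarrow> 0" by fastforce
 have "AE x in M. \<forall>Q\<in>S. x : Q --> (%n. E (int (r n)) (h Q) x) \<longlonglongrightarrow> h Q x"
  using r(2) AE_space
 proof eventually_elim
  case (elim x)
  show ?case
  proof (intro ballI impI)
   fix Q assume Q: "Q : S" "x : Q"
   have "(%n. \<bar>E (int (r n)) (?g Q) x - ?g Q x\<bar>) \<longlonglongrightarrow> 0"
   proof (rule LIMSEQ_null_le[OF _ _ elim(1)])
    show "\<bar>E (int (r n)) (?g Q) x - ?g Q x\<bar> <= ?u (r n) x" for n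
     using Q S by (intro member_le_sum[of Q S "%Q. \<bar>E (int (r n)) (?g Q) x - ?g Q x\<bar>"]) auto
   qed auto
   then have "(%n. E (int (r n)) (?g Q) x - ?g Q x) \<longlonglongrightarrow> 0" by (simp add: tendsto_rabs_zero_iff)
   from tendsto_add[OF this tendsto_const[of "?g Q x"]]
   have lim: "(%n. E (int (r n)) (?g Q) x) \<longlonglongrightarrow> h Q x" using Q by simp
   obtain k where k: "Q : D k" using Q S by (auto simp: cubes_def)
   have eq: "E (int (r n)) (?g Q) x = E (int (r n)) (h Q) x" if n: "n >= nat k" for n
   proof -
    have "k <= int (r n)" using n seq_suble[OF r(1), of n] by linarith
    then have "cell (int (r n)) x \<subseteq> Q" using cell_subset k Q by blast
    moreover have "cell (int (r n)) x : sets M" using cell(1)[OF elim(2)] DI cubes_sets by blast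
    ultimately have "(LINT y:cell (int (r n)) x|M. ?g Q y) = (LINT y:cell (int (r n)) x|M. h Q y)"
     by (intro set_lebesgue_integral_cong) (auto simp: indicator_def)
    then show ?thesis unfolding E_def avg_def by simp
   qed
   show "(%n. E (int (r n)) (h Q) x) \<longlonglongrightarrow> h Q x"
    by (rule Lim_transform_eventually[OF lim]) (auto intro!: eventually_sequentiallyI[of "nat k"] eq)
  qed
 qed
 with r show ?thesis by blast
qed

end

section \<open>Stopping cubes\<close>

context dyadic_lattice
begin

definition mo :: "('a => 'b::{banach, second_countable_topology}) => 'a set => real" where
 "mo b Q = avg M Q (%x. norm (b x - avg M Q b))"

definition upto :: "int => 'a set set" where "upto L = (\<Union>k\<in>{..L}. D k)"

lemma upto_cubes: "Q : upto L ==> Q : cubes" by (auto simp: upto_def cubes_def)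

lemma D_subset_finer:
 assumes "Q : D k" "R : D l" "l <= k" "R \<subseteq> Q" shows "R = Q"
proof -
 obtain T where T: "T : D l" "Q \<subseteq> T" using D_ancestor assms by blast
 obtain x where "x : R" using cubes_ne[OF DI[OF assms(2)]] by blast
 then have "T = R" using D_disjoint[of T l R x] T assms by blast
 then show ?thesis using T assms by blast
qed

lemma D_descendants_finite: "Q : D k ==> finite {R : D (k + int n). R \<subseteq> Q}"
proof (induction n)
 case 0
 have "{R : D (k + int 0). R \<subseteq> Q} \<subseteq> {Q}" using D_subset_finer[OF 0] by auto
 then show ?case by (rule finite_subset) simp
next
 case (Suc n)
 have "{R : D (k + int (Suc n)). R \<subseteq> Q} \<subseteq> (\<Union>T\<in>{T : D (k + int n). T \<subseteq> Q}. {R : D (k + int n + 1). R \<subseteq> T})"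
 proof
  fix R assume R: "R : {R : D (k + int (Suc n)). R \<subseteq> Q}"
  then have R': "R : D (k + int n + 1)" by (simp add: algebra_simps)
  obtain T where T: "T : D (k + int n)" "R \<subseteq> T" using D_ancestor[OF _ R', of "k + int n"] by auto
  have "T \<inter> Q ~= {}" using cubes_ne[OF DI[OF R']] T R by blast
  then have "T \<subseteq> Q" using D_nested[of k "k + int n" Q T] Suc.prems T by auto
  then show "R : (\<Union>T\<in>{T : D (k + int n). T \<subseteq> Q}. {R : D (k + int n + 1). R \<subseteq> T})" using T R R' by auto
 qed
 moreover have "finite ..." using Suc D_children by auto
 ultimately show ?case by (rule finite_subset)
qed

lemma upto_below_finite: "Q : cubes ==> finite {R : upto L. R \<subseteq> Q}"
proof -
 assume "Q : cubes"
 then obtain k where k: "Q : D k" by (auto simp: cubes_def)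
 have "{R : upto L. R \<subseteq> Q} \<subseteq> insert Q (\<Union>n\<in>{..nat (L - k)}. {R : D (k + int n). R \<subseteq> Q})"
 proof
  fix R assume R: "R : {R : upto L. R \<subseteq> Q}"
  then obtain l where l: "l <= L" "R : D l" by (auto simp: upto_def)
  show "R : insert Q (\<Union>n\<in>{..nat (L - k)}. {R : D (k + int n). R \<subseteq> Q})"
  proof (cases "l <= k")
   case True
   then show ?thesis using D_subset_finer[OF k l(2)] R by auto
  next
   case False
   then have "l = k + int (nat (l - k))" "nat (l - k) <= nat (L - k)" using l by auto
   then show ?thesis using R l by (metis (no_types, lifting) UN_I atMost_iff insertCI mem_Collect_eq)
  qed
 qed
 moreover have "finite ..." using D_descendants_finite[OF k] by auto
 ultimately show ?thesis by (rule finite_subset)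
qed

text \<open>
Between a cube and a strictly larger one lies a cube of comparable measure. The same set may occur
in several generations, so the parent in the previous generation need not be strictly larger.
\<close>
lemma immediate_superset:
 assumes "R : D l" "Q : D k" "R \<subset> Q"
 shows "\<exists>m\<le>l. \<exists>T\<in>D m. R \<subset> T & T \<subseteq> Q & measure M T <= Cd * measure M R"
 using assms
proof (induction "nat (l - k)" arbitrary: l)
 case 0
 then have "R = Q" using D_subset_finer[of Q k R l] by auto
 then show ?case using 0 by simp
next
 case (Suc n)
 then have kl: "k <= l - 1" by auto
 obtain P where P: "P : D (l - 1)" "R \<subseteq> P" using D_ancestor[of "l - 1" l R] Suc.prems by auto
 have "P \<inter> Q ~= {}" using cubes_ne[OF DI[OF Suc.prems(1)]] P Suc.prems by blast
 then have PQ: "P \<subseteq> Q" using D_nested[OF kl Suc.prems(2) P(1)] by blast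
 show ?case
 proof (cases "P = R")
  case True
  have "n = nat (l - 1 - k)" using Suc.hyps(2) by auto
  from Suc.hyps(1)[OF this] True P Suc.prems obtain m T where
   "m <= l - 1" "T : D m" "R \<subset> T & T \<subseteq> Q & measure M T <= Cd * measure M R" by blast
  then show ?thesis by (intro exI[of _ m]) auto
 next
  case False
  have "measure M P <= Cd * measure M R"
   using D_parent[of R "l - 1" P] Suc.prems P by auto
  then show ?thesis using P PQ False by (intro exI[of _ "l - 1"]) auto
 qed
qed

end

locale augmented_family = dyadic_lattice M D Cd for M :: "'a measure" and D Cd +
 fixes b :: "'a => 'b::{banach, second_countable_topology}" and S :: "'a set set" and L :: int
 assumes bint: "Q : cubes ==> set_integrable M Q b"
  and fS: "finite S" and SL: "S \<subseteq> upto L"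
begin

definition dev :: "'a set => 'a => real" where "dev Q x = norm (b x - avg M Q b)"

text \<open>
A stopping cube belongs to the given family, or the deviation of $b$ from its mean over $Q$ is on
average more than four times as large as over $Q$. Cubes finer than generation $L$ are ignored, so
that the construction is finite.
\<close>
definition cand :: "'a set => 'a set set" where
 "cand Q = {R : upto L. R \<subset> Q & (R : S | 4 * mo b Q * measure M R < (LINT x:R|M. dev Q x))}"

definition chld :: "'a set => 'a set set" where
 "chld Q = {R : cand Q. \<forall>T\<in>cand Q. R \<subseteq> T --> T = R}"

inductive_set aug :: "'a set set" where
 base: "Q : S ==> Q : aug"
| step: "Q : aug ==> R : chld Q ==> R : aug"

lemma aug_upto: "R : aug ==> R : upto L & (\<exists>Q\<in>S. R \<subseteq> Q)"
proof (induction rule: aug.induct)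
 case (base Q) then show ?case using SL by auto
next
 case (step Q R)
 then have "R : upto L" "R \<subset> Q" by (auto simp: chld_def cand_def)
 with step show ?case by blast
qed

lemma aug_cubes: "R : aug ==> R : cubes" using aug_upto upto_cubes by blast

lemma finite_aug: "finite aug"
proof -
 have "aug \<subseteq> (\<Union>Q\<in>S. {R : upto L. R \<subseteq> Q})" using aug_upto by blast
 moreover have "finite ..." using fS SL upto_below_finite upto_cubes by blast
 ultimately show ?thesis by (rule finite_subset)
qed

lemma finite_cand: "Q : cubes ==> finite (cand Q)"
 by (rule finite_subset[OF _ upto_below_finite[of Q L]]) (auto simp: cand_def)

lemma finite_chld: "Q : cubes ==> finite (chld Q)"
 using finite_cand[of Q] by (auto simp: chld_def)

lemma chldD: "R : chld Q ==> R : upto L" "R : chld Q ==> R \<subset> Q" "R : chld Q ==> R : cubes"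
 using upto_cubes by (auto simp: chld_def cand_def)

lemma cand_chld: assumes "Q : cubes" "R : cand Q" shows "\<exists>P\<in>chld Q. R \<subseteq> P"
proof -
 obtain m where "m : cand Q" "R \<subseteq> m" "\<forall>b\<in>cand Q. m \<subseteq> b --> m = b"
  using finite_has_maximal2[OF finite_cand[OF assms(1)] assms(2)] by auto
 then show ?thesis by (auto simp: chld_def)
qed

lemma chld_maximal: "P : chld Q ==> P' : chld Q ==> P \<subseteq> P' ==> P = P'"
 by (auto simp: chld_def)

lemma chld_disjoint:
 assumes "P : chld Q" "P' : chld Q" "x : P" "x : P'" shows "P = P'"
 using cubes_laminar[OF chldD(3)[OF assms(1)] chldD(3)[OF assms(2)]] assms
  chld_maximal[OF assms(1,2)] chld_maximal[OF assms(2,1)] by auto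

lemma aug_tree:
 assumes "R' : aug" "R : aug" "R' \<subset> R"
 shows "\<exists>P\<in>chld R. R' \<subseteq> P"
 using assms
proof (induction "card {T\<in>aug. R' \<subset> T}" arbitrary: R' R rule: less_induct)
 case less
 have Rc: "R : cubes" "R' : upto L" using aug_upto[OF less.prems(1)] aug_cubes[OF less.prems(2)] by auto
 from less.prems(1) show ?case
 proof (cases rule: aug.cases)
  case base
  then have "R' : cand R" using less.prems Rc by (auto simp: cand_def)
  then show ?thesis using cand_chld[OF Rc(1)] by auto
 next
  case (step Q)
  have R'Q: "R' \<subset> Q" using chldD(2)[OF step(2)] .
  have "R' ~= {}" using cubes_ne[OF upto_cubes[OF Rc(2)]] .
  then have "Q \<inter> R ~= {}" using R'Q less.prems(3) by blast
  then consider "Q = R" | "Q \<subset> R" | "R \<subset> Q" using cubes_laminar[OF aug_cubes[OF step(1)] Rc(1)] by blast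
  then show ?thesis
  proof cases
   case 1 then show ?thesis using step by blast
  next
   case 2
   have "{T\<in>aug. Q \<subset> T} \<subset> {T\<in>aug. R' \<subset> T}" using R'Q step by blast
   then have "card {T\<in>aug. Q \<subset> T} < card {T\<in>aug. R' \<subset> T}"
    using finite_aug by (intro psubset_card_mono) auto
   from less.hyps[OF this _ less.prems(2) 2] step R'Q show ?thesis by blast
  next
   case 3
   have "{T\<in>aug. R \<subset> T} \<subset> {T\<in>aug. R' \<subset> T}" using less.prems by blast
   then have "card {T\<in>aug. R \<subset> T} < card {T\<in>aug. R' \<subset> T}"
    using finite_aug by (intro psubset_card_mono) auto
   from less.hyps[OF this less.prems(2) _ 3] step obtain P where P: "P : chld Q" "R \<subseteq> P" by blast
   then have "R' = P" using chld_maximal[of R' Q P] step less.prems by blast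
   then show ?thesis using P less.prems by blast
  qed
 qed
qed

lemma aug_parent_unique:
 assumes "P : chld R" "P : chld R'" "R : aug" "R' : aug" shows "R = R'"
proof -
 have *: "~ R1 \<subset> R2" if "P : chld R1" "P : chld R2" "R1 : aug" "R2 : aug" for R1 R2
 proof
  assume "R1 \<subset> R2"
  from aug_tree[OF that(3,4) this] obtain P' where P': "P' : chld R2" "R1 \<subseteq> P'" by auto
  have "P \<subset> R1" using chldD(2)[OF that(1)] .
  then show False using chld_maximal[OF that(2) P'(1)] P'(2) by auto
 qed
 have "P ~= {}" "P \<subset> R" "P \<subset> R'" using chldD(2)[OF assms(1)] chldD(2)[OF assms(2)] cubes_ne[OF chldD(3)[OF assms(1)]] by auto
 then have "R \<inter> R' ~= {}" by blast
 then show ?thesis using cubes_laminar[OF aug_cubes[OF assms(3)] aug_cubes[OF assms(4)]]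
   *[OF assms] *[OF assms(2,1,4,3)] by auto
qed

lemma dev_nonneg: "0 <= dev Q x" by (simp add: dev_def)

lemma dev_int: "Q : cubes ==> set_integrable M Q (dev R)"
proof -
 assume Q: "Q : cubes"
 have "set_integrable M Q (%x. avg M R b)"
  using cubes_sets[OF Q] cubes_fin[OF Q] unfolding set_integrable_def by simp
 then have "set_integrable M Q (%x. b x - avg M R b)" using bint[OF Q] by (intro set_integral_diff(1))
 then show ?thesis unfolding dev_def by (rule set_integrable_norm)
qed

lemma mo_dev: "Q : cubes ==> (LINT x:Q|M. dev Q x) = mo b Q * measure M Q"
 using cubes_pos[of Q] by (simp add: mo_def avg_def dev_def)

lemma mo_nonneg: "0 <= mo b Q"
 unfolding mo_def avg_def set_lebesgue_integral_def
 by (intro scaleR_nonneg_nonneg integral_nonneg_AE AE_I2) auto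

lemma dev_mono:
 assumes "R : cubes" "Q : cubes" "R \<subseteq> Q"
 shows "(LINT x:R|M. dev P x) <= (LINT x:Q|M. dev P x)"
 using dev_int[OF assms(1), of P] dev_int[OF assms(2), of P] assms(3) dev_nonneg
 unfolding set_lebesgue_integral_def set_integrable_def
 by (intro integral_mono) (auto simp: indicator_def)

lemma not_cand:
 assumes "T : upto L" "T \<subseteq> Q" "T \<notin> cand Q" "Q : cubes"
 shows "(LINT x:T|M. dev Q x) <= 4 * mo b Q * measure M T"
proof (cases "T = Q")
 case True
 then show ?thesis using mo_dev[OF assms(4)] mo_nonneg[of Q] by simp
next
 case False
 then show ?thesis using assms by (auto simp: cand_def not_less)
qed

lemma avg_diff_le:
 assumes "P : cubes"
 shows "norm (avg M P b - avg M Q b) <= (1 / measure M P) * (LINT x:P|M. dev Q x)"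
proof -
 have c: "set_integrable M P (%x. avg M Q b)"
  using cubes_sets[OF assms] cubes_fin[OF assms] unfolding set_integrable_def by simp
 have "(LINT x:P|M. b x - avg M Q b) = (LINT x:P|M. b x) - measure M P *\<^sub>R avg M Q b"
  using bint[OF assms] c cubes_sets[OF assms] cubes_fin[OF assms] by (subst set_integral_diff(2)) (auto simp: set_lebesgue_integral_def)
 then have "avg M P b - avg M Q b = (1 / measure M P) *\<^sub>R (LINT x:P|M. b x - avg M Q b)"
  unfolding scaleR_diff_right using cubes_pos[OF assms] by (simp add: avg_def[of M P b] scaleR_diff_right)
 then have "norm (avg M P b - avg M Q b) = (1 / measure M P) * norm (LINT x:P|M. b x - avg M Q b)"
  by simp
 also have "... <= (1 / measure M P) * (LINT x:P|M. dev Q x)"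
  unfolding dev_def using bint[OF assms] c
  by (intro mult_left_mono set_integral_norm_bound set_integral_diff(1)) auto
 finally show ?thesis .
qed

text \<open>
The cube just above a stopping cube is not a candidate, and it has comparable measure.
\<close>
lemma chld_avg:
 assumes P: "P : chld Q" and Q: "Q : upto L"
 shows "norm (avg M P b - avg M Q b) <= 4 * Cd * mo b Q"
proof -
 have Pc: "P : cubes" and Qc: "Q : cubes" using chldD[OF P] upto_cubes[OF Q] by auto
 obtain l k where lk: "l <= L" "P : D l" "Q : D k" using chldD(1)[OF P] Q by (auto simp: upto_def)
 obtain m T where T: "m <= l" "T : D m" "P \<subset> T" "T \<subseteq> Q" "measure M T <= Cd * measure M P"
  using immediate_superset[OF lk(2,3) chldD(2)[OF P]] by blast
 have Tu: "T : upto L" using T lk by (force simp: upto_def)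
 have "T \<notin> cand Q" using P T(3) by (auto simp: chld_def)
 have "(LINT x:P|M. dev Q x) <= (LINT x:T|M. dev Q x)"
  by (rule dev_mono[OF Pc upto_cubes[OF Tu]]) (use T in auto)
 also have "... <= 4 * mo b Q * measure M T" by (rule not_cand) (use Tu T \<open>T \<notin> cand Q\<close> Qc in auto)
 also have "... <= 4 * mo b Q * (Cd * measure M P)" using T mo_nonneg[of Q] by (intro mult_left_mono) auto
 finally have *: "(LINT x:P|M. dev Q x) <= 4 * mo b Q * (Cd * measure M P)" .
 have "norm (avg M P b - avg M Q b) <= (1 / measure M P) * (LINT x:P|M. dev Q x)" by (rule avg_diff_le[OF Pc])
 also have "... <= (1 / measure M P) * (4 * mo b Q * (Cd * measure M P))"
  using * by (intro mult_left_mono) auto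
 also have "... = 4 * Cd * mo b Q" using cubes_pos[OF Pc] by simp
 finally show ?thesis .
qed

text \<open>
Pass from $Q$ to the stopping child that contains the point: replacing $b_Q$ by the mean over the
child costs a multiple of the oscillation over $Q$, and the rest is the same statement for the
child. If no child contains the point, the stopping rule bounds the mean over the cell of
generation $L$.
\<close>
lemma local_oscillation_bound:
 assumes Q: "Q : aug" and x: "x : Q"
 shows "E L (dev Q) x <= 4 * Cd * (\<Sum>R\<in>{R\<in>aug. x : R & R \<subseteq> Q}. mo b R)"
 using assms
proof (induction "card {R\<in>aug. x : R & R \<subseteq> Q}" arbitrary: Q rule: less_induct)
 case less
 note Q = less.prems(1) and x = less.prems(2)
 have Qc: "Q : cubes" "Q : upto L" using aug_upto aug_cubes Q by auto
 have xs: "x : space M" using x sets.sets_into_space[OF cubes_sets[OF Qc(1)]] by auto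
 let ?A = "%Q. {R\<in>aug. x : R & R \<subseteq> Q}"
 have fA: "finite (?A Q)" for Q using finite_aug by auto
 have cell: "cell L x : cubes" "cell L x : upto L" "x : cell L x"
  using cell[OF xs, of L] DI[of "cell L x" L] by (auto simp: upto_def)
 have sum0: "0 <= (\<Sum>R\<in>?A Q. mo b R)" for Q by (intro sum_nonneg mo_nonneg)
 show ?case
 proof (cases "\<exists>P\<in>chld Q. x : P")
  case True
  then obtain P where P: "P : chld Q" "x : P" by blast
  have Pa: "P : aug" "P \<subset> Q" using P Q aug.step chldD by auto
  have sub: "?A P \<subseteq> ?A Q - {Q}" using Pa by auto
  have QA: "Q : ?A Q" using Q x by auto
  have "card (?A P) <= card (?A Q - {Q})" using fA[of Q] sub by (intro card_mono) auto
  also have "... < card (?A Q)" using fA[of Q] QA by (rule card_Diff1_less)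
  finally have "card (?A P) < card (?A Q)" .
  from less.hyps[OF this Pa(1) P(2)] have IH: "E L (dev P) x <= 4 * Cd * (\<Sum>R\<in>?A P. mo b R)" .
  define c where "c = norm (avg M P b - avg M Q b)"
  have "E L (dev Q) x <= E L (%y. dev P y + c) x"
   unfolding E_def avg_def real_scaleR_def
  proof (rule mult_left_mono)
   show "(LINT y:cell L x|M. dev Q y) <= (LINT y:cell L x|M. dev P y + c)"
   proof (rule set_integral_mono)
    show "set_integrable M (cell L x) (%y. dev P y + c)"
     using cubes_sets[OF cell(1)] cubes_fin[OF cell(1)]
     by (intro set_integral_add(1) dev_int cell(1)) (auto simp: set_integrable_def)
    fix y
    have "b y - avg M Q b = (b y - avg M P b) + (avg M P b - avg M Q b)" by simp
    then show "dev Q y <= dev P y + c"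
     unfolding dev_def c_def by (metis norm_triangle_ineq)
   qed (rule dev_int[OF cell(1)])
  qed auto
  also have "... = E L (dev P) x + c"
  proof -
   have "(LINT y:cell L x|M. dev P y + c) = (LINT y:cell L x|M. dev P y) + measure M (cell L x) * c"
    using cubes_sets[OF cell(1)] cubes_fin[OF cell(1)]
    by (subst set_integral_add(2)[OF dev_int[OF cell(1)]]) (auto simp: set_integrable_def set_lebesgue_integral_def)
   then show ?thesis using cubes_pos[OF cell(1)] unfolding E_def avg_def by (simp add: field_simps)
  qed
  also have "... <= 4 * Cd * (\<Sum>R\<in>?A P. mo b R) + 4 * Cd * mo b Q"
   using IH chld_avg[OF P(1) Qc(2)] unfolding c_def by (rule add_mono)
  also have "... = 4 * Cd * (mo b Q + (\<Sum>R\<in>?A P. mo b R))" by (simp add: distrib_left)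
  also have "mo b Q + (\<Sum>R\<in>?A P. mo b R) <= mo b Q + (\<Sum>R\<in>?A Q - {Q}. mo b R)"
   using sub fA[of Q] mo_nonneg by (intro add_left_mono sum_mono2) auto
  also have "... = (\<Sum>R\<in>?A Q. mo b R)" using sum.remove[OF fA QA, of "mo b"] by simp
  finally show ?thesis using Cd_ge_1 by (simp add: mult_left_mono)
 next
  case False
  obtain k where "k <= L" "Q : D k" using Qc(2) by (auto simp: upto_def)
  then have "cell L x \<subseteq> Q" using cell_subset[of Q k L x] x by auto
  moreover have "cell L x \<notin> cand Q"
   using False cand_chld[OF Qc(1), of "cell L x"] cell(3) by auto
  ultimately have "(LINT y:cell L x|M. dev Q y) <= 4 * mo b Q * measure M (cell L x)"
   by (intro not_cand cell(2) Qc(1))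
  then have "E L (dev Q) x <= 4 * mo b Q"
   using cubes_pos[OF cell(1)] unfolding E_def avg_def by (simp add: field_simps)
  also have "... <= 4 * Cd * mo b Q" using Cd_ge_1 mo_nonneg[of Q] by (simp add: mult_right_mono)
  also have "mo b Q <= (\<Sum>R\<in>?A Q. mo b R)" using Q x fA mo_nonneg by (intro member_le_sum) auto
  finally show ?thesis using Cd_ge_1 by (simp add: mult_left_mono)
 qed
qed

text \<open>
The factor four in the stopping rule, by Chebyshev.
\<close>
lemma bad_children_small:
 assumes Q: "Q : cubes"
 shows "measure M (\<Union>(chld Q - S)) <= measure M Q / 4"
proof -
 let ?B = "chld Q - S"
 have fB: "finite ?B" using finite_chld[OF Q] by auto
 have Bc: "R : cubes" "R \<subseteq> Q" "4 * mo b Q * measure M R < (LINT x:R|M. dev Q x)" if "R : ?B" for R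
 proof -
  have RQ: "R : chld Q" "R \<notin> S" using that by auto
  show "R : cubes" "R \<subseteq> Q" using chldD(2,3)[OF RQ(1)] by auto
  show "4 * mo b Q * measure M R < (LINT x:R|M. dev Q x)" using RQ by (simp add: chld_def cand_def)
 qed
 show ?thesis
 proof (cases "mo b Q = 0")
  case True
  have "?B = {}"
  proof (rule ccontr)
   assume "?B ~= {}"
   then obtain R where R: "R : ?B" by blast
   have "0 < (LINT x:R|M. dev Q x)" using Bc(3)[OF R] True by simp
   also have "... <= (LINT x:Q|M. dev Q x)" by (rule dev_mono[OF Bc(1)[OF R] Q Bc(2)[OF R]])
   finally show False using mo_dev[OF Q] True by simp
  qed
  then show ?thesis by (simp only: Union_empty measure_empty) simp
 next
  case False
  then have m: "0 < mo b Q" using mo_nonneg[of Q] by simp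
  have disj: "disjoint_family_on (%R. R) ?B"
   unfolding disjoint_family_on_def using chld_disjoint[of _ Q] by (auto simp: disjoint_iff)
  have "measure M (\<Union>R\<in>?B. R) = (\<Sum>R\<in>?B. measure M R)"
  proof (rule measure_finite_Union[OF fB _ disj])
   show "(%R. R) ` ?B \<subseteq> sets M" using cubes_sets[OF Bc(1)] by auto
   show "emeasure M R ~= \<infinity>" if "R : ?B" for R using cubes_fin[OF Bc(1)[OF that]] by simp
  qed
  then have "4 * mo b Q * measure M (\<Union>?B) = (\<Sum>R\<in>?B. 4 * mo b Q * measure M R)"
   by (simp add: sum_distrib_left)
  also have "... <= (\<Sum>R\<in>?B. LINT x:R|M. dev Q x)" using Bc(3) by (intro sum_mono) (simp add: less_imp_le)
  also have "... = (LINT x:(\<Union>?B)|M. dev Q x)"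
  proof -
   have "(LINT x:(\<Union>R\<in>?B. R)|M. dev Q x) = (\<Sum>R\<in>?B. LINT x:R|M. dev Q x)"
   proof (rule set_integral_finite_UN_AE[OF fB])
    fix i j assume ij: "i : ?B" "j : ?B"
    then show "AE x in M. x : i & x : j --> i = j"
     using chld_disjoint[of i Q j] by (intro AE_I2) auto
    show "i : sets M" "set_integrable M i (dev Q)" using cubes_sets[OF Bc(1)] dev_int[OF Bc(1)] ij by auto
   qed
   then show ?thesis by simp
  qed
  also have "... <= (LINT x:Q|M. dev Q x)"
  proof -
   have "\<Union>?B \<subseteq> Q" by (rule Union_least) (rule Bc(2))
   moreover have "\<Union>?B : sets M" using fB cubes_sets[OF Bc(1)] by (intro sets.finite_Union) auto
   ultimately have U: "\<Union>?B \<subseteq> Q" "\<Union>?B : sets M" by auto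
   have "set_integrable M (\<Union>?B) (dev Q)" using set_integrable_subset[OF dev_int[OF Q] U(2,1)] .
   then show ?thesis using dev_int[OF Q, of Q] U(1) dev_nonneg
    unfolding set_lebesgue_integral_def set_integrable_def
    by (intro integral_mono) (auto simp: indicator_def)
  qed
  also have "... = mo b Q * measure M Q" by (rule mo_dev[OF Q])
  finally show ?thesis using m by simp
 qed
qed

text \<open>
The children of $R$ outside $S$ cover at most a quarter of it. If those in $S$ cover at most half,
then a quarter of $R$ is left over, and these remainders are disjoint for different $R$. Otherwise
$R$ takes over the sets $E_P$ of its children $P$ in $S$; as a cube is the child of only one
member, this overlaps at most $K$ times.
\<close>
lemma aug_sparse:
 assumes \<eta>: "0 <= \<eta>" "\<eta> <= 1" and Es: "!!Q. Q : S ==> Es Q : sets M & Es Q \<subseteq> Q & \<eta> * measure M Q <= measure M (Es Q)"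
  and K: "!!x. x : space M ==> card {Q\<in>S. x : Es Q} <= K"
 shows "\<exists>E'. (\<forall>R\<in>aug. E' R : sets M & E' R \<subseteq> R & \<eta> / 4 * measure M R <= measure M (E' R)) \<and>
  (\<forall>x\<in>space M. card {R\<in>aug. x : E' R} <= K + 1)"
proof -
 define small where "small R \<longleftrightarrow> measure M (\<Union>(chld R \<inter> S)) <= measure M R / 2" for R
 define E' where "E' R = (if small R then R - \<Union>(chld R) else \<Union>(Es ` (chld R \<inter> S)))" for R
 have A: "E' R : sets M & E' R \<subseteq> R & \<eta> / 4 * measure M R <= measure M (E' R)" if R: "R : aug" for R
 proof -
  have Rc: "R : cubes" using aug_cubes R by auto
  have fc: "finite (chld R)" using finite_chld[OF Rc] .
  have cs: "P : sets M" "P \<subseteq> R" "emeasure M P < \<infinity>" if "P : chld R" for P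
   using chldD(3)[OF that] chldD(2)[OF that] cubes_sets cubes_fin by auto
  have Uc: "\<Union>(chld R) : sets M" "\<Union>(chld R) \<subseteq> R" "\<Union>(chld R \<inter> S) : sets M" "\<Union>(chld R - S) : sets M"
  proof -
   show "\<Union>(chld R) \<subseteq> R" using cs(2) by (rule Union_least)
  qed (use fc cs(1) in \<open>auto intro!: sets.finite_Union\<close>)
  have finR: "R : fmeasurable M" using cubes_sets[OF Rc] cubes_fin[OF Rc] by (simp add: fmeasurable_def)
  have R0: "0 < measure M R" using cubes_pos[OF Rc] .
  show ?thesis
  proof (cases "small R")
   case True
   have "measure M (\<Union>(chld R)) <= measure M (\<Union>(chld R \<inter> S)) + measure M (\<Union>(chld R - S))"
   proof -
    have "\<Union>(chld R) = \<Union>(chld R \<inter> S) \<union> \<Union>(chld R - S)" by blast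
    moreover have "\<Union>(chld R \<inter> S) : fmeasurable M" "\<Union>(chld R - S) : fmeasurable M"
     using Uc cs finR by (auto intro!: fmeasurableI2[OF finR])
    ultimately show ?thesis using measure_Un_le Uc by metis
   qed
   also have "... <= measure M R / 2 + measure M R / 4"
    using True bad_children_small[OF Rc] by (intro add_mono) (auto simp: small_def)
   finally have "measure M (\<Union>(chld R)) <= 3/4 * measure M R" by simp
   moreover have "measure M (R - \<Union>(chld R)) = measure M R - measure M (\<Union>(chld R))"
    using finR Uc by (intro measurable_measure_Diff) auto
   ultimately have "1/4 * measure M R <= measure M (E' R)" using True by (simp add: E'_def)
   moreover have "\<eta> / 4 * measure M R <= 1/4 * measure M R" using \<eta> R0 by (intro mult_right_mono) auto
   ultimately show ?thesis using True Uc cubes_sets[OF Rc] by (auto simp: E'_def)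
  next
   case False
   let ?B = "chld R \<inter> S"
   have fB: "finite ?B" using fc by auto
   have disj: "disjoint_family_on (%R. R) ?B" "disjoint_family_on Es ?B"
   proof -
    show "disjoint_family_on (%R. R) ?B"
     unfolding disjoint_family_on_def using chld_disjoint[of _ R] by (auto simp: disjoint_iff)
    show "disjoint_family_on Es ?B"
     unfolding disjoint_family_on_def
    proof (intro ballI impI)
     fix m n assume mn: "m : ?B" "n : ?B" "m ~= n"
     then have "Es m \<subseteq> m" "Es n \<subseteq> n" using Es by auto
     moreover have "m \<inter> n = {}" using mn chld_disjoint[of m R n] by auto
     ultimately show "Es m \<inter> Es n = {}" by auto
    qed
   qed
   have Efin: "emeasure M (Es P) ~= \<infinity>" if "P : ?B" for P
   proof -
    have "emeasure M (Es P) <= emeasure M P" using that Es[of P] cs[of P] by (intro emeasure_mono) auto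
    also have "... < \<infinity>" using cs(3)[of P] that by auto
    finally show ?thesis by simp
   qed
   have "measure M (\<Union>P\<in>?B. P) = (\<Sum>P\<in>?B. measure M P)"
   proof (rule measure_finite_Union[OF fB _ disj(1)])
    show "(%P. P) ` ?B \<subseteq> sets M" using cs(1) by auto
    show "emeasure M P ~= \<infinity>" if "P : ?B" for P using cs(3)[of P] that by auto
   qed
   then have "measure M (\<Union>?B) = (\<Sum>P\<in>?B. measure M P)" by simp
   moreover have "measure M (\<Union>P\<in>?B. Es P) = (\<Sum>P\<in>?B. measure M (Es P))"
    by (rule measure_finite_Union[OF fB _ disj(2) Efin]) (use Es in auto)
   moreover have "\<eta> * (\<Sum>P\<in>?B. measure M P) <= (\<Sum>P\<in>?B. measure M (Es P))"
    unfolding sum_distrib_left using Es by (intro sum_mono) auto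
   ultimately have "\<eta> * measure M (\<Union>?B) <= measure M (E' R)" using False by (simp add: E'_def)
   moreover have "\<eta> / 4 * measure M R <= \<eta> * measure M (\<Union>?B)"
   proof -
    have "measure M R / 4 <= measure M (\<Union>?B)" using False R0 by (simp add: small_def)
    then have "\<eta> * (measure M R / 4) <= \<eta> * measure M (\<Union>?B)" using \<eta> by (intro mult_left_mono) auto
    then show ?thesis by simp
   qed
   moreover have "\<Union>(Es ` ?B) : sets M" using fB Es by (intro sets.finite_UN) auto
   moreover have "\<Union>(Es ` ?B) \<subseteq> R"
   proof (rule UN_least)
    fix P assume "P : ?B"
    then show "Es P \<subseteq> R" using Es[of P] cs(2)[of P] by auto
   qed
   ultimately show ?thesis using False by (simp add: E'_def)
  qed
 qed
 have B: "card {R\<in>aug. x : E' R} <= K + 1" if x: "x : space M" for x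
 proof -
  let ?X = "{R\<in>aug. small R & x : E' R}" and ?Y = "{R\<in>aug. ~ small R & x : E' R}"
  have "R = R'" if RR: "R : ?X" "R' : ?X" for R R'
  proof -
   have nn: "~ R1 \<subset> R2" if "R1 : ?X" "R2 : ?X" for R1 R2
   proof
    assume "R1 \<subset> R2"
    have R12: "R1 : aug" "R2 : aug" using that by auto
    from aug_tree[OF R12 \<open>R1 \<subset> R2\<close>] obtain P where "P : chld R2" "R1 \<subseteq> P" by auto
    moreover have "x : R1" "x \<notin> \<Union>(chld R2)" using that by (auto simp: E'_def)
    ultimately show False by auto
   qed
   have Ra: "R : aug" "R' : aug" using RR by auto
   have "x : R" "x : R'" using RR A[OF Ra(1)] A[OF Ra(2)] by auto
   then show ?thesis using cubes_laminar[OF aug_cubes[OF Ra(1)] aug_cubes[OF Ra(2)]]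
     nn[OF RR] nn[OF RR(2,1)] by auto
  qed
  then have "\<forall>R\<in>?X. \<forall>R'\<in>?X. R = R'" by (intro ballI)
  moreover have "finite ?X" using finite_aug by auto
  ultimately have cX: "card ?X <= 1" using card_le_Suc0_iff_eq[of ?X] by simp
  define f where "f R = (SOME P. P : chld R \<inter> S & x : Es P)" for R
  have f: "f R : chld R \<inter> S & x : Es (f R)" if "R : ?Y" for R
  proof -
   have "\<exists>P. P : chld R \<inter> S & x : Es P" using that by (auto simp: E'_def)
   then show ?thesis unfolding f_def by (rule someI_ex)
  qed
  have "inj_on f ?Y"
  proof (rule inj_onI)
   fix R R' assume "R : ?Y" "R' : ?Y" "f R = f R'"
   then show "R = R'" using f[of R] f[of R'] aug_parent_unique[of "f R" R R'] by auto
  qed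
  moreover have "f ` ?Y \<subseteq> {Q\<in>S. x : Es Q}"
  proof
   fix P assume "P : f ` ?Y"
   then obtain R where "R : ?Y" "P = f R" by blast
   then show "P : {Q\<in>S. x : Es Q}" using f[of R] by simp
  qed
  ultimately have "card ?Y <= card {Q\<in>S. x : Es Q}" using fS by (intro card_inj_on_le) simp_all
  then have cY: "card ?Y <= K" using K[OF x] by simp
  have "{R\<in>aug. x : E' R} = ?X \<union> ?Y" by auto
  then have "card {R\<in>aug. x : E' R} <= card ?X + card ?Y" by (simp only: card_Un_le)
  then show ?thesis using cX cY by simp
 qed
 show ?thesis by (rule exI[of _ E'], intro conjI ballI A B)
qed

end

section \<open>Carleson embedding for sparse families\<close>

lemma WL_mono:
 assumes g: "WL M p w g A" and f: "f : borel_measurable M" and p: "0 <= p"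
  and w: "!!x. x : space M ==> 0 <= w x" and le: "AE x in M. \<bar>f x\<bar> <= \<bar>g x\<bar>"
 shows "WL M p w f A"
proof -
 have "(\<integral>\<^sup>+x. ennreal (\<bar>f x\<bar> powr p * w x) \<partial>M) <= (\<integral>\<^sup>+x. ennreal (\<bar>g x\<bar> powr p * w x) \<partial>M)"
  using le AE_space by (intro nn_integral_mono_AE, eventually_elim) (auto intro!: ennreal_leI mult_right_mono powr_mono2 p w)
 then show ?thesis using g f by (auto simp: WL_def intro: order_trans)
qed

lemma WL_le: assumes "WL M p w f A" "A <= B" "0 <= p" shows "WL M p w f B"
proof -
 have "ennreal (A powr p) <= ennreal (B powr p)"
  using assms by (intro ennreal_leI powr_mono2) (auto simp: WL_def)
 then show ?thesis using assms unfolding WL_def by (meson order_trans)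
qed

lemma WL_scale:
 assumes f: "WL M p w f A" and c: "0 <= c" and w: "w : borel_measurable M"
 shows "WL M p w (%x. c * f x) (c * A)"
proof -
 have [measurable]: "f : borel_measurable M" "w : borel_measurable M" using f w by (auto simp: WL_def)
 have "(\<integral>\<^sup>+x. ennreal (\<bar>c * f x\<bar> powr p * w x) \<partial>M) = (\<integral>\<^sup>+x. ennreal (c powr p) * ennreal (\<bar>f x\<bar> powr p * w x) \<partial>M)"
  using c by (intro nn_integral_cong) (simp add: abs_mult powr_mult ennreal_mult' mult.assoc)
 also have "... = ennreal (c powr p) * (\<integral>\<^sup>+x. ennreal (\<bar>f x\<bar> powr p * w x) \<partial>M)"
  by (intro nn_integral_cmult) auto
 also have "... <= ennreal (c powr p) * ennreal (A powr p)"
  using f by (intro mult_left_mono) (auto simp: WL_def)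
 also have "... = ennreal ((c * A) powr p)"
  using f c by (simp add: powr_mult ennreal_mult WL_def)
 finally show ?thesis using f c by (auto simp: WL_def)
qed

lemma powr_add_le:
 fixes x y :: real
 assumes "1 <= p" "0 <= x" "0 <= y"
 shows "(x + y) powr p <= 2 powr p * (x powr p + y powr p)"
proof -
 have "(x + y) powr p <= (2 * max x y) powr p" using assms by (intro powr_mono2) auto
 also have "... = 2 powr p * max x y powr p" using assms by (simp add: powr_mult)
 also have "max x y powr p <= x powr p + y powr p" using assms by (auto simp: max_def)
 finally show ?thesis by simp
qed

lemma WL_add:
 assumes f: "WL M p w f A" and g: "WL M p w g B" and p: "1 <= p"
  and w: "w : borel_measurable M" "!!x. x : space M ==> 0 <= w x"
 shows "WL M p w (%x. f x + g x) (4 * (A + B))"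
proof -
 have [measurable]: "f : borel_measurable M" "g : borel_measurable M" "w : borel_measurable M"
  using f g w by (auto simp: WL_def)
 have AB: "0 <= A" "0 <= B" using f g by (auto simp: WL_def)
 have "(\<integral>\<^sup>+x. ennreal (\<bar>f x + g x\<bar> powr p * w x) \<partial>M) \<le>
  (\<integral>\<^sup>+x. ennreal (2 powr p) * (ennreal (\<bar>f x\<bar> powr p * w x) + ennreal (\<bar>g x\<bar> powr p * w x)) \<partial>M)"
 proof (intro nn_integral_mono)
  fix x assume x: "x : space M"
  have "\<bar>f x + g x\<bar> powr p <= (\<bar>f x\<bar> + \<bar>g x\<bar>) powr p" using p by (intro powr_mono2) auto
  also have "... <= 2 powr p * (\<bar>f x\<bar> powr p + \<bar>g x\<bar> powr p)" using p by (intro powr_add_le) auto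
  finally have "\<bar>f x + g x\<bar> powr p * w x <= 2 powr p * (\<bar>f x\<bar> powr p + \<bar>g x\<bar> powr p) * w x"
   using w(2)[OF x] by (rule mult_right_mono)
  also have "... = 2 powr p * (\<bar>f x\<bar> powr p * w x + \<bar>g x\<bar> powr p * w x)" by (simp add: algebra_simps)
  finally show "ennreal (\<bar>f x + g x\<bar> powr p * w x) <= ennreal (2 powr p) * (ennreal (\<bar>f x\<bar> powr p * w x) + ennreal (\<bar>g x\<bar> powr p * w x))"
   using w(2)[OF x] by (simp add: ennreal_mult[symmetric] ennreal_plus[symmetric] ennreal_leI del: ennreal_plus)
 qed
 also have "... = ennreal (2 powr p) * ((\<integral>\<^sup>+x. ennreal (\<bar>f x\<bar> powr p * w x) \<partial>M) + (\<integral>\<^sup>+x. ennreal (\<bar>g x\<bar> powr p * w x) \<partial>M))"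
  by (subst nn_integral_cmult) (auto simp: nn_integral_add)
 also have "... <= ennreal (2 powr p) * (ennreal (A powr p) + ennreal (B powr p))"
  using f g by (intro mult_left_mono add_mono) (auto simp: WL_def)
 also have "... = ennreal (2 powr p * (A powr p + B powr p))"
  by (simp add: ennreal_mult[symmetric] ennreal_plus[symmetric] del: ennreal_plus)
 also have "... <= ennreal ((4 * (A + B)) powr p)"
 proof (rule ennreal_leI)
  have "A powr p <= (A + B) powr p" "B powr p <= (A + B) powr p" using AB p by (auto intro!: powr_mono2)
  then have "A powr p + B powr p <= 2 * (A + B) powr p" by simp
  also have "... <= 2 powr p * (A + B) powr p"
   using p powr_mono[of 1 p 2] by (intro mult_right_mono) auto
  finally have "2 powr p * (A powr p + B powr p) <= 2 powr p * (2 powr p * (A + B) powr p)"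
   by (intro mult_left_mono) auto
  also have "... = (4 * (A + B)) powr p"
  proof -
   have "(2 * 2) powr p = (2 powr p * 2 powr p :: real)" by (rule powr_mult)
   then have "4 powr p = (2 powr p * 2 powr p :: real)" by simp
   moreover have "(4 * (A + B)) powr p = 4 powr p * (A + B) powr p" by (rule powr_mult)
   ultimately show ?thesis by (metis mult.assoc)
  qed
  finally show "2 powr p * (A powr p + B powr p) <= (4 * (A + B)) powr p" .
 qed
 finally show ?thesis using AB by (auto simp: WL_def)
qed

lemma WL_limit:
 assumes u: "!!n::nat. WL M p w (u n) A" and f: "f : borel_measurable M"
  and w[measurable]: "w : borel_measurable M" and p: "0 < p"
  and lim: "AE x in M. (%n. u n x) \<longlonglongrightarrow> f x"
 shows "WL M p w f A"
proof -
 have [measurable]: "u n : borel_measurable M" for n using u by (auto simp: WL_def)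
 have "(\<integral>\<^sup>+x. ennreal (\<bar>f x\<bar> powr p * w x) \<partial>M) = (\<integral>\<^sup>+x. liminf (%n. ennreal (\<bar>u n x\<bar> powr p * w x)) \<partial>M)"
 proof (intro nn_integral_cong_AE, use lim in eventually_elim)
  case (elim x)
  have "(%n. \<bar>u n x\<bar> powr p * w x) \<longlonglongrightarrow> \<bar>f x\<bar> powr p * w x"
   using elim p by (intro tendsto_intros) auto
  then have "(%n. ennreal (\<bar>u n x\<bar> powr p * w x)) \<longlonglongrightarrow> ennreal (\<bar>f x\<bar> powr p * w x)"
   by (rule tendsto_ennrealI)
  then show ?case by (intro lim_imp_Liminf[symmetric]) auto
 qed
 also have "... <= liminf (%n. \<integral>\<^sup>+x. ennreal (\<bar>u n x\<bar> powr p * w x) \<partial>M)"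
  by (rule nn_integral_liminf) auto
 also have "... <= ennreal (A powr p)"
  using u by (intro Liminf_le) (auto simp: WL_def)
 finally show ?thesis using f u by (auto simp: WL_def)
qed

lemma powr_neg_step:
 fixes x C s :: real
 assumes C: "2 <= C" and s: "0 < s" and T: "0 < T0" "T0 <= (1 - 1/C) * T"
 defines "\<kappa> \<equiv> (1 - 1/C) powr s"
 shows "(1 + \<kappa> / (1 - \<kappa>)) * T powr (-s) <= \<kappa> / (1 - \<kappa>) * T0 powr (-s)"
proof -
 have c: "0 < 1 - 1/C" "1 - 1/C < 1" using C by auto
 have k: "0 < \<kappa>" "\<kappa> < 1" using c s powr_less_mono2[of s "1 - 1/C" 1] by (simp_all add: \<kappa>_def)
 have Tp: "0 < T" using T c by (smt (verit) mult_nonneg_nonpos)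
 have "((1 - 1/C) * T) powr (-s) <= T0 powr (-s)"
  using T s by (intro powr_mono2') auto
 moreover have "((1 - 1/C) * T) powr (-s) = (1 - 1/C) powr (-s) * T powr (-s)"
  by (rule powr_mult)
 moreover have "(1 - 1/C) powr (-s) = 1 / \<kappa>" by (simp only: \<kappa>_def powr_minus_divide)
 ultimately have "1 / \<kappa> * T powr (-s) <= T0 powr (-s)" by simp
 then have "\<kappa> * (1 / \<kappa> * T powr (-s)) <= \<kappa> * T0 powr (-s)" using k by (intro mult_left_mono) auto
 then have "T powr (-s) <= \<kappa> * T0 powr (-s)" using k by simp
 then have "(1 / (1 - \<kappa>)) * T powr (-s) <= (1 / (1 - \<kappa>)) * (\<kappa> * T0 powr (-s))"
  using k by (intro mult_left_mono) auto
 moreover have "1 + \<kappa> / (1 - \<kappa>) = 1 / (1 - \<kappa>)" using k by (simp add: field_simps)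
 ultimately show ?thesis by simp
qed

text \<open>
A Carleson packing condition along a chain makes the partial sums of $t$ grow geometrically, so
that the negative powers form a series dominated by a geometric one that starts at $r^{-s}$.
\<close>
lemma chain_sum_bound:
 fixes t :: "'a set => real"
 assumes C: "2 <= C" and s: "0 < s" and r: "0 < r"
  and fin: "finite G" and chain: "!!Q R. Q : G ==> R : G ==> Q \<subseteq> R | R \<subseteq> Q"
  and t: "!!Q. Q : G ==> r <= t Q"
  and sum: "!!Q. Q : G ==> (\<Sum>R\<in>{R\<in>G. R \<subseteq> Q}. t R) <= C * t Q"
 shows "(\<Sum>Q\<in>G. t Q powr (-s)) <= C powr s * (1 + (1 - 1/C) powr s / (1 - (1 - 1/C) powr s)) * r powr (-s)"
proof -
 define \<kappa> where "\<kappa> = (1 - 1/C) powr s"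
 define B where "B = \<kappa> / (1 - \<kappa>)"
 have c: "0 < 1 - 1/C" "1 - 1/C < 1" using C by auto
 have k: "0 < \<kappa>" "\<kappa> < 1" using c s powr_less_mono2[of s "1 - 1/C" 1] by (simp_all add: \<kappa>_def)
 have B: "0 < B" using k by (simp add: B_def)
 define T where "T G Q = (\<Sum>R\<in>{R\<in>G. R \<subseteq> Q}. t R)" for G Q
 have main: "(\<Sum>Q\<in>G. T G Q powr (-s)) + B * (\<Sum>Q\<in>G. t Q) powr (-s) <= (1 + B) * r powr (-s)"
  if "G ~= {}"
  using fin that chain t sum
 proof (induction "card G" arbitrary: G rule: less_induct)
  case less
  obtain Qm where Qm: "Qm : G" "!!R. R : G ==> Qm \<subseteq> R ==> R = Qm"
   using finite_has_maximal[OF less.prems(1,2)] by metis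
  have max: "R \<subseteq> Qm" if "R : G" for R using less.prems(3)[OF that Qm(1)] Qm(2)[OF that] by auto
  define G' where "G' = G - {Qm}"
  have TQm: "T G Qm = (\<Sum>Q\<in>G. t Q)" unfolding T_def using max by (intro sum.cong) auto
  have sumG: "(\<Sum>Q\<in>G. t Q) = t Qm + (\<Sum>Q\<in>G'. t Q)"
   unfolding G'_def using sum.remove[OF less.prems(1) Qm(1)] by simp
  have tm: "0 < t Qm" using less.prems(4)[OF Qm(1)] r by simp
  show ?case
  proof (cases "G' = {}")
   case True
   then have "G = {Qm}" using Qm by (auto simp: G'_def)
   moreover have "t Qm powr (-s) <= r powr (-s)"
    using less.prems(4)[OF Qm(1)] r s by (intro powr_mono2') auto
   moreover have "{R. R = Qm & R \<subseteq> Qm} = {Qm}" by auto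
   ultimately show ?thesis using B by (simp add: T_def distrib_right mult_left_mono add_mono)
  next
   case False
   have fin': "finite G'" using less.prems(1) by (simp add: G'_def)
   have TG': "T G Q = T G' Q" if "Q : G'" for Q
   proof -
    have "{R : G. R \<subseteq> Q} = {R : G'. R \<subseteq> Q}" using that Qm(2)[of Q] by (auto simp: G'_def)
    then show ?thesis by (simp add: T_def)
   qed
   have card: "card G' < card G" unfolding G'_def using less.prems(1) Qm(1) by (rule card_Diff1_less)
   have IH: "(\<Sum>Q\<in>G'. T G' Q powr (-s)) + B * (\<Sum>Q\<in>G'. t Q) powr (-s) <= (1 + B) * r powr (-s)"
   proof (rule less.hyps[OF card fin' False])
    fix Q R assume "Q : G'" "R : G'"
    then show "Q \<subseteq> R | R \<subseteq> Q" using less.prems(3) by (simp add: G'_def)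
   next
    fix Q assume Q: "Q : G'"
    then show "r <= t Q" using less.prems(4) by (simp add: G'_def)
    have "T G Q <= C * t Q" unfolding T_def using less.prems(5)[of Q] Q by (simp add: G'_def)
    then show "(\<Sum>R\<in>{R\<in>G'. R \<subseteq> Q}. t R) <= C * t Q" using TG'[OF Q] by (simp add: T_def)
   qed
   let ?U = "\<Sum>Q\<in>G'. t Q" and ?T = "\<Sum>Q\<in>G. t Q"
   have T0: "0 < ?U"
    using fin' False less.prems(4) r by (intro sum_pos) (auto simp: G'_def intro: less_le_trans)
   have "?T <= C * t Qm" using less.prems(5)[OF Qm(1)] TQm by (simp add: T_def)
   then have "?T / C <= t Qm" using C by (simp add: field_simps)
   moreover have "(1 - 1/C) * ?T = ?T - ?T / C" by (simp only: left_diff_distrib mult_1 times_divide_eq_left)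
   ultimately have "?U <= (1 - 1/C) * ?T" using sumG by linarith
   from powr_neg_step[OF C s T0 this] have st: "(1 + B) * ?T powr (-s) <= B * ?U powr (-s)"
    by (simp add: B_def \<kappa>_def)
   have "(\<Sum>Q\<in>G. T G Q powr (-s)) = T G Qm powr (-s) + (\<Sum>Q\<in>G'. T G Q powr (-s))"
    unfolding G'_def using sum.remove[OF less.prems(1) Qm(1)] by simp
   also have "(\<Sum>Q\<in>G'. T G Q powr (-s)) = (\<Sum>Q\<in>G'. T G' Q powr (-s))"
    by (intro sum.cong) (simp_all add: TG')
   finally have "(\<Sum>Q\<in>G. T G Q powr (-s)) + B * ?T powr (-s) = (1 + B) * ?T powr (-s) + (\<Sum>Q\<in>G'. T G' Q powr (-s))"
    by (simp add: TQm distrib_right)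
   then show ?thesis using st IH by linarith
  qed
 qed
 show ?thesis
 proof (cases "G = {}")
  case True
  then show ?thesis using C k B r by (simp add: \<kappa>_def[symmetric] B_def[symmetric])
 next
  case False
  have tQ: "t Q powr (-s) <= C powr s * T G Q powr (-s)" if Q: "Q : G" for Q
  proof -
   have tp: "0 < t Q" using t[OF Q] r by simp
   have "t Q <= T G Q" unfolding T_def using Q fin t r
    by (intro member_le_sum) (auto intro: order_trans less_imp_le)
   then have Tp: "0 < T G Q" using tp by simp
   have "T G Q <= C * t Q" using sum[OF Q] by (simp add: T_def)
   then have "(C * t Q) powr (-s) <= T G Q powr (-s)" using Tp s by (intro powr_mono2') auto
   then have "C powr s * (C * t Q) powr (-s) <= C powr s * T G Q powr (-s)" by (intro mult_left_mono) auto
   moreover have "C powr s * (C * t Q) powr (-s) = (C powr s * C powr (-s)) * t Q powr (-s)"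
    by (simp only: powr_mult mult.assoc)
   moreover have "C powr s * C powr (-s) = 1" using C by (simp flip: powr_add)
   ultimately show ?thesis by simp
  qed
  have "(\<Sum>Q\<in>G. t Q powr (-s)) <= C powr s * (\<Sum>Q\<in>G. T G Q powr (-s))"
   unfolding sum_distrib_left by (intro sum_mono tQ)
  also have "(\<Sum>Q\<in>G. T G Q powr (-s)) <= (1 + B) * r powr (-s)"
  proof -
   have "0 <= B * (\<Sum>Q\<in>G. t Q) powr (-s)" using B by simp
   then show ?thesis using main[OF False] by linarith
  qed
  finally show ?thesis using C by (simp add: B_def \<kappa>_def mult_left_mono mult.assoc)
 qed
qed

definition Csp :: "real => real => real => real => nat => real" where
 "Csp p q A \<eta> K = A * (A / \<eta>) powr (q / p) * (A / \<eta>) powr (p / q) * (real K powr (1/p) * q) * (real K powr (1/q) * p)"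

abbreviation Iset :: "'a measure => ('a => real) => 'a set => real" where "Iset M w Q \<equiv> (LINT x:Q|M. w x)"

lemma set_integrable_sub:
 fixes w :: "'a => real"
 shows "set_integrable M Q w ==> F : sets M ==> F \<subseteq> Q ==> set_integrable M F w"
 by (rule set_integrable_subset)

lemma nn_I:
 assumes "set_integrable M F w" "!!x. x : space M ==> 0 <= w x"
 shows "(\<integral>\<^sup>+x\<in>F. ennreal (w x) \<partial>M) = ennreal (Iset M w F)" "0 <= Iset M w F"
proof -
 have "(\<integral>\<^sup>+x\<in>F. ennreal (w x) \<partial>M) = (\<integral>\<^sup>+x. ennreal (indicator F x *\<^sub>R w x) \<partial>M)"
  by (intro nn_integral_cong) (auto simp: indicator_def)
 also have "... = ennreal (Iset M w F)"
  using assms unfolding set_integrable_def set_lebesgue_integral_def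
  by (intro nn_integral_eq_integral) (auto intro!: AE_I2)
 finally show "(\<integral>\<^sup>+x\<in>F. ennreal (w x) \<partial>M) = ennreal (Iset M w F)" .
 show "0 <= Iset M w F" unfolding set_lebesgue_integral_def using assms
  by (intro integral_nonneg_AE AE_I2) auto
qed

lemma I_pos:
 assumes "set_integrable M F w" "!!x. x : space M ==> 0 <= w x" "AE x in M. 0 < w x"
  "F : sets M" "0 < measure M F"
 shows "0 < Iset M w F"
proof (rule ccontr)
 assume "~ 0 < Iset M w F"
 then have 0: "(\<integral>\<^sup>+x\<in>F. ennreal (w x) \<partial>M) = 0" using nn_I[OF assms(1,2)] by simp
 have [measurable]: "(%x. indicator F x *\<^sub>R w x) : borel_measurable M"
  using assms(1) unfolding set_integrable_def by (rule borel_measurable_integrable)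
 have "(\<integral>\<^sup>+x. ennreal (indicator F x *\<^sub>R w x) \<partial>M) = (\<integral>\<^sup>+x\<in>F. ennreal (w x) \<partial>M)"
  by (intro nn_integral_cong) (auto simp: indicator_def)
 then have "(\<integral>\<^sup>+x. ennreal (indicator F x *\<^sub>R w x) \<partial>M) = 0" using 0 by simp
 moreover have m: "(%x. ennreal (indicator F x *\<^sub>R w x)) : borel_measurable M" by measurable
 ultimately have "AE x in M. ennreal (indicator F x *\<^sub>R w x) = 0" by (simp only: nn_integral_0_iff_AE)
 with assms(3) have "AE x in M. x \<notin> F" by eventually_elim (auto simp: indicator_def ennreal_eq_0_iff)
 then have "emeasure M F = 0" using assms(4) by (simp add: AE_iff_null_sets null_setsD1)
 then show False using assms(5) by (simp add: measure_def)
qed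

lemma I_mono:
 assumes "set_integrable M Q w" "!!x. x : space M ==> 0 <= w x" "F : sets M" "F \<subseteq> Q"
 shows "Iset M w F <= Iset M w Q"
 using assms set_integrable_sub[OF assms(1,3,4)] unfolding set_lebesgue_integral_def set_integrable_def
 by (intro integral_mono) (auto simp: indicator_def)

lemma WL_indicator:
 assumes "set_integrable M F w" "!!x. x : space M ==> 0 <= w x" "F : sets M" "0 < p"
 shows "WL M p w (indicator F) (Iset M w F powr (1/p))"
proof -
 have "(\<integral>\<^sup>+x. ennreal (\<bar>indicator F x\<bar> powr p * w x) \<partial>M) = (\<integral>\<^sup>+x\<in>F. ennreal (w x) \<partial>M)"
  by (intro nn_integral_cong) (auto simp: indicator_def)
 then show ?thesis using nn_I[OF assms(1,2)] assms(3,4) by (simp add: WL_def powr_powr)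
qed

text \<open>
Hoelder for $w^{1/p}\sigma^{1/q}=1$ on $F$ bounds $\mu(F)$ by $w(F)^{1/p}\sigma(Q)^{1/q}$; compare
with the $A_p$ condition on $Q$.
\<close>
lemma weight_sub_le:
 assumes dw: "dual_w M p q w sg" and A: "0 < A"
  and int: "set_integrable M Q w" "set_integrable M Q sg"
  and Ap: "Iset M w Q powr (1/p) * Iset M sg Q powr (1/q) <= A * measure M Q"
  and Q: "Q : sets M" "emeasure M Q < \<infinity>" "0 < measure M Q" and F: "F : sets M" "F \<subseteq> Q"
  and \<eta>: "0 < \<eta>" "\<eta> * measure M Q <= measure M F"
 shows "Iset M w Q powr (1/p) <= (A / \<eta>) * Iset M w F powr (1/p)"
proof -
 have pq: "1 < p" "1 < q" using dw by (auto simp: dual_w_def)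
 have w0: "!!x. x : space M ==> 0 <= w x" "!!x. x : space M ==> 0 <= sg x" using dw by (auto simp: dual_w_def)
 have sgp: "AE x in M. 0 < sg x" using dw unfolding dual_w_def by (auto elim: eventually_mono)
 have iw: "set_integrable M F w" "set_integrable M F sg" using set_integrable_sub int F by auto
 have "(\<integral>\<^sup>+x. ennreal \<bar>indicator F x * indicator F x\<bar> \<partial>M) <= ennreal (Iset M w F powr (1/p) * Iset M sg F powr (1/q))"
  using pq w0 by (intro Holder_weighted[OF dw] WL_indicator iw F) auto
 moreover have "(\<integral>\<^sup>+x. ennreal \<bar>indicator F x * indicator F x\<bar> \<partial>M) = emeasure M F"
  using F by (simp add: indicator_inter_arith[symmetric] ennreal_indicator)
 moreover have "emeasure M F = ennreal (measure M F)"
 proof -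
  have "emeasure M F <= emeasure M Q" using F Q by (intro emeasure_mono) auto
  then show ?thesis using Q by (intro emeasure_eq_ennreal_measure) auto
 qed
 ultimately have "measure M F <= Iset M w F powr (1/p) * Iset M sg F powr (1/q)" by (simp add: ennreal_le_iff)
 also have "Iset M sg F powr (1/q) <= Iset M sg Q powr (1/q)"
  using I_mono[OF int(2) w0(2) F] nn_I(2)[OF iw(2) w0(2)] pq by (intro powr_mono2) auto
 finally have 1: "\<eta> * measure M Q <= Iset M w F powr (1/p) * Iset M sg Q powr (1/q)" using \<eta> by (simp add: mult_left_mono)
 have s: "0 < Iset M sg Q powr (1/q)"
  using I_pos[OF int(2) w0(2) sgp Q(1,3)] by simp
 have "\<eta> * (Iset M w Q powr (1/p) * Iset M sg Q powr (1/q)) <= \<eta> * (A * measure M Q)"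
  using Ap \<eta> by (intro mult_left_mono) auto
 also have "... = A * (\<eta> * measure M Q)" by simp
 also have "... <= A * (Iset M w F powr (1/p) * Iset M sg Q powr (1/q))" using 1 A by (intro mult_left_mono) auto
 finally have "(\<eta> * Iset M w Q powr (1/p)) * Iset M sg Q powr (1/q) <= (A * Iset M w F powr (1/p)) * Iset M sg Q powr (1/q)"
  by (simp add: mult.assoc)
 then have "\<eta> * Iset M w Q powr (1/p) <= A * Iset M w F powr (1/p)" using s by simp
 then show ?thesis using \<eta> by (simp add: field_simps)
qed

context dyadic_lattice
begin

abbreviation I :: "('a => real) => 'a set => real" where "I w Q \<equiv> (LINT x:Q|M. w x)"

definition muck :: "real => real => ('a => real) => ('a => real) => real => bool" where
 "muck p q w sg A \<longleftrightarrow> dual_w M p q w sg & 0 < A \<and>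
  (\<forall>Q\<in>cubes. set_integrable M Q w & set_integrable M Q sg \<and>
   I w Q powr (1/p) * I sg Q powr (1/q) <= A * measure M Q)"

definition sparse :: "'a set set => ('a set => 'a set) => real => nat => bool" where
 "sparse S Es \<eta> K \<longleftrightarrow> S \<subseteq> cubes & 0 < \<eta> & \<eta> <= 1 \<and>
   (\<forall>Q\<in>S. Es Q : sets M & Es Q \<subseteq> Q & \<eta> * measure M Q <= measure M (Es Q)) \<and>
   (\<forall>x\<in>space M. finite {Q\<in>S. x : Es Q} & card {Q\<in>S. x : Es Q} <= K)"

lemma muck_sym: "muck p q w sg A ==> muck q p sg w A"
 unfolding muck_def using dual_w_sym by (auto simp: mult.commute)

lemma muckD:
 assumes "muck p q w sg A"
 shows "dual_w M p q w sg" "1 < p" "1 < q" "1/p + 1/q = 1" "0 < A"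
  "w : borel_measurable M" "sg : borel_measurable M"
  "!!x. x : space M ==> 0 <= w x" "!!x. x : space M ==> 0 <= sg x"
  "!!Q. Q : cubes ==> set_integrable M Q w" "!!Q. Q : cubes ==> set_integrable M Q sg"
  "!!Q. Q : cubes ==> I w Q powr (1/p) * I sg Q powr (1/q) <= A * measure M Q"
  "AE x in M. 0 < w x"
proof -
 show "AE x in M. 0 < w x"
  using assms unfolding muck_def dual_w_def by (auto elim: eventually_mono)
qed (use assms in \<open>auto simp: muck_def dual_w_def\<close>)

lemma sparse_subset:
 assumes "sparse S Es \<eta> K" "S' \<subseteq> S" shows "sparse S' Es \<eta> K"
proof -
 have "finite {Q\<in>S'. x : Es Q} & card {Q\<in>S'. x : Es Q} <= K" if "x : space M" for x
 proof -
  have sub: "{Q\<in>S'. x : Es Q} \<subseteq> {Q\<in>S. x : Es Q}" using assms by auto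
  have f: "finite {Q\<in>S. x : Es Q}" "card {Q\<in>S. x : Es Q} <= K" using assms that by (auto simp: sparse_def)
  then show ?thesis using finite_subset[OF sub f(1)] card_mono[OF f(1) sub] by simp
 qed
 then show ?thesis using assms unfolding sparse_def by (auto simp: subset_iff)
qed

lemma weight_sparse_le:
 assumes m: "muck p q w sg A" and Q: "Q : cubes" and F: "F : sets M" "F \<subseteq> Q"
  and \<eta>: "0 < \<eta>" "\<eta> * measure M Q <= measure M F"
 shows "I w Q powr (1/p) <= (A / \<eta>) * I w F powr (1/p)"
 by (rule weight_sub_le[OF muckD(1)[OF m] muckD(5)[OF m] muckD(10)[OF m Q] muckD(11)[OF m Q]
    muckD(12)[OF m Q] cubes_sets[OF Q] cubes_fin[OF Q] cubes_pos[OF Q] F \<eta>])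

lemma WL_cube_integrable:
 assumes m: "muck p q w sg A" and f: "WL M p w f F" and Q: "Q : cubes"
 shows "set_integrable M Q f" "(LINT x:Q|M. \<bar>f x\<bar>) <= F * I sg Q powr (1/q)"
proof -
 note D = muckD[OF m]
 have [measurable]: "f : borel_measurable M" "Q : sets M" using f cubes_sets[OF Q] by (auto simp: WL_def)
 have "WL M q sg (indicator Q) (I sg Q powr (1/q))"
  using D Q by (intro WL_indicator cubes_sets) auto
 from Holder_weighted[OF D(1) f this]
 have *: "(\<integral>\<^sup>+x. ennreal \<bar>f x * indicator Q x\<bar> \<partial>M) <= ennreal (F * I sg Q powr (1/q))" .
 also have "... < \<infinity>" by simp
 finally have fin: "(\<integral>\<^sup>+x. ennreal \<bar>f x * indicator Q x\<bar> \<partial>M) < \<infinity>" .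
 show int: "set_integrable M Q f"
  unfolding set_integrable_def
 proof (rule integrableI_bounded)
  have "(\<integral>\<^sup>+x. ennreal (norm (indicator Q x *\<^sub>R f x)) \<partial>M) = (\<integral>\<^sup>+x. ennreal \<bar>f x * indicator Q x\<bar> \<partial>M)"
   by (intro nn_integral_cong) (auto simp: indicator_def)
  then show "(\<integral>\<^sup>+x. ennreal (norm (indicator Q x *\<^sub>R f x)) \<partial>M) < \<infinity>" using fin by simp
 qed measurable
 have "(\<integral>\<^sup>+x. ennreal \<bar>f x * indicator Q x\<bar> \<partial>M) = (\<integral>\<^sup>+x\<in>Q. ennreal \<bar>f x\<bar> \<partial>M)"
  by (intro nn_integral_cong) (auto simp: indicator_def)
 also have "... = ennreal (LINT x:Q|M. \<bar>f x\<bar>)"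
  using set_integrable_abs[OF int] by (intro nn_I) auto
 finally have "ennreal (LINT x:Q|M. \<bar>f x\<bar>) <= ennreal (F * I sg Q powr (1/q))" using * by simp
 then show "(LINT x:Q|M. \<bar>f x\<bar>) <= F * I sg Q powr (1/q)"
  using f by (simp add: ennreal_le_iff WL_def)
qed

text \<open>
The means $\int_Q f/\sigma(Q)$ are means of $f/\sigma$ with respect to $\sigma$, hence at most the
dyadic maximal function of $f/\sigma$ on the set $E_Q$. These sets overlap at most $K$ times, and
Doob's inequality applies.
\<close>
lemma Carleson_sparse:
 assumes m: "muck p q w sg A" and S: "finite S" "sparse S Es \<eta> K"
  and f: "WL M p w f F" and f0: "!!x. x : space M ==> 0 <= f x"
 shows "(\<Sum>Q\<in>S. (I f Q / I sg Q) powr p * I sg (Es Q)) <= (real K powr (1/p) * q * F) powr p"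
proof -
 note D = muckD[OF m]
 have [measurable]: "f : borel_measurable M" "sg : borel_measurable M" "w : borel_measurable M"
  using f D by (auto simp: WL_def)
 have F0: "0 <= F" using f by (simp add: WL_def)
 have Sc: "Q : cubes" if "Q : S" for Q using S that by (auto simp: sparse_def)
 have Es: "Es Q : sets M" "Es Q \<subseteq> Q" if "Q : S" for Q using S that by (auto simp: sparse_def)
 define N where "N = density M (%x. ennreal (sg x))"
 have spN: "space N = space M" "sets N = sets M" by (auto simp: N_def)
 have sgp: "AE x in M. 0 < sg x" using muckD(13)[OF muck_sym[OF m]] .
 define h where "h x = f x / sg x" for x
 have hM[measurable]: "h : borel_measurable M" unfolding h_def by measurable
 then have hNm: "h : borel_measurable N" by (simp add: N_def)
 define a where "a Q = I f Q / I sg Q" for Q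
 have sgQ: "0 < I sg Q" if "Q : S" for Q
  using I_pos[OF D(11)[OF Sc[OF that]] D(9) sgp cubes_sets[OF Sc[OF that]] cubes_pos[OF Sc[OF that]]] .
 have fint: "set_integrable M Q f" if "Q : S" for Q using WL_cube_integrable[OF m f Sc[OF that]] by simp
 have emN: "emeasure N G = ennreal (I sg G)" if "G : sets M" "set_integrable M G sg" for G
  using nn_I(1)[OF that(2) D(9)] that(1) by (simp add: N_def emeasure_density)
 have a0: "0 <= a Q" if "Q : S" for Q
  using sgQ[OF that] nn_I(2)[OF fint[OF that] f0] by (simp add: a_def)
 have hN: "WL N p (%_. 1) h F"
 proof -
  have "(\<integral>\<^sup>+x. ennreal (\<bar>h x\<bar> powr p * 1) \<partial>N) = (\<integral>\<^sup>+x. ennreal (sg x) * ennreal (\<bar>h x\<bar> powr p) \<partial>M)"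
   unfolding N_def h_def by (subst nn_integral_density) auto
  also have "... = (\<integral>\<^sup>+x. ennreal (\<bar>f x\<bar> powr p * w x) \<partial>M)"
  proof (intro nn_integral_cong_AE, use sgp dual_w_powr[OF dual_w_sym[OF D(1)]] in eventually_elim)
   case (elim x)
   have e: "w x = sg x powr (1 - p)" using elim(2) conj_exp(5)[OF D(2-4)] by simp
   have "\<bar>h x\<bar> powr p = \<bar>f x\<bar> powr p / sg x powr p" using elim(1) by (simp add: h_def powr_divide)
   also have "sg x powr p = sg x / w x" using elim(1) unfolding e by (simp add: powr_diff)
   finally have "sg x * \<bar>h x\<bar> powr p = \<bar>f x\<bar> powr p * w x" using elim(1) by simp
   then show ?case using elim(1) by (simp flip: ennreal_mult)
  qed
  finally show ?thesis using f hNm by (auto simp: WL_def)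
 qed
 define m where "m x = Max (insert 0 (a ` {Q\<in>S. x : Q}))" for x
 have doob: "WL N p (%_. 1) m (q * F)"
  unfolding m_def
 proof (rule Doob_finite_laminar[OF D(2-4) S(1) _ _ _ a0 _ _ hN])
  show "S \<subseteq> sets N" using cubes_sets[OF Sc] by (auto simp: spN)
  show "emeasure N Q < \<infinity>" if "Q : S" for Q using emN[OF cubes_sets D(11)] Sc[OF that] by simp
  show "Q \<subseteq> R | R \<subseteq> Q | Q \<inter> R = {}" if "Q : S" "R : S" for Q R using cubes_laminar Sc that by auto
  show "0 <= h x" if "x : space N" for x using that f0 D(9) by (simp add: h_def spN)
  fix Q assume Q: "Q : S"
  have "ennreal (a Q) * emeasure N Q = ennreal (a Q * I sg Q)"
   using emN[OF cubes_sets D(11)] Sc[OF Q] a0[OF Q] sgQ[OF Q] by (simp add: ennreal_mult)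
  also have "a Q * I sg Q = I f Q" using sgQ[OF Q] by (simp add: a_def)
  also have "ennreal ... = (\<integral>\<^sup>+x\<in>Q. ennreal (f x) \<partial>M)" using nn_I[OF fint[OF Q] f0] by simp
  also have "... = (\<integral>\<^sup>+x. ennreal (sg x) * (ennreal (h x) * indicator Q x) \<partial>M)"
  proof (intro nn_integral_cong_AE, use sgp in eventually_elim)
   case (elim x)
   then have "ennreal (f x) = ennreal (sg x) * ennreal (h x)"
    by (simp add: h_def flip: ennreal_mult')
   then show ?case by (simp add: mult.assoc)
  qed
  also have "... = (\<integral>\<^sup>+x\<in>Q. ennreal (h x) \<partial>N)"
   unfolding N_def h_def using cubes_sets[OF Sc[OF Q]] by (subst nn_integral_density) auto
  finally show "ennreal (a Q) * emeasure N Q <= (\<integral>\<^sup>+x\<in>Q. ennreal (h x) \<partial>N)" by simp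
 qed
 have [measurable]: "m : borel_measurable N" using doob by (simp add: WL_def)
 have [measurable]: "Es Q : sets N" if "Q : S" for Q using Es that by (simp add: spN)
 have am: "a Q <= m x" if "Q : S" "x : Q" for Q x
  unfolding m_def using S(1) that by (intro Max_ge) auto
 have m0: "0 <= m x" for x unfolding m_def using S(1) by (intro Max_ge) auto
 have Eint: "set_integrable M (Es Q) sg" if "Q : S" for Q
  using set_integrable_sub[OF D(11)[OF Sc[OF that]] Es[OF that]] .
 have "ennreal (\<Sum>Q\<in>S. a Q powr p * I sg (Es Q)) = (\<Sum>Q\<in>S. ennreal (a Q powr p) * emeasure N (Es Q))"
  using nn_I(2)[OF Eint D(9)] emN[OF Es(1) Eint]
  by (subst sum_ennreal[symmetric]) (auto simp: ennreal_mult intro!: sum.cong)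
 also have "... = (\<Sum>Q\<in>S. (\<integral>\<^sup>+x. ennreal (a Q powr p) * indicator (Es Q) x \<partial>N))"
  by (intro sum.cong) (auto simp: nn_integral_cmult_indicator)
 also have "... = (\<integral>\<^sup>+x. (\<Sum>Q\<in>S. ennreal (a Q powr p) * indicator (Es Q) x) \<partial>N)"
  by (intro nn_integral_sum[symmetric]) auto
 also have "... <= (\<integral>\<^sup>+x. ennreal (real K) * ennreal (\<bar>m x\<bar> powr p * 1) \<partial>N)"
 proof (intro nn_integral_mono)
  fix x assume x: "x : space N"
  have "(\<Sum>Q\<in>S. ennreal (a Q powr p) * indicator (Es Q) x) = (\<Sum>Q\<in>{Q\<in>S. x : Es Q}. ennreal (a Q powr p))"
   unfolding sum.inter_filter[OF S(1)] by (intro sum.cong) (auto simp: indicator_def)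
  also have "... <= (\<Sum>Q\<in>{Q\<in>S. x : Es Q}. ennreal (m x powr p))"
  proof (rule sum_mono)
   fix Q assume "Q : {Q\<in>S. x : Es Q}"
   then have Q: "Q : S" "x : Q" using Es(2)[of Q] by auto
   then show "ennreal (a Q powr p) <= ennreal (m x powr p)"
    using am[OF Q] a0[OF Q(1)] D(2) by (intro ennreal_leI powr_mono2) auto
  qed
  also have "... = of_nat (card {Q\<in>S. x : Es Q}) * ennreal (m x powr p)" by simp
  also have "... <= of_nat K * ennreal (m x powr p)"
   using S(2) x by (intro mult_right_mono) (auto simp: sparse_def spN)
  finally show "(\<Sum>Q\<in>S. ennreal (a Q powr p) * indicator (Es Q) x) <= ennreal (real K) * ennreal (\<bar>m x\<bar> powr p * 1)"
   using m0 by (simp add: ennreal_of_nat_eq_real_of_nat)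
 qed
 also have "... = ennreal (real K) * (\<integral>\<^sup>+x. ennreal (\<bar>m x\<bar> powr p * 1) \<partial>N)"
  by (intro nn_integral_cmult) auto
 also have "... <= ennreal (real K) * ennreal ((q * F) powr p)"
  using doob by (intro mult_left_mono) (auto simp: WL_def)
 also have "... = ennreal ((real K powr (1/p) * q * F) powr p)"
  using D(2,3) F0 by (simp add: powr_mult powr_powr flip: ennreal_mult)
 finally show ?thesis by (simp add: a_def ennreal_le_iff)
qed

text \<open>
By the $A_p$ condition the weights of $Q$ can be replaced by those of $E_Q$, which splits each
term into a factor for $f$ and one for $g$; Hoelder for sums and the Carleson estimate on both
sides finish the proof.
\<close>
lemma sparse_bilinear:
 assumes m: "muck p q w sg A" and S: "finite S" "sparse S Es \<eta> K"
  and f: "WL M p w f F" and f0: "!!x. x : space M ==> 0 <= f x"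
  and g: "WL M q sg g G" and g0: "!!x. x : space M ==> 0 <= g x"
 shows "(\<Sum>Q\<in>S. I f Q * I g Q / measure M Q) <= Csp p q A \<eta> K * F * G"
proof -
 note D = muckD[OF m] and m' = muck_sym[OF m]
 note D' = muckD[OF m']
 have \<eta>: "0 < \<eta>" using S by (simp add: sparse_def)
 have FG: "0 <= F" "0 <= G" using f g by (auto simp: WL_def)
 let ?c1 = "(A / \<eta>) powr (q / p)" and ?c2 = "(A / \<eta>) powr (p / q)"
 have trm: "I f Q * I g Q / measure M Q \<le>
   A * ?c1 * ?c2 * ((I f Q / I sg Q * I sg (Es Q) powr (1/p)) * (I g Q / I w Q * I w (Es Q) powr (1/q)))" if Q: "Q : S" for Q
 proof -
  have Qc: "Q : cubes" and Es: "Es Q : sets M" "Es Q \<subseteq> Q" "\<eta> * measure M Q <= measure M (Es Q)"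
   using S Q by (auto simp: sparse_def)
  have pos: "0 < I w Q" "0 < I sg Q"
   using I_pos[OF D(10)[OF Qc] D(8) D(13) cubes_sets[OF Qc] cubes_pos[OF Qc]]
    I_pos[OF D(11)[OF Qc] D(9) D'(13) cubes_sets[OF Qc] cubes_pos[OF Qc]] by auto
  have fg: "0 <= I f Q" "0 <= I g Q"
   using nn_I(2)[OF WL_cube_integrable(1)[OF m f Qc] f0] nn_I(2)[OF WL_cube_integrable(1)[OF m' g Qc] g0] by auto
  have mu: "0 < measure M Q" using cubes_pos[OF Qc] .
  have "I w Q * I sg Q = (I w Q powr (1/p) * I sg Q powr (1/q)) * (I w Q powr (1/q) * I sg Q powr (1/p))"
  proof -
   have "I w Q = I w Q powr (1/p) * I w Q powr (1/q)" "I sg Q = I sg Q powr (1/q) * I sg Q powr (1/p)"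
    using pos D(4) by (simp_all add: add.commute flip: powr_add)
   then show ?thesis by (metis mult.assoc mult.left_commute)
  qed
  also have "... <= (A * measure M Q) * (I w Q powr (1/q) * I sg Q powr (1/p))"
   using D(12)[OF Qc] by (intro mult_right_mono) auto
  also have "... <= (A * measure M Q) * ((?c2 * I w (Es Q) powr (1/q)) * (?c1 * I sg (Es Q) powr (1/p)))"
  proof (intro mult_left_mono mult_mono)
   have "I w Q powr (1/q) = (I w Q powr (1/p)) powr (p/q)" using D(2) by (simp add: powr_powr)
   also have "... <= ((A / \<eta>) * I w (Es Q) powr (1/p)) powr (p/q)"
    using weight_sparse_le[OF m Qc Es(1,2) \<eta> Es(3)] D(2,3) by (intro powr_mono2) auto
   also have "... = ?c2 * I w (Es Q) powr (1/q)" unfolding powr_mult using D(2) by (simp add: powr_powr)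
   finally show "I w Q powr (1/q) <= ?c2 * I w (Es Q) powr (1/q)" .
   have "I sg Q powr (1/p) = (I sg Q powr (1/q)) powr (q/p)" using D(3) by (simp add: powr_powr)
   also have "... <= ((A / \<eta>) * I sg (Es Q) powr (1/q)) powr (q/p)"
    using weight_sparse_le[OF m' Qc Es(1,2) \<eta> Es(3)] D(2,3) by (intro powr_mono2) auto
   also have "... = ?c1 * I sg (Es Q) powr (1/p)" unfolding powr_mult using D(3) by (simp add: powr_powr)
   finally show "I sg Q powr (1/p) <= ?c1 * I sg (Es Q) powr (1/p)" .
  qed (use D(5) mu in auto)
  finally have le: "I w Q * I sg Q <= (A * measure M Q) * ((?c2 * I w (Es Q) powr (1/q)) * (?c1 * I sg (Es Q) powr (1/p)))" .
  have "I f Q * I g Q / measure M Q = (I f Q / I sg Q) * (I g Q / I w Q) * (I w Q * I sg Q / measure M Q)"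
   using pos by simp
  also have "... <= (I f Q / I sg Q) * (I g Q / I w Q) * (((A * measure M Q) * ((?c2 * I w (Es Q) powr (1/q)) * (?c1 * I sg (Es Q) powr (1/p)))) / measure M Q)"
   using le fg pos mu by (intro mult_left_mono divide_right_mono) auto
  also have "... = A * ?c1 * ?c2 * ((I f Q / I sg Q * I sg (Es Q) powr (1/p)) * (I g Q / I w Q * I w (Es Q) powr (1/q)))"
   using mu by (simp add: field_simps)
  finally show ?thesis .
 qed
 have pos: "0 <= I f Q / I sg Q" "0 <= I g Q / I w Q" "0 <= I sg (Es Q)" "0 <= I w (Es Q)" if Q: "Q : S" for Q
 proof -
  have Qc: "Q : cubes" and Es: "Es Q : sets M" "Es Q \<subseteq> Q"
   using S Q by (auto simp: sparse_def)
  show "0 <= I f Q / I sg Q"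
   using nn_I(2)[OF WL_cube_integrable(1)[OF m f Qc] f0] nn_I(2)[OF D(11)[OF Qc] D(9)] by simp
  show "0 <= I g Q / I w Q"
   using nn_I(2)[OF WL_cube_integrable(1)[OF m' g Qc] g0] nn_I(2)[OF D(10)[OF Qc] D(8)] by simp
  show "0 <= I sg (Es Q)" using nn_I(2)[OF set_integrable_sub[OF D(11)[OF Qc] Es] D(9)] .
  show "0 <= I w (Es Q)" using nn_I(2)[OF set_integrable_sub[OF D(10)[OF Qc] Es] D(8)] .
 qed
 have "(\<Sum>Q\<in>S. (I f Q / I sg Q * I sg (Es Q) powr (1/p)) * (I g Q / I w Q * I w (Es Q) powr (1/q)))
   \<le> (real K powr (1/p) * q * F) * (real K powr (1/q) * p * G)"
 proof (rule Holder_sum[OF D(2-4) S(1)])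
  have "(\<Sum>Q\<in>S. (I f Q / I sg Q * I sg (Es Q) powr (1/p)) powr p) = (\<Sum>Q\<in>S. (I f Q / I sg Q) powr p * I sg (Es Q))"
  proof (intro sum.cong refl)
   fix Q assume "Q : S"
   then show "(I f Q / I sg Q * I sg (Es Q) powr (1/p)) powr p = (I f Q / I sg Q) powr p * I sg (Es Q)"
    using pos[of Q] D(2) by (subst powr_mult) (simp_all add: powr_powr)
  qed
  then show "(\<Sum>Q\<in>S. (I f Q / I sg Q * I sg (Es Q) powr (1/p)) powr p) <= (real K powr (1/p) * q * F) powr p"
   using Carleson_sparse[OF m S f f0] by simp
  have "(\<Sum>Q\<in>S. (I g Q / I w Q * I w (Es Q) powr (1/q)) powr q) = (\<Sum>Q\<in>S. (I g Q / I w Q) powr q * I w (Es Q))"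
  proof (intro sum.cong refl)
   fix Q assume "Q : S"
   then show "(I g Q / I w Q * I w (Es Q) powr (1/q)) powr q = (I g Q / I w Q) powr q * I w (Es Q)"
    using pos[of Q] D(3) by (subst powr_mult) (simp_all add: powr_powr)
  qed
  then show "(\<Sum>Q\<in>S. (I g Q / I w Q * I w (Es Q) powr (1/q)) powr q) <= (real K powr (1/q) * p * G) powr q"
   using Carleson_sparse[OF m' S g g0] by simp
  show "0 <= I f Q / I sg Q * I sg (Es Q) powr (1/p)" if "Q : S" for Q
   by (intro mult_nonneg_nonneg pos(1) that) auto
  show "0 <= I g Q / I w Q * I w (Es Q) powr (1/q)" if "Q : S" for Q
   by (intro mult_nonneg_nonneg pos(2) that) auto
 qed (use FG D(2,3) in auto)
 then have "A * ?c1 * ?c2 * (\<Sum>Q\<in>S. (I f Q / I sg Q * I sg (Es Q) powr (1/p)) * (I g Q / I w Q * I w (Es Q) powr (1/q)))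
   \<le> A * ?c1 * ?c2 * ((real K powr (1/p) * q * F) * (real K powr (1/q) * p * G))"
  using D(5) by (intro mult_left_mono) auto
 moreover have "(\<Sum>Q\<in>S. I f Q * I g Q / measure M Q) <= A * ?c1 * ?c2 * (\<Sum>Q\<in>S. (I f Q / I sg Q * I sg (Es Q) powr (1/p)) * (I g Q / I w Q * I w (Es Q) powr (1/q)))"
  unfolding sum_distrib_left by (intro sum_mono trm)
 ultimately show ?thesis by (simp add: Csp_def mult_ac)
qed

end

section \<open>The dyadic two-weight commutator estimate\<close>

context dyadic_lattice
begin

definition step_fun :: "'a set set => ('a set => real) => 'a => real" where
 "step_fun S c x = (\<Sum>Q\<in>S. c Q * indicator Q x)"

lemma step_fun_meas: "finite S ==> S \<subseteq> cubes ==> step_fun S c : borel_measurable M"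
 unfolding step_fun_def[abs_def] using cubes_sets by (intro borel_measurable_sum) auto

lemma step_fun_nonneg: "(!!Q. Q : S ==> 0 <= c Q) ==> 0 <= step_fun S c x"
 unfolding step_fun_def by (intro sum_nonneg) auto

lemma step_fun_integral:
 assumes S: "finite S" "S \<subseteq> cubes" and c: "!!Q. Q : S ==> 0 <= c Q"
  and [measurable]: "g : borel_measurable M" and g0: "!!x. x : space M ==> 0 <= g x"
 shows "(\<integral>\<^sup>+x. ennreal (step_fun S c x * g x) \<partial>M) = (\<Sum>Q\<in>S. ennreal (c Q) * (\<integral>\<^sup>+x\<in>Q. ennreal (g x) \<partial>M))"
proof -
 have [measurable]: "Q : sets M" if "Q : S" for Q using that S cubes_sets by auto
 have "(\<integral>\<^sup>+x. ennreal (step_fun S c x * g x) \<partial>M) = (\<integral>\<^sup>+x. (\<Sum>Q\<in>S. ennreal (c Q) * (ennreal (g x) * indicator Q x)) \<partial>M)"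
 proof (intro nn_integral_cong)
  fix x assume x: "x : space M"
  have "ennreal (step_fun S c x * g x) = ennreal (\<Sum>Q\<in>S. c Q * indicator Q x * g x)"
   by (simp add: step_fun_def sum_distrib_right)
  also have "... = (\<Sum>Q\<in>S. ennreal (c Q * indicator Q x * g x))"
   using c g0[OF x] by (intro sum_ennreal[symmetric]) auto
  also have "... = (\<Sum>Q\<in>S. ennreal (c Q) * (ennreal (g x) * indicator Q x))"
   using c g0[OF x] by (intro sum.cong) (auto simp: indicator_def ennreal_mult)
  finally show "ennreal (step_fun S c x * g x) = ..." .
 qed
 also have "... = (\<Sum>Q\<in>S. (\<integral>\<^sup>+x. ennreal (c Q) * (ennreal (g x) * indicator Q x) \<partial>M))"
  by (intro nn_integral_sum) auto
 also have "... = (\<Sum>Q\<in>S. ennreal (c Q) * (\<integral>\<^sup>+x\<in>Q. ennreal (g x) \<partial>M))"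
  by (intro sum.cong nn_integral_cmult) auto
 finally show ?thesis .
qed

lemma step_fun_WL_ex:
 assumes m: "muck p q w sg A" and S: "finite S" "S \<subseteq> cubes"
 shows "\<exists>C. WL M p w (step_fun S c) C"
 using S
proof (induction S rule: finite_induct)
 case empty
 have "WL M p w (step_fun {} c) 0" using muckD(2)[OF m] by (simp add: WL_def step_fun_def[abs_def])
 then show ?case by blast
next
 case (insert Q S)
 note D = muckD[OF m]
 obtain C where C: "WL M p w (step_fun S c) C" using insert by auto
 have Q: "Q : cubes" using insert by auto
 have 1: "WL M p w (%x. \<bar>c Q\<bar> * indicator Q x) (\<bar>c Q\<bar> * I w Q powr (1/p))"
  using WL_scale[OF WL_indicator[OF D(10)[OF Q] D(8) cubes_sets[OF Q]], of p "\<bar>c Q\<bar>"] D(2,6) by simp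
 have "WL M p w (%x. c Q * indicator Q x) (\<bar>c Q\<bar> * I w Q powr (1/p))"
  by (rule WL_mono[OF 1 _ _ D(8)]) (use D(2) cubes_sets[OF Q] in \<open>auto simp: abs_mult\<close>)
 from WL_add[OF this C _ D(6,8)] D(2)
 have "WL M p w (%x. c Q * indicator Q x + step_fun S c x) (4 * (\<bar>c Q\<bar> * I w Q powr (1/p) + C))" by simp
 moreover have "step_fun (insert Q S) c = (%x. c Q * indicator Q x + step_fun S c x)"
 proof
  fix x show "step_fun (insert Q S) c x = c Q * indicator Q x + step_fun S c x"
   unfolding step_fun_def by (rule sum.insert[OF insert.hyps(1,2)])
 qed
 ultimately show ?case by auto
qed

lemma step_fun_WL_dual:
 assumes m: "muck p q w sg A" and S: "finite S" "S \<subseteq> cubes" and c: "!!Q. Q : S ==> 0 <= c Q" and C: "0 <= C"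
  and bd: "!!g B. WL M q sg g B ==> (!!x. x : space M ==> 0 <= g x) ==> (\<Sum>Q\<in>S. c Q * I g Q) <= C * B"
 shows "WL M p w (step_fun S c) C"
proof (rule WL_dual[OF muckD(1)[OF m] step_fun_meas[OF S] step_fun_nonneg[OF c] _ C])
 obtain C' where "WL M p w (step_fun S c) C'" using step_fun_WL_ex[OF m S] by blast
 then have "(\<integral>\<^sup>+x. ennreal (\<bar>step_fun S c x\<bar> powr p * w x) \<partial>M) <= ennreal (C' powr p)" by (simp add: WL_def)
 also have "... < \<infinity>" by simp
 finally show "(\<integral>\<^sup>+x. ennreal (step_fun S c x powr p * w x) \<partial>M) < \<infinity>"
  using step_fun_nonneg[of S c] c by simp
next
 fix g B assume g: "WL M q sg g B" and g0: "!!x. x : space M ==> 0 <= g x"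
 have [measurable]: "g : borel_measurable M" using g by (simp add: WL_def)
 have gi: "set_integrable M Q g" if "Q : S" for Q using WL_cube_integrable[OF muck_sym[OF m] g] S that by blast
 have "(\<integral>\<^sup>+x. ennreal (step_fun S c x * g x) \<partial>M) = (\<Sum>Q\<in>S. ennreal (c Q) * (\<integral>\<^sup>+x\<in>Q. ennreal (g x) \<partial>M))"
  by (rule step_fun_integral[OF S c]) (use g0 in auto)
 also have "... = (\<Sum>Q\<in>S. ennreal (c Q * I g Q))"
 proof (rule sum.cong)
  fix Q assume Q: "Q : S"
  show "ennreal (c Q) * (\<integral>\<^sup>+x\<in>Q. ennreal (g x) \<partial>M) = ennreal (c Q * I g Q)"
   using nn_I[OF gi[OF Q] g0] c[OF Q] by (simp add: ennreal_mult)
 qed simp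
 also have "... = ennreal (\<Sum>Q\<in>S. c Q * I g Q)"
  using nn_I(2)[OF gi g0] c by (intro sum_ennreal) auto
 also have "... <= ennreal (C * B)" using bd[OF g g0] by (rule ennreal_leI)
 finally show "(\<integral>\<^sup>+x. ennreal (step_fun S c x * g x) \<partial>M) <= ennreal (C * B)" .
qed auto

lemma sparse_operator_bound:
 assumes m: "muck p q w sg A" and S: "finite S" "sparse S Es \<eta> K"
  and f: "WL M p w f F" and f0: "!!x. x : space M ==> 0 <= f x"
 shows "WL M p w (step_fun S (%Q. I f Q / measure M Q)) (Csp p q A \<eta> K * F)"
proof (rule step_fun_WL_dual[OF m S(1)])
 note D = muckD[OF m]
 show Sc: "S \<subseteq> cubes" using S by (simp add: sparse_def)
 show "0 <= I f Q / measure M Q" if "Q : S" for Q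
  using nn_I(2)[OF WL_cube_integrable(1)[OF m f] f0] Sc that by auto
 have "0 < \<eta>" using S by (simp add: sparse_def)
 then show "0 <= Csp p q A \<eta> K * F" using D(2,3,5) f by (simp add: Csp_def WL_def)
 fix g B assume "WL M q sg g B" "!!x. x : space M ==> 0 <= g x"
 from sparse_bilinear[OF m S f f0 this] show "(\<Sum>Q\<in>S. I f Q / measure M Q * I g Q) <= Csp p q A \<eta> K * F * B"
  by simp
qed

lemma Csp_nonneg: "1 < p ==> 1 < q ==> 0 < A ==> 0 < \<eta> ==> 0 <= Csp p q A \<eta> K"
 by (simp add: Csp_def)

text \<open>
Pair with a function $g$ from the dual space. On $Q$ the inner sum is at most the sparse operator
of $S$ applied to $f$, and $\alpha_Q$ is at most a multiple of the mean of $\nu$. What remains is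
the integral of that function against $\nu$ times the sparse operator of $R$ applied to $g$, and
multiplication by $\nu$ is an isometry from $L^q_{\sigma_2}$ to $L^q_{\sigma_1}$.
\<close>
lemma two_family_bound:
 assumes m1: "muck p q w1 sg1 A1" and m2: "muck p q w2 sg2 A2"
  and \<nu>: "\<nu> : borel_measurable M" "!!x. x : space M ==> 0 <= \<nu> x" "!!Q. Q : cubes ==> set_integrable M Q \<nu>"
  and \<nu>rel: "AE x in M. \<nu> x powr q * sg1 x = sg2 x"
  and S: "finite S" "sparse S Es \<eta> K" and R: "finite R" "sparse R Er \<eta>' K'"
  and f: "WL M p w1 f F" and f0: "!!x. x : space M ==> 0 <= f x"
  and eps: "0 <= eps" and \<alpha>: "!!Q. Q : R ==> 0 <= \<alpha> Q & \<alpha> Q <= eps * I \<nu> Q / measure M Q"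
 shows "WL M p w2 (step_fun R (%Q. \<alpha> Q * (\<Sum>T\<in>{T\<in>S. Q \<subseteq> T}. I f T / measure M T)))
  (eps * (Csp p q A1 \<eta> K * F * Csp q p A2 \<eta>' K'))"
proof (rule step_fun_WL_dual[OF m2 R(1)])
 note D1 = muckD[OF m1] and D2 = muckD[OF m2]
 have Sc: "S \<subseteq> cubes" using S by (simp add: sparse_def)
 show Rc: "R \<subseteq> cubes" using R by (simp add: sparse_def)
 have \<eta>: "0 < \<eta>" "0 < \<eta>'" using S R by (auto simp: sparse_def)
 have F0: "0 <= F" using f by (simp add: WL_def)
 let ?\<Phi> = "%Q. \<Sum>T\<in>{T\<in>S. Q \<subseteq> T}. I f T / measure M T"
 have fT: "0 <= I f T / measure M T" if "T : S" for T
  using nn_I(2)[OF WL_cube_integrable(1)[OF m1 f] f0] Sc that by auto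
 have \<Phi>0: "0 <= ?\<Phi> Q" for Q using fT by (intro sum_nonneg) auto
 show "0 <= \<alpha> Q * ?\<Phi> Q" if "Q : R" for Q using \<alpha>[OF that] \<Phi>0 by simp
 have C0: "0 <= Csp p q A1 \<eta> K" "0 <= Csp q p A2 \<eta>' K'" using D1 D2 \<eta> by (auto intro!: Csp_nonneg)
 then show "0 <= eps * (Csp p q A1 \<eta> K * F * Csp q p A2 \<eta>' K')" using eps F0 by simp
 fix g B assume g: "WL M q sg2 g B" and g0: "!!x. x : space M ==> 0 <= g x"
 have B0: "0 <= B" using g by (simp add: WL_def)
 let ?Af = "step_fun S (%T. I f T / measure M T)" and ?Ag = "step_fun R (%Q. I g Q / measure M Q)"
 have gQ: "0 <= I g Q / measure M Q" if "Q : R" for Q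
  using nn_I(2)[OF WL_cube_integrable(1)[OF muck_sym[OF m2] g] g0] Rc that by auto
 have Af: "WL M p w1 ?Af (Csp p q A1 \<eta> K * F)" by (rule sparse_operator_bound[OF m1 S f f0])
 have Ag: "WL M q sg2 ?Ag (Csp q p A2 \<eta>' K' * B)" by (rule sparse_operator_bound[OF muck_sym[OF m2] R g g0])
 have [measurable]: "?Af : borel_measurable M" "?Ag : borel_measurable M" "\<nu> : borel_measurable M"
  using Af Ag \<nu> by (auto simp: WL_def)
 have "(\<integral>\<^sup>+x. ennreal (\<bar>\<nu> x * ?Ag x\<bar> powr q * sg1 x) \<partial>M) = (\<integral>\<^sup>+x. ennreal (\<bar>?Ag x\<bar> powr q * sg2 x) \<partial>M)"
 proof (intro nn_integral_cong_AE, use \<nu>rel AE_space in eventually_elim)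
  case (elim x)
  have "\<bar>\<nu> x * ?Ag x\<bar> powr q * sg1 x = \<bar>?Ag x\<bar> powr q * (\<nu> x powr q * sg1 x)"
   using \<nu>(2)[OF elim(2)] by (simp add: abs_mult powr_mult)
  then show ?case using elim by simp
 qed
 then have \<nu>Ag: "WL M q sg1 (%x. \<nu> x * ?Ag x) (Csp q p A2 \<eta>' K' * B)" using Ag by (simp add: WL_def)
 have X0: "0 <= ?\<Phi> Q * I \<nu> Q" if "Q : R" for Q
  using nn_I(2)[OF \<nu>(3) \<nu>(2)] Rc that by (intro mult_nonneg_nonneg \<Phi>0) auto
 have "ennreal (\<Sum>Q\<in>R. I g Q / measure M Q * (?\<Phi> Q * I \<nu> Q)) = (\<Sum>Q\<in>R. ennreal (I g Q / measure M Q * (?\<Phi> Q * I \<nu> Q)))"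
  by (rule sum_ennreal[symmetric]) (intro mult_nonneg_nonneg gQ X0)
 also have "... = (\<Sum>Q\<in>R. ennreal (I g Q / measure M Q) * ennreal (?\<Phi> Q * I \<nu> Q))"
  by (intro sum.cong refl ennreal_mult gQ X0)
 also have "... <= (\<Sum>Q\<in>R. ennreal (I g Q / measure M Q) * (\<integral>\<^sup>+x\<in>Q. ennreal (\<nu> x * ?Af x) \<partial>M))"
 proof (intro sum_mono mult_left_mono)
  fix Q assume Q: "Q : R"
  then have Qc: "Q : cubes" using Rc by auto
  then have [measurable]: "Q : sets M" using cubes_sets by auto
  have "ennreal (?\<Phi> Q * I \<nu> Q) = ennreal (?\<Phi> Q) * (\<integral>\<^sup>+x\<in>Q. ennreal (\<nu> x) \<partial>M)"
   using nn_I[OF \<nu>(3)[OF Qc] \<nu>(2)] \<Phi>0[of Q] by (simp add: ennreal_mult)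
  also have "... = (\<integral>\<^sup>+x. ennreal (?\<Phi> Q) * (ennreal (\<nu> x) * indicator Q x) \<partial>M)"
   by (intro nn_integral_cmult[symmetric]) auto
  also have "... <= (\<integral>\<^sup>+x\<in>Q. ennreal (\<nu> x * ?Af x) \<partial>M)"
  proof (intro nn_integral_mono)
   fix x assume x: "x : space M"
   have "?\<Phi> Q <= ?Af x" if "x : Q"
   proof -
    have "?\<Phi> Q = (\<Sum>T\<in>{T\<in>S. Q \<subseteq> T}. I f T / measure M T * indicator T x)"
     using that by (intro sum.cong) (auto simp: indicator_def)
    also have "... <= ?Af x" unfolding step_fun_def
    proof (rule sum_mono2[OF S(1)])
     show "0 <= I f T / measure M T * indicator T x" if "T : S - {T\<in>S. Q \<subseteq> T}" for T
      using that by (intro mult_nonneg_nonneg fT) auto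
    qed auto
    finally show ?thesis .
   qed
   then show "ennreal (?\<Phi> Q) * (ennreal (\<nu> x) * indicator Q x) <= ennreal (\<nu> x * ?Af x) * indicator Q x"
    using \<nu>(2)[OF x] \<Phi>0[of Q] by (auto simp: indicator_def mult.commute mult_left_mono intro!: ennreal_leI simp flip: ennreal_mult)
  qed
  finally show "ennreal (?\<Phi> Q * I \<nu> Q) <= (\<integral>\<^sup>+x\<in>Q. ennreal (\<nu> x * ?Af x) \<partial>M)" .
 qed auto
 also have "... = (\<integral>\<^sup>+x. ennreal (?Ag x * (\<nu> x * ?Af x)) \<partial>M)"
  using step_fun_nonneg[of S "%T. I f T / measure M T"] fT \<nu>(2)
  by (intro step_fun_integral[symmetric] R(1) Rc gQ) auto
 also have "... <= (\<integral>\<^sup>+x. ennreal \<bar>?Af x * (\<nu> x * ?Ag x)\<bar> \<partial>M)"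
  by (intro nn_integral_mono ennreal_leI) (simp add: mult_ac abs_le_iff)
 also have "... <= ennreal ((Csp p q A1 \<eta> K * F) * (Csp q p A2 \<eta>' K' * B))"
  by (rule Holder_weighted[OF D1(1) Af \<nu>Ag])
 finally have 1: "(\<Sum>Q\<in>R. I g Q / measure M Q * (?\<Phi> Q * I \<nu> Q)) <= (Csp p q A1 \<eta> K * F) * (Csp q p A2 \<eta>' K' * B)"
  using C0 F0 B0 by (simp add: ennreal_le_iff)
 have "(\<Sum>Q\<in>R. \<alpha> Q * ?\<Phi> Q * I g Q) <= (\<Sum>Q\<in>R. eps * (I g Q / measure M Q * (?\<Phi> Q * I \<nu> Q)))"
 proof (rule sum_mono)
  fix Q assume Q: "Q : R"
  have "0 < measure M Q" using Q Rc cubes_pos by auto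
  then have gI: "0 <= I g Q" using gQ[OF Q] by (simp add: zero_le_divide_iff)
  have "\<alpha> Q * (?\<Phi> Q * I g Q) <= (eps * I \<nu> Q / measure M Q) * (?\<Phi> Q * I g Q)"
   using \<alpha>[OF Q] \<Phi>0[of Q] gI by (intro mult_right_mono) auto
  then show "\<alpha> Q * ?\<Phi> Q * I g Q <= eps * (I g Q / measure M Q * (?\<Phi> Q * I \<nu> Q))"
   by (simp add: mult_ac)
 qed
 also have "... = eps * (\<Sum>Q\<in>R. I g Q / measure M Q * (?\<Phi> Q * I \<nu> Q))" by (simp add: sum_distrib_left)
 also have "... <= eps * ((Csp p q A1 \<eta> K * F) * (Csp q p A2 \<eta>' K' * B))" using 1 eps by (rule mult_left_mono)
 finally show "(\<Sum>Q\<in>R. \<alpha> Q * ?\<Phi> Q * I g Q) <= eps * (Csp p q A1 \<eta> K * F * Csp q p A2 \<eta>' K') * B"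
  by (simp add: mult_ac)
qed

text \<open>
The pointwise domination by the stopping family holds for the conditional means of generation $L$
and carries over to $b$ as $L$ grows. After interchanging the sums the cubes outside
\<open>Bad\<close> are estimated by \<open>two_family_bound\<close>, and those in
\<open>Bad\<close> by the bound $t$ on the sums of the means above them.
\<close>
lemma bloom_main:
 fixes b :: "'a => 'b::{banach, second_countable_topology}"
 assumes m1: "muck p q w1 sg1 A1" and m2: "muck p q w2 sg2 A2"
  and \<nu>: "\<nu> : borel_measurable M" "!!x. x : space M ==> 0 <= \<nu> x" "!!Q. Q : cubes ==> set_integrable M Q \<nu>"
  and \<nu>rel: "AE x in M. \<nu> x powr q * sg1 x = sg2 x"
  and bm: "b : borel_measurable M" and bint: "!!Q. Q : cubes ==> set_integrable M Q b"
  and S: "finite S" "sparse S Es \<eta> K"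
  and f: "WL M p w1 f F" and f0: "!!x. x : space M ==> 0 <= f x"
  and eps: "0 <= eps" and Bad: "finite Bad" "Bad \<subseteq> cubes"
  and mo: "!!Q. Q : cubes - Bad ==> mo b Q <= eps * I \<nu> Q / measure M Q"
  and t: "0 <= t" "!!R. R : Bad ==> (\<Sum>Q\<in>{Q\<in>S. R \<subseteq> Q}. I f Q / measure M Q) <= t"
  and Cb: "WL M p w2 (step_fun Bad (mo b)) Cb"
 shows "WL M p w2 (%x. \<Sum>Q\<in>S. (I f Q / measure M Q) * (norm (b x - avg M Q b) * indicator Q x))
  (16 * Cd * (eps * (Csp p q A1 \<eta> K * F * Csp q p A2 (\<eta>/4) (K + 1)) + t * Cb))"
proof -
 note D1 = muckD[OF m1] and D2 = muckD[OF m2]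
 have Sc: "S \<subseteq> cubes" using S by (simp add: sparse_def)
 have \<eta>: "0 < \<eta>" "\<eta> <= 1" using S by (auto simp: sparse_def)
 let ?f = "%Q. I f Q / measure M Q"
 have fT: "0 <= ?f T" if "T : S" for T
  using nn_I(2)[OF WL_cube_integrable(1)[OF m1 f] f0] Sc that by auto
 let ?dev = "%Q x. norm (b x - avg M Q b)"
 let ?C = "16 * Cd * (eps * (Csp p q A1 \<eta> K * F * Csp q p A2 (\<eta>/4) (K + 1)) + t * Cb)"
 let ?H = "%L x. \<Sum>Q\<in>S. ?f Q * (E L (?dev Q) x * indicator Q x)"
 obtain L0 where L0: "S \<subseteq> upto L0"
 proof -
  have "\<exists>L. S \<subseteq> upto L" using S(1) Sc
  proof (induction S rule: finite_induct)
   case (insert Q S)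
   then obtain L k where "S \<subseteq> upto L" "Q : D k" by (auto simp: cubes_def)
   then have "insert Q S \<subseteq> upto (max L k)" by (fastforce simp: upto_def)
   then show ?case by blast
  qed auto
  then show ?thesis using that by blast
 qed
 have level: "WL M p w2 (?H L) ?C" if L: "L0 <= L" for L
 proof -
  have SL: "S \<subseteq> upto L" using L0 L by (fastforce simp: upto_def)
  interpret A: augmented_family M D Cd b S L
   by unfold_locales (use bint S(1) SL in auto)
  have dev: "A.dev = ?dev" by (simp add: A.dev_def fun_eq_iff)
  have "\<exists>E'. (\<forall>R\<in>A.aug. E' R : sets M & E' R \<subseteq> R & \<eta> / 4 * measure M R <= measure M (E' R)) \<and>
    (\<forall>x\<in>space M. card {R\<in>A.aug. x : E' R} <= K + 1)"
   by (rule A.aug_sparse[of \<eta> Es K]) (use S \<eta> in \<open>auto simp: sparse_def\<close>)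
  then obtain E' where E': "\<forall>R\<in>A.aug. E' R : sets M & E' R \<subseteq> R & \<eta> / 4 * measure M R <= measure M (E' R)"
   "\<forall>x\<in>space M. card {R\<in>A.aug. x : E' R} <= K + 1" by (elim exE conjE)
  have augc: "A.aug \<subseteq> cubes" using A.aug_cubes by blast
  have sp: "sparse A.aug E' (\<eta>/4) (K + 1)"
   unfolding sparse_def using E' \<eta> augc A.finite_aug by auto
  let ?\<Phi> = "%R. \<Sum>T\<in>{T\<in>S. R \<subseteq> T}. ?f T"
  have \<Phi>0: "0 <= ?\<Phi> R" for R using fT by (intro sum_nonneg) auto
  let ?G = "step_fun A.aug (%R. mo b R * ?\<Phi> R)"
  let ?g1 = "step_fun (A.aug - Bad) (%R. mo b R * ?\<Phi> R)"
  let ?g2 = "step_fun (A.aug \<inter> Bad) (%R. mo b R * ?\<Phi> R)"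
  have "WL M p w2 ?g1 (eps * (Csp p q A1 \<eta> K * F * Csp q p A2 (\<eta>/4) (K + 1)))"
  proof (rule two_family_bound[OF m1 m2 \<nu> \<nu>rel S _ _ f f0 eps])
   show "finite (A.aug - Bad)" using A.finite_aug by auto
   show "sparse (A.aug - Bad) E' (\<eta>/4) (K + 1)" using sp by (rule sparse_subset) auto
   show "0 <= mo b Q & mo b Q <= eps * I \<nu> Q / measure M Q" if "Q : A.aug - Bad" for Q
    using that augc A.mo_nonneg[of Q] mo[of Q] by auto
  qed
  moreover have "WL M p w2 ?g2 (t * Cb)"
  proof (rule WL_mono[OF WL_scale[OF Cb t(1) D2(6)] _ _ D2(8)])
   show "?g2 : borel_measurable M" using A.finite_aug augc by (intro step_fun_meas) auto
   show "AE x in M. \<bar>?g2 x\<bar> <= \<bar>t * step_fun Bad (mo b) x\<bar>"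
   proof (intro AE_I2)
    fix x
    have "0 <= ?g2 x" using A.mo_nonneg \<Phi>0 by (intro step_fun_nonneg) auto
    moreover have "?g2 x <= (\<Sum>R\<in>A.aug \<inter> Bad. t * (mo b R * indicator R x))"
     unfolding step_fun_def
    proof (rule sum_mono)
     fix R assume R: "R : A.aug \<inter> Bad"
     have "mo b R * ?\<Phi> R <= mo b R * t" using t(2)[of R] R A.mo_nonneg[of R] by (intro mult_left_mono) auto
     then have "mo b R * ?\<Phi> R * indicator R x <= mo b R * t * indicator R x" by (rule mult_right_mono) auto
     then show "mo b R * ?\<Phi> R * indicator R x <= t * (mo b R * indicator R x)" by (simp add: mult_ac)
    qed
    moreover have "... <= (\<Sum>R\<in>Bad. t * (mo b R * indicator R x))"
     using Bad t(1) A.mo_nonneg by (intro sum_mono2) auto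
    moreover have "... = t * step_fun Bad (mo b) x" by (simp add: step_fun_def sum_distrib_left)
    ultimately show "\<bar>?g2 x\<bar> <= \<bar>t * step_fun Bad (mo b) x\<bar>" by simp
   qed
  qed (use D2 in auto)
  ultimately have "WL M p w2 (%x. ?g1 x + ?g2 x) (4 * (eps * (Csp p q A1 \<eta> K * F * Csp q p A2 (\<eta>/4) (K + 1)) + t * Cb))"
   using D2 by (intro WL_add) auto
  moreover have "(%x. ?g1 x + ?g2 x) = ?G"
  proof
   fix x
   have "?G x = ?g2 x + ?g1 x"
    unfolding step_fun_def by (rule sum.Int_Diff[OF A.finite_aug])
   then show "?g1 x + ?g2 x = ?G x" by simp
  qed
  ultimately have "WL M p w2 ?G (4 * (eps * (Csp p q A1 \<eta> K * F * Csp q p A2 (\<eta>/4) (K + 1)) + t * Cb))" by simp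
  from WL_scale[OF this _ D2(6), of "4 * Cd"] Cd_ge_1
  have G: "WL M p w2 (%x. 4 * Cd * ?G x) ?C" by (simp add: mult_ac)
  show ?thesis
  proof (rule WL_mono[OF G _ _ D2(8)])
   show "?H L : borel_measurable M"
    using Sc cubes_sets by (intro borel_measurable_sum borel_measurable_times borel_measurable_const E_measurable borel_measurable_indicator) auto
   show "AE x in M. \<bar>?H L x\<bar> <= \<bar>4 * Cd * ?G x\<bar>"
   proof (intro AE_I2)
    fix x
    have E0: "0 <= E L (?dev Q) x" for Q
     unfolding E_def avg_def set_lebesgue_integral_def
     by (intro scaleR_nonneg_nonneg integral_nonneg_AE AE_I2) auto
    have "0 <= ?H L x" using fT E0 by (intro sum_nonneg mult_nonneg_nonneg) auto
    moreover have "?H L x <= 4 * Cd * ?G x"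
    proof -
     have "?H L x <= (\<Sum>Q\<in>S. ?f Q * (4 * Cd * (\<Sum>R\<in>A.aug. if R \<subseteq> Q then mo b R * indicator R x else 0)))"
     proof (intro sum_mono mult_left_mono fT)
      fix Q assume Q: "Q : S"
      show "E L (?dev Q) x * indicator Q x <= 4 * Cd * (\<Sum>R\<in>A.aug. if R \<subseteq> Q then mo b R * indicator R x else 0)"
      proof (cases "x : Q")
       case True
       have "E L (?dev Q) x <= 4 * Cd * (\<Sum>R\<in>{R\<in>A.aug. x : R & R \<subseteq> Q}. mo b R)"
        using A.local_oscillation_bound[OF A.aug.base[OF Q] True] by (simp add: dev)
       also have "(\<Sum>R\<in>{R\<in>A.aug. x : R & R \<subseteq> Q}. mo b R) = (\<Sum>R\<in>A.aug. if R \<subseteq> Q then mo b R * indicator R x else 0)"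
        unfolding sum.inter_filter[OF A.finite_aug] by (intro sum.cong) (auto simp: indicator_def)
       finally show ?thesis using True by simp
      next
       case False
       have "0 <= (\<Sum>R\<in>A.aug. if R \<subseteq> Q then mo b R * indicator R x else 0)"
        using A.mo_nonneg by (intro sum_nonneg) auto
       then show ?thesis using False Cd_ge_1 by simp
      qed
     qed
     also have "... = 4 * Cd * (\<Sum>Q\<in>S. \<Sum>R\<in>A.aug. ?f Q * (if R \<subseteq> Q then mo b R * indicator R x else 0))"
      by (simp add: sum_distrib_left mult_ac)
     also have "(\<Sum>Q\<in>S. \<Sum>R\<in>A.aug. ?f Q * (if R \<subseteq> Q then mo b R * indicator R x else 0)) =
       (\<Sum>R\<in>A.aug. \<Sum>Q\<in>S. ?f Q * (if R \<subseteq> Q then mo b R * indicator R x else 0))" by (rule sum.swap)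
     also have "... = ?G x"
      unfolding step_fun_def
     proof (rule sum.cong[OF refl])
      fix R
      have "(\<Sum>Q\<in>S. ?f Q * (if R \<subseteq> Q then mo b R * indicator R x else 0)) = (\<Sum>Q\<in>S. (if R \<subseteq> Q then ?f Q else 0)) * (mo b R * indicator R x)"
       unfolding sum_distrib_right by (intro sum.cong) auto
      also have "(\<Sum>Q\<in>S. (if R \<subseteq> Q then ?f Q else 0)) = ?\<Phi> R"
       unfolding sum.inter_filter[OF S(1)] ..
      finally show "(\<Sum>Q\<in>S. ?f Q * (if R \<subseteq> Q then mo b R * indicator R x else 0)) = mo b R * ?\<Phi> R * indicator R x"
       by (simp add: mult_ac)
     qed
     finally show ?thesis .
    qed
    ultimately show "\<bar>?H L x\<bar> <= \<bar>4 * Cd * ?G x\<bar>" by simp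
   qed
  qed (use D2 in auto)
 qed
 have devint: "set_integrable M Q (?dev R)" if "Q : cubes" for Q R
 proof -
  interpret A: augmented_family M D Cd b "{}" 0 by unfold_locales (use bint in auto)
  have "A.dev R = ?dev R" by (simp add: A.dev_def fun_eq_iff)
  then show ?thesis using A.dev_int[OF that, of R] by simp
 qed
 obtain r where r: "strict_mono (r::nat=>nat)"
  "AE x in M. \<forall>Q\<in>S. x : Q --> (%n. E (int (r n)) (?dev Q) x) \<longlonglongrightarrow> ?dev Q x"
  using E_convergence[OF S(1) Sc, of ?dev] devint Sc by blast
 let ?N = "nat L0"
 show ?thesis
 proof (rule WL_limit[where u="%n. ?H (int (r (n + ?N)))"])
  show "WL M p w2 (?H (int (r (n + ?N)))) ?C" for n
  proof (rule level)
   show "L0 <= int (r (n + ?N))" using seq_suble[OF r(1), of "n + ?N"] by linarith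
  qed
  show "(%x. \<Sum>Q\<in>S. ?f Q * (?dev Q x * indicator Q x)) : borel_measurable M"
  proof (intro borel_measurable_sum)
   fix Q assume "Q : S"
   then have [measurable]: "Q : sets M" using Sc cubes_sets by auto
   show "(%x. ?f Q * (?dev Q x * indicator Q x)) : borel_measurable M" using bm by measurable
  qed
  show "AE x in M. (%n. ?H (int (r (n + ?N))) x) \<longlonglongrightarrow> (\<Sum>Q\<in>S. ?f Q * (?dev Q x * indicator Q x))"
   using r(2)
  proof eventually_elim
   case (elim x)
   show ?case
   proof (intro tendsto_sum tendsto_mult_left)
    fix Q assume Q: "Q : S"
    show "(%n. E (int (r (n + ?N))) (?dev Q) x * indicator Q x) \<longlonglongrightarrow> ?dev Q x * indicator Q x"
    proof (cases "x : Q")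
     case True
     then have "(%n. E (int (r n)) (?dev Q) x) \<longlonglongrightarrow> ?dev Q x" using elim Q by blast
     then have "(%n. E (int (r (n + ?N))) (?dev Q) x) \<longlonglongrightarrow> ?dev Q x" by (rule LIMSEQ_ignore_initial_segment)
     then show ?thesis by (intro tendsto_mult_right)
    qed simp
   qed
  qed
 qed (use D2 in auto)
qed

text \<open>
The cubes of a sparse family that contain $R$ form a chain, and by the $A_p$ condition
$\sigma(Q)^{1/q}/\mu(Q)$ is at most a multiple of $w(Q)^{-1/p}$. Sparseness gives the packing
condition for $w$ along the chain.
\<close>
lemma tail_sum_bound:
 assumes m: "muck p q w sg A" and S: "sparse S Es \<eta> K" and R: "R : cubes"
 shows "\<exists>C. \<forall>G. finite G --> G \<subseteq> {Q\<in>S. R \<subseteq> Q} --> (\<Sum>Q\<in>G. I sg Q powr (1/q) / measure M Q) <= C"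
proof -
 note D = muckD[OF m]
 have \<eta>: "0 < \<eta>" using S by (simp add: sparse_def)
 define C where "C = 2 + (A / \<eta>) powr p * real K"
 define B where "B = A * (C powr (1/p) * (1 + (1 - 1/C) powr (1/p) / (1 - (1 - 1/C) powr (1/p))) * I w R powr (-(1/p)))"
 have wpos: "0 < I w Q" if "Q : cubes" for Q
  using I_pos[OF D(10)[OF that] D(8) D(13) cubes_sets[OF that] cubes_pos[OF that]] .
 have "(\<Sum>Q\<in>G. I sg Q powr (1/q) / measure M Q) <= B" if G: "finite G" "G \<subseteq> {Q\<in>S. R \<subseteq> Q}" for G
 proof -
  have GS: "Q : S" "R \<subseteq> Q" "Q : cubes" if "Q : G" for Q using that G S by (auto simp: sparse_def)
  have Rne: "R ~= {}" using cubes_ne[OF R] .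
  have Es: "Es Q : sets M" "Es Q \<subseteq> Q" "\<eta> * measure M Q <= measure M (Es Q)" if "Q : G" for Q
   using GS[OF that] S by (auto simp: sparse_def)
  have Eint: "set_integrable M (Es Q) w" if "Q : G" for Q
   using set_integrable_sub[OF D(10)[OF GS(3)[OF that]] Es(1,2)[OF that]] .
  have "(\<Sum>Q\<in>G. I w Q powr (-(1/p))) <= C powr (1/p) * (1 + (1 - 1/C) powr (1/p) / (1 - (1 - 1/C) powr (1/p))) * I w R powr (-(1/p))"
  proof (rule chain_sum_bound)
   show "2 <= C" unfolding C_def by simp
   show "0 < 1/p" using D(2) by simp
   show "0 < I w R" using wpos[OF R] .
   show "Q \<subseteq> T | T \<subseteq> Q" if "Q : G" "T : G" for Q T
    using cubes_laminar[OF GS(3)[OF that(1)] GS(3)[OF that(2)]] GS(2)[OF that(1)] GS(2)[OF that(2)] Rne by auto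
   show "I w R <= I w Q" if "Q : G" for Q
    using I_mono[OF D(10)[OF GS(3)[OF that]] D(8) cubes_sets[OF R] GS(2)[OF that]] .
   fix Q assume Q: "Q : G"
   let ?X = "{T\<in>G. T \<subseteq> Q}"
   have fX: "finite ?X" using G by simp
   have TX: "I w T <= (A / \<eta>) powr p * I w (Es T)" if "T : ?X" for T
   proof -
    have TG: "T : G" using that by simp
    have "I w T powr (1/p) <= (A / \<eta>) * I w (Es T) powr (1/p)"
     by (rule weight_sparse_le[OF m GS(3)[OF TG] Es(1,2)[OF TG] \<eta> Es(3)[OF TG]])
    then have "(I w T powr (1/p)) powr p <= ((A / \<eta>) * I w (Es T) powr (1/p)) powr p"
     using D(2) by (intro powr_mono2) auto
    then show ?thesis using D(2) wpos[OF GS(3)[OF TG]] nn_I(2)[OF Eint[OF TG] D(8)]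
     unfolding powr_mult by (simp add: powr_powr)
   qed
   have "(\<Sum>T\<in>?X. I w (Es T)) <= real K * I w Q"
   proof -
    have "ennreal (\<Sum>T\<in>?X. I w (Es T)) = (\<Sum>T\<in>?X. \<integral>\<^sup>+x\<in>Es T. ennreal (w x) \<partial>M)"
     using nn_I[OF Eint D(8)] by (subst sum_ennreal[symmetric]) auto
    also have "... = (\<integral>\<^sup>+x. (\<Sum>T\<in>?X. ennreal (w x) * indicator (Es T) x) \<partial>M)"
     using Es D(6) by (intro nn_integral_sum[symmetric]) auto
    also have "... <= (\<integral>\<^sup>+x. ennreal (real K) * (ennreal (w x) * indicator Q x) \<partial>M)"
    proof (rule nn_integral_mono)
     fix x assume x: "x : space M"
     show "(\<Sum>T\<in>?X. ennreal (w x) * indicator (Es T) x) <= ennreal (real K) * (ennreal (w x) * indicator Q x)"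
     proof (cases "x : Q")
      case True
      have "(\<Sum>T\<in>?X. ennreal (w x) * indicator (Es T) x) = (\<Sum>T\<in>{T\<in>?X. x : Es T}. ennreal (w x))"
       unfolding sum.inter_filter[OF fX] by (intro sum.cong) (auto simp: indicator_def)
      also have "... = of_nat (card {T\<in>?X. x : Es T}) * ennreal (w x)" by simp
      also have "... <= of_nat K * ennreal (w x)"
      proof (intro mult_right_mono)
       have "card {T\<in>?X. x : Es T} <= card {T\<in>S. x : Es T}"
        using S x GS by (intro card_mono) (auto simp: sparse_def)
       also have "... <= K" using S x by (auto simp: sparse_def)
       finally show "(of_nat (card {T\<in>?X. x : Es T}) :: ennreal) <= of_nat K" by simp
      qed simp
      finally show ?thesis using True by (simp add: ennreal_of_nat_eq_real_of_nat)
     next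
      case False
      then have "x \<notin> Es T" if "T : ?X" for T using Es(2)[of T] that by auto
      then show ?thesis by (simp add: sum.neutral)
     qed
    qed
    also have "... = ennreal (real K) * (\<integral>\<^sup>+x\<in>Q. ennreal (w x) \<partial>M)"
     using D(6) cubes_sets[OF GS(3)[OF Q]] by (intro nn_integral_cmult) auto
    also have "... = ennreal (real K * I w Q)"
     using nn_I[OF D(10)[OF GS(3)[OF Q]] D(8)] by (simp add: ennreal_mult)
    finally show ?thesis using wpos[OF GS(3)[OF Q]] by (simp add: ennreal_le_iff)
   qed
   then have "(A / \<eta>) powr p * (\<Sum>T\<in>?X. I w (Es T)) <= (A / \<eta>) powr p * (real K * I w Q)"
    by (intro mult_left_mono) auto
   moreover have "(\<Sum>T\<in>?X. I w T) <= (A / \<eta>) powr p * (\<Sum>T\<in>?X. I w (Es T))"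
    unfolding sum_distrib_left by (intro sum_mono TX)
   moreover have "(A / \<eta>) powr p * (real K * I w Q) <= C * I w Q"
    using wpos[OF GS(3)[OF Q]] by (simp add: C_def distrib_right)
   ultimately show "(\<Sum>T\<in>?X. I w T) <= C * I w Q" by linarith
  qed (use G in auto)
  then have "A * (\<Sum>Q\<in>G. I w Q powr (-(1/p))) <= B" unfolding B_def using D(5) by (intro mult_left_mono) auto
  moreover have "(\<Sum>Q\<in>G. I sg Q powr (1/q) / measure M Q) <= (\<Sum>Q\<in>G. A * I w Q powr (-(1/p)))"
  proof (rule sum_mono)
   fix Q assume Q: "Q : G"
   have "I w Q powr (1/p) * I sg Q powr (1/q) <= A * measure M Q" using D(12)[OF GS(3)[OF Q]] .
   then show "I sg Q powr (1/q) / measure M Q <= A * I w Q powr (-(1/p))"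
    using wpos[OF GS(3)[OF Q]] cubes_pos[OF GS(3)[OF Q]] unfolding powr_minus by (simp add: field_simps)
  qed
  ultimately show ?thesis by (simp add: sum_distrib_left)
 qed
 then show ?thesis by blast
qed

text \<open>
A convergent series has small tails, and there are only finitely many $R$.
\<close>
lemma tail_small:
 assumes m: "muck p q w sg A" and S: "sparse S Es \<eta> K" and Bad: "finite Bad" "Bad \<subseteq> cubes" and e: "0 < e"
 shows "\<exists>F. finite F & F \<subseteq> S & (\<forall>G R. finite G --> G \<subseteq> S - F --> R : Bad -->
   (\<Sum>Q\<in>{Q\<in>G. R \<subseteq> Q}. I sg Q powr (1/q) / measure M Q) <= e)"
proof -
 let ?u = "%Q. I sg Q powr (1/q) / measure M Q"
 define v where "v Q = (\<Sum>R\<in>Bad. if R \<subseteq> Q then ?u Q else 0)" for Q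
 have u0: "0 <= ?u Q" for Q by simp
 have v0: "0 <= v Q" for Q unfolding v_def by (intro sum_nonneg) auto
 have "\<forall>R\<in>Bad. \<exists>C. \<forall>G. finite G --> G \<subseteq> {Q\<in>S. R \<subseteq> Q} --> (\<Sum>Q\<in>G. ?u Q) <= C"
  using Bad by (intro ballI tail_sum_bound[OF m S]) auto
 from bchoice[OF this] obtain C where
  C': "\<forall>R\<in>Bad. \<forall>G. finite G --> G \<subseteq> {Q\<in>S. R \<subseteq> Q} --> (\<Sum>Q\<in>G. ?u Q) <= C R" by (elim exE)
 have C: "(\<Sum>Q\<in>G. ?u Q) <= C R" if "R : Bad" "finite G" "G \<subseteq> {Q\<in>S. R \<subseteq> Q}" for R G
  using C'[rule_format, OF that] .
 have vsum: "(\<Sum>Q\<in>G. v Q) = (\<Sum>R\<in>Bad. \<Sum>Q\<in>{Q\<in>G. R \<subseteq> Q}. ?u Q)" if "finite G" for G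
  unfolding v_def sum.inter_filter[OF that] by (rule sum.swap)
 have vb: "(\<Sum>Q\<in>G. v Q) <= (\<Sum>R\<in>Bad. C R)" if "finite G" "G \<subseteq> S" for G
  unfolding vsum[OF that(1)]
 proof (rule sum_mono)
  fix R assume R: "R : Bad"
  show "(\<Sum>Q\<in>{Q\<in>G. R \<subseteq> Q}. ?u Q) <= C R" using that by (intro C[OF R]) auto
 qed
 let ?X = "(%G. \<Sum>Q\<in>G. v Q) ` {G. finite G & G \<subseteq> S}"
 have bdd: "bdd_above ?X" by (rule bdd_aboveI[of _ "\<Sum>R\<in>Bad. C R"]) (use vb in auto)
 have ne: "?X ~= {}" by auto
 have "Sup ?X - e < Sup ?X" using e by simp
 then obtain F where F: "finite F" "F \<subseteq> S" "Sup ?X - e < (\<Sum>Q\<in>F. v Q)"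
  using less_cSup_iff[OF ne bdd] by auto
 have "(\<Sum>Q\<in>{Q\<in>G. R \<subseteq> Q}. ?u Q) <= e" if G: "finite G" "G \<subseteq> S - F" and R: "R : Bad" for G R
 proof -
  have "(\<Sum>Q\<in>F. v Q) + (\<Sum>Q\<in>G. v Q) = (\<Sum>Q\<in>F \<union> G. v Q)"
   using F G by (intro sum.union_disjoint[symmetric]) auto
  also have "... <= Sup ?X" using F G bdd by (intro cSup_upper) auto
  finally have "(\<Sum>Q\<in>G. v Q) <= e" using F by linarith
  moreover have "(\<Sum>Q\<in>{Q\<in>G. R \<subseteq> Q}. ?u Q) <= (\<Sum>R\<in>Bad. \<Sum>Q\<in>{Q\<in>G. R \<subseteq> Q}. ?u Q)"
   using R Bad(1) by (intro member_le_sum[of R Bad "%R. \<Sum>Q\<in>{Q\<in>G. R \<subseteq> Q}. ?u Q"]) (auto intro: sum_nonneg)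
  ultimately show ?thesis unfolding vsum[OF G(1)] by linarith
 qed
 then show ?thesis using F by (intro exI[of _ F]) auto
qed

end

section \<open>Balls, doubling and pairs of Muckenhoupt weights\<close>

lemma powi_pos: "0 < dlt ==> 0 < (dlt::real) powi k" by (rule zero_less_power_int)

lemma powi_antimono:
 fixes dlt :: real assumes "0 < dlt" "dlt < 1" "k <= l" shows "dlt powi l <= dlt powi k"
 using assms by (intro power_int_decreasing) auto

lemma powi_small:
 fixes dlt e :: real assumes "0 < dlt" "dlt < 1" "0 < e" shows "\<exists>n::nat. dlt powi (int n) < e"
 using real_arch_pow_inv[OF assms(3,2)] by auto

lemma powi_large:
 fixes dlt e :: real assumes "0 < dlt" "dlt < 1" "0 < e" shows "\<exists>n::nat. e < dlt powi (- int n)"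
proof -
 obtain n where n: "dlt ^ n < 1 / e" using real_arch_pow_inv[of "1/e" dlt] assms by auto
 then have "e < 1 / dlt ^ n" using assms by (simp add: field_simps)
 then show ?thesis by (intro exI[of _ n]) (simp add: power_int_minus field_simps)
qed

lemma finite_card_disjoint_large:
 assumes sets: "\<G> \<subseteq> sets M" and disj: "disjoint \<G>" and sub: "\<Union>\<G> \<subseteq> W" and W: "W : sets M" "emeasure M W < \<infinity>" "0 < measure M W"
  and C: "0 < C" and le: "!!G. G : \<G> ==> measure M W <= C * measure M G"
 shows "finite \<G> & real (card \<G>) <= C"
proof -
 have fm: "W : fmeasurable M" using W by (simp add: fmeasurable_def)
 have bd: "real (card F) <= C" if F: "F \<subseteq> \<G>" "finite F" for F
 proof -
  have em: "emeasure M G ~= \<infinity>" if "G : F" for G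
  proof -
   have "G \<subseteq> W" using that F sub by auto
   then have "emeasure M G <= emeasure M W" using W by (intro emeasure_mono) auto
   then show ?thesis using W by auto
  qed
  have "measure M (\<Union>G\<in>F. G) = (\<Sum>G\<in>F. measure M G)"
  proof (rule measure_finite_Union[OF F(2) _ _ em])
   show "(%G. G) ` F \<subseteq> sets M" using F sets by auto
   show "disjoint_family_on (%G. G) F" using F disj by (auto simp: disjoint_family_on_def disjoint_def)
  qed
  moreover have "measure M (\<Union>G\<in>F. G) <= measure M W"
  proof (rule measure_mono_fmeasurable[OF _ _ fm])
   show "(\<Union>G\<in>F. G) \<subseteq> W" using F sub by auto
   show "(\<Union>G\<in>F. G) : sets M" using F sets by (intro sets.finite_UN) auto
  qed
  moreover have "real (card F) * measure M W <= (\<Sum>G\<in>F. C * measure M G)"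
   using le F by (intro sum_bounded_below[of F "measure M W", simplified]) auto
  ultimately have "real (card F) * measure M W <= C * measure M W"
   using C by (simp add: sum_distrib_left[symmetric]) (smt (verit) mult_left_mono)
  then show ?thesis using W by simp
 qed
 have "card F <= nat \<lfloor>C\<rfloor>" if "F \<subseteq> \<G>" "finite F" for F using bd[OF that] by (simp add: le_nat_floor)
 then have "finite \<G> & card \<G> <= nat \<lfloor>C\<rfloor>" by (intro finite_if_finite_subsets_card_bdd) auto
 then show ?thesis using bd[of \<G>] by auto
qed

context homogeneous_type
begin

abbreviation B :: "'a => real => 'a set" where "B x r \<equiv> qball M d x r"

lemma in_B: "y : B x r \<longleftrightarrow> y : space M & d x y < r" by (auto simp: qball_def)

lemma B_space: "B x r \<subseteq> space M" by (auto simp: qball_def)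

lemma B_mono: "r <= s ==> B x r \<subseteq> B x s" by (auto simp: qball_def)

lemma center_in_B: "x : space M ==> 0 < r ==> x : B x r" using d_eq_0_iff[of x x] by (simp add: qball_def)

lemma B_subset:
 assumes "x : space M" "y : space M" shows "B x r \<subseteq> B y (A\<^sub>0 * (d y x + r))"
proof
 fix z assume z: "z : B x r"
 then have zs: "z : space M" "d x z < r" by (auto simp: in_B)
 have "d y z <= A\<^sub>0 * (d y x + d x z)" using d_triangle[of y z x] assms zs by simp
 also have "... < A\<^sub>0 * (d y x + r)" using zs A0_ge_1 by simp
 finally show "z : B y (A\<^sub>0 * (d y x + r))" using zs by (simp add: in_B)
qed

lemma space_UN_balls:
 assumes "x : space M" "0 < r" shows "(\<Union>n::nat. B x (2 ^ n * r)) = space M"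
proof
 show "space M \<subseteq> (\<Union>n::nat. B x (2 ^ n * r))"
 proof
  fix y assume y: "y : space M"
  obtain n where "d x y / r < 2 ^ n" using real_arch_pow[of 2 "d x y / r"] by auto
  then have "d x y < 2 ^ n * r" using assms by (simp add: field_simps)
  then show "y : (\<Union>n::nat. B x (2 ^ n * r))" using y by (auto simp: in_B)
 qed
qed (use B_space in auto)

lemma emeasure_B_iter:
 assumes "x : space M" "0 < r"
 shows "emeasure M (B x (2 ^ n * r)) <= ennreal C\<^sub>\<mu> ^ n * emeasure M (B x r)"
proof (induction n)
 case (Suc n)
 have "emeasure M (B x (2 ^ Suc n * r)) <= ennreal C\<^sub>\<mu> * emeasure M (B x (2 ^ n * r))"
  using doubling[of x "2 ^ n * r"] assms by (simp add: mult.assoc)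
 also have "... <= ennreal C\<^sub>\<mu> * (ennreal C\<^sub>\<mu> ^ n * emeasure M (B x r))"
  by (rule mult_left_mono[OF Suc]) simp
 finally show ?case by (simp add: mult.assoc)
qed simp

lemma emeasure_B_pos: assumes "x : space M" "0 < r" shows "0 < emeasure M (B x r)"
proof (rule ccontr)
 assume "~ 0 < emeasure M (B x r)"
 then have "emeasure M (B x r) = 0" by simp
 then have z: "emeasure M (B x (2 ^ n * r)) = 0" for n using emeasure_B_iter[OF assms, of n] by simp
 have "emeasure M (\<Union>n::nat. B x (2 ^ n * r)) = 0"
  using z assms by (intro emeasure_UN_eq_0) (auto intro!: qball_sets)
 then show False using nonzero by (simp add: space_UN_balls[OF assms])
qed

lemma emeasure_B: assumes "x : space M" "0 < r" shows "emeasure M (B x r) = ennreal (measure M (B x r))"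
 using finite_qball[OF assms] by (intro emeasure_eq_ennreal_measure) auto

lemma measure_B_pos: assumes "x : space M" "0 < r" shows "0 < measure M (B x r)"
 using emeasure_B_pos[OF assms] by (simp add: emeasure_B[OF assms])

lemma B_fmeasurable: assumes "x : space M" "0 < r" shows "B x r : fmeasurable M"
 using finite_qball[OF assms] qball_sets[OF assms] by (simp add: fmeasurable_def)

lemma measure_B_mono:
 assumes "y : space M" "0 < s" "F : sets M" "F \<subseteq> B y s" shows "measure M F <= measure M (B y s)"
 using assms B_fmeasurable by (intro measure_mono_fmeasurable) auto

lemma doubling_ratio:
 "\<exists>C\<ge>1. \<forall>x\<in>space M. \<forall>r>0. measure M (B x (t * r)) <= C * measure M (B x r)"
proof -
 obtain n :: nat where n: "t < 2 ^ n" using real_arch_pow[of 2 t] by auto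
 define C where "C = max 1 C\<^sub>\<mu>"
 have C: "1 <= C" "C\<^sub>\<mu> <= C" by (auto simp: C_def)
 show ?thesis
 proof (intro exI[of _ "C ^ n"] conjI ballI allI impI)
  show "1 <= C ^ n" using C by simp
  fix x r assume x: "x : space M" and r: "(0::real) < r"
  show "measure M (B x (t * r)) <= C ^ n * measure M (B x r)"
  proof (cases "0 < t")
   case True
   have "measure M (B x (t * r)) <= measure M (B x (2 ^ n * r))"
    using True n r x by (intro measure_B_mono qball_sets B_mono) (auto simp: mult_right_mono)
   moreover have "ennreal (measure M (B x (2 ^ n * r))) <= ennreal (C ^ n * measure M (B x r))"
   proof -
    have "ennreal (measure M (B x (2 ^ n * r))) <= ennreal C\<^sub>\<mu> ^ n * ennreal (measure M (B x r))"
     using emeasure_B_iter[OF x r, of n] emeasure_B[OF x r] emeasure_B[of x "2 ^ n * r"] x r by simp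
    also have "... <= ennreal C ^ n * ennreal (measure M (B x r))"
     using C by (intro mult_right_mono power_mono ennreal_leI) auto
    also have "... = ennreal (C ^ n * measure M (B x r))" using C by (simp add: ennreal_power ennreal_mult)
    finally show ?thesis .
   qed
   ultimately show ?thesis using C measure_B_pos[OF x r] by (simp add: ennreal_le_iff)
  next
   case False
   then have "t * r <= 0" using r by (simp add: mult_nonpos_nonneg)
   then have "B x (t * r) = {}" using x d_nonneg by (force simp: qball_def)
   then show ?thesis using C measure_B_pos[OF x r] by simp
  qed
 qed
qed

lemma doubling_compare:
 obtains C where "1 <= C" "!!x y r s. x : space M ==> 0 < r ==> y : space M ==> 0 < s ==> B x r \<subseteq> B y (t * s) ==> measure M (B x r) <= C * measure M (B y s)"
proof -
 obtain C where C: "1 <= C" "\<forall>x\<in>space M. \<forall>r>0. measure M (B x (max 1 t * r)) <= C * measure M (B x r)"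
  using doubling_ratio[of "max 1 t"] by blast
 have "measure M (B x r) <= C * measure M (B y s)"
  if "x : space M" "0 < r" "y : space M" "0 < s" "B x r \<subseteq> B y (t * s)" for x y r s
 proof -
  have "B x r \<subseteq> B y (max 1 t * s)" using that(4,5) B_mono[of "t * s" "max 1 t * s" y] by (simp add: mult_right_mono)
  then have "measure M (B x r) <= measure M (B y (max 1 t * s))"
   using that by (intro measure_B_mono qball_sets) auto
  also have "... <= C * measure M (B y s)" using C(2) that by simp
  finally show ?thesis .
 qed
 then show ?thesis using that C(1) by blast
qed

text \<open>
Local integrability on an exhausting sequence of balls.
\<close>
lemma measurable_of_local:
 fixes w :: "'a => 'b::{banach, second_countable_topology}"
 assumes w: "w : L1_loc M d" shows "w : borel_measurable M"
proof -
 obtain x where x: "x : space M" using nonzero by (metis emeasure_empty equals0I)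
 let ?u = "%n y. indicator (B x (2 ^ n * 1)) y *\<^sub>R w y"
 show ?thesis
 proof (rule borel_measurable_LIMSEQ_metric[of ?u])
  show "?u n : borel_measurable M" for n :: nat
  proof -
   have "set_integrable M (B x (2 ^ n * 1)) w" using w x by (auto simp: L1_loc_def)
   then show ?thesis unfolding set_integrable_def by (rule borel_measurable_integrable)
  qed
  fix y assume y: "y : space M"
  then obtain n where n: "y : B x (2 ^ n * 1)" using space_UN_balls[OF x, of 1] by auto
  have "?u m y = w y" if "n <= m" for m
  proof -
   have "B x (2 ^ n * 1) \<subseteq> B x (2 ^ m * 1)" using that by (intro B_mono) (simp add: power_increasing)
   then show ?thesis using n by auto
  qed
  then show "(%n. ?u n y) \<longlonglongrightarrow> w y"
   by (intro tendsto_eventually eventually_sequentiallyI[of n])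
 qed
qed

end

text \<open>
The $A_p$ inequality on a single set, in the $p$-th root form that is symmetric under exchanging
$w$ with its dual weight.
\<close>
definition Ap_on :: "'a measure => real => real => ('a => real) => ('a => real) => real => 'a set => bool" where
 "Ap_on M p q w sg A Q \<longleftrightarrow> Q : sets M & emeasure M Q < \<infinity> & 0 < measure M Q \<and>
   set_integrable M Q w & set_integrable M Q sg \<and>
   Iset M w Q powr (1/p) * Iset M sg Q powr (1/q) <= A * measure M Q"

lemma Ap_on_subset:
 assumes dw: "dual_w M p q w sg" and B: "Ap_on M p q w sg A B" and Q: "Q : sets M" "Q \<subseteq> B" "0 < measure M Q"
  and C: "0 <= A" "measure M B <= C * measure M Q"
 shows "Ap_on M p q w sg (A * C) Q"
proof -
 have i: "set_integrable M B w" "set_integrable M B sg" using B by (auto simp: Ap_on_def)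
 have iQ: "set_integrable M Q w" "set_integrable M Q sg" using set_integrable_sub i Q by auto
 have w0: "!!x. x : space M ==> 0 <= w x" "!!x. x : space M ==> 0 <= sg x" and pq: "1 < p" "1 < q" using dw by (auto simp: dual_w_def)
 have "Iset M w Q powr (1/p) * Iset M sg Q powr (1/q) <= Iset M w B powr (1/p) * Iset M sg B powr (1/q)"
  using I_mono[OF i(1) w0(1) Q(1,2)] I_mono[OF i(2) w0(2) Q(1,2)] nn_I(2)[OF iQ(1) w0(1)] nn_I(2)[OF iQ(2) w0(2)] pq
  by (intro mult_mono powr_mono2) auto
 also have "... <= A * measure M B" using B by (auto simp: Ap_on_def)
 also have "... <= A * (C * measure M Q)" using C by (intro mult_left_mono) auto
 finally have "Iset M w Q powr (1/p) * Iset M sg Q powr (1/q) <= A * C * measure M Q" by (simp add: mult.assoc)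
 moreover have "emeasure M Q < \<infinity>"
 proof (rule le_less_trans)
  show "emeasure M Q <= emeasure M B" using Q(2) B by (intro emeasure_mono) (auto simp: Ap_on_def)
 qed (use B in \<open>auto simp: Ap_on_def\<close>)
 ultimately show ?thesis using iQ Q by (simp add: Ap_on_def)
qed

lemma Ap_on_sym: "Ap_on M p q w sg A Q ==> Ap_on M q p sg w A Q"
 by (simp add: Ap_on_def mult.commute)

lemma Ap_on_pos:
 assumes dw: "dual_w M p q w sg" and Q: "Ap_on M p q w sg A Q"
 shows "0 < Iset M w Q" "0 < Iset M sg Q"
proof -
 have w0: "!!x. x : space M ==> 0 <= w x" "!!x. x : space M ==> 0 <= sg x" using dw by (auto simp: dual_w_def)
 have ae: "AE x in M. 0 < w x" "AE x in M. 0 < sg x" using dw unfolding dual_w_def by (auto elim: eventually_mono)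
 show "0 < Iset M w Q" using Q I_pos[of M Q w] w0 ae by (auto simp: Ap_on_def)
 show "0 < Iset M sg Q" using Q I_pos[of M Q sg] w0 ae by (auto simp: Ap_on_def)
qed

lemma Ap_on_sub_weight:
 assumes dw: "dual_w M p q w sg" and A: "0 < A" and Q: "Ap_on M p q w sg A Q" and F: "F : sets M" "F \<subseteq> Q"
  and \<eta>: "0 < \<eta>" "\<eta> * measure M Q <= measure M F"
 shows "Iset M w Q powr (1/p) <= (A / \<eta>) * Iset M w F powr (1/p)"
 using Q unfolding Ap_on_def by (intro weight_sub_le[OF dw A _ _ _ _ _ _ F \<eta>]) auto

context homogeneous_type
begin

lemma Ap_dual_w:
 assumes p: "1 < p" and w: "w : Ap M d p"
 shows "dual_w M p (p / (p - 1)) w (%x. w x powr (- 1 / (p - 1)))"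
proof -
 have wm: "w : borel_measurable M" using w measurable_of_local by (auto simp: Ap_def weight_def)
 have q: "1 < p / (p - 1)" "1/p + 1/(p/(p-1)) = 1" using p by (auto simp: field_simps)
 have "AE x in M. 0 < w x" using w by (auto simp: Ap_def)
 then have "AE x in M. 0 < w x & 0 < w x powr (- 1 / (p - 1)) & w x powr (1/p) * (w x powr (- 1 / (p - 1))) powr (1/(p/(p-1))) = 1"
 proof eventually_elim
  case (elim x)
  have e: "(- 1 / (p - 1)) * (1/(p/(p-1))) = - (1/p)" using p by (simp add: field_simps)
  have "(w x powr (- 1 / (p - 1))) powr (1/(p/(p-1))) = w x powr (- (1/p))" unfolding powr_powr e ..
  then have "w x powr (1/p) * (w x powr (- 1 / (p - 1))) powr (1/(p/(p-1))) = 1"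
   using elim by (simp flip: powr_add)
  then show ?case using elim by simp
 qed
 then show ?thesis using p q wm w unfolding dual_w_def by (auto simp: Ap_def weight_def)
qed

lemma Ap_on_balls:
 assumes p: "1 < p" and w: "w : Ap M d p"
 obtains A where "0 < A" "!!x r. x : space M ==> 0 < r ==> Ap_on M p (p / (p - 1)) w (%x. w x powr (- 1 / (p - 1))) A (B x r)"
proof -
 let ?sg = "%x. w x powr (- 1 / (p - 1))" and ?q = "p / (p - 1)"
 obtain C0 where C0: "!!x r. x : space M ==> 0 < r ==> avg M (B x r) w * avg M (B x r) ?sg powr (p - 1) <= C0"
  using w unfolding Ap_def bdd_above_def by blast
 define C where "C = max 1 C0"
 have "Ap_on M p ?q w ?sg (C powr (1/p)) (B x r)" if x: "x : space M" and r: "0 < r" for x r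
 proof -
  have int: "set_integrable M (B x r) w" "set_integrable M (B x r) ?sg"
   using w x r by (auto simp: Ap_def weight_def L1_loc_def)
  have w0: "!!x. x : space M ==> 0 <= w x" using w by (auto simp: Ap_def weight_def)
  have nn: "0 <= Iset M w (B x r)" "0 <= Iset M ?sg (B x r)"
   using nn_I(2)[OF int(1) w0] nn_I(2)[OF int(2)] by auto
  let ?m = "measure M (B x r)" let ?W = "Iset M w (B x r)" let ?S = "Iset M ?sg (B x r)"
  have m: "0 < ?m" using measure_B_pos[OF x r] .
  have "(?W / ?m) * (?S / ?m) powr (p - 1) <= C"
   using C0[OF x r] by (simp add: avg_def C_def)
  then have "((?W / ?m) * (?S / ?m) powr (p - 1)) powr (1/p) <= C powr (1/p)"
   using nn m p by (intro powr_mono2) auto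
  moreover have "((?W / ?m) * (?S / ?m) powr (p - 1)) powr (1/p) = ?W powr (1/p) * ?S powr (1/?q) / ?m"
  proof -
   have "((?W / ?m) * (?S / ?m) powr (p - 1)) powr (1/p) = (?W / ?m) powr (1/p) * (?S / ?m) powr (1/?q)"
   proof -
    have e: "(p - 1) * (1/p) = 1/?q" using p by (simp add: field_simps)
    show ?thesis unfolding powr_mult powr_powr e ..
   qed
   also have "... = ?W powr (1/p) * ?S powr (1/?q) / (?m powr (1/p) * ?m powr (1/?q))"
    using nn m by (simp add: powr_divide)
   also have "?m powr (1/p) * ?m powr (1/?q) = ?m powr (1/p + 1/?q)" by (simp only: powr_add)
   also have "1/p + 1/?q = 1" using p by (simp add: field_simps)
   finally show ?thesis using m by simp
  qed
  ultimately have "?W powr (1/p) * ?S powr (1/?q) / ?m <= C powr (1/p)" by (simp only:)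
  then have "?W powr (1/p) * ?S powr (1/?q) <= C powr (1/p) * ?m" using m by (simp only: pos_divide_le_eq)
  then show ?thesis using int x r m qball_sets finite_qball by (simp add: Ap_on_def)
 qed
 moreover have "0 < C powr (1/p)" by (simp add: C_def)
 ultimately show ?thesis using that by blast
qed

end

text \<open>
For the weight $\nu=w_1^{1/p}w_2^{-1/p}$ the identities $\nu=w_1^{1/p}\sigma_2^{1/q}$ and
$\nu^q\sigma_1=\sigma_2$ hold almost everywhere.
\<close>
locale weight_pair =
 fixes M :: "'a measure" and p q :: real and w1 sg1 w2 sg2 \<nu> :: "'a => real"
 assumes dw1: "dual_w M p q w1 sg1" and dw2: "dual_w M p q w2 sg2"
  and nu: "\<nu> = (%x. w1 x powr (1 / p) * w2 x powr (- 1 / p))"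
begin

lemma pq: "1 < p" "1 < q" "1/p + 1/q = 1" using dw1 by (auto simp: dual_w_def)

lemma meas[measurable]: "w1 : borel_measurable M" "sg1 : borel_measurable M" "w2 : borel_measurable M" "sg2 : borel_measurable M"
 using dw1 dw2 by (auto simp: dual_w_def)

lemma w_nonneg: "x : space M ==> 0 <= w1 x" "x : space M ==> 0 <= w2 x"
  "x : space M ==> 0 <= sg1 x" "x : space M ==> 0 <= sg2 x"
 using dw1 dw2 by (auto simp: dual_w_def)

lemma nu_meas[measurable]: "\<nu> : borel_measurable M" unfolding nu by measurable

lemma nu_nonneg: "0 <= \<nu> x" by (simp add: nu)

lemma AE_weights: "AE x in M. 0 < w1 x & 0 < w2 x & 0 < sg1 x & 0 < sg2 x & w1 x powr (1/p) * sg1 x powr (1/q) = 1 & w2 x powr (1/p) * sg2 x powr (1/q) = 1"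
proof -
 have "AE x in M. 0 < w1 x & 0 < sg1 x & w1 x powr (1/p) * sg1 x powr (1/q) = 1"
  "AE x in M. 0 < w2 x & 0 < sg2 x & w2 x powr (1/p) * sg2 x powr (1/q) = 1"
  using dw1 dw2 by (auto simp: dual_w_def)
 then show ?thesis by eventually_elim auto
qed

lemma AE_nu: "AE x in M. 0 < \<nu> x & \<nu> x = w1 x powr (1/p) * sg2 x powr (1/q) & 1 / \<nu> x = w2 x powr (1/p) * sg1 x powr (1/q) & \<nu> x powr q * sg1 x = sg2 x"
 using AE_weights dual_w_powr[OF dw1] dual_w_powr[OF dw2]
proof eventually_elim
 case (elim x)
 then have pos: "0 < w1 x" "0 < w2 x" "0 < sg1 x" "0 < sg2 x" by auto
 have m: "w2 x powr (- 1 / p) = 1 / w2 x powr (1/p)" using powr_minus_divide[of "w2 x" "1/p"] by simp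
 have s2: "sg2 x powr (1/q) = 1 / w2 x powr (1/p)" using elim(1) pos by (simp add: field_simps)
 have s1: "sg1 x powr (1/q) = 1 / w1 x powr (1/p)" using elim(1) pos by (simp add: field_simps)
 have nx: "\<nu> x = w1 x powr (1/p) * w2 x powr (- 1 / p)" by (simp only: nu)
 have n: "\<nu> x = w1 x powr (1/p) * sg2 x powr (1/q)" unfolding nx m s2 ..
 have "\<nu> x powr q * sg1 x = (w1 x powr (1/p) * sg2 x powr (1/q)) powr q * (sg1 x powr (1/q)) powr q"
  using pos pq(2) unfolding n by (simp add: powr_powr)
 also have "... = (w1 x powr (1/p) * sg1 x powr (1/q)) powr q * sg2 x"
  using pos pq(2) by (simp add: powr_mult powr_powr)
 also have "... = sg2 x" using elim(1) by simp
 finally have r: "\<nu> x powr q * sg1 x = sg2 x" .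
 have "0 < \<nu> x" using pos by (simp add: nu)
 moreover have "1 / \<nu> x = w2 x powr (1/p) * sg1 x powr (1/q)" unfolding n s1 s2 using pos by simp
 ultimately show ?case using n r by blast
qed

lemma nu_rel: "AE x in M. \<nu> x powr q * sg1 x = sg2 x"
 using AE_nu by (rule eventually_mono) (elim conjE)

lemma nu_upper:
 assumes Q: "Q : sets M" "set_integrable M Q w1" "set_integrable M Q sg2"
 shows "set_integrable M Q \<nu>" "Iset M \<nu> Q <= Iset M w1 Q powr (1/p) * Iset M sg2 Q powr (1/q)"
proof -
 have [measurable]: "Q : sets M" by fact
 have f: "WL M p (%_. 1) (%x. indicator Q x * w1 x powr (1/p)) (Iset M w1 Q powr (1/p))"
 proof -
  have "(\<integral>\<^sup>+x. ennreal (\<bar>indicator Q x * w1 x powr (1/p)\<bar> powr p * 1) \<partial>M) = (\<integral>\<^sup>+x\<in>Q. ennreal (w1 x) \<partial>M)"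
   using pq w_nonneg by (intro nn_integral_cong) (auto simp: indicator_def powr_powr)
  then show ?thesis using nn_I[OF Q(2) w_nonneg(1)] pq by (simp add: WL_def powr_powr)
 qed
 have g: "WL M q (%_. 1) (%x. indicator Q x * sg2 x powr (1/q)) (Iset M sg2 Q powr (1/q))"
 proof -
  have "(\<integral>\<^sup>+x. ennreal (\<bar>indicator Q x * sg2 x powr (1/q)\<bar> powr q * 1) \<partial>M) = (\<integral>\<^sup>+x\<in>Q. ennreal (sg2 x) \<partial>M)"
   using pq w_nonneg by (intro nn_integral_cong) (auto simp: indicator_def powr_powr)
  then show ?thesis using nn_I[OF Q(3) w_nonneg(4)] pq by (simp add: WL_def powr_powr)
 qed
 have "(\<integral>\<^sup>+x\<in>Q. ennreal (\<nu> x) \<partial>M) = (\<integral>\<^sup>+x. ennreal \<bar>(indicator Q x * w1 x powr (1/p)) * (indicator Q x * sg2 x powr (1/q))\<bar> \<partial>M)"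
  by (intro nn_integral_cong_AE, use AE_nu in eventually_elim) (auto simp: indicator_def)
 also have "... <= ennreal (Iset M w1 Q powr (1/p) * Iset M sg2 Q powr (1/q))"
  by (rule Holder_weighted[OF dual_w_one[OF pq] f g])
 finally have le: "(\<integral>\<^sup>+x\<in>Q. ennreal (\<nu> x) \<partial>M) <= ennreal (Iset M w1 Q powr (1/p) * Iset M sg2 Q powr (1/q))" .
 show int: "set_integrable M Q \<nu>"
  unfolding set_integrable_def
 proof (rule integrableI_bounded)
  have "(\<integral>\<^sup>+x. ennreal (norm (indicator Q x *\<^sub>R \<nu> x)) \<partial>M) = (\<integral>\<^sup>+x\<in>Q. ennreal (\<nu> x) \<partial>M)"
   using nu_nonneg by (intro nn_integral_cong) (auto simp: indicator_def)
  also have "... < \<infinity>" using le by (auto simp: le_less_trans)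
  finally show "(\<integral>\<^sup>+x. ennreal (norm (indicator Q x *\<^sub>R \<nu> x)) \<partial>M) < \<infinity>" .
 qed measurable
 show "Iset M \<nu> Q <= Iset M w1 Q powr (1/p) * Iset M sg2 Q powr (1/q)"
  using le nn_I[OF int nu_nonneg] by (simp add: ennreal_le_iff)
qed

end

lemma weight_pair_swap:
 assumes "weight_pair M p q w1 sg1 w2 sg2 \<nu>"
 shows "weight_pair M p q w2 sg2 w1 sg1 (%x. w2 x powr (1 / p) * w1 x powr (- 1 / p))"
 using assms by (simp add: weight_pair_def)

context weight_pair
begin

text \<open>
Apply \<open>nu_upper\<close> to the reciprocal weight, which belongs to the exchanged pair, use
Cauchy-Schwarz for $\nu^{1/2}\nu^{-1/2}=1$, and combine with the two $A_p$ conditions.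
\<close>
lemma nu_lower:
 assumes A1: "Ap_on M p q w1 sg1 A1 Q" and A2: "Ap_on M p q w2 sg2 A2 Q" and A: "0 < A1" "0 < A2"
 shows "Iset M w1 Q powr (1/p) * Iset M sg2 Q powr (1/q) <= A1 * A2 * Iset M \<nu> Q" "0 < Iset M \<nu> Q"
proof -
 have Q[measurable]: "Q : sets M" and m: "0 < measure M Q" and fin: "emeasure M Q < \<infinity>" using A1 by (auto simp: Ap_on_def)
 have i: "set_integrable M Q w1" "set_integrable M Q sg1" "set_integrable M Q w2" "set_integrable M Q sg2"
  using A1 A2 by (auto simp: Ap_on_def)
 let ?\<nu>' = "%x. w2 x powr (1 / p) * w1 x powr (- 1 / p)"
 interpret S: weight_pair M p q w2 sg2 w1 sg1 ?\<nu>'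
  by (rule weight_pair_swap[of M p q w1 sg1 w2 sg2 \<nu>]) (rule weight_pair_axioms)
 note up = S.nu_upper[OF Q i(3) i(2)]
 have iv: "set_integrable M Q \<nu>" using nu_upper[OF Q i(1,4)] by simp
 have dd: "dual_w M 2 2 \<nu> ?\<nu>'"
  unfolding dual_w_def
 proof (intro conjI)
  show "AE x in M. 0 < \<nu> x & 0 < ?\<nu>' x & \<nu> x powr (1/2) * ?\<nu>' x powr (1/2) = 1"
   using AE_nu S.AE_nu
  proof eventually_elim
   case (elim x)
   have n0: "0 < \<nu> x" "0 < ?\<nu>' x" using elim by blast+
   have e: "?\<nu>' x = 1 / \<nu> x"
   proof -
    from elim(1) have a: "1 / \<nu> x = w2 x powr (1/p) * sg1 x powr (1/q)" by (elim conjE)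
    from elim(2) have b: "?\<nu>' x = w2 x powr (1/p) * sg1 x powr (1/q)" by (elim conjE)
    show ?thesis unfolding a b ..
   qed
   have "\<nu> x * ?\<nu>' x = \<nu> x * (1 / \<nu> x)" by (simp only: e)
   also have "... = 1" using n0 by simp
   finally have "(\<nu> x * ?\<nu>' x) powr (1/2) = 1" by simp
   then have "\<nu> x powr (1/2) * ?\<nu>' x powr (1/2) = 1" by (simp only: powr_mult)
   then show ?case using n0 by blast
  qed
 qed (use nu_nonneg S.nu_nonneg in auto)
 have "(\<integral>\<^sup>+x. ennreal \<bar>indicator Q x * indicator Q x\<bar> \<partial>M) <= ennreal (Iset M \<nu> Q powr (1/2) * Iset M ?\<nu>' Q powr (1/2))"
  by (intro Holder_weighted[OF dd] WL_indicator iv up Q nu_nonneg S.nu_nonneg) auto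
 moreover have "(\<integral>\<^sup>+x. ennreal \<bar>indicator Q x * indicator Q x\<bar> \<partial>M) = emeasure M Q"
  by (simp add: indicator_inter_arith[symmetric] ennreal_indicator)
 moreover have "emeasure M Q = ennreal (measure M Q)"
  using fin by (intro emeasure_eq_ennreal_measure) auto
 ultimately have 1: "measure M Q <= Iset M \<nu> Q powr (1/2) * Iset M ?\<nu>' Q powr (1/2)" by (simp add: ennreal_le_iff)
 have nn: "0 <= Iset M \<nu> Q" "0 <= Iset M ?\<nu>' Q" using nn_I(2)[OF iv nu_nonneg] nn_I(2)[OF up(1) S.nu_nonneg] by auto
 have "measure M Q * measure M Q <= (Iset M \<nu> Q powr (1/2) * Iset M ?\<nu>' Q powr (1/2)) * (Iset M \<nu> Q powr (1/2) * Iset M ?\<nu>' Q powr (1/2))"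
  using 1 m by (intro mult_mono) auto
 also have "... = (Iset M \<nu> Q powr (1/2) * Iset M \<nu> Q powr (1/2)) * (Iset M ?\<nu>' Q powr (1/2) * Iset M ?\<nu>' Q powr (1/2))" by (simp add: mult_ac)
 also have "... = Iset M \<nu> Q * Iset M ?\<nu>' Q" using nn by (simp flip: powr_add)
 finally have 2: "measure M Q * measure M Q <= Iset M \<nu> Q * Iset M ?\<nu>' Q" .
 have "0 < Iset M \<nu> Q * Iset M ?\<nu>' Q" using m by (intro less_le_trans[OF _ 2]) simp
 then show pos: "0 < Iset M \<nu> Q" using nn by (simp add: zero_less_mult_iff)
 let ?a = "Iset M w1 Q powr (1/p)" and ?b = "Iset M sg2 Q powr (1/q)" and ?c = "Iset M w2 Q powr (1/p)" and ?e = "Iset M sg1 Q powr (1/q)"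
 have ce: "0 < ?c" "0 < ?e" using Ap_on_pos[OF dw1 A1] Ap_on_pos[OF dw2 A2] by auto
 have "(?a * ?e) * (?c * ?b) <= (A1 * measure M Q) * (A2 * measure M Q)"
  by (rule mult_mono) (use A1 A2 A m in \<open>auto simp: Ap_on_def\<close>)
 also have "... = A1 * A2 * (measure M Q * measure M Q)" by simp
 also have "... <= A1 * A2 * (Iset M \<nu> Q * (?c * ?e))"
 proof (intro mult_left_mono order_trans[OF 2] nn)
  show "Iset M ?\<nu>' Q <= ?c * ?e" by (rule up(2))
 qed (use A in auto)
 finally have "(?a * ?b) * (?c * ?e) <= (A1 * A2 * Iset M \<nu> Q) * (?c * ?e)" by (simp add: mult_ac)
 then show "?a * ?b <= A1 * A2 * Iset M \<nu> Q" using ce by (simp add: mult_le_cancel_right)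
qed

lemma nu_compare:
 assumes B: "Ap_on M p q w1 sg1 A1 B" "Ap_on M p q w2 sg2 A2 B" and Q: "Q : sets M" "Q \<subseteq> B" "0 < measure M Q"
  and A: "0 < A1" "0 < A2" and C: "1 <= C" "measure M B <= C * measure M Q"
 shows "Iset M \<nu> B <= (A1 * C)\<^sup>2 * (A2 * C)\<^sup>2 * Iset M \<nu> Q"
proof -
 have QA: "Ap_on M p q w1 sg1 (A1 * C) Q" "Ap_on M p q w2 sg2 (A2 * C) Q"
  using Ap_on_subset[OF dw1 B(1) Q] Ap_on_subset[OF dw2 B(2) Q] A C by auto
 have C': "0 < 1 / C" "1 / C * measure M B <= measure M Q" using C by (auto simp: field_simps)
 have "Iset M \<nu> B <= Iset M w1 B powr (1/p) * Iset M sg2 B powr (1/q)"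
  using B by (intro nu_upper) (auto simp: Ap_on_def)
 also have "... <= (A1 / (1/C) * Iset M w1 Q powr (1/p)) * (A2 / (1/C) * Iset M sg2 Q powr (1/q))"
  using Ap_on_sub_weight[OF dw1 A(1) B(1) Q(1,2) C'] Ap_on_sub_weight[OF dual_w_sym[OF dw2] A(2) Ap_on_sym[OF B(2)] Q(1,2) C'] A C
  by (intro mult_mono) auto
 also have "... = (A1 * C) * (A2 * C) * (Iset M w1 Q powr (1/p) * Iset M sg2 Q powr (1/q))" by (simp add: mult_ac)
 also have "... <= (A1 * C) * (A2 * C) * ((A1 * C) * (A2 * C) * Iset M \<nu> Q)"
  using nu_lower(1)[OF QA] A C by (intro mult_left_mono) auto
 finally show ?thesis by (simp add: power2_eq_square mult_ac)
qed

text \<open>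
Changing the centring constant costs a factor two; the factor in front compares $\nu(B)$ with
$\nu(Q)$.
\<close>
lemma osc_le:
 fixes b :: "'a => 'b::{banach, second_countable_topology}"
 assumes B: "Ap_on M p q w1 sg1 A1 B" "Ap_on M p q w2 sg2 A2 B" and Q: "Q : sets M" "Q \<subseteq> B" "0 < measure M Q"
  and A: "0 < A1" "0 < A2" and C: "1 <= C" "measure M B <= C * measure M Q"
  and b: "set_integrable M B b"
 shows "osc M \<nu> b Q <= 2 * ((A1 * C)\<^sup>2 * (A2 * C)\<^sup>2) * osc M \<nu> b B"
proof -
 have QA: "Ap_on M p q w1 sg1 (A1 * C) Q" "Ap_on M p q w2 sg2 (A2 * C) Q"
  using Ap_on_subset[OF dw1 B(1) Q] Ap_on_subset[OF dw2 B(2) Q] A C by auto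
 have bQ: "set_integrable M Q b" by (rule set_integrable_subset[OF b Q(1,2)])
 have fin: "emeasure M Q < \<infinity>" "emeasure M B < \<infinity>" "B : sets M" using QA B by (auto simp: Ap_on_def)
 let ?c = "avg M B b"
 have ci: "set_integrable M Q (%x. c)" "set_integrable M B (%x. c)" for c :: 'b
  using fin Q(1) by (auto simp: set_integrable_def)
 have di: "set_integrable M Q (%x. norm (b x - c))" "set_integrable M B (%x. norm (b x - c))" for c
  using set_integral_diff(1)[OF bQ ci(1)] set_integral_diff(1)[OF b ci(2)] by (auto intro: set_integrable_norm)
 let ?J = "LINT x:Q|M. norm (b x - ?c)"
 have J: "?J <= (LINT x:B|M. norm (b x - ?c))"
  using di[of ?c] Q(2) unfolding set_lebesgue_integral_def set_integrable_def
  by (intro integral_mono) (auto simp: indicator_def)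
 have J0: "0 <= ?J" unfolding set_lebesgue_integral_def by (intro integral_nonneg_AE AE_I2) auto
 have avd: "norm (?c - avg M Q b) <= (1 / measure M Q) * ?J"
 proof -
  have "(LINT x:Q|M. b x - ?c) = (LINT x:Q|M. b x) - measure M Q *\<^sub>R ?c"
   using bQ ci(1)[of ?c] Q(1) fin by (subst set_integral_diff(2)) (auto simp: set_lebesgue_integral_def)
  then have "(1 / measure M Q) *\<^sub>R (LINT x:Q|M. b x - ?c) = avg M Q b - ?c"
   using Q(3) by (simp add: avg_def[of M Q b] scaleR_diff_right)
  then have "norm (?c - avg M Q b) = (1 / measure M Q) * norm (LINT x:Q|M. b x - ?c)"
   by (metis norm_minus_commute norm_scaleR abs_of_nonneg divide_nonneg_nonneg measure_nonneg zero_le_one)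
  also have "... <= (1 / measure M Q) * ?J"
   using set_integral_norm_bound[OF set_integral_diff(1)[OF bQ ci(1)], of ?c] by (intro mult_left_mono) auto
  finally show ?thesis .
 qed
 have "(LINT x:Q|M. norm (b x - avg M Q b)) <= (LINT x:Q|M. norm (b x - ?c) + norm (?c - avg M Q b))"
 proof (rule set_integral_mono[OF di(1)])
  show "set_integrable M Q (%x. norm (b x - ?c) + norm (?c - avg M Q b))"
   using di(1)[of ?c] Q(1) fin by (intro set_integral_add(1)) (auto simp: set_integrable_def)
  fix x
  have "b x - avg M Q b = (b x - ?c) + (?c - avg M Q b)" by simp
  then show "norm (b x - avg M Q b) <= norm (b x - ?c) + norm (?c - avg M Q b)" by (metis norm_triangle_ineq)
 qed
 also have "... = ?J + measure M Q * norm (?c - avg M Q b)"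
  using di(1)[of ?c] Q(1) fin by (subst set_integral_add(2)) (auto simp: set_integrable_def set_lebesgue_integral_def)
 also have "... <= ?J + measure M Q * ((1 / measure M Q) * ?J)"
  using avd by (intro add_left_mono mult_left_mono) auto
 also have "... = 2 * ?J" using Q(3) by simp
 also have "... <= 2 * (LINT x:B|M. norm (b x - ?c))" using J by simp
 finally have N: "(LINT x:Q|M. norm (b x - avg M Q b)) <= 2 * (LINT x:B|M. norm (b x - ?c))" .
 have pos: "0 < Iset M \<nu> Q" "0 < Iset M \<nu> B" using nu_lower(2)[OF QA] nu_lower(2)[OF B] A C by auto
 have cmp: "Iset M \<nu> B <= (A1 * C)\<^sup>2 * (A2 * C)\<^sup>2 * Iset M \<nu> Q" by (rule nu_compare[OF B Q A C])
 let ?K = "(A1 * C)\<^sup>2 * (A2 * C)\<^sup>2" and ?JB = "LINT x:B|M. norm (b x - ?c)"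
 have JB0: "0 <= ?JB" unfolding set_lebesgue_integral_def by (intro integral_nonneg_AE AE_I2) auto
 have "1 / Iset M \<nu> Q <= ?K / Iset M \<nu> B" using cmp pos by (simp add: field_simps)
 have "osc M \<nu> b Q <= (1 / Iset M \<nu> Q) * (2 * ?JB)"
  unfolding osc_def using N pos by (intro mult_left_mono) auto
 also have "... <= (?K / Iset M \<nu> B) * (2 * ?JB)"
  using \<open>1 / Iset M \<nu> Q <= ?K / Iset M \<nu> B\<close> JB0 by (intro mult_right_mono) auto
 also have "... = 2 * ?K * osc M \<nu> b B" by (simp add: osc_def)
 finally show ?thesis .
qed

end

section \<open>Compactness of series of rank-one operators\<close>

text \<open>
Finite sets exhausting a countable $S$; they turn unordered sums into limits of sequences.
\<close>
definition exh :: "'i set => nat => 'i set" where "exh S n = {Q\<in>S. to_nat_on S Q < n}"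

lemma exh_finite: assumes "countable S" shows "finite (exh S n)"
proof -
 have "inj_on (to_nat_on S) (exh S n)"
  using inj_on_to_nat_on[OF assms] by (rule inj_on_subset) (auto simp: exh_def)
 moreover have "finite (to_nat_on S ` exh S n)" by (rule finite_subset[of _ "{..<n}"]) (auto simp: exh_def)
 ultimately show ?thesis by (rule finite_imageD[rotated])
qed

lemma exh_subset: "exh S n \<subseteq> S" by (auto simp: exh_def)

lemma exh_mono: "m <= n ==> exh S m \<subseteq> exh S n" by (auto simp: exh_def)

lemma exh_absorbs:
 assumes "finite G" "G \<subseteq> S" shows "\<exists>n. G \<subseteq> exh S n"
proof -
 have "G \<subseteq> exh S (Suc (Max (to_nat_on S ` G)))"
  using assms by (auto simp: exh_def less_Suc_eq_le)
 then show ?thesis by blast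
qed

lemma exh_filterlim: assumes "countable S" shows "filterlim (exh S) (finite_subsets_at_top S) sequentially"
 unfolding filterlim_finite_subsets_at_top
proof (intro allI impI)
 fix X assume "finite X & X \<subseteq> S"
 then obtain n where n: "X \<subseteq> exh S n" using exh_absorbs[of X S] by auto
 have "finite (exh S m) & X \<subseteq> exh S m & exh S m \<subseteq> S" if "n <= m" for m
  using n exh_mono[OF that, of S] exh_finite[OF assms, of m] exh_subset[of S m] by auto
 then show "\<forall>\<^sub>F y in sequentially. finite (exh S y) & X \<subseteq> exh S y & exh S y \<subseteq> S"
  by (rule eventually_sequentiallyI)
qed

lemma abs_summable_euclidean:
 fixes t :: "'i => 'k::euclidean_space"
 assumes "t summable_on S" shows "(%Q. norm (t Q)) summable_on S"
proof -
 have comp: "(%Q. \<bar>t Q \<bullet> e\<bar>) summable_on S" for e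
 proof -
  have "(%Q. t Q \<bullet> e) summable_on S"
   by (rule summable_on_bounded_linear[OF bounded_linear_inner_left assms])
  then show ?thesis using summable_on_iff_abs_summable_on_real[of "%Q. t Q \<bullet> e" S] by simp
 qed
 have "(%Q. \<Sum>e\<in>X. \<bar>t Q \<bullet> e\<bar>) summable_on S" if "finite X" for X
  using that by (induction X rule: finite_induct) (auto intro: summable_on_add comp)
 from this[OF finite_Basis] show ?thesis by (rule summable_on_comparison_test) (use norm_le_l1 in auto)
qed

lemma abs_summable_iff_exh:
 fixes t :: "'i => 'k::euclidean_space"
 assumes S: "countable S"
 shows "t summable_on S \<longleftrightarrow> (\<exists>C::nat. \<forall>n. (\<Sum>Q\<in>exh S n. norm (t Q)) <= real C)"
proof
 assume "t summable_on S"
 then have a: "(%Q. norm (t Q)) summable_on S" by (rule abs_summable_euclidean)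
 have "(\<Sum>Q\<in>exh S n. norm (t Q)) <= real (nat \<lceil>\<Sum>\<^sub>\<infinity>Q\<in>S. norm (t Q)\<rceil>)" for n
 proof -
  have "(\<Sum>Q\<in>exh S n. norm (t Q)) <= (\<Sum>\<^sub>\<infinity>Q\<in>S. norm (t Q))"
   by (intro finite_sum_le_infsum a exh_finite S exh_subset) auto
  also have "... <= real (nat \<lceil>\<Sum>\<^sub>\<infinity>Q\<in>S. norm (t Q)\<rceil>)" by (rule real_nat_ceiling_ge)
  finally show ?thesis .
 qed
 then show "\<exists>C::nat. \<forall>n. (\<Sum>Q\<in>exh S n. norm (t Q)) <= real C" by blast
next
 assume "\<exists>C::nat. \<forall>n. (\<Sum>Q\<in>exh S n. norm (t Q)) <= real C"
 then obtain C :: nat where C: "!!n. (\<Sum>Q\<in>exh S n. norm (t Q)) <= real C" by blast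
 have "(\<Sum>Q\<in>G. norm (t Q)) <= real C" if G: "finite G" "G \<subseteq> S" for G
 proof -
  obtain n where "G \<subseteq> exh S n" using exh_absorbs[OF G] by auto
  then have "(\<Sum>Q\<in>G. norm (t Q)) <= (\<Sum>Q\<in>exh S n. norm (t Q))" by (intro sum_mono2 exh_finite S) auto
  then show ?thesis using C[of n] by simp
 qed
 then have "\<forall>\<^sub>F X in finite_subsets_at_top S. (\<Sum>Q\<in>X. norm (t Q)) <= real C"
  by (intro eventually_finite_subsets_at_top_weakI) auto
 then have "(%Q. norm (t Q)) summable_on S" by (intro nonneg_bounded_partial_sums_imp_summable_on) auto
 then show "t summable_on S" by (rule abs_summable_summable)
qed

text \<open>
The points where the series converges form a measurable set, off which the sum is $0$ by
convention.
\<close>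
lemma measurable_infsum:
 fixes t :: "'i => 'a => 'k::euclidean_space"
 assumes S: "countable S" and t: "!!Q. Q : S ==> t Q : borel_measurable M"
 shows "(%x. \<Sum>\<^sub>\<infinity>Q\<in>S. t Q x) : borel_measurable M"
proof -
 have [measurable]: "(%x. \<Sum>Q\<in>exh S n. t Q x) : borel_measurable M"
  "(%x. \<Sum>Q\<in>exh S n. norm (t Q x)) : borel_measurable M" for n
  using t exh_subset[of S n] by (auto intro!: borel_measurable_sum)
 have "(%x. \<Sum>\<^sub>\<infinity>Q\<in>S. t Q x) =
  (%x. if (\<exists>C::nat. \<forall>n. (\<Sum>Q\<in>exh S n. norm (t Q x)) <= real C) then lim (%n. \<Sum>Q\<in>exh S n. t Q x) else 0)"
 proof
  fix x
  show "(\<Sum>\<^sub>\<infinity>Q\<in>S. t Q x) = (if (\<exists>C::nat. \<forall>n. (\<Sum>Q\<in>exh S n. norm (t Q x)) <= real C) then lim (%n. \<Sum>Q\<in>exh S n. t Q x) else 0)"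
  proof (cases "(%Q. t Q x) summable_on S")
   case True
   have "(%n. \<Sum>Q\<in>exh S n. t Q x) \<longlonglongrightarrow> (\<Sum>\<^sub>\<infinity>Q\<in>S. t Q x)"
    using infsum_tendsto[OF True] exh_filterlim[OF S] by (rule filterlim_compose)
   then have "lim (%n. \<Sum>Q\<in>exh S n. t Q x) = (\<Sum>\<^sub>\<infinity>Q\<in>S. t Q x)" by (rule limI)
   then show ?thesis using True abs_summable_iff_exh[OF S, of "%Q. t Q x"] by simp
  next
   case False
   then have "~ (\<exists>C::nat. \<forall>n. (\<Sum>Q\<in>exh S n. norm (t Q x)) <= real C)"
    by (simp only: abs_summable_iff_exh[OF S, of "%Q. t Q x"] not_False_eq_True)
   then show ?thesis by (simp only: if_False infsum_not_exists[OF False])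
  qed
 qed
 also have "... : borel_measurable M" by measurable
 finally show ?thesis .
qed

text \<open>
Fatou for the partial sums along \<open>exh\<close>. A finite weighted norm forces convergence at
almost every point since the weight is positive there.
\<close>
lemma WL_series:
 fixes h :: "'i => 'a => real" and u :: "'i => 'k::euclidean_space"
 assumes S: "countable S" and h: "!!Q. Q : S ==> h Q : borel_measurable M" and h0: "!!Q x. 0 <= h Q x"
  and w: "w : borel_measurable M" "!!x. x : space M ==> 0 <= w x" "AE x in M. 0 < w x" and p: "1 < p"
  and bd: "!!G. finite G ==> G \<subseteq> S ==> WL M p w (%x. \<Sum>Q\<in>G. h Q x * norm (u Q)) C"
 shows "(%x. \<Sum>\<^sub>\<infinity>Q\<in>S. h Q x *\<^sub>R u Q) : borel_measurable M" (is ?meas)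
  and "AE x in M. (%Q. norm (h Q x *\<^sub>R u Q)) summable_on S" (is ?ae)
  and "WL M p w (%x. norm (\<Sum>\<^sub>\<infinity>Q\<in>S. h Q x *\<^sub>R u Q)) C" (is ?wl)
proof -
 have [measurable]: "w : borel_measurable M" by fact
 show meas: ?meas using S h by (intro measurable_infsum) auto
 have nrm: "norm (h Q x *\<^sub>R u Q) = h Q x * norm (u Q)" for Q x using h0 by simp
 let ?s = "%n x. \<Sum>Q\<in>exh S n. h Q x * norm (u Q)"
 have W: "WL M p w (?s n) C" for n by (intro bd exh_finite S exh_subset)
 then have [measurable]: "?s n : borel_measurable M" for n by (simp add: WL_def)
 have s0: "0 <= ?s n x" for n x using h0 by (intro sum_nonneg) auto
 have smono: "?s m x <= ?s n x" if "m <= n" for m n x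
  using exh_mono[OF that, of S] h0 by (intro sum_mono2 exh_finite S) auto
 let ?g = "%n x. ennreal (\<bar>?s n x\<bar> powr p * w x)"
 have inc: "incseq (%n x. ennreal (\<bar>?s n x\<bar> powr p * (max 0 (w x))))"
  unfolding incseq_def le_fun_def
 proof (intro allI impI ennreal_leI mult_right_mono)
  fix m n x assume "(m::nat) <= n"
  then show "\<bar>?s m x\<bar> powr p <= \<bar>?s n x\<bar> powr p" using smono[of m n x] s0 p by (intro powr_mono2) auto
 qed auto
 have "(\<integral>\<^sup>+x. (SUP n. ennreal (\<bar>?s n x\<bar> powr p * (max 0 (w x)))) \<partial>M) = (SUP n. \<integral>\<^sup>+x. ennreal (\<bar>?s n x\<bar> powr p * (max 0 (w x))) \<partial>M)"
  by (intro nn_integral_monotone_convergence_SUP inc) auto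
 also have "... <= ennreal (C powr p)"
 proof (rule SUP_least)
  fix n
  have "(\<integral>\<^sup>+x. ennreal (\<bar>?s n x\<bar> powr p * (max 0 (w x))) \<partial>M) = (\<integral>\<^sup>+x. ?g n x \<partial>M)"
   using w(2) by (intro nn_integral_cong) (simp add: max_def)
  then show "(\<integral>\<^sup>+x. ennreal (\<bar>?s n x\<bar> powr p * (max 0 (w x))) \<partial>M) <= ennreal (C powr p)" using W[of n] by (simp add: WL_def)
 qed
 also have "... < \<infinity>" by simp
 finally have fin: "(\<integral>\<^sup>+x. (SUP n. ennreal (\<bar>?s n x\<bar> powr p * (max 0 (w x)))) \<partial>M) ~= \<infinity>" by simp
 have "AE x in M. (SUP n. ennreal (\<bar>?s n x\<bar> powr p * (max 0 (w x)))) ~= \<infinity>"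
  by (rule nn_integral_PInf_AE[OF _ fin]) measurable
 then show ae: ?ae using w(3)
 proof eventually_elim
  case (elim x)
  let ?Z = "SUP n. ennreal (\<bar>?s n x\<bar> powr p * (max 0 (w x)))"
  define z where "z = enn2real ?Z"
  have Zt: "?Z < top" using elim(1) unfolding infinity_ennreal_def less_top .
  have Z: "?Z = ennreal z" "0 <= z" unfolding z_def by (rule ennreal_enn2real[OF Zt, symmetric]) (rule enn2real_nonneg)
  have sz: "?s n x <= (z / w x) powr (1/p)" for n
  proof -
   have "ennreal (\<bar>?s n x\<bar> powr p * (max 0 (w x))) <= ?Z" by (rule SUP_upper) simp
   then have "?s n x powr p * w x <= z" using Z elim(2) s0 by (simp add: max_def ennreal_le_iff)
   then have "?s n x powr p <= z / w x" using elim(2) by (simp add: field_simps)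
   then have "(?s n x powr p) powr (1/p) <= (z / w x) powr (1/p)" using p by (intro powr_mono2) auto
   then show ?thesis using p s0 by (simp add: powr_powr)
  qed
  have "\<exists>C::nat. \<forall>n. (\<Sum>Q\<in>exh S n. norm (h Q x *\<^sub>R u Q)) <= real C"
  proof (intro exI allI)
   fix n
   have "(\<Sum>Q\<in>exh S n. norm (h Q x *\<^sub>R u Q)) = ?s n x" by (simp only: nrm)
   also have "... <= (z / w x) powr (1/p)" by (rule sz)
   also have "... <= real (nat \<lceil>(z / w x) powr (1/p)\<rceil>)" by (rule real_nat_ceiling_ge)
   finally show "(\<Sum>Q\<in>exh S n. norm (h Q x *\<^sub>R u Q)) <= real (nat \<lceil>(z / w x) powr (1/p)\<rceil>)" .
  qed
  then have "(%Q. h Q x *\<^sub>R u Q) summable_on S" using abs_summable_iff_exh[OF S] by blast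
  then show ?case by (rule abs_summable_euclidean)
 qed
 show ?wl
 proof (rule WL_limit[where u="%n x. norm (\<Sum>Q\<in>exh S n. h Q x *\<^sub>R u Q)"])
  show "WL M p w (%x. norm (\<Sum>Q\<in>exh S n. h Q x *\<^sub>R u Q)) C" for n
  proof (rule WL_mono[OF W[of n] _ _ w(2)])
   show "(%x. norm (\<Sum>Q\<in>exh S n. h Q x *\<^sub>R u Q)) : borel_measurable M"
   proof -
    have "(%x. \<Sum>Q\<in>exh S n. h Q x *\<^sub>R u Q) : borel_measurable M"
    proof (intro borel_measurable_sum)
     fix Q assume "Q : exh S n"
     then have [measurable]: "h Q : borel_measurable M" using h exh_subset[of S n] by auto
     show "(%x. h Q x *\<^sub>R u Q) : borel_measurable M" by measurable
    qed
    then show ?thesis by measurable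
   qed
   show "AE x in M. \<bar>norm (\<Sum>Q\<in>exh S n. h Q x *\<^sub>R u Q)\<bar> <= \<bar>?s n x\<bar>"
   proof (intro AE_I2)
    fix x
    have "norm (\<Sum>Q\<in>exh S n. h Q x *\<^sub>R u Q) <= (\<Sum>Q\<in>exh S n. norm (h Q x *\<^sub>R u Q))" by (rule norm_sum)
    also have "... = ?s n x" by (simp only: nrm)
    finally show "\<bar>norm (\<Sum>Q\<in>exh S n. h Q x *\<^sub>R u Q)\<bar> <= \<bar>?s n x\<bar>" using s0[of x n] by simp
   qed
  qed (use p in auto)
  show "(%x. norm (\<Sum>\<^sub>\<infinity>Q\<in>S. h Q x *\<^sub>R u Q)) : borel_measurable M" using meas by measurable
  show "AE x in M. (%n. norm (\<Sum>Q\<in>exh S n. h Q x *\<^sub>R u Q)) \<longlonglongrightarrow> norm (\<Sum>\<^sub>\<infinity>Q\<in>S. h Q x *\<^sub>R u Q)"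
   using ae
  proof eventually_elim
   case (elim x)
   then have "(%Q. h Q x *\<^sub>R u Q) summable_on S" by (rule abs_summable_summable)
   from filterlim_compose[OF infsum_tendsto[OF this] exh_filterlim[OF S]]
   show ?case by (rule tendsto_norm)
  qed
 qed (use p in auto)
qed

lemma Lp_WL:
 fixes f :: "'a => 'b::{banach, second_countable_topology}"
 assumes w: "w : borel_measurable M" "!!x. x : space M ==> 0 <= w x" and p: "1 < p" and f: "f : Lp M p w"
 shows "WL M p w (%x. norm (f x)) (Lp_norm M p w f)"
proof -
 have [measurable]: "f : borel_measurable M" "w : borel_measurable M" using f w by (auto simp: Lp_def)
 have int: "integrable (density M (%x. ennreal (w x))) (%x. norm (f x) powr p)" using f by (simp add: Lp_def)
 have "(\<integral>\<^sup>+x. ennreal (\<bar>norm (f x)\<bar> powr p * w x) \<partial>M) = (\<integral>\<^sup>+x. ennreal (w x) * ennreal (norm (f x) powr p) \<partial>M)"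
  using w(2) by (intro nn_integral_cong) (simp add: ennreal_mult' mult.commute)
 also have "... = (\<integral>\<^sup>+x. ennreal (norm (f x) powr p) \<partial>density M (%x. ennreal (w x)))"
  by (intro nn_integral_density[symmetric]) auto
 also have "... = ennreal (LINT x|density M (%x. ennreal (w x)). norm (f x) powr p)"
  by (intro nn_integral_eq_integral int) auto
 also have "(LINT x|density M (%x. ennreal (w x)). norm (f x) powr p) = Lp_norm M p w f powr p"
 proof -
  have "0 <= (LINT x|density M (%x. ennreal (w x)). norm (f x) powr p)" by (intro integral_nonneg_AE) auto
  then show ?thesis using p by (simp add: Lp_norm_def powr_powr)
 qed
 finally show ?thesis by (simp add: WL_def Lp_norm_def)
qed

lemma WL_Lp:
 fixes f :: "'a => 'b::{banach, second_countable_topology}"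
 assumes w: "w : borel_measurable M" "!!x. x : space M ==> 0 <= w x" and p: "1 < p"
  and fm[measurable]: "f : borel_measurable M" and f: "WL M p w (%x. norm (f x)) A"
 shows "f : Lp M p w" "Lp_norm M p w f <= A"
proof -
 have [measurable]: "w : borel_measurable M" using w by auto
 have "(\<integral>\<^sup>+x. ennreal (norm (f x) powr p) \<partial>density M (%x. ennreal (w x))) = (\<integral>\<^sup>+x. ennreal (w x) * ennreal (norm (f x) powr p) \<partial>M)"
  by (intro nn_integral_density) auto
 also have "... = (\<integral>\<^sup>+x. ennreal (\<bar>norm (f x)\<bar> powr p * w x) \<partial>M)"
  using w(2) by (intro nn_integral_cong) (simp add: ennreal_mult' mult.commute)
 also have "... <= ennreal (A powr p)" using f by (simp add: WL_def)
 finally have le: "(\<integral>\<^sup>+x. ennreal (norm (f x) powr p) \<partial>density M (%x. ennreal (w x))) <= ennreal (A powr p)" .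
 have int: "integrable (density M (%x. ennreal (w x))) (%x. norm (f x) powr p)"
 proof (rule integrableI_bounded)
  have "(\<integral>\<^sup>+x. ennreal (norm (norm (f x) powr p)) \<partial>density M (%x. ennreal (w x))) = (\<integral>\<^sup>+x. ennreal (norm (f x) powr p) \<partial>density M (%x. ennreal (w x)))"
   by (intro nn_integral_cong) simp
  also have "... < \<infinity>" using le by (rule le_less_trans) simp
  finally show "(\<integral>\<^sup>+x. ennreal (norm (norm (f x) powr p)) \<partial>density M (%x. ennreal (w x))) < \<infinity>" .
 qed measurable
 then show "f : Lp M p w" by (simp add: Lp_def)
 have "ennreal (LINT x|density M (%x. ennreal (w x)). norm (f x) powr p) <= ennreal (A powr p)"
  using le nn_integral_eq_integral[OF int] by simp
 then have "(LINT x|density M (%x. ennreal (w x)). norm (f x) powr p) <= A powr p" by (simp add: ennreal_le_iff)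
 then have "(LINT x|density M (%x. ennreal (w x)). norm (f x) powr p) powr (1/p) <= (A powr p) powr (1/p)"
  using p by (intro powr_mono2 integral_nonneg_AE) auto
 then show "Lp_norm M p w f <= A" using f p by (simp add: Lp_norm_def powr_powr WL_def)
qed

lemma diagonal_convergence:
 fixes c :: "nat => 'i => 'k::heine_borel"
 assumes S: "countable S" and bd: "!!Q. Q : S ==> bounded (range (%n. c n Q))"
 shows "\<exists>r::nat=>nat. strict_mono r & (\<forall>Q\<in>S. convergent (%n. c (r n) Q))"
proof (cases "S = {}")
 case True
 then show ?thesis by (intro exI[of _ id]) (auto simp: strict_mono_def)
next
 case False
 define P where "P n s = convergent (%i. c (s i) (from_nat_into S n))" for n and s :: "nat => nat"
 interpret subseqs P
 proof
  fix n and s :: "nat => nat" assume "strict_mono s"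
  have "from_nat_into S n : S" by (rule from_nat_into[OF False])
  from bd[OF this] have "bounded (range (%i. c (s i) (from_nat_into S n)))" by (rule bounded_subset) auto
  from bounded_imp_convergent_subsequence[OF this] show "\<exists>r'. strict_mono r' & P n (s \<circ> r')"
   unfolding P_def convergent_def o_def by blast
 qed
 have st: "P n (s \<circ> r)" if "strict_mono r" "P n s" for r s n
  using convergent_subseq_convergent[OF that(2)[unfolded P_def] that(1)] by (simp add: P_def o_def)
 have "convergent (%n. c (diagseq n) Q)" if Q: "Q : S" for Q
 proof -
  obtain k where k: "from_nat_into S k = Q" using from_nat_into_surj[OF S Q] by blast
  have "P k (diagseq \<circ> (+) (Suc k))" by (rule diagseq_holds[OF st])
  then have "convergent (%i. c (diagseq (i + Suc k)) Q)" by (simp add: P_def k o_def add.commute)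
  then show ?thesis using convergent_ignore_initial_segment[of "%i. c (diagseq i) Q" "Suc k"] by simp
 qed
 then show ?thesis using subseq_diagseq by blast
qed

text \<open>
Given a bounded sequence, a diagonal argument makes every coefficient $\varphi_Q$ converge. The
series with the limit coefficients is the limit of the images: finitely many terms converge, and
the tails are uniformly small both for the sequence and, by Fatou, for the limit.
\<close>
lemma compact_from_tails:
 fixes h :: "'i => 'a => real" and \<phi> :: "'i => ('a => 'k::euclidean_space) => 'k"
 assumes S: "countable S" and h: "!!Q. Q : S ==> h Q : borel_measurable M" and h0: "!!Q x. 0 <= h Q x"
  and w: "w2 : borel_measurable M" "!!x. x : space M ==> 0 <= w2 x" "AE x in M. 0 < w2 x" and p: "1 < p"
  and \<phi>b: "!!Q. Q : S ==> \<exists>C. \<forall>f\<in>Lp M p w1. norm (\<phi> Q f) <= C * Lp_norm M p w1 f"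
  and hb: "!!F. finite F ==> F \<subseteq> S ==> \<exists>C. WL M p w2 (%x. \<Sum>Q\<in>F. h Q x) C"
  and tail: "!!eps. 0 < eps ==> \<exists>F. finite F & F \<subseteq> S & (\<forall>G f. finite G --> G \<subseteq> S - F --> f : Lp M p w1 -->
    WL M p w2 (%x. \<Sum>Q\<in>G. h Q x * norm (\<phi> Q f)) (eps * Lp_norm M p w1 f))"
 shows "compact_Lp_op M p w1 w2 (%f x. \<Sum>\<^sub>\<infinity>Q\<in>S. h Q x *\<^sub>R \<phi> Q f)"
proof -
 let ?W = "WL M p w2"
 let ?s = "%(G::'i set) (v::'i => 'k) x. \<Sum>Q\<in>G. h Q x * norm (v Q)"
 let ?N = "Lp_norm M p w1"
 have N0: "0 <= ?N f" for f by (simp add: Lp_norm_def)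
 have ser: "(%x. \<Sum>\<^sub>\<infinity>Q\<in>S. h Q x *\<^sub>R u Q) : borel_measurable M"
   "AE x in M. (%Q. norm (h Q x *\<^sub>R u Q)) summable_on S"
   "?W (%x. norm (\<Sum>\<^sub>\<infinity>Q\<in>S. h Q x *\<^sub>R u Q)) C"
  if bd: "!!G. finite G ==> G \<subseteq> S ==> ?W (?s G (%Q. u Q)) C" for u :: "'i => 'k" and C
 proof -
  show "(%x. \<Sum>\<^sub>\<infinity>Q\<in>S. h Q x *\<^sub>R u Q) : borel_measurable M"
   by (rule WL_series(1)[of S h M w2 p u C]) (use S h h0 w p bd in auto)
  show "AE x in M. (%Q. norm (h Q x *\<^sub>R u Q)) summable_on S"
   by (rule WL_series(2)[of S h M w2 p u C]) (use S h h0 w p bd in auto)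
  show "?W (%x. norm (\<Sum>\<^sub>\<infinity>Q\<in>S. h Q x *\<^sub>R u Q)) C"
   by (rule WL_series(3)[of S h M w2 p u C]) (use S h h0 w p bd in auto)
 qed
 have finWL: "\<exists>K\<ge>0. \<forall>v::'i=>'k. ?W (?s F v) (K * (\<Sum>Q\<in>F. norm (v Q)))"
  if F: "finite F" "F \<subseteq> S" for F
 proof -
  obtain C where C: "?W (%x. \<Sum>Q\<in>F. h Q x) C" using hb[OF F] by blast
  have "?W (?s F v) (C * (\<Sum>Q\<in>F. norm (v Q)))" for v :: "'i => 'k"
  proof -
   let ?V = "\<Sum>Q\<in>F. norm (v Q)"
   have V0: "0 <= ?V" by (intro sum_nonneg) auto
   have "?W (%x. ?V * (\<Sum>Q\<in>F. h Q x)) (?V * C)" by (rule WL_scale[OF C V0 w(1)])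
   then show ?thesis
    unfolding mult.commute[of C]
   proof (rule WL_mono[OF _ _ _ w(2)])
    show "(?s F v) : borel_measurable M" using F h by (intro borel_measurable_sum borel_measurable_times) auto
    show "AE x in M. \<bar>\<Sum>Q\<in>F. h Q x * norm (v Q)\<bar> <= \<bar>?V * (\<Sum>Q\<in>F. h Q x)\<bar>"
    proof (intro AE_I2)
     fix x
     have "(\<Sum>Q\<in>F. h Q x * norm (v Q)) <= (\<Sum>Q\<in>F. h Q x * ?V)"
      using h0 F by (intro sum_mono mult_left_mono member_le_sum) auto
     also have "... = ?V * (\<Sum>Q\<in>F. h Q x)" by (simp add: sum_distrib_left mult.commute)
     finally have "(\<Sum>Q\<in>F. h Q x * norm (v Q)) <= ?V * (\<Sum>Q\<in>F. h Q x)" .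
     moreover have "0 <= (\<Sum>Q\<in>F. h Q x * norm (v Q))" using h0 by (intro sum_nonneg) auto
     ultimately show "\<bar>\<Sum>Q\<in>F. h Q x * norm (v Q)\<bar> <= \<bar>?V * (\<Sum>Q\<in>F. h Q x)\<bar>" by simp
    qed
   qed (use p in auto)
  qed
  moreover have "0 <= C" using C by (simp add: WL_def)
  ultimately show ?thesis by blast
 qed
 have sumsplit: "?W (?s G v) (4 * (C1 + C2))"
  if F: "finite F" "F \<subseteq> S" and G: "finite G" "G \<subseteq> S" and 1: "?W (?s F v) C1"
   and 2: "?W (?s (G - F) v) C2" for F G C1 C2 and v :: "'i => 'k"
 proof (rule WL_mono[OF WL_add[OF 1 2 _ w(1,2)] _ _ w(2)])
  show "(?s G v) : borel_measurable M" using G h by (intro borel_measurable_sum borel_measurable_times) auto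
  show "AE x in M. \<bar>\<Sum>Q\<in>G. h Q x * norm (v Q)\<bar> <= \<bar>(\<Sum>Q\<in>F. h Q x * norm (v Q)) + (\<Sum>Q\<in>G - F. h Q x * norm (v Q))\<bar>"
  proof (intro AE_I2)
   fix x
   have "(\<Sum>Q\<in>G. h Q x * norm (v Q)) = (\<Sum>Q\<in>G \<inter> F. h Q x * norm (v Q)) + (\<Sum>Q\<in>G - F. h Q x * norm (v Q))"
    by (rule sum.Int_Diff[OF G(1)])
   also have "... <= (\<Sum>Q\<in>F. h Q x * norm (v Q)) + (\<Sum>Q\<in>G - F. h Q x * norm (v Q))"
    using h0 F by (intro add_right_mono sum_mono2) auto
   finally have "(\<Sum>Q\<in>G. h Q x * norm (v Q)) <= (\<Sum>Q\<in>F. h Q x * norm (v Q)) + (\<Sum>Q\<in>G - F. h Q x * norm (v Q))" .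
   moreover have "0 <= (\<Sum>Q\<in>G. h Q x * norm (v Q))" using h0 by (intro sum_nonneg) auto
   ultimately show "\<bar>\<Sum>Q\<in>G. h Q x * norm (v Q)\<bar> <= \<bar>(\<Sum>Q\<in>F. h Q x * norm (v Q)) + (\<Sum>Q\<in>G - F. h Q x * norm (v Q))\<bar>" by simp
  qed
 qed (use p in auto)
 obtain Cphi where Cphi: "!!Q f. Q : S ==> f : Lp M p w1 ==> norm (\<phi> Q f) <= Cphi Q * ?N f"
 proof -
  have "\<forall>Q\<in>S. \<exists>C. \<forall>f\<in>Lp M p w1. norm (\<phi> Q f) <= C * ?N f" using \<phi>b by blast
  from bchoice[OF this] obtain C where C: "\<forall>Q\<in>S. \<forall>f\<in>Lp M p w1. norm (\<phi> Q f) <= C Q * ?N f" by (elim exE)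
  show ?thesis by (rule that[of C]) (use C in simp)
 qed
 \<comment> \<open>The tail estimate with $\varepsilon=1$ and the finitely many remaining terms bound all partial sums.\<close>
 have unif: "\<exists>K\<ge>0. \<forall>G f. finite G --> G \<subseteq> S --> f : Lp M p w1 --> ?W (?s G (%Q. \<phi> Q f)) (K * ?N f)"
 proof -
  obtain F where F: "finite F" "F \<subseteq> S" and Ft: "\<forall>G f. finite G --> G \<subseteq> S - F --> f : Lp M p w1 -->
    ?W (?s G (%Q. \<phi> Q f)) (1 * ?N f)" using tail[of 1] by auto
  obtain K where K: "0 <= K" "\<forall>v::'i=>'k. ?W (?s F v) (K * (\<Sum>Q\<in>F. norm (v Q)))"
   using finWL[OF F] by blast
  let ?K = "4 * (K * (\<Sum>Q\<in>F. \<bar>Cphi Q\<bar>) + 1)"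
  have "?W (?s G (%Q. \<phi> Q f)) (?K * ?N f)" if G: "finite G" "G \<subseteq> S" and f: "f : Lp M p w1" for G f
  proof -
   have "?W (?s (G - F) (%Q. \<phi> Q f)) (1 * ?N f)"
    using Ft[rule_format, of "G - F" f] G f by auto
   from sumsplit[OF F G K(2)[rule_format] this]
   have "?W (?s G (%Q. \<phi> Q f)) (4 * (K * (\<Sum>Q\<in>F. norm (\<phi> Q f)) + 1 * ?N f))" .
   then show ?thesis
   proof (rule WL_le)
    have "(\<Sum>Q\<in>F. norm (\<phi> Q f)) <= (\<Sum>Q\<in>F. \<bar>Cphi Q\<bar> * ?N f)"
    proof (rule sum_mono)
     fix Q assume "Q : F"
     then have "norm (\<phi> Q f) <= Cphi Q * ?N f" using Cphi F f by auto
     also have "... <= \<bar>Cphi Q\<bar> * ?N f" using N0 by (intro mult_right_mono) auto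
     finally show "norm (\<phi> Q f) <= \<bar>Cphi Q\<bar> * ?N f" .
    qed
    then have "K * (\<Sum>Q\<in>F. norm (\<phi> Q f)) <= K * (\<Sum>Q\<in>F. \<bar>Cphi Q\<bar> * ?N f)" using K(1) by (rule mult_left_mono)
    also have "... = K * (\<Sum>Q\<in>F. \<bar>Cphi Q\<bar>) * ?N f" by (simp add: sum_distrib_right mult.assoc)
    finally show "4 * (K * (\<Sum>Q\<in>F. norm (\<phi> Q f)) + 1 * ?N f) <= ?K * ?N f" by (simp add: distrib_right)
   qed (use p in auto)
  qed
  moreover have "0 <= ?K" using K(1) by (simp add: sum_nonneg)
  ultimately show ?thesis by blast
 qed
 then obtain K where K: "0 <= K" and KW: "!!G f. finite G ==> G \<subseteq> S ==> f : Lp M p w1 ==> ?W (?s G (%Q. \<phi> Q f)) (K * ?N f)"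
  by blast
 let ?T = "%f x. \<Sum>\<^sub>\<infinity>Q\<in>S. h Q x *\<^sub>R \<phi> Q f"
 have bounded: "?T f : Lp M p w2" if f: "f : Lp M p w1" for f
 proof (rule WL_Lp(1)[OF w(1,2) p])
  show "?T f : borel_measurable M" by (rule ser(1)[of "%Q. \<phi> Q f"]) (rule KW[OF _ _ f])
  show "?W (%x. norm (?T f x)) (K * ?N f)" by (rule ser(3)[of "%Q. \<phi> Q f"]) (rule KW[OF _ _ f])
 qed
 have seq: "\<exists>r g. strict_mono (r :: nat => nat) & g : Lp M p w2 & (%n. Lp_norm M p w2 (%x. ?T (F (r n)) x - g x)) \<longlonglongrightarrow> 0"
  if F: "!!n. F n : Lp M p w1" and Fb: "bounded (range (%n. ?N (F n)))" for F :: "nat => 'a => 'k"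
 proof -
  obtain B where B: "!!n. ?N (F n) <= B" using Fb by (auto simp: bounded_iff abs_le_iff)
  have B0: "0 <= B" using B[of 0] N0[of "F 0"] by linarith
  have bnd: "bounded (range (%n. \<phi> Q (F n)))" if Q: "Q : S" for Q
  proof (rule boundedI)
   fix y assume "y : range (%n. \<phi> Q (F n))"
   then obtain n where n: "y = \<phi> Q (F n)" by blast
   have "norm y <= Cphi Q * ?N (F n)" using Cphi[OF Q F] n by simp
   also have "... <= \<bar>Cphi Q\<bar> * B" using B N0 by (intro mult_mono) auto
   finally show "norm y <= \<bar>Cphi Q\<bar> * B" .
  qed
  have "\<exists>r::nat=>nat. strict_mono r & (\<forall>Q\<in>S. convergent (%n. \<phi> Q (F (r n))))"
   by (rule diagonal_convergence[OF S]) (rule bnd)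
  then obtain r where r: "strict_mono (r::nat=>nat)" "!!Q. Q : S ==> convergent (%n. \<phi> Q (F (r n)))"
   by blast
  define c where "c Q = lim (%n. \<phi> Q (F (r n)))" for Q
  have lim: "(%n. \<phi> Q (F (r n))) \<longlonglongrightarrow> c Q" if "Q : S" for Q
   using r(2)[OF that] unfolding c_def by (simp add: convergent_LIMSEQ_iff)
  define g where "g x = (\<Sum>\<^sub>\<infinity>Q\<in>S. h Q x *\<^sub>R c Q)" for x
  have climit: "?W (?s G c) C"
   if G: "finite G" "G \<subseteq> S" and bd: "!!n. ?W (?s G (%Q. \<phi> Q (F (r n)))) C" for G C
  proof (rule WL_limit[OF bd])
   show "(?s G c) : borel_measurable M" using G h by (intro borel_measurable_sum borel_measurable_times) auto
   show "AE x in M. (%n. \<Sum>Q\<in>G. h Q x * norm (\<phi> Q (F (r n)))) \<longlonglongrightarrow> (\<Sum>Q\<in>G. h Q x * norm (c Q))"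
    using G lim by (intro AE_I2 tendsto_sum tendsto_mult_left tendsto_norm) auto
  qed (use w p in auto)
  have KB: "?W (?s G (%Q. \<phi> Q (F n))) (K * B)" if "finite G" "G \<subseteq> S" for G n
   by (rule WL_le[OF KW[OF that F]]) (use B K p in \<open>auto intro: mult_left_mono\<close>)
  have cB: "?W (?s G c) (K * B)" if "finite G" "G \<subseteq> S" for G
   using climit[OF that KB[OF that]] .
  have serc: "g : borel_measurable M" "AE x in M. (%Q. norm (h Q x *\<^sub>R c Q)) summable_on S"
   "?W (%x. norm (g x)) (K * B)"
  proof -
   show "g : borel_measurable M" unfolding g_def[abs_def] by (rule ser(1)[of c]) (rule cB)
   show "AE x in M. (%Q. norm (h Q x *\<^sub>R c Q)) summable_on S" by (rule ser(2)[of c]) (rule cB)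
   show "?W (%x. norm (g x)) (K * B)" unfolding g_def by (rule ser(3)[of c]) (rule cB)
  qed
  have g: "g : Lp M p w2"
   by (rule WL_Lp(1)[OF w(1,2) p serc(1,3)])
  let ?v = "%n Q. \<phi> Q (F (r n)) - c Q"
  have vsplit: "?W (?s G (?v n)) (8 * C)"
   if G: "finite G" "G \<subseteq> S" and 1: "?W (?s G (%Q. \<phi> Q (F (r n)))) C"
    and 2: "?W (?s G c) C" for G n C
  proof -
   have "?W (%x. (\<Sum>Q\<in>G. h Q x * norm (\<phi> Q (F (r n)))) + (\<Sum>Q\<in>G. h Q x * norm (c Q))) (4 * (C + C))"
    by (rule WL_add[OF 1 2 _ w(1,2)]) (use p in auto)
   then have "?W (?s G (?v n)) (4 * (C + C))"
   proof (rule WL_mono[OF _ _ _ w(2)])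
    show "(?s G (?v n)) : borel_measurable M" using G h by (intro borel_measurable_sum borel_measurable_times) auto
    show "AE x in M. \<bar>\<Sum>Q\<in>G. h Q x * norm (?v n Q)\<bar> <= \<bar>(\<Sum>Q\<in>G. h Q x * norm (\<phi> Q (F (r n)))) + (\<Sum>Q\<in>G. h Q x * norm (c Q))\<bar>"
    proof (intro AE_I2)
     fix x
     have "(\<Sum>Q\<in>G. h Q x * norm (?v n Q)) <= (\<Sum>Q\<in>G. h Q x * (norm (\<phi> Q (F (r n))) + norm (c Q)))"
      using h0 by (intro sum_mono mult_left_mono norm_triangle_ineq4) auto
     also have "... = (\<Sum>Q\<in>G. h Q x * norm (\<phi> Q (F (r n)))) + (\<Sum>Q\<in>G. h Q x * norm (c Q))"
      by (simp add: distrib_left sum.distrib)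
     finally have "(\<Sum>Q\<in>G. h Q x * norm (?v n Q)) <= ..." .
     moreover have "0 <= (\<Sum>Q\<in>G. h Q x * norm (?v n Q))" using h0 by (intro sum_nonneg) auto
     ultimately show "\<bar>\<Sum>Q\<in>G. h Q x * norm (?v n Q)\<bar> <= \<bar>(\<Sum>Q\<in>G. h Q x * norm (\<phi> Q (F (r n)))) + (\<Sum>Q\<in>G. h Q x * norm (c Q))\<bar>" by simp
    qed
   qed (use p in auto)
   then show ?thesis by simp
  qed
  have vB: "?W (?s G (?v n)) (8 * (K * B))" if "finite G" "G \<subseteq> S" for G n
   using vsplit[OF that KB[OF that] cB[OF that]] .
  have diff: "AE x in M. ?T (F (r n)) x - g x = (\<Sum>\<^sub>\<infinity>Q\<in>S. h Q x *\<^sub>R ?v n Q)" for n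
  proof -
   have "AE x in M. (%Q. norm (h Q x *\<^sub>R ?v n Q)) summable_on S" by (rule ser(2)[of "?v n"]) (rule vB)
   with serc(2) show ?thesis
  proof eventually_elim
   case (elim x)
   have s: "(%Q. h Q x *\<^sub>R c Q) summable_on S" "(%Q. h Q x *\<^sub>R ?v n Q) summable_on S"
    using elim by (auto intro: abs_summable_summable)
   have "?T (F (r n)) x = (\<Sum>\<^sub>\<infinity>Q\<in>S. h Q x *\<^sub>R c Q + h Q x *\<^sub>R ?v n Q)" by (simp add: scaleR_diff_right)
   also have "... = g x + (\<Sum>\<^sub>\<infinity>Q\<in>S. h Q x *\<^sub>R ?v n Q)" unfolding g_def by (rule infsum_add[OF s])
   finally show ?case by simp
  qed
  qed
  have "(%n. Lp_norm M p w2 (%x. ?T (F (r n)) x - g x)) \<longlonglongrightarrow> 0"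
  proof (rule LIMSEQ_I)
   fix e :: real assume e: "0 < e"
   define eps where "eps = e / (64 * (B + 1))"
   have eps: "0 < eps" using e B0 by (simp add: eps_def)
   obtain F0 where F0: "finite F0" "F0 \<subseteq> S" and F0t: "\<forall>G f. finite G --> G \<subseteq> S - F0 --> f : Lp M p w1 -->
    ?W (?s G (%Q. \<phi> Q f)) (eps * ?N f)" using tail[OF eps] by auto
   obtain K0 where K0: "0 <= K0" "\<forall>v::'i=>'k. ?W (?s F0 v) (K0 * (\<Sum>Q\<in>F0. norm (v Q)))"
    using finWL[OF F0] by blast
   have t1: "?W (?s G (%Q. \<phi> Q (F (r n)))) (eps * B)" if G: "finite G" "G \<subseteq> S - F0" for G n
   proof (rule WL_le)
    show "?W (?s G (%Q. \<phi> Q (F (r n)))) (eps * ?N (F (r n)))"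
     using F0t[rule_format, OF G F] .
    show "eps * ?N (F (r n)) <= eps * B" using B eps by (intro mult_left_mono) auto
   qed (use p in auto)
   have t2: "?W (?s G (?v n)) (8 * (eps * B))" if G: "finite G" "G \<subseteq> S - F0" for G n
    using G by (intro vsplit climit t1) auto
   have est: "Lp_norm M p w2 (%x. ?T (F (r n)) x - g x) <= 4 * (K0 * (\<Sum>Q\<in>F0. norm (?v n Q)) + 8 * (eps * B))" for n
   proof (rule WL_Lp(2)[OF w(1,2) p])
    show mT: "(%x. ?T (F (r n)) x - g x) : borel_measurable M"
    proof -
     have [measurable]: "?T (F (r n)) : borel_measurable M" using bounded[OF F, of "r n"] by (simp only: Lp_def mem_Collect_eq)
     show ?thesis using serc(1) by measurable
    qed
    have fb: "?W (?s G (?v n)) (4 * (K0 * (\<Sum>Q\<in>F0. norm (?v n Q)) + 8 * (eps * B)))"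
     if G: "finite G" "G \<subseteq> S" for G
     using G by (intro sumsplit[OF F0 G K0(2)[rule_format] t2]) auto
    have "?W (%x. norm (\<Sum>\<^sub>\<infinity>Q\<in>S. h Q x *\<^sub>R ?v n Q)) (4 * (K0 * (\<Sum>Q\<in>F0. norm (?v n Q)) + 8 * (eps * B)))"
     by (rule ser(3)[of "?v n"]) (rule fb)
    then show "?W (%x. norm (?T (F (r n)) x - g x)) (4 * (K0 * (\<Sum>Q\<in>F0. norm (?v n Q)) + 8 * (eps * B)))"
    proof (rule WL_mono[OF _ _ _ w(2)])
     show "(%x. norm (?T (F (r n)) x - g x)) : borel_measurable M" using mT by measurable
     show "AE x in M. \<bar>norm (?T (F (r n)) x - g x)\<bar> <= \<bar>norm (\<Sum>\<^sub>\<infinity>Q\<in>S. h Q x *\<^sub>R ?v n Q)\<bar>"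
      using diff[of n] by eventually_elim simp
    qed (use p in auto)
   qed
   have "(%n. 4 * (K0 * (\<Sum>Q\<in>F0. norm (?v n Q)) + 8 * (eps * B))) \<longlonglongrightarrow> 4 * (K0 * (\<Sum>Q\<in>F0. norm (c Q - c Q)) + 8 * (eps * B))"
    using F0 lim by (intro tendsto_intros) auto
   moreover have "4 * (K0 * (\<Sum>Q\<in>F0. norm (c Q - c Q)) + 8 * (eps * B)) < e"
    using e B0 by (simp add: eps_def field_simps add_pos_nonneg)
   ultimately have "\<forall>\<^sub>F n in sequentially. 4 * (K0 * (\<Sum>Q\<in>F0. norm (?v n Q)) + 8 * (eps * B)) < e"
    by (rule order_tendstoD(2))
   then obtain n0 where n0: "!!n. n >= n0 ==> 4 * (K0 * (\<Sum>Q\<in>F0. norm (?v n Q)) + 8 * (eps * B)) < e"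
    unfolding eventually_sequentially by blast
   have "norm (Lp_norm M p w2 (%x. ?T (F (r n)) x - g x) - 0) < e" if "n >= n0" for n
    using est[of n] n0[OF that] by (simp add: Lp_norm_def)
   then show "\<exists>n0. \<forall>n\<ge>n0. norm (Lp_norm M p w2 (%x. ?T (F (r n)) x - g x) - 0) < e" by blast
  qed
  then show ?thesis using r(1) g by blast
 qed
 show ?thesis unfolding compact_Lp_op_def using bounded seq by blast
qed

section \<open>Dyadic systems in spaces of homogeneous type\<close>

locale dyadic_space = homogeneous_type M d A\<^sub>0 C\<^sub>\<mu>
 for M :: "'a measure" and d :: "'a => 'a => real" and A\<^sub>0 C\<^sub>\<mu> :: real +
 fixes dlt c1 C1 :: real and N :: nat and c :: "int => 'a set => 'a" and D :: "int => 'a set set"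
 assumes ds: "dyadic_system M d dlt c1 C1 N c D"
begin

lemma params: "0 < dlt" "dlt < 1" "0 < c1" "c1 <= C1" "0 < C1"
 using ds by (auto simp: dyadic_system_def)

lemma sc_pos: "0 < c1 * dlt powi k" "0 < C1 * dlt powi k"
 using params powi_pos[of dlt k] by auto

lemma D_basic: "countable (D k)" "D k \<subseteq> qborel M d" "disjoint (D k)" "\<Union>(D k) = space M"
 using ds unfolding dyadic_system_def by auto

lemma D_nest: "k <= l ==> Q : D k ==> R : D l ==> R \<subseteq> Q | R \<inter> Q = {}"
 using ds unfolding dyadic_system_def by simp

lemma D_anc: assumes "l <= k" "Q : D k" shows "\<exists>R\<in>D l. Q \<subseteq> R"
proof -
 have "\<exists>!R. R : D l & Q \<subseteq> R" using ds assms unfolding dyadic_system_def by simp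
 from ex1_implies_ex[OF this] show ?thesis by auto
qed

lemma D_child: assumes "Q : D k" shows "\<exists>F\<subseteq>D (k + 1). finite F & Q = \<Union>F"
proof -
 have "\<exists>F\<subseteq>D (k + 1). finite F & card F <= N & Q = \<Union>F" using ds assms unfolding dyadic_system_def by simp
 then show ?thesis by auto
qed

lemma D_ball:
 assumes "Q : D k"
 shows "c k Q : Q" "B (c k Q) (c1 * dlt powi k) \<subseteq> Q" "Q \<subseteq> B (c k Q) (C1 * dlt powi k)"
 using ds assms unfolding dyadic_system_def by simp_all

lemma D_meas: "Q : D k ==> Q : sets M"
 using D_basic(2)[of k] qborel_sets by auto

lemma D_center: assumes "Q : D k" shows "c k Q : space M"
 using D_ball(1)[OF assms] sets.sets_into_space[OF D_meas[OF assms]] by auto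

lemma D_fm: assumes "Q : D k" shows "Q : fmeasurable M"
 by (rule fmeasurableI2[OF B_fmeasurable[OF D_center[OF assms] sc_pos(2)] D_ball(3)[OF assms] D_meas[OF assms]])

lemma D_measure_le: assumes "Q : D k" shows "measure M Q <= measure M (B (c k Q) (C1 * dlt powi k))"
 by (rule measure_B_mono[OF D_center[OF assms] sc_pos(2) D_meas[OF assms] D_ball(3)[OF assms]])

lemma D_inner_le: assumes "Q : D k" shows "measure M (B (c k Q) (c1 * dlt powi k)) <= measure M Q"
 using D_ball(2)[OF assms] D_center[OF assms] sc_pos(1) D_fm[OF assms] qball_sets
 by (intro measure_mono_fmeasurable) auto

lemma D_measure_pos: assumes "Q : D k" shows "0 < measure M Q"
 using measure_B_pos[OF D_center[OF assms] sc_pos(1)] D_inner_le[OF assms] by (rule less_le_trans)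

lemma cube_ball_compare:
 obtains C where "1 <= C" "!!k Q. Q : D k ==> measure M (B (c k Q) (C1 * dlt powi k)) <= C * measure M Q"
proof -
 obtain C where C: "1 <= C" "\<forall>x\<in>space M. \<forall>r>0. measure M (B x (C1 / c1 * r)) <= C * measure M (B x r)"
  using doubling_ratio[of "C1 / c1"] by auto
 show ?thesis
 proof (rule that[OF C(1)])
  fix k Q assume Q: "Q : D k"
  have e: "C1 * dlt powi k = C1 / c1 * (c1 * dlt powi k)" using params by simp
  have "measure M (B (c k Q) (C1 * dlt powi k)) <= C * measure M (B (c k Q) (c1 * dlt powi k))"
   unfolding e by (rule C(2)[rule_format, OF D_center[OF Q] sc_pos(1)[of k]])
  also have "... <= C * measure M Q" using D_inner_le[OF Q] C(1) by (intro mult_left_mono) auto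
  finally show "measure M (B (c k Q) (C1 * dlt powi k)) <= C * measure M Q" .
 qed
qed

lemma cube_parent_compare:
 obtains C where "1 <= C" "!!k Q R. R : D (k + 1) ==> Q : D k ==> R \<subseteq> Q ==> measure M Q <= C * measure M R"
proof -
 define t where "t = A\<^sub>0 * (2 * C1) / (c1 * dlt)"
 obtain C where C: "1 <= C" "!!x y r s. x : space M ==> 0 < r ==> y : space M ==> 0 < s ==> B x r \<subseteq> B y (t * s) ==> measure M (B x r) <= C * measure M (B y s)"
  using doubling_compare[of t] by metis
 show ?thesis
 proof (rule that[OF C(1)])
  fix k Q R assume R: "R : D (k + 1)" and Q: "Q : D k" and RQ: "R \<subseteq> Q"
  let ?x = "c k Q" and ?y = "c (k + 1) R"
  have sp: "?x : space M" "?y : space M" using D_center Q R by auto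
  have "?y : B ?x (C1 * dlt powi k)" using D_ball(1)[OF R] RQ D_ball(3)[OF Q] by auto
  then have dxy: "d ?y ?x < C1 * dlt powi k" using d_sym[OF sp] by (simp add: in_B)
  have "B ?x (C1 * dlt powi k) \<subseteq> B ?y (A\<^sub>0 * (d ?y ?x + C1 * dlt powi k))" by (rule B_subset[OF sp])
  also have "... \<subseteq> B ?y (t * (c1 * dlt powi (k + 1)))"
  proof (rule B_mono)
   have "A\<^sub>0 * (d ?y ?x + C1 * dlt powi k) <= A\<^sub>0 * (C1 * dlt powi k + C1 * dlt powi k)"
    using dxy A0_ge_1 by (intro mult_left_mono) auto
   also have "... = t * (c1 * dlt powi (k + 1))"
    using params by (simp add: t_def power_int_add)
   finally show "A\<^sub>0 * (d ?y ?x + C1 * dlt powi k) <= t * (c1 * dlt powi (k + 1))" .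
  qed
  finally have "measure M (B ?x (C1 * dlt powi k)) <= C * measure M (B ?y (c1 * dlt powi (k + 1)))"
   by (rule C(2)[OF sp(1) sc_pos(2) sp(2) sc_pos(1)])
  also have "... <= C * measure M R" using D_inner_le[OF R] C(1) by (intro mult_left_mono) auto
  finally show "measure M Q <= C * measure M R" using D_measure_le[OF Q] by linarith
 qed
qed

lemma small_cube_in_ball:
 assumes x: "x : space M" and r: "0 < r"
 shows "\<exists>k. \<forall>Q\<in>D k. x : Q --> Q \<subseteq> B x r"
proof -
 have "0 < r / (A\<^sub>0 * (2 * C1))" using r params A0_ge_1 by simp
 then obtain n where n: "dlt powi int n < r / (A\<^sub>0 * (2 * C1))" using powi_small[OF params(1,2)] by blast
 have "A\<^sub>0 * (2 * C1) * dlt powi int n < r" using n params A0_ge_1 by (simp add: field_simps)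
 then have le: "A\<^sub>0 * (C1 * dlt powi int n + C1 * dlt powi int n) <= r" by (simp add: algebra_simps)
 have "Q \<subseteq> B x r" if Q: "Q : D (int n)" "x : Q" for Q
 proof -
  let ?y = "c (int n) Q"
  have y: "?y : space M" using D_center[OF Q(1)] .
  have "x : B ?y (C1 * dlt powi int n)" using D_ball(3)[OF Q(1)] Q(2) by auto
  then have dxy: "d x ?y < C1 * dlt powi int n" using d_sym[OF x y] by (simp add: in_B)
  have "Q \<subseteq> B x (A\<^sub>0 * (d x ?y + C1 * dlt powi int n))"
   using D_ball(3)[OF Q(1)] B_subset[OF y x] by (rule order_trans)
  also have "... \<subseteq> B x r"
  proof (rule B_mono)
   have "A\<^sub>0 * (d x ?y + C1 * dlt powi int n) <= A\<^sub>0 * (C1 * dlt powi int n + C1 * dlt powi int n)"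
    using dxy A0_ge_1 by (intro mult_left_mono) auto
   then show "A\<^sub>0 * (d x ?y + C1 * dlt powi int n) <= r" using le by linarith
  qed
  finally show ?thesis .
 qed
 then show ?thesis by blast
qed

text \<open>
Every open set is the union of the cubes that it contains, as small cubes lie in small balls.
\<close>
lemma qborel_generated: "qborel M d \<subseteq> sigma_sets (space M) (\<Union>k. D k)"
 unfolding qborel_def
proof (rule sigma_sets_mono, rule subsetI)
 fix U assume "U : {U. qopen M d U}"
 then have U: "U \<subseteq> space M" "!!x. x : U ==> \<exists>r>0. B x r \<subseteq> U" by (auto simp: qopen_def)
 have "U = \<Union>{Q : (\<Union>k. D k). Q \<subseteq> U}"
 proof
  show "U \<subseteq> \<Union>{Q : (\<Union>k. D k). Q \<subseteq> U}"
  proof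
   fix x assume x: "x : U"
   then obtain r where r: "0 < r" "B x r \<subseteq> U" using U(2) by blast
   have xs: "x : space M" using x U(1) by auto
   obtain k where k: "\<forall>Q\<in>D k. x : Q --> Q \<subseteq> B x r" using small_cube_in_ball[OF xs r(1)] by blast
   obtain Q where "Q : D k" "x : Q" using D_basic(4)[of k] xs by auto
   moreover from this have "Q \<subseteq> U" using k r(2) by auto
   ultimately show "x : \<Union>{Q : (\<Union>k. D k). Q \<subseteq> U}" by auto
  qed
 qed auto
 moreover have "\<Union>{Q : (\<Union>k. D k). Q \<subseteq> U} : sigma_sets (space M) (\<Union>k. D k)"
 proof (rule sigma_sets_UNION)
  show "countable {Q : (\<Union>k. D k). Q \<subseteq> U}"
   by (rule countable_subset[of _ "\<Union>k. D k"]) (use D_basic(1) in auto)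
  show "Q : sigma_sets (space M) (\<Union>k. D k)" if "Q : {Q : (\<Union>k. D k). Q \<subseteq> U}" for Q
   using that by (auto intro: sigma_sets.Basic)
 qed
 ultimately show "U : sigma_sets (space M) (\<Union>k. D k)" by simp
qed

lemma lattice: "\<exists>Cd. dyadic_lattice M D Cd"
proof -
 obtain C where C: "1 <= C" "!!k Q R. R : D (k + 1) ==> Q : D k ==> R \<subseteq> Q ==> measure M Q <= C * measure M R"
  using cube_parent_compare by metis
 have "dyadic_lattice M D C"
 proof
  fix k l :: int and Q R :: "'a set" and x
  show "countable (D k)" "\<Union>(D k) = space M" using D_basic by auto
  show "D k \<subseteq> sets M" using D_meas by auto
  show "Q : D k ==> R : D k ==> x : Q ==> x : R ==> Q = R"
   using D_basic(3)[of k] unfolding disjoint_def by auto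
  show "k <= l ==> Q : D k ==> R : D l ==> R \<subseteq> Q | R \<inter> Q = {}" by (rule D_nest)
  show "Q : D k ==> 0 < measure M Q" by (rule D_measure_pos)
  show "Q : D k ==> emeasure M Q < \<infinity>" using D_fm by (auto simp: fmeasurable_def)
  show "R : D (k + 1) ==> Q : D k ==> R \<subseteq> Q ==> measure M Q <= C * measure M R" by (rule C(2))
  show "l <= k ==> Q : D k ==> \<exists>R\<in>D l. Q \<subseteq> R" by (rule D_anc)
  show "1 <= C" by (rule C(1))
  show "finite {R : D (k + 1). R \<subseteq> Q}" if Q: "Q : D k"
  proof -
   obtain F where F: "F \<subseteq> D (k + 1)" "finite F" "Q = \<Union>F" using D_child[OF Q] by blast
   have "{R : D (k + 1). R \<subseteq> Q} \<subseteq> F"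
   proof
    fix R assume "R : {R : D (k + 1). R \<subseteq> Q}"
    then have R: "R : D (k + 1)" "R \<subseteq> Q" by auto
    have cR: "c (k + 1) R : R" using D_ball(1)[OF R(1)] .
    then obtain T where T: "T : F" "c (k + 1) R : T" using R F by auto
    have "R \<inter> T ~= {}" using cR T by auto
    then have "R = T" using D_basic(3)[of "k + 1"] T F(1) R(1) unfolding disjoint_def by auto
    then show "R : F" using T by simp
   qed
   then show ?thesis using F(2) by (rule finite_subset)
  qed
  show "\<exists>B\<in>sigma_sets (space M) (\<Union>k. D k). (A - B) \<union> (B - A) : null_sets M" if "A : sets M" for A
   using regular[OF that] qborel_generated by blast
 qed
 then show ?thesis by blast
qed

lemma finite_cubes_meeting_ball:
 assumes x: "x : space M" shows "finite {Q : D k. Q \<inter> B x r ~= {}}"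
proof (cases "0 < r")
 case False
 then have "B x r = {}" using d_nonneg[OF x] by (force simp: in_B)
 then show ?thesis by simp
next
 case True
 let ?R = "C1 * dlt powi k"
 define r1 where "r1 = A\<^sub>0 * (r + ?R)"
 define s where "s = A\<^sub>0 * (r1 + ?R)"
 define t where "t = A\<^sub>0 * (r1 + s) / (c1 * dlt powi k)"
 have r1: "0 < r1" unfolding r1_def using True sc_pos(2)[of k] A0_ge_1 by (intro mult_pos_pos) auto
 have s: "0 < s" unfolding s_def using r1 sc_pos(2)[of k] A0_ge_1 by (intro mult_pos_pos) auto
 obtain C where C: "1 <= C" "!!x y r s. x : space M ==> 0 < r ==> y : space M ==> 0 < s ==> B x r \<subseteq> B y (t * s) ==> measure M (B x r) <= C * measure M (B y s)"
  using doubling_compare[of t] by metis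
 let ?G = "{Q : D k. Q \<inter> B x r ~= {}}"
 have props: "Q \<subseteq> B x s & measure M (B x s) <= C * measure M Q" if Q': "Q : ?G" for Q
 proof -
  have Q: "Q : D k" using Q' by simp
  obtain z where z: "z : Q" "z : B x r" using Q' by auto
  let ?y = "c k Q"
  have y: "?y : space M" using D_center[OF Q] .
  have zs: "z : space M" "d x z < r" using z(2) by (auto simp: in_B)
  have "z : B ?y ?R" using D_ball(3)[OF Q] z(1) by auto
  then have "d z ?y < ?R" using d_sym[OF zs(1) y] by (simp add: in_B)
  then have "A\<^sub>0 * (d x z + d z ?y) <= r1" unfolding r1_def using zs A0_ge_1 by (intro mult_left_mono) auto
  then have dxy: "d x ?y <= r1" using d_triangle[OF x y zs(1)] by linarith
  have "Q \<subseteq> B x (A\<^sub>0 * (d x ?y + ?R))" using D_ball(3)[OF Q] B_subset[OF y x] by (rule order_trans)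
  also have "... \<subseteq> B x s" unfolding s_def using dxy A0_ge_1 by (intro B_mono mult_left_mono) auto
  finally have 1: "Q \<subseteq> B x s" .
  have "B x s \<subseteq> B ?y (A\<^sub>0 * (d ?y x + s))" by (rule B_subset[OF x y])
  also have "... \<subseteq> B ?y (t * (c1 * dlt powi k))"
  proof (rule B_mono)
   have "A\<^sub>0 * (d ?y x + s) <= A\<^sub>0 * (r1 + s)" using dxy d_sym[OF x y] A0_ge_1 by (intro mult_left_mono) auto
   also have "... = t * (c1 * dlt powi k)"
   proof -
    have X: "c1 * dlt powi k ~= 0" using sc_pos(1)[of k] by linarith
    show ?thesis by (rule iffD1[OF nonzero_divide_eq_eq[OF X] t_def[symmetric]])
   qed
   finally show "A\<^sub>0 * (d ?y x + s) <= t * (c1 * dlt powi k)" .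
  qed
  finally have "measure M (B x s) <= C * measure M (B ?y (c1 * dlt powi k))"
   by (rule C(2)[OF x s y sc_pos(1)])
  also have "... <= C * measure M Q" using D_inner_le[OF Q] C(1) by (intro mult_left_mono) auto
  finally show ?thesis using 1 by blast
 qed
 have "finite ?G & real (card ?G) <= C"
 proof (rule finite_card_disjoint_large)
  show "?G \<subseteq> sets M" using D_meas by auto
  show "disjoint ?G" using D_basic(3)[of k] by (auto simp: disjoint_def)
  show "\<Union>?G \<subseteq> B x s" by (rule Union_least) (use props in blast)
  show "B x s : sets M" "emeasure M (B x s) < \<infinity>" "0 < measure M (B x s)"
   using qball_sets[OF x s] finite_qball[OF x s] measure_B_pos[OF x s] by auto
  show "0 < C" using C(1) by simp
  show "measure M (B x s) <= C * measure M Q" if "Q : ?G" for Q using props[OF that] by blast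
 qed
 then show ?thesis by blast
qed

lemma generations_finite:
 assumes "0 < a" shows "finite {k. a <= C1 * dlt powi k & C1 * dlt powi k <= b}"
proof -
 obtain n1 :: nat where n1: "dlt powi int n1 < a / C1" using powi_small[OF params(1,2), of "a / C1"] assms params by auto
 obtain n2 :: nat where n2: "max 1 b / C1 < dlt powi (- int n2)" using powi_large[OF params(1,2), of "max 1 b / C1"] params by auto
 have "{k. a <= C1 * dlt powi k & C1 * dlt powi k <= b} \<subseteq> {- int n2..int n1}"
 proof
  fix k assume "k : {k. a <= C1 * dlt powi k & C1 * dlt powi k <= b}"
  then have k: "a <= C1 * dlt powi k" "C1 * dlt powi k <= b" by auto
  have "k <= int n1"
  proof (rule ccontr)
   assume "~ k <= int n1"
   then have "dlt powi k <= dlt powi int n1" using params by (intro powi_antimono) auto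
   then have "dlt powi k < a / C1" using n1 by linarith
   then show False using k(1) params by (simp add: field_simps)
  qed
  moreover have "- int n2 <= k"
  proof (rule ccontr)
   assume "~ - int n2 <= k"
   then have "dlt powi (- int n2) <= dlt powi k" using params by (intro powi_antimono) auto
   then have "max 1 b / C1 < dlt powi k" using n2 by linarith
   then show False using k(2) params by (simp add: field_simps)
  qed
  ultimately show "k : {- int n2..int n1}" by simp
 qed
 then show ?thesis by (rule finite_subset) simp
qed

end

locale bloom_setting = homogeneous_type M d A\<^sub>0 C\<^sub>\<mu>
 for M :: "'a measure" and d :: "'a => 'a => real" and A\<^sub>0 C\<^sub>\<mu> :: real +
 fixes p :: real and lam1 lam2 \<nu> :: "'a => real"
 assumes p: "1 < p" and lam1: "lam1 : Ap M d p" and lam2: "lam2 : Ap M d p"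
  and nu_def: "\<nu> = (%x. lam1 x powr (1 / p) * lam2 x powr (- 1 / p))"
begin

abbreviation "q \<equiv> p / (p - 1)"
abbreviation "sig1 \<equiv> (%x. lam1 x powr (- 1 / (p - 1)))"
abbreviation "sig2 \<equiv> (%x. lam2 x powr (- 1 / (p - 1)))"

sublocale W: weight_pair M p q lam1 sig1 lam2 sig2 \<nu>
 by unfold_locales (use Ap_dual_w[OF p lam1] Ap_dual_w[OF p lam2] nu_def in auto)

definition Kap :: real where
 "Kap = (SOME A. 0 < A & (\<forall>x\<in>space M. \<forall>r>0. Ap_on M p q lam1 sig1 A (B x r) & Ap_on M p q lam2 sig2 A (B x r)))"

lemma Kap: "0 < Kap" "x : space M ==> 0 < r ==> Ap_on M p q lam1 sig1 Kap (B x r)"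
 "x : space M ==> 0 < r ==> Ap_on M p q lam2 sig2 Kap (B x r)"
proof -
 obtain A where A: "0 < A" "!!x r. x : space M ==> 0 < r ==> Ap_on M p q lam1 sig1 A (B x r)"
  using Ap_on_balls[OF p lam1] by metis
 obtain A' where A': "0 < A'" "!!x r. x : space M ==> 0 < r ==> Ap_on M p q lam2 sig2 A' (B x r)"
  using Ap_on_balls[OF p lam2] by metis
 have up: "Ap_on M p q w s (max A A') Q" if "Ap_on M p q w s a Q" "a <= max A A'" for w s a Q
 proof -
  have "a * measure M Q <= max A A' * measure M Q" using that by (intro mult_right_mono) auto
  then show ?thesis using that unfolding Ap_on_def by linarith
 qed
 have "\<exists>A. 0 < A & (\<forall>x\<in>space M. \<forall>r>0. Ap_on M p q lam1 sig1 A (B x r) & Ap_on M p q lam2 sig2 A (B x r))"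
 proof (intro exI[of _ "max A A'"] conjI ballI allI impI)
  show "0 < max A A'" using A(1) by simp
  show "Ap_on M p q lam1 sig1 (max A A') (B x r)" if "x : space M" "0 < r" for x r
   by (rule up[OF A(2)[OF that]]) simp
  show "Ap_on M p q lam2 sig2 (max A A') (B x r)" if "x : space M" "0 < r" for x r
   by (rule up[OF A'(2)[OF that]]) simp
 qed
 from someI_ex[OF this] show "0 < Kap" "x : space M ==> 0 < r ==> Ap_on M p q lam1 sig1 Kap (B x r)"
  "x : space M ==> 0 < r ==> Ap_on M p q lam2 sig2 Kap (B x r)"
  unfolding Kap_def by simp_all
qed

end

locale bloom_dyadic = bloom_setting M d A\<^sub>0 C\<^sub>\<mu> p lam1 lam2 \<nu> + dyadic_space M d A\<^sub>0 C\<^sub>\<mu> dlt c1 C1 N c D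
 for M :: "'a measure" and d A\<^sub>0 C\<^sub>\<mu> p lam1 lam2 \<nu> dlt c1 C1 N c D
begin

definition Ccb :: real where
 "Ccb = (SOME C. 1 <= C & (\<forall>k. \<forall>Q\<in>D k. measure M (B (c k Q) (C1 * dlt powi k)) <= C * measure M Q))"

lemma Ccb: "1 <= Ccb" "Q : D k ==> measure M (B (c k Q) (C1 * dlt powi k)) <= Ccb * measure M Q"
proof -
 obtain C where "1 <= C" "!!k Q. Q : D k ==> measure M (B (c k Q) (C1 * dlt powi k)) <= C * measure M Q"
  using cube_ball_compare by metis
 then have "\<exists>C. 1 <= C & (\<forall>k. \<forall>Q\<in>D k. measure M (B (c k Q) (C1 * dlt powi k)) <= C * measure M Q)" by blast
 from someI_ex[OF this] show "1 <= Ccb" "Q : D k ==> measure M (B (c k Q) (C1 * dlt powi k)) <= Ccb * measure M Q"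
  unfolding Ccb_def by simp_all
qed

definition Cd :: real where "Cd = (SOME C. dyadic_lattice M D C)"

sublocale L: dyadic_lattice M D Cd
 unfolding Cd_def using lattice by (rule someI_ex)

lemma Ap_on_cube:
 assumes "Q : D k"
 shows "Ap_on M p q lam1 sig1 (Kap * Ccb) Q" "Ap_on M p q lam2 sig2 (Kap * Ccb) Q"
 using Ap_on_subset[OF W.dw1 Kap(2)[OF D_center[OF assms] sc_pos(2)] D_meas[OF assms] D_ball(3)[OF assms] D_measure_pos[OF assms] _ Ccb(2)[OF assms]]
  Ap_on_subset[OF W.dw2 Kap(3)[OF D_center[OF assms] sc_pos(2)] D_meas[OF assms] D_ball(3)[OF assms] D_measure_pos[OF assms] _ Ccb(2)[OF assms]]
  Kap(1) by auto

lemma KC_pos: "0 < Kap * Ccb" using Kap(1) Ccb(1) by simp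

lemma muck1: "L.muck p q lam1 sig1 (Kap * Ccb)" and muck2: "L.muck p q lam2 sig2 (Kap * Ccb)"
proof -
 show "L.muck p q lam1 sig1 (Kap * Ccb)"
  unfolding L.muck_def L.cubes_def using W.dw1 KC_pos Ap_on_cube(1) by (auto simp: Ap_on_def)
 show "L.muck p q lam2 sig2 (Kap * Ccb)"
  unfolding L.muck_def L.cubes_def using W.dw2 KC_pos Ap_on_cube(2) by (auto simp: Ap_on_def)
qed

lemma nu_int: "Q : L.cubes ==> set_integrable M Q \<nu>"
 using Ap_on_cube unfolding L.cubes_def by (auto simp: Ap_on_def intro!: W.nu_upper(1))

lemma nu_pos: "Q : D k ==> 0 < Iset M \<nu> Q"
 using W.nu_lower(2)[OF Ap_on_cube KC_pos KC_pos] .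

definition Kosc :: real where "Kosc = 2 * ((Kap * Ccb)\<^sup>2 * (Kap * Ccb)\<^sup>2)"

lemma Kosc_pos: "0 < Kosc"
 unfolding Kosc_def using Kap(1) Ccb(1) by (intro mult_pos_pos zero_less_power) auto

lemma local_int:
 fixes b :: "'a => 'b::{banach, second_countable_topology}"
 assumes b: "b : L1_loc M d" and Q: "Q : D k" shows "set_integrable M Q b"
proof -
 have "set_integrable M (B (c k Q) (C1 * dlt powi k)) b"
  using b D_center[OF Q] sc_pos(2)[of k] by (auto simp: L1_loc_def)
 then show ?thesis using D_meas[OF Q] D_ball(3)[OF Q] by (rule set_integrable_subset)
qed

lemma osc_cube_le:
 fixes b :: "'a => 'b::{banach, second_countable_topology}"
 assumes b: "b : L1_loc M d" and Q: "Q : D k"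
 shows "osc M \<nu> b Q <= Kosc * osc M \<nu> b (B (c k Q) (C1 * dlt powi k))"
proof -
 have "set_integrable M (B (c k Q) (C1 * dlt powi k)) b"
  using b D_center[OF Q] sc_pos(2)[of k] by (auto simp: L1_loc_def)
 from W.osc_le[OF Kap(2,3)[OF D_center[OF Q] sc_pos(2)] D_meas[OF Q] D_ball(3)[OF Q] D_measure_pos[OF Q] Kap(1) Kap(1) Ccb(1) Ccb(2)[OF Q] this]
 show ?thesis unfolding Kosc_def .
qed

lemma mo_osc:
 fixes b :: "'a => 'b::{banach, second_countable_topology}"
 assumes Q: "Q : D k"
 shows "L.mo b Q = osc M \<nu> b Q * Iset M \<nu> Q / measure M Q"
 using nu_pos[OF Q] D_measure_pos[OF Q] by (simp add: L.mo_def avg_def osc_def)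

end

section \<open>Vanishing mean oscillation implies compactness\<close>

context homogeneous_type
begin

lemma osc_nonneg:
 fixes b :: "'a => 'b::{banach, second_countable_topology}"
 assumes "0 <= Iset M \<nu> Q" shows "0 <= osc M \<nu> b Q"
 unfolding osc_def using assms
 by (intro mult_nonneg_nonneg) (auto simp: set_lebesgue_integral_def intro!: integral_nonneg_AE)

lemma BMO_bound:
 fixes b :: "'a => 'b::{banach, second_countable_topology}"
 assumes "b : BMO M d \<nu>"
 obtains C where "0 <= C" "!!x r. x : space M ==> 0 < r ==> osc M \<nu> b (B x r) <= C"
proof -
 obtain C where C: "\<forall>y\<in>{osc M \<nu> b (B x r) | x r. x : space M & 0 < r}. y <= C"
  using assms unfolding BMO_def bdd_above_def by auto
 have "osc M \<nu> b (B x r) <= max 0 C" if "x : space M" "0 < r" for x r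
 proof -
  have "osc M \<nu> b (B x r) : {osc M \<nu> b (B x r) | x r. x : space M & 0 < r}" using that by blast
  then have "osc M \<nu> b (B x r) <= C" using C by blast
  then show ?thesis by simp
 qed
 then show ?thesis using that[of "max 0 C"] by simp
qed

lemma VMO_bounds:
 fixes b :: "'a => 'b::{banach, second_countable_topology}"
 assumes b: "b : VMO M d x\<^sub>0 \<nu>" and e: "0 < eps" and nu: "!!x. 0 <= \<nu> x"
 obtains a0 a1 a2 where "0 < a0" "!!x r. x : space M ==> 0 < r ==> r < a0 ==> osc M \<nu> b (B x r) < eps"
  "!!x r. x : space M ==> 0 < r ==> a1 < r ==> osc M \<nu> b (B x r) < eps"
  "!!x r. x : space M ==> 0 < r ==> a2 < (INF y\<in>B x r. d y x\<^sub>0) ==> osc M \<nu> b (B x r) < eps"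
proof -
 have bB: "b : BMO M d \<nu>" using b by (simp add: VMO_def)
 obtain C where C: "0 <= C" "!!x r. x : space M ==> 0 < r ==> osc M \<nu> b (B x r) <= C"
  using BMO_bound[OF bB] by metis
 let ?s = "%a. SUP x\<in>space M. osc M \<nu> b (B x a)"
 have up: "osc M \<nu> b (B x a) <= ?s a" if "x : space M" "0 < a" for x a
  using that C(2) by (intro cSUP_upper bdd_aboveI[of _ C]) auto
 have "(?s \<longlongrightarrow> 0) (at_right 0)" using b by (simp add: VMO_def)
 then have "\<forall>\<^sub>F a in at_right 0. ?s a < eps" using e by (rule order_tendstoD(2))
 then obtain a0 where a0: "0 < a0" "!!a. 0 < a ==> a < a0 ==> ?s a < eps"
  unfolding eventually_at_right_field by auto
 have "(?s \<longlongrightarrow> 0) at_top" using b by (simp add: VMO_def)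
 then have "\<forall>\<^sub>F a in at_top. ?s a < eps" using e by (rule order_tendstoD(2))
 then obtain a1 where a1: "!!a. a1 <= a ==> ?s a < eps" unfolding eventually_at_top_linorder by auto
 let ?A = "%a. {(x, r). x : space M & 0 < r & a < (INF y\<in>B x r. d y x\<^sub>0)}"
 let ?t = "%a. SUP (x, r)\<in>?A a. osc M \<nu> b (B x r)"
 have "(?t \<longlongrightarrow> 0) at_top" using b by (simp add: VMO_def)
 then have "\<forall>\<^sub>F a in at_top. ?t a < eps" using e by (rule order_tendstoD(2))
 then obtain a2 where a2: "?t a2 < eps" unfolding eventually_at_top_linorder by auto
 have up2: "osc M \<nu> b (B x r) <= ?t a2" if "x : space M" "0 < r" "a2 < (INF y\<in>B x r. d y x\<^sub>0)" for x r
 proof -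
  have "(case (x, r) of (x, r) => osc M \<nu> b (B x r)) <= ?t a2"
   using that C(2) by (intro cSUP_upper bdd_aboveI[of _ C]) auto
  then show ?thesis by simp
 qed
 show ?thesis
 proof (rule that[of a0 a1 a2])
  show "0 < a0" by (rule a0(1))
  show "osc M \<nu> b (B x r) < eps" if "x : space M" "0 < r" "r < a0" for x r
   using up[OF that(1,2)] a0(2)[OF that(2,3)] by (rule le_less_trans)
  show "osc M \<nu> b (B x r) < eps" if "x : space M" "0 < r" "a1 < r" for x r
   using up[OF that(1,2)] a1[OF less_imp_le[OF that(3)]] by (rule le_less_trans)
  show "osc M \<nu> b (B x r) < eps" if "x : space M" "0 < r" "a2 < (INF y\<in>B x r. d y x\<^sub>0)" for x r
   using up2[OF that] a2 by (rule le_less_trans)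
 qed
qed

end

lemma norm_avg_le:
 fixes f :: "'a => 'b::{banach, second_countable_topology}"
 shows "norm (avg M Q f) <= Iset M (%x. norm (f x)) Q / measure M Q"
proof -
 have "norm (LINT x:Q|M. f x) <= (LINT x|M. norm (indicator Q x *\<^sub>R f x))"
  unfolding set_lebesgue_integral_def by (rule integral_norm_bound)
 also have "... = Iset M (%x. norm (f x)) Q" unfolding set_lebesgue_integral_def
  by (intro Bochner_Integration.integral_cong) auto
 finally show ?thesis by (simp add: avg_def divide_right_mono)
qed

context bloom_dyadic
begin

lemma cubes_level: "Q : L.cubes ==> \<exists>k. Q : D k" by (auto simp: L.cubes_def)

lemma osc_cube_bounded:
 fixes b :: "'a => 'b::{banach, second_countable_topology}"
 assumes "b : BMO M d \<nu>"
 obtains C where "0 <= C" "!!Q. Q : L.cubes ==> osc M \<nu> b Q <= C"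
proof -
 obtain C where C: "0 <= C" "!!x r. x : space M ==> 0 < r ==> osc M \<nu> b (B x r) <= C"
  using BMO_bound[OF assms] by metis
 have bl: "b : L1_loc M d" using assms by (simp add: BMO_def)
 have "osc M \<nu> b Q <= Kosc * C" if "Q : L.cubes" for Q
 proof -
  obtain k where Q: "Q : D k" using cubes_level[OF \<open>Q : L.cubes\<close>] by blast
  have "osc M \<nu> b Q <= Kosc * osc M \<nu> b (B (c k Q) (C1 * dlt powi k))" by (rule osc_cube_le[OF bl Q])
  also have "... <= Kosc * C" using C(2)[OF D_center[OF Q] sc_pos(2)] Kosc_pos by (intro mult_left_mono) auto
  finally show ?thesis .
 qed
 then show ?thesis using that[of "Kosc * C"] C(1) Kosc_pos by simp
qed

text \<open>
A cube is comparable to its ball, whose oscillation is small when the ball is small, large or far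
away. The remaining cubes have bounded generation and meet a fixed ball.
\<close>
lemma finite_large_osc:
 fixes b :: "'a => 'b::{banach, second_countable_topology}"
 assumes b: "b : VMO M d x\<^sub>0 \<nu>" and x0: "x\<^sub>0 : space M" and e: "0 < eps"
 shows "finite {Q : L.cubes. eps < osc M \<nu> b Q}"
proof -
 have bl: "b : L1_loc M d" using b by (simp add: VMO_def BMO_def)
 have e': "0 < eps / Kosc" using e Kosc_pos by simp
 obtain a0 a1 a2 where a: "0 < a0" "!!x r. x : space M ==> 0 < r ==> r < a0 ==> osc M \<nu> b (B x r) < eps / Kosc"
  "!!x r. x : space M ==> 0 < r ==> a1 < r ==> osc M \<nu> b (B x r) < eps / Kosc"
  "!!x r. x : space M ==> 0 < r ==> a2 < (INF y\<in>B x r. d y x\<^sub>0) ==> osc M \<nu> b (B x r) < eps / Kosc"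
 proof (rule VMO_bounds[OF b e' W.nu_nonneg])
  fix a0 a1 a2 :: real
  assume h: "0 < a0"
   and h0: "!!x r. x : space M ==> 0 < r ==> r < a0 ==> osc M \<nu> b (B x r) < eps / Kosc"
   and h1: "!!x r. x : space M ==> 0 < r ==> a1 < r ==> osc M \<nu> b (B x r) < eps / Kosc"
   and h2: "!!x r. x : space M ==> 0 < r ==> a2 < (INF y\<in>B x r. d y x\<^sub>0) ==> osc M \<nu> b (B x r) < eps / Kosc"
  show ?thesis by (rule that[OF h h0 h1 h2])
 qed
 define R where "R = A\<^sub>0 * (\<bar>a2\<bar> + 1 + \<bar>a1\<bar>) + 1"
 let ?gen = "{k. a0 <= C1 * dlt powi k & C1 * dlt powi k <= a1}"
 have "{Q : L.cubes. eps < osc M \<nu> b Q} \<subseteq> (\<Union>k\<in>?gen. {Q : D k. Q \<inter> B x\<^sub>0 R ~= {}})"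
 proof
  fix Q assume Q': "Q : {Q : L.cubes. eps < osc M \<nu> b Q}"
  then obtain k where Q: "Q : D k" using cubes_level[of Q] by auto
  let ?y = "c k Q" and ?r = "C1 * dlt powi k"
  have y: "?y : space M" using D_center[OF Q] .
  have "eps < Kosc * osc M \<nu> b (B ?y ?r)" using osc_cube_le[OF bl Q] Q' by simp
  then have big: "~ osc M \<nu> b (B ?y ?r) < eps / Kosc" using Kosc_pos by (simp add: field_simps)
  have 1: "a0 <= ?r" using a(2)[OF y sc_pos(2)] big by (meson not_le)
  have 2: "?r <= a1" using a(3)[OF y sc_pos(2)] big by (meson not_le)
  have "~ a2 < (INF z\<in>B ?y ?r. d z x\<^sub>0)" using a(4)[OF y sc_pos(2)] big by blast
  then have "(INF z\<in>B ?y ?r. d z x\<^sub>0) < a2 + 1" by simp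
  moreover have "bdd_below ((%z. d z x\<^sub>0) ` B ?y ?r)"
   using d_nonneg[OF _ x0] by (intro bdd_belowI[of _ 0]) (auto simp: in_B)
  ultimately obtain z where z: "z : B ?y ?r" "d z x\<^sub>0 < a2 + 1"
   using cINF_less_iff[of "B ?y ?r" "%z. d z x\<^sub>0"] center_in_B[OF y sc_pos(2)[of k]] by blast
  have zs: "z : space M" using z(1) by (simp add: in_B)
  have "d x\<^sub>0 ?y <= A\<^sub>0 * (d x\<^sub>0 z + d z ?y)" by (rule d_triangle[OF x0 y zs])
  also have "... <= A\<^sub>0 * (\<bar>a2\<bar> + 1 + \<bar>a1\<bar>)"
   using z d_sym[OF x0 zs] d_sym[OF zs y] 2 A0_ge_1 by (intro mult_left_mono) (auto simp: in_B)
  finally have "?y : B x\<^sub>0 R" using y by (simp add: in_B R_def)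
  then have "Q \<inter> B x\<^sub>0 R ~= {}" using D_ball(1)[OF Q] by blast
  then show "Q : (\<Union>k\<in>?gen. {Q : D k. Q \<inter> B x\<^sub>0 R ~= {}})" using Q 1 2 by auto
 qed
 moreover have "finite (\<Union>k\<in>?gen. {Q : D k. Q \<inter> B x\<^sub>0 R ~= {}})"
  by (intro finite_UN_I generations_finite[OF a(1)] finite_cubes_meeting_ball[OF x0])
 ultimately show ?thesis by (rule finite_subset)
qed

abbreviation dv :: "('a => 'b::{banach, second_countable_topology}) => 'a set => 'a => real" where
 "dv b Q x \<equiv> norm (b x - avg M Q b) * indicator Q x"

abbreviation av :: "('a => real) => 'a set => real" where "av f Q \<equiv> Iset M f Q / measure M Q"

definition Kmain :: "real => nat => real" where
 "Kmain \<eta> K = 16 * Cd * (Csp p q (Kap * Ccb) \<eta> K * Csp q p (Kap * Ccb) (\<eta>/4) (K + 1))"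

lemma q_gt_1: "1 < q" using p by (simp add: field_simps)

lemma Kmain_nonneg: "0 < \<eta> ==> 0 <= Kmain \<eta> K"
 unfolding Kmain_def using L.Cd_ge_1 p q_gt_1 KC_pos
 by (intro mult_nonneg_nonneg L.Csp_nonneg) auto

lemma mo_le_of_osc:
 fixes b :: "'a => 'b::{banach, second_countable_topology}"
 assumes Q: "Q : L.cubes" and "osc M \<nu> b Q <= eps"
 shows "L.mo b Q <= eps * Iset M \<nu> Q / measure M Q"
proof -
 obtain k where k: "Q : D k" using cubes_level[OF Q] by blast
 have "osc M \<nu> b Q * Iset M \<nu> Q / measure M Q <= eps * Iset M \<nu> Q / measure M Q"
  using assms nu_pos[OF k] by (intro divide_right_mono mult_right_mono) auto
 then show ?thesis using mo_osc[OF k, of b] by simp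
qed

lemma local_int_cubes:
 fixes b :: "'a => 'b::{banach, second_countable_topology}"
 assumes "b : L1_loc M d" "Q : L.cubes" shows "set_integrable M Q b"
proof -
 obtain k where "Q : D k" using cubes_level[OF assms(2)] by auto
 then show ?thesis by (rule local_int[OF assms(1)])
qed

lemma main_bound:
 fixes b :: "'a => 'b::{banach, second_countable_topology}"
 assumes bl: "b : L1_loc M d" and S: "finite S" "L.sparse S Es \<eta> K"
  and f: "WL M p lam1 f F" and f0: "!!x. x : space M ==> 0 <= f x"
  and eps: "0 <= eps" and Bad: "finite Bad" "Bad \<subseteq> L.cubes" "!!Q. Q : L.cubes - Bad ==> osc M \<nu> b Q <= eps"
  and t: "0 <= t" "!!R. R : Bad ==> (\<Sum>Q\<in>{Q\<in>S. R \<subseteq> Q}. av f Q) <= t"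
  and Cb: "WL M p lam2 (L.step_fun Bad (L.mo b)) Cb"
 shows "WL M p lam2 (%x. \<Sum>Q\<in>S. av f Q * dv b Q x) (eps * Kmain \<eta> K * F + 16 * Cd * (t * Cb))"
proof -
 have "WL M p lam2 (%x. \<Sum>Q\<in>S. av f Q * dv b Q x)
  (16 * Cd * (eps * (Csp p q (Kap * Ccb) \<eta> K * F * Csp q p (Kap * Ccb) (\<eta>/4) (K + 1)) + t * Cb))"
 proof (rule L.bloom_main[OF muck1 muck2 W.nu_meas W.nu_nonneg nu_int W.nu_rel measurable_of_local[OF bl] _ S f f0 eps Bad(1,2) _ t Cb])
  show "set_integrable M Q b" if "Q : L.cubes" for Q using local_int_cubes[OF bl that] .
  show "L.mo b Q <= eps * Iset M \<nu> Q / measure M Q" if "Q : L.cubes - Bad" for Q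
   using that Bad(3) by (intro mo_le_of_osc) auto
 qed
 moreover have "16 * Cd * (eps * (Csp p q (Kap * Ccb) \<eta> K * F * Csp q p (Kap * Ccb) (\<eta>/4) (K + 1)) + t * Cb)
   = eps * Kmain \<eta> K * F + 16 * Cd * (t * Cb)" by (simp add: Kmain_def algebra_simps)
 ultimately show ?thesis by simp
qed

lemma uniform_bound:
 fixes b :: "'a => 'b::{banach, second_countable_topology}"
 assumes bl: "b : L1_loc M d" and S: "finite S" "L.sparse S Es \<eta> K"
  and f: "WL M p lam1 f F" and f0: "!!x. x : space M ==> 0 <= f x"
  and C: "0 <= C" "!!Q. Q : L.cubes ==> osc M \<nu> b Q <= C"
 shows "WL M p lam2 (%x. \<Sum>Q\<in>S. av f Q * dv b Q x) (C * Kmain \<eta> K * F)"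
proof -
 have z: "WL M p lam2 (L.step_fun {} (L.mo b)) 0" using p by (simp add: WL_def L.step_fun_def[abs_def])
 show ?thesis using main_bound[OF bl S f f0 C(1) _ _ C(2) order_refl _ z] by auto
qed

lemma sparse_single: assumes "Q : L.cubes" shows "L.sparse {Q} (%Q. Q) 1 1"
proof -
 have "card {R : {Q}. x : R} <= 1" for x
 proof -
  have "{R : {Q}. x : R} \<subseteq> {Q}" by auto
  from card_mono[OF _ this] show ?thesis by simp
 qed
 then show ?thesis unfolding L.sparse_def using assms L.cubes_sets[OF assms] by simp
qed

text \<open>
Apply the operator bound to the sparse family that consists of $Q$ alone and to the indicator of
$Q$.
\<close>
lemma John_Nirenberg:
 fixes b :: "'a => 'b::{banach, second_countable_topology}"
 assumes bl: "b : L1_loc M d" and C: "0 <= C" "!!Q. Q : L.cubes ==> osc M \<nu> b Q <= C" and Q: "Q : L.cubes"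
 shows "WL M p lam2 (dv b Q) (C * Kmain 1 1 * Iset M lam1 Q powr (1/p))"
proof -
 have f: "WL M p lam1 (indicator Q) (Iset M lam1 Q powr (1/p))"
  using L.muckD(10)[OF muck1 Q] W.w_nonneg(1) L.cubes_sets[OF Q] p by (intro WL_indicator) auto
 have "av (indicator Q) Q = 1"
 proof -
  have "Iset M (indicator Q) Q = measure M Q"
   using L.cubes_sets[OF Q] unfolding set_lebesgue_integral_def by (simp add: indicator_inter_arith[symmetric])
  then show ?thesis using L.cubes_pos[OF Q] by simp
 qed
 note av1 = this
 have sg: "(\<Sum>R\<in>{Q}. g R) = g Q" for g :: "'a set => real" by simp
 have "WL M p lam2 (%x. \<Sum>R\<in>{Q}. av (indicator Q) R * dv b R x) (C * Kmain 1 1 * Iset M lam1 Q powr (1/p))"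
  by (rule uniform_bound[OF bl _ sparse_single[OF Q] f _ C]) auto
 then show ?thesis by (simp only: sg av1 mult_1)
qed

lemma finite_sum_dv:
 fixes b :: "'a => 'b::{banach, second_countable_topology}"
 assumes bl: "b : L1_loc M d" and C: "0 <= C" "!!Q. Q : L.cubes ==> osc M \<nu> b Q <= C" and F: "finite F" "F \<subseteq> L.cubes"
 shows "\<exists>C'. WL M p lam2 (%x. \<Sum>Q\<in>F. dv b Q x) C'"
 using F
proof (induction F rule: finite_induct)
 case empty
 then show ?case using p by (intro exI[of _ 0]) (simp add: WL_def)
next
 case (insert Q F)
 then obtain C' where C': "WL M p lam2 (%x. \<Sum>Q\<in>F. dv b Q x) C'" by auto
 have Q: "Q : L.cubes" using insert by auto
 have "WL M p lam2 (%x. dv b Q x + (\<Sum>Q\<in>F. dv b Q x)) (4 * (C * Kmain 1 1 * Iset M lam1 Q powr (1/p) + C'))"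
  using p W.w_nonneg(2) by (intro WL_add[OF John_Nirenberg[OF bl C Q] C']) auto
 moreover have "(%x. \<Sum>R\<in>insert Q F. dv b R x) = (%x. dv b Q x + (\<Sum>R\<in>F. dv b R x))"
  by (rule ext) (rule sum.insert[OF insert.hyps(1,2)])
 ultimately show ?case by (intro exI) (simp only:)
qed

text \<open>
Cubes with oscillation above a fraction of $\varepsilon$ are finite in number and are put into
\<open>Bad\<close>.
\<close>
lemma tail_bound:
 fixes b :: "'a => 'b::{banach, second_countable_topology}"
 assumes bl: "b : L1_loc M d" and S: "L.sparse S Es \<eta> K"
  and fin: "\<forall>eps>0. finite {Q : L.cubes. eps < osc M \<nu> b Q}" and e: "0 < eps"
 shows "\<exists>F. finite F & F \<subseteq> S & (\<forall>G f A. finite G --> G \<subseteq> S - F --> WL M p lam1 f A --> (\<forall>x\<in>space M. 0 <= f x) -->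
   WL M p lam2 (%x. \<Sum>Q\<in>G. av f Q * dv b Q x) (eps * A))"
proof -
 have \<eta>: "0 < \<eta>" using S by (simp add: L.sparse_def)
 define eps1 where "eps1 = eps / (2 * (Kmain \<eta> K + 1))"
 have e1: "0 < eps1" using e Kmain_nonneg[OF \<eta>, of K] by (simp add: eps1_def)
 let ?Bad = "{Q : L.cubes. eps1 < osc M \<nu> b Q}"
 have Bad: "finite ?Bad" "?Bad \<subseteq> L.cubes" "!!Q. Q : L.cubes - ?Bad ==> osc M \<nu> b Q <= eps1"
  using fin e1 by auto
 obtain Cb where Cb: "WL M p lam2 (L.step_fun ?Bad (L.mo b)) Cb"
  using L.step_fun_WL_ex[OF muck2 Bad(1,2)] by blast
 have Cb0: "0 <= Cb" using Cb by (simp add: WL_def)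
 define \<tau> where "\<tau> = eps / (2 * (16 * Cd * (Cb + 1)))"
 have tau: "0 < \<tau>" using e L.Cd_ge_1 Cb0 by (simp add: \<tau>_def)
 obtain F where F: "finite F" "F \<subseteq> S" and Ft: "\<forall>G R. finite G --> G \<subseteq> S - F --> R : ?Bad -->
   (\<Sum>Q\<in>{Q\<in>G. R \<subseteq> Q}. Iset M sig1 Q powr (1/q) / measure M Q) <= \<tau>"
  using L.tail_small[OF muck1 S Bad(1,2) tau] by (elim exE conjE)
 have "WL M p lam2 (%x. \<Sum>Q\<in>G. av f Q * dv b Q x) (eps * A)"
  if G: "finite G" "G \<subseteq> S - F" and f: "WL M p lam1 f A" and f0: "\<forall>x\<in>space M. 0 <= f x" for G f A
 proof -
  have A0: "0 <= A" using f by (simp add: WL_def)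
  have GS: "G \<subseteq> S" using G by auto
  have SG: "L.sparse G Es \<eta> K" by (rule L.sparse_subset[OF S GS])
  have Gc: "Q : L.cubes" if "Q : G" for Q using SG that by (auto simp: L.sparse_def)
  have avle: "av f Q <= A * (Iset M sig1 Q powr (1/q) / measure M Q)" if Q: "Q : G" for Q
  proof -
   note wi = L.WL_cube_integrable[OF muck1 f Gc[OF Q]]
   have "Iset M f Q <= (LINT x:Q|M. \<bar>f x\<bar>)"
    using wi(1) by (intro set_integral_mono set_integrable_abs) auto
   then have "Iset M f Q <= A * Iset M sig1 Q powr (1/q)" using wi(2) by linarith
   then show ?thesis using L.cubes_pos[OF Gc[OF Q]] by (simp add: divide_right_mono)
  qed
  have "WL M p lam2 (%x. \<Sum>Q\<in>G. av f Q * dv b Q x) (eps1 * Kmain \<eta> K * A + 16 * Cd * ((\<tau> * A) * Cb))"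
  proof (rule main_bound[OF bl G(1) SG f _ _ Bad _ _ Cb])
   fix R assume R: "R : ?Bad"
   have "(\<Sum>Q\<in>{Q\<in>G. R \<subseteq> Q}. av f Q) <= (\<Sum>Q\<in>{Q\<in>G. R \<subseteq> Q}. A * (Iset M sig1 Q powr (1/q) / measure M Q))"
    by (rule sum_mono) (use avle in auto)
   also have "... = A * (\<Sum>Q\<in>{Q\<in>G. R \<subseteq> Q}. Iset M sig1 Q powr (1/q) / measure M Q)" by (simp add: sum_distrib_left)
   also have "... <= A * \<tau>" using Ft[rule_format, OF G R] A0 by (rule mult_left_mono)
   finally show "(\<Sum>Q\<in>{Q\<in>G. R \<subseteq> Q}. av f Q) <= \<tau> * A" by (simp add: mult.commute)
  qed (use f0 e1 tau A0 in auto)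
  then show ?thesis
  proof (rule WL_le)
   have "eps1 * Kmain \<eta> K <= eps / 2"
    using e Kmain_nonneg[OF \<eta>, of K] by (simp add: eps1_def field_simps)
   then have 1: "eps1 * Kmain \<eta> K * A <= eps / 2 * A" using A0 by (rule mult_right_mono)
   have "16 * Cd * (\<tau> * Cb) <= eps / 2"
   proof -
    have "16 * Cd * (\<tau> * Cb) = eps / 2 * (Cb / (Cb + 1))"
    proof -
     have gen: "X * (e / (2 * (X * Y)) * z) = e / 2 * (z / Y)" if "0 < X" "0 < Y" for X Y e z :: real
      using that by (simp add: field_simps)
     show ?thesis unfolding \<tau>_def using L.Cd_ge_1 Cb0 by (intro gen) auto
    qed
    also have "... <= eps / 2 * 1" using e Cb0 by (intro mult_left_mono) auto
    finally show ?thesis by simp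
   qed
   then have "16 * Cd * (\<tau> * Cb) * A <= eps / 2 * A" using A0 by (rule mult_right_mono)
   then have 2: "16 * Cd * ((\<tau> * A) * Cb) <= eps / 2 * A" by (simp add: mult_ac)
   have "eps / 2 * A + eps / 2 * A = eps * A" by simp
   then show "eps1 * Kmain \<eta> K * A + 16 * Cd * ((\<tau> * A) * Cb) <= eps * A" using 1 2 by linarith
  qed (use p in auto)
 qed
 then show ?thesis using F by (intro exI[of _ F]) simp
qed

lemma Lp_norm_WL: "f : Lp M p lam1 ==> WL M p lam1 (%x. norm (f x)) (Lp_norm M p lam1 f)"
 for f :: "'a => 'b::{banach, second_countable_topology}"
 by (rule Lp_WL[OF W.meas(1) W.w_nonneg(1) p])

lemma dv_meas:
 fixes b :: "'a => 'b::{banach, second_countable_topology}"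
 assumes bl: "b : L1_loc M d" and Q: "Q : L.cubes" shows "dv b Q : borel_measurable M"
proof -
 have [measurable]: "b : borel_measurable M" "Q : sets M" using measurable_of_local[OF bl] L.cubes_sets[OF Q] by auto
 show ?thesis by measurable
qed

lemma dv_avg_le:
 fixes b :: "'a => 'b::{banach, second_countable_topology}" and f :: "'a => 'c::{banach, second_countable_topology}"
 assumes bl: "b : L1_loc M d" and G: "finite G" "G \<subseteq> L.cubes"
  and WLb: "WL M p lam2 (%x. \<Sum>Q\<in>G. av (%x. norm (f x)) Q * dv b Q x) C"
 shows "WL M p lam2 (%x. \<Sum>Q\<in>G. dv b Q x * norm (avg M Q f)) C"
proof (rule WL_mono[OF WLb _ _ W.w_nonneg(2)])
 show "(%x. \<Sum>Q\<in>G. dv b Q x * norm (avg M Q f)) : borel_measurable M"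
 proof (intro borel_measurable_sum)
  fix Q assume "Q : G"
  then have [measurable]: "dv b Q : borel_measurable M" using dv_meas[OF bl] G by auto
  show "(%x. dv b Q x * norm (avg M Q f)) : borel_measurable M" by measurable
 qed
 show "AE x in M. \<bar>\<Sum>Q\<in>G. dv b Q x * norm (avg M Q f)\<bar> <= \<bar>\<Sum>Q\<in>G. av (%x. norm (f x)) Q * dv b Q x\<bar>"
 proof (intro AE_I2)
  fix x
  have "(\<Sum>Q\<in>G. dv b Q x * norm (avg M Q f)) <= (\<Sum>Q\<in>G. av (%x. norm (f x)) Q * dv b Q x)"
  proof (rule sum_mono)
   fix Q
   have "dv b Q x * norm (avg M Q f) <= dv b Q x * av (%x. norm (f x)) Q"
    by (intro mult_left_mono norm_avg_le) auto
   then show "dv b Q x * norm (avg M Q f) <= av (%x. norm (f x)) Q * dv b Q x" by (simp only: mult.commute)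
  qed
  moreover have "0 <= (\<Sum>Q\<in>G. dv b Q x * norm (avg M Q f))" by (intro sum_nonneg) auto
  ultimately show "\<bar>\<Sum>Q\<in>G. dv b Q x * norm (avg M Q f)\<bar> <= \<bar>\<Sum>Q\<in>G. av (%x. norm (f x)) Q * dv b Q x\<bar>" by simp
 qed
qed (use p in auto)

theorem VMO_imp_compact:
 fixes b :: "'a => 'b::{banach, second_countable_topology}"
 assumes b: "b : VMO M d x\<^sub>0 \<nu>" and x0: "x\<^sub>0 : space M" and S: "L.sparse S Es \<eta> K"
 shows "compact_Lp_op M p lam1 lam2 (bloom_sparse M S b :: ('a => 'k::euclidean_space) => 'a => 'k)"
proof -
 have bB: "b : BMO M d \<nu>" using b by (simp add: VMO_def)
 have bl: "b : L1_loc M d" using bB by (simp add: BMO_def)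
 obtain C where C: "0 <= C" "!!Q. Q : L.cubes ==> osc M \<nu> b Q <= C" using osc_cube_bounded[OF bB] by metis
 have fin: "\<forall>eps>0. finite {Q : L.cubes. eps < osc M \<nu> b Q}"
  using finite_large_osc[OF b x0] by auto
 have Sc: "S \<subseteq> L.cubes" using S by (simp add: L.sparse_def)
 have cS: "countable S" using countable_subset[OF Sc L.cubes_countable] .
 have "compact_Lp_op M p lam1 lam2 (%f x. \<Sum>\<^sub>\<infinity>Q\<in>S. dv b Q x *\<^sub>R (avg M Q f :: 'k))"
 proof (rule compact_from_tails[OF cS _ _ W.meas(3) W.w_nonneg(2) L.muckD(13)[OF muck2] p])
  show "dv b Q : borel_measurable M" if "Q : S" for Q using dv_meas[OF bl] that Sc by auto
  show "0 <= dv b Q x" for Q x by simp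
  show "\<exists>C. \<forall>f\<in>Lp M p lam1. norm (avg M Q f :: 'k) <= C * Lp_norm M p lam1 f" if "Q : S" for Q
  proof (intro exI ballI)
   fix f :: "'a => 'k" assume f: "f : Lp M p lam1"
   have Qc: "Q : L.cubes" using that Sc by auto
   have "norm (avg M Q f) <= av (%x. norm (f x)) Q" by (rule norm_avg_le)
   also have "Iset M (%x. norm (f x)) Q <= Lp_norm M p lam1 f * Iset M sig1 Q powr (1/q)"
    using L.WL_cube_integrable(2)[OF muck1 Lp_norm_WL[OF f] Qc] by simp
   then have "av (%x. norm (f x)) Q <= Lp_norm M p lam1 f * Iset M sig1 Q powr (1/q) / measure M Q"
    by (intro divide_right_mono) auto
   finally show "norm (avg M Q f) <= (Iset M sig1 Q powr (1/q) / measure M Q) * Lp_norm M p lam1 f"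
    by (simp add: mult.commute)
  qed
  show "\<exists>C. WL M p lam2 (%x. \<Sum>Q\<in>F. dv b Q x) C" if "finite F" "F \<subseteq> S" for F
   using finite_sum_dv[OF bl C that(1)] that(2) Sc by auto
  show "\<exists>F. finite F & F \<subseteq> S & (\<forall>G f. finite G --> G \<subseteq> S - F --> f : Lp M p lam1 -->
    WL M p lam2 (%x. \<Sum>Q\<in>G. dv b Q x * norm (avg M Q f :: 'k)) (eps * Lp_norm M p lam1 f))" if e: "0 < eps" for eps
  proof -
   obtain F where F: "finite F" "F \<subseteq> S" and Ft: "\<forall>G f A. finite G --> G \<subseteq> S - F --> WL M p lam1 f A --> (\<forall>x\<in>space M. 0 <= f x) -->
     WL M p lam2 (%x. \<Sum>Q\<in>G. av f Q * dv b Q x) (eps * A)"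
    using tail_bound[OF bl S fin e] by (elim exE conjE)
   have "WL M p lam2 (%x. \<Sum>Q\<in>G. dv b Q x * norm (avg M Q f)) (eps * Lp_norm M p lam1 f)"
    if G: "finite G" "G \<subseteq> S - F" and f: "f : Lp M p lam1" for G and f :: "'a => 'k"
   proof (rule dv_avg_le[OF bl G(1)])
    show "G \<subseteq> L.cubes" using G Sc by auto
    show "WL M p lam2 (%x. \<Sum>Q\<in>G. av (%x. norm (f x)) Q * dv b Q x) (eps * Lp_norm M p lam1 f)"
     by (rule Ft[rule_format, OF G Lp_norm_WL[OF f]]) simp
   qed
   then show ?thesis using F by (intro exI[of _ F]) simp
  qed
 qed
 then show ?thesis unfolding bloom_sparse_def[abs_def] .
qed

lemma sparse_ae_summable:
 fixes b :: "'a => 'b::{banach, second_countable_topology}" and f :: "'a => 'k::euclidean_space"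
 assumes bB: "b : BMO M d \<nu>" and S: "L.sparse S Es \<eta> K" and f: "f : Lp M p lam1"
 shows "AE x in M. (%Q. norm (dv b Q x *\<^sub>R avg M Q f)) summable_on S"
proof -
 have bl: "b : L1_loc M d" using bB by (simp add: BMO_def)
 obtain C where C: "0 <= C" "!!Q. Q : L.cubes ==> osc M \<nu> b Q <= C" using osc_cube_bounded[OF bB] by metis
 have Sc: "S \<subseteq> L.cubes" using S by (simp add: L.sparse_def)
 have cS: "countable S" using countable_subset[OF Sc L.cubes_countable] .
 show ?thesis
 proof (rule WL_series(2)[OF cS _ _ W.meas(3) W.w_nonneg(2) L.muckD(13)[OF muck2] p])
  show "dv b Q : borel_measurable M" if "Q : S" for Q using dv_meas[OF bl] that Sc by auto
  show "WL M p lam2 (%x. \<Sum>Q\<in>G. dv b Q x * norm (avg M Q f)) (C * Kmain \<eta> K * Lp_norm M p lam1 f)" if G: "finite G" "G \<subseteq> S" for G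
  proof (rule dv_avg_le[OF bl G(1)])
   show "G \<subseteq> L.cubes" using G Sc by auto
   show "WL M p lam2 (%x. \<Sum>Q\<in>G. av (%x. norm (f x)) Q * dv b Q x) (C * Kmain \<eta> K * Lp_norm M p lam1 f)"
    by (rule uniform_bound[OF bl G(1) L.sparse_subset[OF S G(2)] Lp_norm_WL[OF f] _ C]) auto
  qed
 qed auto
qed

end

section \<open>Dyadic systems with prescribed centres\<close>

text \<open>
A choice from $S$ by means of an enumeration of $Y$. Unlike an arbitrary choice it depends
measurably on $S$ (\<open>mset_first\<close>).
\<close>
definition first :: "'b set => 'b set => 'b" where
 "first Y S = (SOME y. y : S & (\<forall>z\<in>S. to_nat_on Y y <= to_nat_on Y z))"

lemma first:
 assumes "S ~= {}" shows "first Y S : S & (\<forall>z\<in>S. to_nat_on Y (first Y S) <= to_nat_on Y z)"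
proof -
 obtain y0 where y0: "y0 : S" using assms by auto
 have "\<exists>y. y : S & (\<forall>z. z : S --> to_nat_on Y y <= to_nat_on Y z)"
  using ex_has_least_nat[of "%y. y : S" y0 "to_nat_on Y"] y0 by auto
 then have "\<exists>y. y : S & (\<forall>z\<in>S. to_nat_on Y y <= to_nat_on Y z)" by auto
 from someI_ex[OF this] show ?thesis unfolding first_def .
qed

lemma first_eq_iff:
 assumes Y: "countable Y" and S: "S \<subseteq> Y" "S ~= {}" and y: "y : Y"
 shows "first Y S = y \<longleftrightarrow> y : S & (\<forall>z\<in>Y. to_nat_on Y z < to_nat_on Y y --> z \<notin> S)"
proof
 assume "first Y S = y"
 then show "y : S & (\<forall>z\<in>Y. to_nat_on Y z < to_nat_on Y y --> z \<notin> S)"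
  using first[OF S(2), of Y] by (auto simp: not_less[symmetric])
next
 assume a: "y : S & (\<forall>z\<in>Y. to_nat_on Y z < to_nat_on Y y --> z \<notin> S)"
 note f = first[OF S(2), of Y]
 have fY: "first Y S : Y" using f S(1) by auto
 have "to_nat_on Y (first Y S) <= to_nat_on Y y" using f a by auto
 moreover have "~ to_nat_on Y (first Y S) < to_nat_on Y y" using a f fY by auto
 ultimately have "to_nat_on Y (first Y S) = to_nat_on Y y" by simp
 then show "first Y S = y" using inj_on_to_nat_on[OF Y] fY y by (auto dest: inj_onD)
qed

context homogeneous_type
begin

text \<open>
Balls of a quasi-metric need not be open or Borel. Repeatedly adding balls with geometrically
decreasing radii produces an open set between two concentric balls.
\<close>
primrec hullstep :: "nat => real => 'a => 'a set" where
 "hullstep 0 \<rho> y = {y}"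
| "hullstep (Suc n) \<rho> y = (\<Union>z\<in>B y (\<rho> / (2 * A\<^sub>0)). hullstep n (\<rho> / (2 * A\<^sub>0)) z)"

definition ohull :: "real => 'a => 'a set" where "ohull \<rho> y = (\<Union>n. hullstep n \<rho> y)"

lemma hullstep_subset: "y : space M ==> 0 < \<rho> ==> hullstep n \<rho> y \<subseteq> B y \<rho>"
proof (induction n arbitrary: \<rho> y)
 case 0
 then show ?case using center_in_B by simp
next
 case (Suc n)
 let ?r = "\<rho> / (2 * A\<^sub>0)"
 have r: "0 < ?r" "A\<^sub>0 * (?r + ?r) = \<rho>" using Suc.prems A0_ge_1 by auto
 show ?case
 proof
  fix x assume "x : hullstep (Suc n) \<rho> y"
  then obtain z where z: "z : B y ?r" "x : hullstep n ?r z" by auto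
  have zs: "z : space M" "d y z < ?r" using z by (auto simp: in_B)
  have "x : B z ?r" using Suc.IH[OF zs(1) r(1)] z(2) by auto
  then have x: "x : space M" "d z x < ?r" by (auto simp: in_B)
  have "d y x <= A\<^sub>0 * (d y z + d z x)" by (rule d_triangle[OF Suc.prems(1) x(1) zs(1)])
  also have "... < A\<^sub>0 * (?r + ?r)" using zs x A0_ge_1 by (intro mult_strict_left_mono) auto
  finally show "x : B y \<rho>" using r x by (simp add: in_B)
 qed
qed

lemma hullstep_open: "y : space M ==> 0 < \<rho> ==> z : hullstep n \<rho> y ==> \<exists>r>0. B z r \<subseteq> hullstep (Suc n) \<rho> y"
proof (induction n arbitrary: \<rho> y)
 case 0
 then show ?case using A0_ge_1 by (intro exI[of _ "\<rho> / (2 * A\<^sub>0)"]) auto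
next
 case (Suc n)
 let ?r = "\<rho> / (2 * A\<^sub>0)"
 have r: "0 < ?r" using Suc.prems A0_ge_1 by auto
 obtain u where u: "u : B y ?r" "z : hullstep n ?r u" using Suc.prems(3) by auto
 then have "u : space M" by (simp add: in_B)
 from Suc.IH[OF this r u(2)] obtain s where s: "0 < s" "B z s \<subseteq> hullstep (Suc n) ?r u" by auto
 have "hullstep (Suc n) ?r u \<subseteq> hullstep (Suc (Suc n)) \<rho> y"
  using u(1) by (subst (2) hullstep.simps(2)) (rule UN_upper)
 then have "B z s \<subseteq> hullstep (Suc (Suc n)) \<rho> y" using s(2) by (rule order_trans[rotated])
 then show ?case using s(1) by auto
qed

lemma ohull:
 assumes "y : space M" "0 < \<rho>"
 shows "qopen M d (ohull \<rho> y)" "B y (\<rho> / (2 * A\<^sub>0)) \<subseteq> ohull \<rho> y" "ohull \<rho> y \<subseteq> B y \<rho>"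
proof -
 show s: "ohull \<rho> y \<subseteq> B y \<rho>" unfolding ohull_def using hullstep_subset[OF assms] by (rule UN_least)
 have "B y (\<rho> / (2 * A\<^sub>0)) \<subseteq> hullstep (Suc 0) \<rho> y" by auto
 also have "... \<subseteq> ohull \<rho> y" unfolding ohull_def by (rule UN_upper) simp
 finally show "B y (\<rho> / (2 * A\<^sub>0)) \<subseteq> ohull \<rho> y" .
 show "qopen M d (ohull \<rho> y)"
  unfolding qopen_def
 proof (intro conjI ballI)
  show "ohull \<rho> y \<subseteq> space M" using s B_space by (rule order_trans)
  fix z assume "z : ohull \<rho> y"
  then obtain n where "z : hullstep n \<rho> y" by (auto simp: ohull_def)
  from hullstep_open[OF assms this] obtain r where r: "0 < r" "B z r \<subseteq> hullstep (Suc n) \<rho> y" by blast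
  have "hullstep (Suc n) \<rho> y \<subseteq> ohull \<rho> y" unfolding ohull_def by (rule UN_upper) simp
  then have "B z r \<subseteq> ohull \<rho> y" using r(2) by (rule order_trans[rotated])
  then show "\<exists>r>0. B z r \<subseteq> ohull \<rho> y" using r(1) by auto
 qed
qed

definition separated :: "real => 'a set => bool" where
 "separated s Y \<longleftrightarrow> Y \<subseteq> space M & (\<forall>x\<in>Y. \<forall>y\<in>Y. x ~= y --> s <= d x y)"

text \<open>
Balls around the points with a fraction of the separation as radius are disjoint and comparable to
the large ball, by doubling.
\<close>
lemma separated_count:
 assumes t: "0 < t"
 shows "\<exists>N::nat. \<forall>s>0. \<forall>Y. separated s Y --> (\<forall>x\<in>space M. finite (Y \<inter> B x (t * s)) & card (Y \<inter> B x (t * s)) <= N)"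
proof -
 define t1 where "t1 = A\<^sub>0 * (t + 1 / (2 * A\<^sub>0))"
 define t2 where "t2 = A\<^sub>0 * (t + t1) * (2 * A\<^sub>0)"
 have t1: "0 < t1" unfolding t1_def using t A0_ge_1 by (intro mult_pos_pos add_pos_pos) auto
 obtain C where C: "1 <= C" "!!x y r s. x : space M ==> 0 < r ==> y : space M ==> 0 < s ==> B x r \<subseteq> B y (t2 * s) ==> measure M (B x r) <= C * measure M (B y s)"
  using doubling_compare[of t2] by metis
 have "finite (Y \<inter> B x (t * s)) & card (Y \<inter> B x (t * s)) <= nat \<lfloor>C\<rfloor>"
  if s: "0 < s" and Y: "separated s Y" and x: "x : space M" for s Y x
 proof -
  let ?Y = "Y \<inter> B x (t * s)" and ?r = "s / (2 * A\<^sub>0)"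
  have r: "0 < ?r" "A\<^sub>0 * (?r + ?r) = s" using s A0_ge_1 by auto
  let ?W = "B x (t1 * s)"
  have R: "0 < t1 * s" using t1 s by simp
  have ys: "y : space M" "d x y < t * s" if "y : ?Y" for y using that by (auto simp: in_B)
  have meet: "y = y'" if "y : ?Y" "y' : ?Y" "z : B y ?r" "z : B y' ?r" for y y' z
  proof (rule ccontr)
   assume "y ~= y'"
   then have "s <= d y y'" using Y that(1,2) \<open>y ~= y'\<close> unfolding separated_def by blast
   moreover have "d y y' <= A\<^sub>0 * (d y z + d z y')"
    by (rule d_triangle[OF ys(1)[OF that(1)] ys(1)[OF that(2)]]) (use that(3) in \<open>simp add: in_B\<close>)
   moreover have "A\<^sub>0 * (d y z + d z y') < A\<^sub>0 * (?r + ?r)"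
   proof (intro mult_strict_left_mono add_strict_mono)
    show "d y z < ?r" using that(3) by (simp add: in_B)
    have "z : space M" using that(3) by (simp add: in_B)
    then show "d z y' < ?r" using that(4) d_sym[OF _ ys(1)[OF that(2)], of z] by (simp add: in_B)
    show "0 < A\<^sub>0" using A0_ge_1 by simp
   qed
   ultimately show False using r by linarith
  qed
  let ?G = "(%y. B y ?r) ` ?Y"
  have G: "finite ?G & real (card ?G) <= C"
  proof (rule finite_card_disjoint_large)
   show "?G \<subseteq> sets M" using ys qball_sets r by auto
   show "disjoint ?G" unfolding disjoint_def using meet by (auto simp: disjoint_iff)
   show "\<Union>?G \<subseteq> ?W"
   proof (rule UN_least)
    fix y assume y: "y : ?Y"
    have "B y ?r \<subseteq> B x (A\<^sub>0 * (d x y + ?r))" by (rule B_subset[OF ys(1)[OF y] x])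
    also have "... \<subseteq> ?W"
    proof (rule B_mono)
     have "A\<^sub>0 * (d x y + ?r) <= A\<^sub>0 * (t * s + ?r)" using ys(2)[OF y] A0_ge_1 by (intro mult_left_mono) auto
     also have "... = t1 * s" by (simp add: t1_def algebra_simps)
     finally show "A\<^sub>0 * (d x y + ?r) <= t1 * s" .
    qed
    finally show "B y ?r \<subseteq> ?W" .
   qed
   show "?W : sets M" "emeasure M ?W < \<infinity>" "0 < measure M ?W"
    using qball_sets[OF x R] finite_qball[OF x R] measure_B_pos[OF x R] by auto
   show "0 < C" using C(1) by simp
   fix G assume "G : ?G"
   then obtain y where y: "y : ?Y" "G = B y ?r" by auto
   have "?W \<subseteq> B y (A\<^sub>0 * (d y x + t1 * s))" by (rule B_subset[OF x ys(1)[OF y(1)]])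
   also have "... \<subseteq> B y (t2 * ?r)"
   proof (rule B_mono)
    have "A\<^sub>0 * (d y x + t1 * s) <= A\<^sub>0 * (t * s + t1 * s)"
     using ys[OF y(1)] d_sym[OF x ys(1)[OF y(1)]] A0_ge_1 by (intro mult_left_mono) auto
    also have "... = t2 * ?r" using A0_ge_1 by (simp add: t2_def algebra_simps)
    finally show "A\<^sub>0 * (d y x + t1 * s) <= t2 * ?r" .
   qed
   finally show "measure M ?W <= C * measure M G" unfolding y(2) by (rule C(2)[OF x R ys(1)[OF y(1)] r(1)])
  qed
  have inj: "inj_on (%y. B y ?r) ?Y"
  proof (rule inj_onI)
   fix y y' assume a: "y : ?Y" "y' : ?Y" "B y ?r = B y' ?r"
   have "y : B y ?r" using center_in_B[OF ys(1)[OF a(1)] r(1)] .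
   then show "y = y'" using meet[OF a(1,2), of y] a(3) by auto
  qed
  have "finite ?Y" using G finite_imageD[OF _ inj] by auto
  moreover have "card ?Y = card ?G" using card_image[OF inj] by simp
  ultimately show ?thesis using G by (simp add: le_nat_floor)
 qed
 then show ?thesis by (intro exI[of _ "nat \<lfloor>C\<rfloor>"]) simp
qed

lemma separated_finite:
 assumes "separated s Y" "0 < s" "x : space M" shows "finite (Y \<inter> B x r)"
proof -
 have "0 < max 1 (r / s)" by simp
 from separated_count[OF this] have f: "finite (Y \<inter> B x (max 1 (r / s) * s))" using assms by blast
 have "r <= max 1 (r / s) * s" using assms(2) by (simp add: max_def field_simps)
 then have "Y \<inter> B x r \<subseteq> Y \<inter> B x (max 1 (r / s) * s)" using B_mono by blast
 then show ?thesis using f by (rule finite_subset)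
qed

lemma separated_countable: assumes "separated s Y" "0 < s" shows "countable Y"
proof -
 obtain x where x: "x : space M" using nonzero by (metis emeasure_empty equals0I)
 have "Y \<subseteq> (\<Union>n::nat. Y \<inter> B x (2 ^ n * 1))"
  using assms(1) space_UN_balls[OF x, of 1] unfolding separated_def by auto
 moreover have "countable (\<Union>n::nat. Y \<inter> B x (2 ^ n * 1))"
  using separated_finite[OF assms x] by (intro countable_UN) (auto intro: countable_finite)
 ultimately show ?thesis by (rule countable_subset)
qed

lemma maximal_separated:
 assumes P: "separated s P" and s: "0 < s"
 shows "\<exists>Y. P \<subseteq> Y & separated s Y & (\<forall>x\<in>space M. \<exists>y\<in>Y. d x y < s)"
proof -
 let ?A = "{Y. P \<subseteq> Y & separated s Y}"
 have "\<exists>Y\<in>?A. \<forall>X\<in>?A. Y \<subseteq> X --> X = Y"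
 proof (rule subset_Zorn_nonempty)
  show "?A ~= {}" using P by auto
  fix \<C> assume ne: "\<C> ~= {}" and ch: "subset.chain ?A \<C>"
  have sub: "\<C> \<subseteq> ?A" and tot: "!!X Y. X : \<C> ==> Y : \<C> ==> X \<subseteq> Y | Y \<subseteq> X"
   using ch unfolding subset_chain_def by auto
  have "separated s (\<Union>\<C>)"
   unfolding separated_def
  proof (intro conjI ballI impI)
   show "\<Union>\<C> \<subseteq> space M" using sub by (auto simp: separated_def)
   fix x y assume "x : \<Union>\<C>" "y : \<Union>\<C>" and xy: "x ~= y"
   then obtain X Z where XZ: "X : \<C>" "x : X" "Z : \<C>" "y : Z" by auto
   have "\<exists>V\<in>\<C>. x : V & y : V" using tot[OF XZ(1,3)] XZ by auto
   then obtain V where V: "V : \<C>" "x : V" "y : V" by auto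
   then have "separated s V" using sub by auto
   then show "s <= d x y" using V xy by (auto simp: separated_def)
  qed
  moreover have "P \<subseteq> \<Union>\<C>" using ne sub by auto
  ultimately show "\<Union>\<C> : ?A" by simp
 qed
 then obtain Y where Y: "P \<subseteq> Y" "separated s Y" "!!X. P \<subseteq> X ==> separated s X ==> Y \<subseteq> X ==> X = Y" by auto
 have "\<exists>y\<in>Y. d x y < s" if x: "x : space M" for x
 proof (rule ccontr)
  assume "~ (\<exists>y\<in>Y. d x y < s)"
  then have far: "!!y. y : Y ==> s <= d x y" by (auto simp: not_less)
  have Ys: "Y \<subseteq> space M" using Y(2) by (simp add: separated_def)
  have "separated s (insert x Y)"
   unfolding separated_def
  proof (intro conjI ballI impI)
   show "insert x Y \<subseteq> space M" using x Ys by auto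
   fix u v assume uv: "u : insert x Y" "v : insert x Y" "u ~= v"
   show "s <= d u v"
   proof (cases "u = x")
    case True
    then show ?thesis using uv far by auto
   next
    case False
    then have uY: "u : Y" using uv by auto
    show ?thesis
    proof (cases "v = x")
     case True
     have "d u v = d x u" using True d_sym[of u x] x uY Ys by auto
     then show ?thesis using far[OF uY] by simp
    next
     case False
     then show ?thesis using uv uY Y(2) by (auto simp: separated_def)
    qed
   qed
  qed
  then have "insert x Y = Y" using Y(1) by (intro Y(3)) auto
  then have "x : Y" by auto
  then have "s <= d x x" by (rule far)
  then show False using d_eq_0_iff[OF x x] s by simp
 qed
 then show ?thesis using Y(1,2) by blast
qed

end

text \<open>
A maximal separated net in every generation. The very small ratio of consecutive scales makes a
point that is close to a net point keep it as ancestor.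
\<close>
locale dyadic_net = homogeneous_type M d A C\<^sub>\<mu>
 for M :: "'a measure" and d :: "'a => 'a => real" and A C\<^sub>\<mu> :: real +
 fixes dlt :: real and X :: "int => 'a set"
 assumes delta: "dlt = 1 / (16 * A ^ 4)"
  and Xsep: "separated (dlt powi k) (X k)"
  and Xcov: "x : space M ==> \<exists>y\<in>X k. d x y < dlt powi k"
begin

lemma delta_bounds: "0 < dlt" "dlt < 1" "2 * A * dlt <= 1" "4 * A\<^sup>2 * dlt = 1 / (4 * A\<^sup>2)" "A * dlt <= 1 / 16"
proof -
 have A: "1 <= A" using A0_ge_1 .
 have A4: "1 <= A ^ 4" "A <= A ^ 4" using A power_increasing[of 1 4 A] by auto
 show "0 < dlt" using A4(1) unfolding delta by (intro divide_pos_pos) linarith+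
 show "dlt < 1" unfolding delta using A4(1) by (subst divide_less_eq_1_pos) linarith+
 have "A / A ^ 4 <= 1" using A4 by (subst divide_le_eq_1_pos) linarith+
 then show l: "A * dlt <= 1 / 16" by (simp add: delta)
 show "2 * A * dlt <= 1" using l by simp
 show "4 * A\<^sup>2 * dlt = 1 / (4 * A\<^sup>2)" using A by (simp add: delta field_simps power2_eq_square power4_eq_xxxx)
qed

lemma dp: "0 < dlt powi k" using delta_bounds(1) by (rule powi_pos)

lemma dp_Suc: "dlt powi (k + 1) = dlt * dlt powi k"
 using delta_bounds(1) by (simp add: power_int_add)

lemma X_space: "y : X k ==> y : space M" using Xsep[of k] by (auto simp: separated_def)

lemma X_countable: "countable (X k)" using separated_countable[OF Xsep dp] .

text \<open>
By the quasi-triangle inequality at most one net point is closer than $\delta^k/(2A)$; it is taken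
if there is one.
\<close>
definition par :: "int => 'a => 'a" where
 "par k y = (if \<exists>x\<in>X k. d y x < dlt powi k / (2 * A) then SOME x. x : X k & d y x < dlt powi k / (2 * A)
   else SOME x. x : X k & d y x < dlt powi k)"

lemma par: assumes y: "y : space M" shows "par k y : X k" "d y (par k y) < dlt powi k"
proof -
 have le: "dlt powi k / (2 * A) <= dlt powi k" using dp[of k] A0_ge_1 by (simp add: field_simps)
 have "par k y : X k & d y (par k y) < dlt powi k"
 proof (cases "\<exists>x\<in>X k. d y x < dlt powi k / (2 * A)")
  case True
  then have "\<exists>x. x : X k & d y x < dlt powi k / (2 * A)" by auto
  from someI_ex[OF this] have "par k y : X k & d y (par k y) < dlt powi k / (2 * A)"
   using True by (simp add: par_def)
  then show ?thesis using le by linarith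
 next
  case False
  have "\<exists>x. x : X k & d y x < dlt powi k" using Xcov[OF y, of k] by auto
  from someI_ex[OF this] show ?thesis using False by (simp add: par_def)
 qed
 then show "par k y : X k" "d y (par k y) < dlt powi k" by auto
qed

lemma par_close:
 assumes y: "y : space M" and x: "x : X k" "d y x < dlt powi k / (2 * A)" shows "par k y = x"
proof -
 have ex: "\<exists>x\<in>X k. d y x < dlt powi k / (2 * A)" using x by auto
 then have "\<exists>x. x : X k & d y x < dlt powi k / (2 * A)" by auto
 from someI_ex[OF this] have z: "par k y : X k" "d y (par k y) < dlt powi k / (2 * A)"
  using ex by (auto simp: par_def)
 show ?thesis
 proof (rule ccontr)
  assume ne: "par k y ~= x"
  have sp: "par k y : space M" "x : space M" using X_space z x by auto
  have "dlt powi k <= d (par k y) x" using Xsep[of k] z(1) x(1) ne by (auto simp: separated_def)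
  also have "... <= A * (d (par k y) y + d y x)" by (rule d_triangle[OF sp y])
  also have "... < A * (dlt powi k / (2 * A) + dlt powi k / (2 * A))"
   using z(2) x(2) d_sym[OF sp(1) y] A0_ge_1 by (intro mult_strict_left_mono) auto
  also have "... = dlt powi k" using A0_ge_1 by simp
  finally show False by simp
 qed
qed

primrec anc :: "nat => int => 'a => 'a" where
 "anc 0 m y = y"
| "anc (Suc n) m y = par (m - 1 - int n) (anc n m y)"

lemma anc_X: "y : X m ==> anc n m y : X (m - int n)"
proof (induction n)
 case (Suc n)
 then have "anc n m y : space M" using X_space by blast
 from par(1)[OF this, of "m - 1 - int n"] show ?case by (simp add: algebra_simps)
qed simp

lemma anc_dist: "y : X m ==> d (anc n m y) y <= 2 * A * dlt powi (m - int n)"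
proof (induction n)
 case 0
 then have "y : space M" by (rule X_space)
 then have "d y y = 0" using d_eq_0_iff by blast
 then show ?case using dp[of m] A0_ge_1 by simp
next
 case (Suc n)
 let ?k = "m - 1 - int n" let ?z = "anc n m y"
 have zX: "?z : X (m - int n)" using anc_X[OF Suc.prems] .
 have z: "?z : space M" and y: "y : space M" using X_space[OF zX] X_space[OF Suc.prems] by auto
 have pz: "par ?k ?z : space M" using X_space[OF par(1)[OF z]] .
 have e: "m - int n = ?k + 1" "m - int (Suc n) = ?k" by auto
 have "d (par ?k ?z) y <= A * (d (par ?k ?z) ?z + d ?z y)" by (rule d_triangle[OF pz y z])
 also have "... <= A * (dlt powi ?k + 2 * A * dlt powi (?k + 1))"
 proof (intro mult_left_mono add_mono)
  show "d (par ?k ?z) ?z <= dlt powi ?k" using par(2)[OF z, of ?k] d_sym[OF pz z] by linarith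
  show "d ?z y <= 2 * A * dlt powi (?k + 1)" using Suc.IH[OF Suc.prems] unfolding e(1) .
  show "0 <= A" using A0_ge_1 by simp
 qed
 also have "... = A * dlt powi ?k * (1 + 2 * A * dlt)" unfolding dp_Suc by (simp add: algebra_simps)
 also have "... <= A * dlt powi ?k * (1 + 1)"
  using delta_bounds(3) dp[of ?k] A0_ge_1 by (intro mult_left_mono add_left_mono) auto
 finally show ?case unfolding e by simp
qed

definition near :: "int => 'a => 'a set" where "near m x = {y\<in>X m. x : ohull (2 * A * dlt powi m) y}"

definition pick :: "int => 'a => 'a" where "pick m x = first (X m) (near m x)"

lemma near_ne: assumes x: "x : space M" shows "near m x ~= {}"
proof -
 obtain y where y: "y : X m" "d x y < dlt powi m" using Xcov[OF x] by blast
 have ys: "y : space M" using X_space[OF y(1)] .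
 have r: "0 < 2 * A * dlt powi m" using dp[of m] A0_ge_1 by simp
 have "x : B y (2 * A * dlt powi m / (2 * A))" using x y d_sym[OF x ys] A0_ge_1 by (simp add: in_B)
 then have "x : ohull (2 * A * dlt powi m) y" using ohull(2)[OF ys r] by auto
 then show ?thesis using y by (auto simp: near_def)
qed

lemma pick: assumes x: "x : space M" shows "pick m x : X m" "d x (pick m x) < 2 * A * dlt powi m"
proof -
 have "pick m x : near m x" using first[OF near_ne[OF x]] by (simp add: pick_def)
 then have p: "pick m x : X m" "x : ohull (2 * A * dlt powi m) (pick m x)" by (auto simp: near_def)
 have r: "0 < 2 * A * dlt powi m" using dp[of m] A0_ge_1 by simp
 have ps: "pick m x : space M" using X_space[OF p(1)] .
 have "x : B (pick m x) (2 * A * dlt powi m)" using ohull(3)[OF ps r] p(2) by auto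
 then show "pick m x : X m" "d x (pick m x) < 2 * A * dlt powi m" using p(1) d_sym[OF x ps] by (auto simp: in_B)
qed

text \<open>
The ancestor in generation $k$ that $x$ inherits from a nearby net point in generation $k+n$. It
need not stabilise as $n$ grows.
\<close>
definition tr :: "int => nat => 'a => 'a" where "tr k n x = anc n (k + int n) (pick (k + int n) x)"

lemma tr_X: "x : space M ==> tr k n x : X k"
 unfolding tr_def using anc_X[OF pick(1), of x n "k + int n"] by simp

lemma tr_dist: assumes x: "x : space M" shows "d x (tr k n x) < 4 * A\<^sup>2 * dlt powi k"
proof -
 let ?m = "k + int n" let ?y = "pick ?m x"
 have y: "?y : X ?m" "d x ?y < 2 * A * dlt powi ?m" using pick[OF x] by auto
 have ys: "?y : space M" and ts: "tr k n x : space M" using X_space[OF y(1)] X_space[OF tr_X[OF x]] by auto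
 have "dlt powi ?m <= dlt powi k" using delta_bounds by (intro powi_antimono) auto
 then have "2 * A * dlt powi ?m <= 2 * A * dlt powi k" using A0_ge_1 by (intro mult_left_mono) auto
 then have 1: "d x ?y < 2 * A * dlt powi k" using y(2) by linarith
 have "d (tr k n x) ?y <= 2 * A * dlt powi k" using anc_dist[OF y(1), of n] by (simp add: tr_def)
 then have 2: "d ?y (tr k n x) <= 2 * A * dlt powi k" using d_sym[OF ys ts] by simp
 have "d x (tr k n x) <= A * (d x ?y + d ?y (tr k n x))" by (rule d_triangle[OF x ts ys])
 also have "... < A * (2 * A * dlt powi k + 2 * A * dlt powi k)"
  using 1 2 A0_ge_1 by (intro mult_strict_left_mono) auto
 also have "... = 4 * A\<^sup>2 * dlt powi k" by (simp add: power2_eq_square)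
 finally show ?thesis .
qed

lemma par_tr: "par k (tr (k + 1) n x) = tr k (Suc n) x"
proof -
 have e: "k + 1 + int n = k + int (Suc n)" "k + int (Suc n) - 1 - int n = k" by auto
 show ?thesis unfolding tr_def e(1) anc.simps(2) e(2) ..
qed

text \<open>
The limit points of the ancestors. Since there are finitely many possibilities in each generation,
a coherent choice exists by the argument of Koenig's lemma, and it makes the cubes an exact
partition of the space.
\<close>
definition recur :: "int => 'a => 'a set" where "recur k x = {y\<in>X k. infinite {n. tr k n x = y}}"

lemma tr_range_finite: assumes x: "x : space M" shows "finite (range (%n. tr k n x))"
proof (rule finite_subset)
 show "range (%n. tr k n x) \<subseteq> X k \<inter> B x (4 * A\<^sup>2 * dlt powi k)"
  using tr_X[OF x] tr_dist[OF x] X_space[OF tr_X[OF x]] by (auto simp: in_B)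
 show "finite (X k \<inter> B x (4 * A\<^sup>2 * dlt powi k))" by (rule separated_finite[OF Xsep dp x])
qed

lemma recur_ne: assumes x: "x : space M" shows "recur k x ~= {}"
proof -
 from pigeonhole_infinite[OF infinite_UNIV_nat, of "%n. tr k n x"] tr_range_finite[OF x, of k]
 obtain n0 where "infinite {n. tr k n x = tr k n0 x}" by auto
 then have "tr k n0 x : recur k x" using tr_X[OF x] by (simp add: recur_def)
 then show ?thesis by auto
qed

lemma recur_par: assumes x: "x : space M" and z: "z : recur (k + 1) x" shows "par k z : recur k x"
proof -
 have "infinite {n. tr (k + 1) n x = z}" using z by (simp add: recur_def)
 then have "infinite (Suc ` {n. tr (k + 1) n x = z})" by (simp add: finite_image_iff)
 moreover have "Suc ` {n. tr (k + 1) n x = z} \<subseteq> {n. tr k n x = par k z}" using par_tr[of k _ x] by auto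
 ultimately have "infinite {n. tr k n x = par k z}" using finite_subset by blast
 moreover have "par k z : X k" using z X_space par(1) by (auto simp: recur_def)
 ultimately show ?thesis by (simp add: recur_def)
qed

lemma recur_lift: assumes x: "x : space M" and y: "y : recur k x" shows "\<exists>z\<in>recur (k + 1) x. par k z = y"
proof -
 have "infinite {n. tr k n x = y}" using y by (simp add: recur_def)
 moreover have "{n. tr k n x = y} \<subseteq> insert 0 (Suc ` {n. tr k (Suc n) x = y})"
 proof
  fix n assume "n : {n. tr k n x = y}"
  then show "n : insert 0 (Suc ` {n. tr k (Suc n) x = y})" by (cases n) auto
 qed
 ultimately have "infinite (insert 0 (Suc ` {n. tr k (Suc n) x = y}))" using finite_subset by blast
 then have inf: "infinite {n. tr k (Suc n) x = y}" by auto
 have fin: "finite ((%n. tr (k + 1) n x) ` {n. tr k (Suc n) x = y})"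
  using tr_range_finite[OF x, of "k + 1"] by (rule finite_subset[rotated]) auto
 from pigeonhole_infinite[OF inf fin] obtain n0 where
  n0: "tr k (Suc n0) x = y" "infinite {n\<in>{n. tr k (Suc n) x = y}. tr (k + 1) n x = tr (k + 1) n0 x}" by auto
 have "{n\<in>{n. tr k (Suc n) x = y}. tr (k + 1) n x = tr (k + 1) n0 x} \<subseteq> {n. tr (k + 1) n x = tr (k + 1) n0 x}" by auto
 then have "infinite {n. tr (k + 1) n x = tr (k + 1) n0 x}" using n0(2) finite_subset by blast
 then have "tr (k + 1) n0 x : recur (k + 1) x" using tr_X[OF x] by (simp add: recur_def)
 moreover have "par k (tr (k + 1) n0 x) = y" using n0(1) par_tr by simp
 ultimately show ?thesis by auto
qed

primrec br :: "nat => 'a => 'a" where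
 "br 0 x = first (X 0) (recur 0 x)"
| "br (Suc n) x = first (X (int (Suc n))) {z\<in>recur (int (Suc n)) x. par (int n) z = br n x}"

lemma br_recur: assumes x: "x : space M" shows "br n x : recur (int n) x"
proof (induction n)
 case 0
 show ?case using first[OF recur_ne[OF x]] by simp
next
 case (Suc n)
 have ne: "{z\<in>recur (int (Suc n)) x. par (int n) z = br n x} ~= {}"
  using recur_lift[OF x Suc] by (auto simp: add.commute)
 have "br (Suc n) x : {z\<in>recur (int (Suc n)) x. par (int n) z = br n x}"
  unfolding br.simps(2) using first[OF ne] by blast
 then show ?case by blast
qed

lemma br_cand_ne: assumes x: "x : space M" shows "{z\<in>recur (int (Suc n)) x. par (int n) z = br n x} ~= {}"
 using recur_lift[OF x br_recur[OF x, of n]] by (auto simp: add.commute)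

lemma par_br: assumes x: "x : space M" shows "par (int n) (br (Suc n) x) = br n x"
proof -
 have "br (Suc n) x : {z\<in>recur (int (Suc n)) x. par (int n) z = br n x}"
  unfolding br.simps(2) using first[OF br_cand_ne[OF x]] by blast
 then show ?thesis by blast
qed

definition cen :: "int => 'a => 'a" where
 "cen k x = (if 0 <= k then br (nat k) x else anc (nat (- k)) 0 (br 0 x))"

lemma par_cen: assumes x: "x : space M" shows "par k (cen (k + 1) x) = cen k x"
proof (cases "0 <= k")
 case True
 then have "nat (k + 1) = Suc (nat k)" "int (nat k) = k" by auto
 then show ?thesis using True par_br[OF x, of "nat k"] by (simp add: cen_def)
next
 case False
 define n where "n = nat (- k - 1)"
 have n: "nat (- k) = Suc n" "k = - 1 - int n" using False by (auto simp: n_def)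
 have 1: "cen (k + 1) x = anc n 0 (br 0 x)"
 proof (cases "k = -1")
  case True
  then have "n = 0" by (simp add: n_def)
  then show ?thesis using True by (simp add: cen_def)
 next
  case False2: False
  then have "~ 0 <= k + 1" "nat (- (k + 1)) = n" using False by (auto simp: n_def)
  then show ?thesis by (simp add: cen_def)
 qed
 have "cen k x = anc (Suc n) 0 (br 0 x)" using False n(1) by (simp add: cen_def)
 also have "... = par k (anc n 0 (br 0 x))" using n(2) by simp
 finally show ?thesis using 1 by simp
qed

lemma cen_recur: assumes x: "x : space M" shows "cen k x : recur k x"
proof (cases "0 <= k")
 case True
 then show ?thesis using br_recur[OF x, of "nat k"] by (simp add: cen_def)
next
 case False
 have "cen (- int n) x : recur (- int n) x" for n
 proof (induction n)
  case 0
  then show ?case using br_recur[OF x, of 0] by (simp add: cen_def)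
 next
  case (Suc n)
  have e: "- int n = - int (Suc n) + 1" by simp
  show ?case using recur_par[OF x, of "cen (- int n) x" "- int (Suc n)"] par_cen[OF x, of "- int (Suc n)"] Suc
   by (simp add: e[symmetric])
 qed
 from this[of "nat (- k)"] show ?thesis using False by simp
qed

lemma cen_X: "x : space M ==> cen k x : X k" using cen_recur[of x k] by (simp add: recur_def)

lemma cen_dist: assumes x: "x : space M" shows "d x (cen k x) < 4 * A\<^sup>2 * dlt powi k"
proof -
 have "infinite {n. tr k n x = cen k x}" using cen_recur[OF x] by (simp add: recur_def)
 then have "{n. tr k n x = cen k x} ~= {}" by (metis finite.emptyI)
 then obtain n where "tr k n x = cen k x" by auto
 then show ?thesis using tr_dist[OF x, of k n] by simp
qed

text \<open>
Every net point of generation $k+1$ from which $x$ inherits an ancestor lies so close to $a$ that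
\<open>par_close\<close> makes $a$ its parent. Hence $a$ is the only limit point.
\<close>
lemma cen_inner:
 assumes x: "x : space M" and a: "a : X k" "d x a < 1 / (4 * A\<^sup>2) * dlt powi k" shows "cen k x = a"
proof -
 have as: "a : space M" using X_space[OF a(1)] .
 have tra: "tr k (Suc n) x = a" for n
 proof -
  let ?z = "tr (k + 1) n x"
  have z: "?z : space M" "d x ?z < 4 * A\<^sup>2 * dlt powi (k + 1)" using X_space[OF tr_X[OF x]] tr_dist[OF x] by auto
  have z2: "d x ?z < 1 / (4 * A\<^sup>2) * dlt powi k"
   using z(2) delta_bounds(4) unfolding dp_Suc by (simp add: mult.assoc[symmetric])
  have "d ?z a <= A * (d ?z x + d x a)" by (rule d_triangle[OF z(1) as x])
  also have "... < A * (1 / (4 * A\<^sup>2) * dlt powi k + 1 / (4 * A\<^sup>2) * dlt powi k)"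
   using z2 a(2) d_sym[OF z(1) x] A0_ge_1 by (intro mult_strict_left_mono) auto
  also have "... = dlt powi k / (2 * A)" using A0_ge_1 by (simp add: power2_eq_square field_simps)
  finally have "par k ?z = a" using z(1) a(1) by (intro par_close) auto
  then show ?thesis by (simp only: par_tr)
 qed
 have "infinite {n. tr k n x = cen k x}" using cen_recur[OF x] by (simp add: recur_def)
 moreover have "finite {0::nat}" by simp
 ultimately obtain n where "n : {n. tr k n x = cen k x}" "n \<notin> {0}" by (metis finite_subset subsetI)
 then show ?thesis using tra by (cases n) auto
qed

lemma cen_anc: assumes x: "x : space M" shows "cen (l - int n) x = anc n l (cen l x)"
proof (induction n)
 case (Suc n)
 have "cen (l - int (Suc n)) x = par (l - 1 - int n) (cen (l - int n) x)"
  using par_cen[OF x, of "l - 1 - int n"] by (simp add: algebra_simps)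
 then show ?case using Suc by simp
qed simp

lemma cen_coarser:
 assumes "x : space M" "y : space M" "k <= l" "cen l x = cen l y" shows "cen k x = cen k y"
 using cen_anc[OF assms(1), of l "nat (l - k)"] cen_anc[OF assms(2), of l "nat (l - k)"] assms(3,4) by simp

definition qsigma :: "'a measure" where "qsigma = sigma (space M) {U. qopen M d U}"

lemma qsigma: "space qsigma = space M" "sets qsigma = qborel M d"
proof -
 have "{U. qopen M d U} \<subseteq> Pow (space M)" by (auto simp: qopen_def)
 then show "space qsigma = space M" "sets qsigma = qborel M d"
  by (auto simp: qsigma_def qborel_def)
qed

abbreviation mset :: "('a => bool) => bool" where "mset P \<equiv> {x\<in>space qsigma. P x} : sets qsigma"

text \<open>
The first element is $y$ iff $y$ is available and none of its countably many predecessors is.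
\<close>
lemma mset_first:
 assumes Y: "countable Y" and S: "!!x. x : space M ==> S x \<subseteq> Y & S x ~= {}" and m: "!!z. z : Y ==> mset (%x. z : S x)" and y: "y : Y"
 shows "mset (%x. first Y (S x) = y)"
proof -
 have "{x\<in>space qsigma. first Y (S x) = y} = {x\<in>space qsigma. y : S x & (\<forall>z\<in>{z\<in>Y. to_nat_on Y z < to_nat_on Y y}. ~ z : S x)}"
 proof (rule Collect_cong, rule conj_cong[OF refl])
  fix x assume "x : space qsigma"
  then have x: "x : space M" by (simp add: qsigma)
  show "(first Y (S x) = y) = (y : S x & (\<forall>z\<in>{z\<in>Y. to_nat_on Y z < to_nat_on Y y}. ~ z : S x))"
   using first_eq_iff[OF Y _ _ y, of "S x"] S[OF x] by auto
 qed
 moreover have "mset (%x. y : S x & (\<forall>z\<in>{z\<in>Y. to_nat_on Y z < to_nat_on Y y}. ~ z : S x))"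
 proof (rule sets.sets_Collect_conj[OF sets.sets_Collect_countable_All' m[OF y]])
  show "countable {z\<in>Y. to_nat_on Y z < to_nat_on Y y}" using Y by (rule countable_subset[rotated]) auto
  show "mset (%x. z \<notin> S x)" if "z : {z\<in>Y. to_nat_on Y z < to_nat_on Y y}" for z
   using that by (intro sets.sets_Collect_neg m) simp
 qed
 ultimately show ?thesis by (simp only:)
qed

lemma mset_pick: assumes "y : X m" shows "mset (%x. pick m x = y)"
 unfolding pick_def
proof (rule mset_first[OF X_countable _ _ assms])
 show "near m x \<subseteq> X m & near m x ~= {}" if "x : space M" for x
  using near_ne[OF that] by (auto simp: near_def)
 fix z assume z: "z : X m"
 have r: "0 < 2 * A * dlt powi m" using dp[of m] A0_ge_1 by simp
 note h = ohull[OF X_space[OF z] r]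
 have "{x\<in>space qsigma. z : near m x} = ohull (2 * A * dlt powi m) z"
  using z h(1) by (auto simp: near_def qsigma qopen_def)
 moreover have "ohull (2 * A * dlt powi m) z : sets qsigma"
  unfolding qsigma(2) qborel_def using h(1) by (intro sigma_sets.Basic) simp
 ultimately show "mset (%x. z : near m x)" by simp
qed

lemma mset_tr: "mset (%x. tr k n x = y)"
proof -
 have "{x\<in>space qsigma. tr k n x = y} = {x\<in>space qsigma. \<exists>z\<in>{z\<in>X (k + int n). anc n (k + int n) z = y}. pick (k + int n) x = z}"
  using pick(1) by (auto simp: tr_def qsigma)
 moreover have "mset (%x. \<exists>z\<in>{z\<in>X (k + int n). anc n (k + int n) z = y}. pick (k + int n) x = z)"
 proof (rule sets.sets_Collect_countable_Ex')
  show "countable {z\<in>X (k + int n). anc n (k + int n) z = y}" using X_countable by (rule countable_subset[rotated]) auto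
  show "mset (%x. pick (k + int n) x = z)" if "z : {z\<in>X (k + int n). anc n (k + int n) z = y}" for z
   using that by (intro mset_pick) simp
 qed
 ultimately show ?thesis by (simp only:)
qed

lemma mset_recur: "mset (%x. y : recur k x)"
proof (cases "y : X k")
 case True
 have "{x\<in>space qsigma. y : recur k x} = {x\<in>space qsigma. \<forall>m::nat. \<exists>n::nat. m < n & tr k n x = y}"
  using True by (auto simp: recur_def infinite_nat_iff_unbounded)
 moreover have "mset (%x. \<forall>m::nat. \<exists>n::nat. m < n & tr k n x = y)"
 proof -
  have "mset (%x. m < n & tr k n x = y)" for m n :: nat
   using mset_tr[of k n y] by (cases "m < n") simp_all
  note 1 = this
  have "mset (%x. \<exists>n::nat. m < n & tr k n x = y)" for m :: nat
   by (rule sets.sets_Collect_countable_Ex[where P="%n x. m < n & tr k n x = y" and M=qsigma]) (rule 1)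
  note 2 = this
  show ?thesis by (rule sets.sets_Collect_countable_All[where P="%m x. \<exists>n::nat. m < n & tr k n x = y" and M=qsigma]) (rule 2)
 qed
 ultimately show ?thesis by (simp only:)
next
 case False
 then show ?thesis by (simp add: recur_def)
qed

lemma mset_br: "y : X (int n) ==> mset (%x. br n x = y)"
proof (induction n arbitrary: y)
 case 0
 have "mset (%x. first (X 0) (recur 0 x) = y)"
 proof (rule mset_first[OF X_countable])
  show "recur 0 x \<subseteq> X 0 & recur 0 x ~= {}" if "x : space M" for x
   using recur_ne[OF that] by (auto simp: recur_def)
 qed (use mset_recur 0 in auto)
 then show ?case unfolding br.simps(1) .
next
 case (Suc n)
 have "mset (%x. first (X (int (Suc n))) {z\<in>recur (int (Suc n)) x. par (int n) z = br n x} = y)"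
 proof (rule mset_first[OF X_countable])
  show "{z\<in>recur (int (Suc n)) x. par (int n) z = br n x} \<subseteq> X (int (Suc n)) & {z\<in>recur (int (Suc n)) x. par (int n) z = br n x} ~= {}"
   if "x : space M" for x using br_cand_ne[OF that, of n] by (auto simp: recur_def)
  fix z assume z: "z : X (int (Suc n))"
  have "par (int n) z : X (int n)" using par(1) X_space[OF z] by blast
  from sets.sets_Collect_conj[OF Suc.IH[OF this] mset_recur[of z "int (Suc n)"]]
  show "mset (%x. z : {z\<in>recur (int (Suc n)) x. par (int n) z = br n x})"
   unfolding mem_Collect_eq by (subst eq_commute)
 qed (use Suc.prems in auto)
 then show ?case unfolding br.simps(2) .
qed

lemma mset_cen: assumes y: "y : X k" shows "mset (%x. cen k x = y)"
proof (cases "0 <= k")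
 case True
 then show ?thesis using mset_br[of y "nat k"] y by (simp add: cen_def)
next
 case False
 let ?Z = "{z\<in>X 0. anc (nat (- k)) 0 z = y}"
 have "{x\<in>space qsigma. cen k x = y} = {x\<in>space qsigma. \<exists>z\<in>?Z. br 0 x = z}"
  using False br_recur[of _ 0] by (auto simp: cen_def qsigma recur_def)
 moreover have "mset (%x. \<exists>z\<in>?Z. br 0 x = z)"
 proof (rule sets.sets_Collect_countable_Ex')
  show "countable ?Z" using X_countable by (rule countable_subset[rotated]) auto
  show "mset (%x. br 0 x = z)" if "z : ?Z" for z using mset_br[of z 0] that by simp
 qed
 ultimately show ?thesis by (simp only:)
qed

definition cube :: "int => 'a => 'a set" where "cube k a = {x\<in>space M. cen k x = a}"

definition ctr :: "int => 'a set => 'a" where "ctr k Q = (THE a. a : X k & cube k a = Q)"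

lemma cube_center: assumes "a : X k" shows "a : cube k a"
proof -
 have as: "a : space M" using X_space[OF assms] .
 have "d a a = 0" using d_eq_0_iff[OF as as] by simp
 then have "d a a < 1 / (4 * A\<^sup>2) * dlt powi k" using dp[of k] A0_ge_1 by simp
 then show ?thesis using cen_inner[OF as assms] as by (simp add: cube_def)
qed

lemma ctr_cube: assumes a: "a : X k" shows "ctr k (cube k a) = a"
 unfolding ctr_def
proof (rule the_equality)
 show "a : X k & cube k a = cube k a" using a by simp
 fix b assume b: "b : X k & cube k b = cube k a"
 then have "b : cube k a" using cube_center[of b k] by auto
 moreover have "b : cube k b" using cube_center[of b k] b by auto
 ultimately show "b = a" by (simp add: cube_def)
qed

lemma cube_ancestor_dist:
 assumes a: "a : X k" and b: "b : X l" and kl: "k <= l" and sub: "cube l b \<subseteq> cube k a"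
 shows "d a b <= 2 * A * dlt powi k"
proof -
 have bs: "b : space M" using X_space[OF b] .
 have "b : cube l b" by (rule cube_center[OF b])
 then have 1: "cen l b = b" "cen k b = a" using sub by (auto simp: cube_def)
 have "a = anc (nat (l - k)) l b" using cen_anc[OF bs, of l "nat (l - k)"] 1 kl by simp
 then show ?thesis using anc_dist[OF b, of "nat (l - k)"] kl by simp
qed

text \<open>
A cube consists of the points with a given centre. Nesting holds since the centre in a coarser
generation is a function of the one in a finer generation.
\<close>
theorem net_dyadic_system:
 "\<exists>N. dyadic_system M d dlt (1 / (4 * A\<^sup>2)) (5 * A\<^sup>2) N ctr (%k. cube k ` X k)"
proof -
 have A: "1 <= A" using A0_ge_1 .
 have A2: "1 <= A\<^sup>2" using A by simp
 have t: "0 < 1 / dlt" using delta_bounds(1) by simp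
 obtain N where N: "\<forall>s>0. \<forall>Y. separated s Y --> (\<forall>x\<in>space M. finite (Y \<inter> B x (1 / dlt * s)) & card (Y \<inter> B x (1 / dlt * s)) <= N)"
  using separated_count[OF t] by blast
 let ?D = "%k. cube k ` X k"
 have cube_space: "cube k a \<subseteq> space M" for k a by (auto simp: cube_def)
 have nested: "R \<subseteq> Q | R \<inter> Q = {}" if kl: "k <= l" and Q: "Q : ?D k" and R: "R : ?D l" for k l Q R
 proof -
  obtain a b where ab: "Q = cube k a" "R = cube l b" using Q R by auto
  show ?thesis
  proof (cases "R \<inter> Q = {}")
   case False
   then obtain x where x: "x : space M" "cen l x = b" "cen k x = a" using ab by (auto simp: cube_def)
   have "cen k y = a" if "y : space M" "cen l y = b" for y
    using cen_coarser[OF that(1) x(1) kl] that(2) x by simp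
   then have "R \<subseteq> Q" using ab by (auto simp: cube_def)
   then show ?thesis by simp
  qed simp
 qed
 have disj: "Q = R" if "Q : ?D k" "R : ?D k" "x : Q" "x : R" for k Q R x
  using that by (auto simp: cube_def)
 have cover: "\<Union>(?D k) = space M" for k
  using cen_X[of _ k] by (auto simp: cube_def)
 have ball: "ctr k Q : Q & B (ctr k Q) (1 / (4 * A\<^sup>2) * dlt powi k) \<subseteq> Q & Q \<subseteq> B (ctr k Q) (5 * A\<^sup>2 * dlt powi k)"
  if Q: "Q : ?D k" for k Q
 proof -
  obtain a where a: "a : X k" "Q = cube k a" using Q by auto
  have as: "a : space M" using X_space[OF a(1)] .
  have c: "ctr k Q = a" using ctr_cube[OF a(1)] a(2) by simp
  have 1: "a : Q" using cube_center[OF a(1)] a(2) by simp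
  have 2: "B a (1 / (4 * A\<^sup>2) * dlt powi k) \<subseteq> Q"
  proof
   fix x assume "x : B a (1 / (4 * A\<^sup>2) * dlt powi k)"
   then have x: "x : space M" "d a x < 1 / (4 * A\<^sup>2) * dlt powi k" by (auto simp: in_B)
   then show "x : Q" using cen_inner[OF x(1) a(1)] d_sym[OF as x(1)] a(2) by (simp add: cube_def)
  qed
  have 3: "Q \<subseteq> B a (5 * A\<^sup>2 * dlt powi k)"
  proof
   fix x assume "x : Q"
   then have x: "x : space M" "cen k x = a" using a(2) by (auto simp: cube_def)
   have "d x a < 4 * A\<^sup>2 * dlt powi k" using cen_dist[OF x(1), of k] x(2) by simp
   also have "... <= 5 * A\<^sup>2 * dlt powi k" using dp[of k] by (intro mult_right_mono) auto
   finally show "x : B a (5 * A\<^sup>2 * dlt powi k)" using x(1) d_sym[OF as x(1)] by (simp add: in_B)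
  qed
  show ?thesis using 1 2 3 c by simp
 qed
 have ancestor: "\<exists>!R. R : ?D l & Q \<subseteq> R" if lk: "l <= k" and Q: "Q : ?D k" for k l Q
 proof -
  have cQ: "ctr k Q : Q" using ball[OF Q] by simp
  have cs: "ctr k Q : space M" using cQ Q cube_space by auto
  let ?R = "cube l (cen l (ctr k Q))"
  have R: "?R : ?D l" using cen_X[OF cs] by auto
  have "ctr k Q : ?R" using cs by (simp add: cube_def)
  then have "Q \<subseteq> ?R" using nested[OF lk R Q] cQ by auto
  then have 1: "?R : ?D l & Q \<subseteq> ?R" using R by blast
  have 2: "R' = ?R" if R': "R' : ?D l & Q \<subseteq> R'" for R'
  proof (rule disj[of _ l])
   show "R' : ?D l" using R' by blast
   show "ctr k Q : R'" using R' cQ by blast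
  qed fact+
  show ?thesis using 1 2 by (rule ex1I)
 qed
 have children: "\<exists>F\<subseteq>?D (k + 1). finite F & card F <= N & Q = \<Union>F" if Q: "Q : ?D k" for k Q
 proof -
  obtain a where a: "a : X k" "Q = cube k a" using Q by auto
  have as: "a : space M" using X_space[OF a(1)] .
  let ?Y = "{b\<in>X (k + 1). par k b = a}"
  let ?Z = "X (k + 1) \<inter> B a (1 / dlt * dlt powi (k + 1))"
  have e: "1 / dlt * dlt powi (k + 1) = dlt powi k" using delta_bounds(1) by (simp add: dp_Suc)
  have sub: "?Y \<subseteq> ?Z"
  proof
   fix b assume b: "b : ?Y"
   then have bs: "b : space M" using X_space by auto
   have "d b a < dlt powi k" using par(2)[OF bs, of k] b by simp
   then show "b : ?Z" using b bs d_sym[OF as bs] unfolding e by (simp add: in_B)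
  qed
  have Z: "finite ?Z" "card ?Z <= N" using N[rule_format, OF dp Xsep as] by auto
  have fY: "finite ?Y" using sub Z(1) by (rule finite_subset)
  have "card ?Y <= N" using card_mono[OF Z(1) sub] Z(2) by simp
  then have "card (cube (k + 1) ` ?Y) <= N" using card_image_le[OF fY, of "cube (k + 1)"] by simp
  moreover have "Q = \<Union>(cube (k + 1) ` ?Y)"
  proof (intro set_eqI iffI)
   fix x assume "x : Q"
   then have x: "x : space M" "cen k x = a" using a(2) by (auto simp: cube_def)
   then have "cen (k + 1) x : ?Y" using cen_X[OF x(1)] par_cen[OF x(1)] by simp
   then show "x : \<Union>(cube (k + 1) ` ?Y)" using x(1) by (auto simp: cube_def)
  next
   fix x assume "x : \<Union>(cube (k + 1) ` ?Y)"
   then obtain b where b: "par k b = a" "x : space M" "cen (k + 1) x = b" by (auto simp: cube_def)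
   then show "x : Q" using par_cen[OF b(2), of k] a(2) by (simp add: cube_def)
  qed
  ultimately show ?thesis using fY by (intro exI[of _ "cube (k + 1) ` ?Y"]) auto
 qed
 have balls: "B (ctr l R) (5 * A\<^sup>2 * dlt powi l) \<subseteq> B (ctr k Q) (5 * A\<^sup>2 * dlt powi k)"
  if kl: "k <= l" and Q: "Q : ?D k" and R: "R : ?D l" and RQ: "R \<subseteq> Q" for k l Q R
 proof -
  obtain a b where ab: "a : X k" "Q = cube k a" "b : X l" "R = cube l b" using Q R by auto
  have c: "ctr k Q = a" "ctr l R = b" using ctr_cube ab by auto
  show ?thesis
  proof (cases "k = l")
   case True
   have "b : Q" using cube_center[OF ab(3)] RQ ab(4) by auto
   then have "a = b" using cube_center[OF ab(3)] True ab(2) by (simp add: cube_def)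
   then show ?thesis using c True by simp
  next
   case False
   have sp: "a : space M" "b : space M" using X_space ab by auto
   have dab: "d a b <= 2 * A * dlt powi k" using cube_ancestor_dist[OF ab(1,3) kl] RQ ab by simp
   have "dlt powi l <= dlt powi (k + 1)" using False kl delta_bounds by (intro powi_antimono) auto
   then have l1: "dlt powi l <= dlt * dlt powi k" by (simp only: dp_Suc)
   have "B b (5 * A\<^sup>2 * dlt powi l) \<subseteq> B a (A * (d a b + 5 * A\<^sup>2 * dlt powi l))" by (rule B_subset[OF sp(2,1)])
   also have "... \<subseteq> B a (5 * A\<^sup>2 * dlt powi k)"
   proof (rule B_mono)
    have "A * (d a b + 5 * A\<^sup>2 * dlt powi l) <= A * (2 * A * dlt powi k + 5 * A\<^sup>2 * (dlt * dlt powi k))"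
     using dab l1 A by (intro mult_left_mono add_mono) auto
    also have "... = A\<^sup>2 * dlt powi k * (2 + 5 * (A * dlt))" by (simp add: power2_eq_square algebra_simps)
    also have "... <= A\<^sup>2 * dlt powi k * 5"
     using delta_bounds(5) dp[of k] by (intro mult_left_mono) auto
    finally show "A * (d a b + 5 * A\<^sup>2 * dlt powi l) <= 5 * A\<^sup>2 * dlt powi k" by simp
   qed
   finally show ?thesis using c by simp
  qed
 qed
 have "dyadic_system M d dlt (1 / (4 * A\<^sup>2)) (5 * A\<^sup>2) N ctr ?D"
  unfolding dyadic_system_def
 proof (intro conjI allI impI ballI)
  show "0 < dlt" "dlt < 1" using delta_bounds by auto
  show "0 < 1 / (4 * A\<^sup>2)" using A by simp
  show "1 / (4 * A\<^sup>2) <= 5 * A\<^sup>2"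
  proof -
   have "1 / (4 * A\<^sup>2) <= 1" using A2 by (subst divide_le_eq_1_pos) linarith+
   then show ?thesis using A2 by linarith
  qed
  show "countable (?D k)" for k using X_countable by (rule countable_image)
  show "?D k \<subseteq> qborel M d" for k using mset_cen[of _ k] by (auto simp: cube_def qsigma)
  show "disjoint (?D k)" for k using disj[of _ k] unfolding disjoint_def by (auto simp: disjoint_iff)
  show "\<Union>(?D k) = space M" for k by (rule cover)
  show "R \<subseteq> Q | R \<inter> Q = {}" if "k <= l" "Q : ?D k" "R : ?D l" for k l Q R by (rule nested[OF that])
  show "\<exists>!R. R : ?D l & Q \<subseteq> R" if "l <= k" "Q : ?D k" for k l Q by (rule ancestor[OF that])
  show "\<exists>F\<subseteq>?D (k + 1). finite F & card F <= N & Q = \<Union>F" if "Q : ?D k" for k Q by (rule children[OF that])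
  show "ctr k Q : Q" "B (ctr k Q) (1 / (4 * A\<^sup>2) * dlt powi k) \<subseteq> Q" "Q \<subseteq> B (ctr k Q) (5 * A\<^sup>2 * dlt powi k)"
   if "Q : ?D k" for k Q using ball[OF that] by auto
  show "B (ctr l R) (5 * A\<^sup>2 * dlt powi l) \<subseteq> B (ctr k Q) (5 * A\<^sup>2 * dlt powi k)"
   if "k <= l" "Q : ?D k" "R : ?D l" "R \<subseteq> Q" for k l Q R by (rule balls[OF that])
 qed
 then show ?thesis by blast
qed

end

context homogeneous_type
begin

text \<open>
Extend every $P_k$ to a maximal separated set.
\<close>
theorem dyadic_system_with_centers:
 assumes dlt: "dlt = 1 / (16 * A\<^sub>0 ^ 4)" and P: "!!k. separated (dlt powi k) (P k)"
 shows "\<exists>N c D. dyadic_system M d dlt (1 / (4 * A\<^sub>0\<^sup>2)) (5 * A\<^sub>0\<^sup>2) N c D & (\<forall>k. \<forall>x\<in>P k. \<exists>Q\<in>D k. c k Q = x)"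
proof -
 have d0: "0 < dlt" using A0_ge_1 by (simp add: dlt)
 have "\<forall>k. \<exists>Y. P k \<subseteq> Y & separated (dlt powi k) Y & (\<forall>x\<in>space M. \<exists>y\<in>Y. d x y < dlt powi k)"
  using maximal_separated[OF P powi_pos[OF d0]] by blast
 from choice[OF this] obtain X where X: "!!k. P k \<subseteq> X k" "!!k. separated (dlt powi k) (X k)" "!!k. \<forall>x\<in>space M. \<exists>y\<in>X k. d x y < dlt powi k"
  by blast
 interpret dyadic_net M d A\<^sub>0 C\<^sub>\<mu> dlt X
  by unfold_locales (use dlt X in auto)
 obtain N where N: "dyadic_system M d dlt (1 / (4 * A\<^sub>0\<^sup>2)) (5 * A\<^sub>0\<^sup>2) N ctr (%k. cube k ` X k)"
  using net_dyadic_system by blast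
 have "\<exists>Q\<in>cube k ` X k. ctr k Q = x" if "x : P k" for k x
 proof -
  have "x : X k" using X(1) that by blast
  then show ?thesis using ctr_cube[of x k] by blast
 qed
 then show ?thesis using N by blast
qed

end

section \<open>Sequences of large oscillation\<close>

text \<open>
The relation may depend on the position $n$ in the subsequence, so that smallness can be
prescribed in terms of $n$.
\<close>
lemma diagonal_subsequence_choice:
 fixes P :: "nat => nat => nat => bool"
 assumes ev: "!!n i. eventually (P n i) sequentially"
 shows "\<exists>r. strict_mono r & (\<forall>m n. m < n --> P n (r m) (r n))"
proof -
 have "\<forall>n i. \<exists>T. \<forall>j\<ge>T. P n i j" using ev unfolding eventually_sequentially by blast
 then obtain T where T: "!!n i j. T n i <= j ==> P n i j" by metis
 define r where "r = rec_nat 0 (%n a. Suc (a + (\<Sum>i\<le>a. T (Suc n) i)))"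
 have r: "r (Suc n) = Suc (r n + (\<Sum>i\<le>r n. T (Suc n) i))" for n by (simp add: r_def)
 have sm: "strict_mono r" unfolding strict_mono_Suc_iff by (simp add: r)
 have "P n (r m) (r n)" if mn: "m < n" for m n
 proof (cases n)
  case (Suc k)
  have "r m <= r k" using mn Suc sm by (simp add: strict_mono_less_eq)
  then have "T n (r m) <= (\<Sum>i\<le>r k. T n i)" by (intro member_le_sum) auto
  also have "... <= r n" using r[of k] Suc by simp
  finally show ?thesis by (rule T)
 qed (use mn in simp)
 then show ?thesis using sm by (intro exI[of _ r]) simp
qed

text \<open>
If the overlaps vanish, remove from each set all later ones; if the measures tend to infinity,
remove all earlier ones.
\<close>
lemma sparse_selection:
 fixes N :: "'a measure" and \<theta> :: real and Q :: "nat => 'a set"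
 assumes Q: "!!j. Q j : fmeasurable N" "!!j. 0 < measure N (Q j)" and \<theta>: "0 < \<theta>"
  and AB: "(\<forall>i. (%j. measure N (Q i \<inter> Q j)) \<longlonglongrightarrow> 0) | filterlim (%j. measure N (Q j)) at_top sequentially"
 shows "\<exists>r E. strict_mono (r :: nat => nat) & disjoint_family E \<and>
  (\<forall>j. E j : sets N & E j \<subseteq> Q (r j) & measure N (Q (r j) - E j) <= \<theta> * measure N (Q (r j)))"
 using AB
proof
 have sets: "Q j : sets N" for j using Q(1) by auto
 {
  assume A: "\<forall>i. (%j. measure N (Q i \<inter> Q j)) \<longlonglongrightarrow> 0"
  have "eventually (%j. measure N (Q i \<inter> Q j) < \<theta> * measure N (Q i) * (1/2)^(Suc n)) sequentially" for n i
   by (rule order_tendstoD(2)[OF A[rule_format]]) (intro mult_pos_pos \<theta> Q(2), simp)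
  from diagonal_subsequence_choice[of "%n i j. measure N (Q i \<inter> Q j) < \<theta> * measure N (Q i) * (1/2)^(Suc n)", OF this]
  obtain r where r: "strict_mono r" "!!m n. m < n ==> measure N (Q (r m) \<inter> Q (r n)) < \<theta> * measure N (Q (r m)) * (1/2)^(Suc n)"
   by blast
  let ?E = "%m. Q (r m) - (\<Union>n\<in>{m<..}. Q (r n))"
  have Es: "?E m : sets N" for m using sets by (intro sets.Diff sets.countable_UN') auto
  have small: "measure N (Q (r m) - ?E m) <= \<theta> * measure N (Q (r m))" for m
  proof -
   let ?c = "\<theta> * measure N (Q (r m))"
   let ?P = "%n. Q (r m) \<inter> (if m < n then Q (r n) else {})"
   have diff: "Q (r m) - ?E m = (\<Union>n. ?P n)" by (auto split: if_splits)
   have c: "0 < ?c" using \<theta> Q(2) by simp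
   have "emeasure N (Q (r m) - ?E m) <= (\<Sum>n. emeasure N (?P n))"
    unfolding diff by (rule emeasure_subadditive_countably) (use sets in auto)
   also have "... <= (\<Sum>n. ennreal (?c * (1/2)^(Suc n)))"
   proof (intro suminf_le summableI)
    fix n show "emeasure N (?P n) <= ennreal (?c * (1/2)^(Suc n))"
    proof (cases "m < n")
     case True
     have "Q (r m) \<inter> Q (r n) : fmeasurable N" using Q(1) sets by (intro fmeasurable_Int_fmeasurable) auto
     then have "emeasure N (Q (r m) \<inter> Q (r n)) = ennreal (measure N (Q (r m) \<inter> Q (r n)))"
      by (intro emeasure_eq_measure2)
     then show ?thesis using r(2)[OF True] True by (auto intro!: ennreal_leI)
    qed simp
   qed
   also have "... = ennreal (\<Sum>n. ?c * (1/2)^(Suc n))"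
    using c by (intro suminf_ennreal2 sums_summable[OF sums_mult[OF power_half_series, of ?c]]) auto
   also have "(\<Sum>n. ?c * (1/2)^(Suc n)) = ?c"
    using sums_unique[OF sums_mult[OF power_half_series, of ?c]] by simp
   finally show ?thesis unfolding measure_def[of N "Q (r m) - ?E m"] using c by (intro enn2real_leI) auto
  qed
  have disj: "disjoint_family ?E"
  proof (unfold disjoint_family_on_def, intro ballI impI)
   fix m n :: nat assume "m ~= n"
   then consider "m < n" | "n < m" by linarith
   then show "?E m \<inter> ?E n = {}" by cases auto
  qed
  show ?thesis
   by (rule exI[of _ r], rule exI[of _ ?E]) (use r(1) disj Es small in auto)
 }
 {
  assume B: "filterlim (%j. measure N (Q j)) at_top sequentially"
  have "eventually (%j. real (Suc n) * measure N (Q i) / \<theta> <= measure N (Q j)) sequentially" for n i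
   using B unfolding filterlim_at_top by blast
  from diagonal_subsequence_choice[of "%n i j. real (Suc n) * measure N (Q i) / \<theta> <= measure N (Q j)", OF this]
  obtain r where r: "strict_mono r" "!!m n. m < n ==> real (Suc n) * measure N (Q (r m)) / \<theta> <= measure N (Q (r n))"
   by blast
  let ?E = "%n. Q (r n) - (\<Union>m\<in>{..<n}. Q (r m))"
  have Es: "?E m : sets N" for m using sets by (intro sets.Diff sets.finite_UN) auto
  have small: "measure N (Q (r n) - ?E n) <= \<theta> * measure N (Q (r n))" for n
  proof -
   have U: "(\<Union>m\<in>{..<n}. Q (r m)) : fmeasurable N" using Q(1) by (intro fmeasurable.finite_UN) auto
   have "measure N (Q (r n) - ?E n) <= measure N (\<Union>m\<in>{..<n}. Q (r m))"
    using Es sets U by (intro measure_mono_fmeasurable) auto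
   also have "... <= (\<Sum>m\<in>{..<n}. measure N (Q (r m)))" using sets by (intro measure_UNION_le) auto
   also have "... <= (\<Sum>m\<in>{..<n}. \<theta> * measure N (Q (r n)) / real (Suc n))"
   proof (rule sum_mono)
    fix m assume "m : {..<n}"
    then have "real (Suc n) * measure N (Q (r m)) / \<theta> <= measure N (Q (r n))" using r(2)[of m n] by simp
    then have "measure N (Q (r m)) * real (Suc n) <= \<theta> * measure N (Q (r n))"
     using \<theta> by (simp only: pos_divide_le_eq) (simp only: mult.commute)
    then show "measure N (Q (r m)) <= \<theta> * measure N (Q (r n)) / real (Suc n)"
     by (subst pos_le_divide_eq) simp_all
   qed
   also have "... = (real n / real (Suc n)) * (\<theta> * measure N (Q (r n)))" by simp
   also have "... <= 1 * (\<theta> * measure N (Q (r n)))" using \<theta> by (intro mult_right_mono) auto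
   finally show ?thesis by simp
  qed
  have disj: "disjoint_family ?E"
  proof (unfold disjoint_family_on_def, intro ballI impI)
   fix m n :: nat assume "m ~= n"
   then consider "m < n" | "n < m" by linarith
   then show "?E m \<inter> ?E n = {}" by cases auto
  qed
  show ?thesis
   by (rule exI[of _ r], rule exI[of _ ?E]) (use r(1) disj Es small in auto)
 }
qed

context homogeneous_type
begin

lemma unbounded_of_infinite_measure:
 assumes "emeasure M (space M) = \<infinity>" "x\<^sub>0 : space M" shows "\<exists>x\<in>space M. R < d x x\<^sub>0"
proof (rule ccontr)
 assume n: "~ ?thesis"
 have "space M \<subseteq> B x\<^sub>0 (max 1 (R + 1))"
 proof
  fix x assume x: "x : space M"
  then have "d x x\<^sub>0 <= R" using n by auto
  then show "x : B x\<^sub>0 (max 1 (R + 1))" using x d_sym[OF assms(2) x] by (simp add: in_B)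
 qed
 then have "space M = B x\<^sub>0 (max 1 (R + 1))" using B_space by auto
 moreover have "emeasure M (B x\<^sub>0 (max 1 (R + 1))) < \<infinity>" by (rule finite_qball[OF assms(2)]) simp
 ultimately show False using assms(1) by simp
qed

text \<open>
The large and the distant balls of the definition are those for which radius plus distance of the
centre from $x_0$ is large. Since the space is unbounded, the suprema in the third condition are
over nonempty sets.
\<close>
lemma VMO_of_no_bad_sequence:
 fixes b :: "'a => 'b::{banach, second_countable_topology}"
 assumes b: "b : BMO M d \<nu>" and nu: "!!x. 0 <= \<nu> x" and inf: "emeasure M (space M) = \<infinity>" and x0: "x\<^sub>0 : space M"
  and no: "!!eps x r. 0 < eps ==> (!!j. x j : space M) ==> (!!j. 0 < r j) ==> (!!j. eps <= osc M \<nu> b (B (x j) (r j))) ==>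
   r \<longlonglongrightarrow> 0 | filterlim (%j::nat. r j + d (x j) x\<^sub>0) at_top sequentially ==> False"
 shows "b : VMO M d x\<^sub>0 \<nu>"
proof -
 have small: "\<exists>a>0. \<forall>x\<in>space M. \<forall>r>0. r < a --> osc M \<nu> b (B x r) <= eps" if e: "0 < eps" for eps
 proof (rule ccontr)
  assume n: "~ ?thesis"
  have "\<exists>x r. x : space M & 0 < r & r < inverse (real (Suc j)) & eps <= osc M \<nu> b (B x r)" for j
  proof -
   have "0 < inverse (real (Suc j))" by simp
   then have "~ (\<forall>x\<in>space M. \<forall>r>0. r < inverse (real (Suc j)) --> osc M \<nu> b (B x r) <= eps)" using n by blast
   then obtain x r where "x : space M" "0 < r" "r < inverse (real (Suc j))" "~ osc M \<nu> b (B x r) <= eps" by blast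
   then show ?thesis by (intro exI[of _ x] exI[of _ r]) auto
  qed
  then obtain x r where xr: "!!j. x j : space M" "!!j. 0 < r j" "!!j. r j < inverse (real (Suc j))" "!!j. eps <= osc M \<nu> b (B (x j) (r j))"
   by metis
  have "r \<longlonglongrightarrow> 0"
   by (rule tendsto_sandwich[OF _ _ tendsto_const LIMSEQ_inverse_real_of_nat])
     (use xr(2,3) in \<open>auto intro!: always_eventually less_imp_le\<close>)
  then have "r \<longlonglongrightarrow> 0 | filterlim (%j::nat. r j + d (x j) x\<^sub>0) at_top sequentially" ..
  with e xr(1,2,4) show False by (rule no)
 qed
 have big: "\<exists>a. \<forall>x\<in>space M. \<forall>r>0. a < r + d x x\<^sub>0 --> osc M \<nu> b (B x r) <= eps" if e: "0 < eps" for eps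
 proof (rule ccontr)
  assume n: "~ ?thesis"
  have "\<exists>x r. x : space M & 0 < r & real j < r + d x x\<^sub>0 & eps <= osc M \<nu> b (B x r)" for j
  proof -
   have "~ (\<forall>x\<in>space M. \<forall>r>0. real j < r + d x x\<^sub>0 --> osc M \<nu> b (B x r) <= eps)" using n by blast
   then obtain x r where "x : space M" "0 < r" "real j < r + d x x\<^sub>0" "~ osc M \<nu> b (B x r) <= eps" by blast
   then show ?thesis by (intro exI[of _ x] exI[of _ r]) auto
  qed
  then obtain x r where xr: "!!j. x j : space M" "!!j. 0 < r j" "!!j. real j < r j + d (x j) x\<^sub>0" "!!j. eps <= osc M \<nu> b (B (x j) (r j))"
   by metis
  have "filterlim (%j::nat. r j + d (x j) x\<^sub>0) at_top sequentially"
   by (rule filterlim_at_top_mono[OF filterlim_real_sequentially]) (use xr(3) in \<open>auto intro!: always_eventually less_imp_le\<close>)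
  then have "r \<longlonglongrightarrow> 0 | filterlim (%j::nat. r j + d (x j) x\<^sub>0) at_top sequentially" ..
  with e xr(1,2,4) show False by (rule no)
 qed
 have tend: "(f \<longlongrightarrow> 0) F" if ev: "!!eps. 0 < eps ==> eventually (%a. 0 <= f a & f a <= eps) F" for f :: "real => real" and F
 proof (rule tendstoI)
  fix e :: real assume e: "0 < e"
  then have "eventually (%a. 0 <= f a & f a <= e / 2) F" by (intro ev) simp
  then show "eventually (%a. dist (f a) 0 < e) F" by eventually_elim (use e in auto)
 qed
 have osc0: "0 <= osc M \<nu> b E" for E
  by (rule osc_nonneg) (auto simp: set_lebesgue_integral_def nu intro!: integral_nonneg_AE)
 let ?s = "%a. SUP x\<in>space M. osc M \<nu> b (B x a)"
 have sup: "0 <= ?s a & ?s a <= eps"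
  if le: "!!x. x : space M ==> osc M \<nu> b (B x a) <= eps" for a eps
 proof
  have "osc M \<nu> b (B x\<^sub>0 a) <= ?s a"
   by (rule cSUP_upper[OF x0]) (use le in \<open>auto intro!: bdd_aboveI[of _ eps]\<close>)
  then show "0 <= ?s a" using osc0[of "B x\<^sub>0 a"] by linarith
  show "?s a <= eps" using x0 le by (intro cSUP_least) auto
 qed
 have 1: "(?s \<longlongrightarrow> 0) (at_right 0)"
 proof (rule tend)
  fix eps :: real assume "0 < eps"
  from small[OF this] obtain a where a: "0 < a" "!!x r. x : space M ==> 0 < r ==> r < a ==> osc M \<nu> b (B x r) <= eps" by blast
  show "eventually (%a. 0 <= ?s a & ?s a <= eps) (at_right 0)"
   unfolding eventually_at_right_field
   by (rule exI[of _ a], intro conjI[OF a(1)] allI impI) (rule sup, rule a(2))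
 qed
 have 2: "(?s \<longlongrightarrow> 0) at_top"
 proof (rule tend)
  fix eps :: real assume "0 < eps"
  from big[OF this] obtain a where a: "!!x r. x : space M ==> 0 < r ==> a < r + d x x\<^sub>0 ==> osc M \<nu> b (B x r) <= eps" by blast
  show "eventually (%a. 0 <= ?s a & ?s a <= eps) at_top"
   unfolding eventually_at_top_linorder
  proof (rule exI[of _ "max 1 (a + 1)"], intro allI impI, rule sup, rule a)
   fix r x assume "max 1 (a + 1) <= r" "x : space M"
   then show "x : space M" "0 < r" "a < r + d x x\<^sub>0" using d_nonneg[OF _ x0, of x] by auto
  qed
 qed
 let ?A = "%a. {(x, r). x : space M & 0 < r & a < (INF y\<in>B x r. d y x\<^sub>0)}"
 let ?t = "%a. SUP (x, r)\<in>?A a. osc M \<nu> b (B x r)"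
 have 3: "(?t \<longlongrightarrow> 0) at_top"
 proof (rule tend)
  fix eps :: real assume "0 < eps"
  from big[OF this] obtain a where a: "!!x r. x : space M ==> 0 < r ==> a < r + d x x\<^sub>0 ==> osc M \<nu> b (B x r) <= eps" by blast
  have "0 <= ?t a' & ?t a' <= eps" if aa: "a <= a'" for a'
  proof -
   have le: "(case z of (x, r) => osc M \<nu> b (B x r)) <= eps" if z: "z : ?A a'" for z
   proof -
    obtain x r where xr: "z = (x, r)" "x : space M" "0 < r" "a' < (INF y\<in>B x r. d y x\<^sub>0)" using z by auto
    have "(INF y\<in>B x r. d y x\<^sub>0) <= d x x\<^sub>0"
     by (rule cINF_lower[OF _ center_in_B[OF xr(2,3)]]) (use d_nonneg[OF _ x0] in \<open>auto simp: in_B intro!: bdd_belowI[of _ 0]\<close>)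
    then have "a < r + d x x\<^sub>0" using xr aa by linarith
    from a[OF xr(2,3) this] show ?thesis by (simp add: xr(1))
   qed
   obtain x where x: "x : space M" "A\<^sub>0 * (a' + 2) < d x x\<^sub>0" using unbounded_of_infinite_measure[OF inf x0] by blast
   have "a' + 1 <= (INF y\<in>B x 1. d y x\<^sub>0)"
   proof (rule cINF_greatest)
    show "B x 1 ~= {}" using center_in_B[OF x(1), of 1] by auto
    fix y assume "y : B x 1"
    then have y: "y : space M" "d x y < 1" by (auto simp: in_B)
    have "A\<^sub>0 * (a' + 2) < A\<^sub>0 * (d x y + d y x\<^sub>0)" using x(2) d_triangle[OF x(1) x0 y(1)] by linarith
    then have "a' + 2 < d x y + d y x\<^sub>0" using A0_ge_1 by (simp add: mult_less_cancel_left)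
    then show "a' + 1 <= d y x\<^sub>0" using y by linarith
   qed
   then have xA: "(x, 1) : ?A a'" using x(1) by auto
   have "(case (x, 1::real) of (x, r) => osc M \<nu> b (B x r)) <= ?t a'"
    using le by (intro cSUP_upper[OF xA] bdd_aboveI[of _ eps]) (elim imageE, simp only:)
   then have "0 <= ?t a'" using osc0[of "B x 1"] by simp
   moreover have "?t a' <= eps" by (rule cSUP_least[OF _ le]) (use xA in blast)
   ultimately show ?thesis by simp
  qed
  then show "eventually (%a. 0 <= ?t a & ?t a <= eps) at_top"
   unfolding eventually_at_top_linorder by (intro exI[of _ a] allI impI)
 qed
 show ?thesis unfolding VMO_def using b 1 2 3 by simp
qed

text \<open>
Otherwise some point lies in infinitely many of the sets with overlap at least $e$, so that all
balls around it have measure at least $e$ and it is an atom.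
\<close>
lemma shrinking_sets_vanish:
 assumes N: "sets N = sets M" and G: "G : fmeasurable N" and fin: "!!y r. y : space M ==> 0 < r ==> B y r : fmeasurable N"
  and atom: "!!y. y : space M ==> measure N {y} = 0"
  and Q: "!!j. Q j : sets M" "!!j. Q j \<subseteq> B (x j) (s j)" "!!j. x j : space M" and s: "s \<longlonglongrightarrow> 0"
 shows "(%j. measure N (G \<inter> Q j)) \<longlonglongrightarrow> 0"
proof (rule ccontr)
 assume "~ ?thesis"
 then obtain e where e: "0 < e" "!!n. \<exists>j\<ge>n. e <= measure N (G \<inter> Q j)"
  unfolding LIMSEQ_def by (auto simp: not_less)
 have "\<forall>n. \<exists>j. n <= j & e <= measure N (G \<inter> Q j)" using e(2) by blast
 from choice[OF this] obtain J where J: "!!n. n <= J n" "!!n. e <= measure N (G \<inter> Q (J n))" by blast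
 let ?A = "%n. \<Union>m\<in>{n..}. G \<inter> Q (J m)"
 have Gs: "G : sets N" using G by auto
 have As: "?A n : sets N" for n using Gs Q(1) N by (intro sets.countable_UN') auto
 have AG: "?A n \<subseteq> G" for n by auto
 have Af: "?A n : fmeasurable N" for n by (rule fmeasurableI2[OF G AG As])
 have "e <= measure N (?A n)" for n
 proof (rule order_trans[OF J(2)[of n]])
  show "measure N (G \<inter> Q (J n)) <= measure N (?A n)"
   using Gs Q(1) N Af by (intro measure_mono_fmeasurable) auto
 qed
 moreover have "(%n. measure N (?A n)) \<longlonglongrightarrow> measure N (\<Inter>n. ?A n)"
 proof (rule Lim_measure_decseq)
  show "range ?A \<subseteq> sets N" using As by blast
  show "emeasure N (?A n) ~= \<infinity>" for n using fmeasurableD2[OF Af] by simp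
  show "decseq ?A" unfolding decseq_def by (intro allI impI UN_mono) auto
 qed
 ultimately have "e <= measure N (\<Inter>n. ?A n)" by (intro LIMSEQ_le_const) auto
 then have "(\<Inter>n. ?A n) ~= {}" using e(1) by (intro notI) (simp only: measure_empty)
 then obtain y where y: "!!n. y : ?A n" by blast
 have ys: "y : space M" using y[of 0] sets.sets_into_space[OF Gs] sets_eq_imp_space_eq[OF N] by auto
 have ball: "e <= measure N (B y \<rho>)" if \<rho>: "0 < \<rho>" for \<rho>
 proof -
  have "0 < \<rho> / (2 * A\<^sub>0)" using \<rho> A0_ge_1 by simp
  from order_tendstoD(2)[OF s this] obtain n where n: "!!j. n <= j ==> s j < \<rho> / (2 * A\<^sub>0)"
   unfolding eventually_sequentially by blast
  obtain m where m: "n <= m" "y : Q (J m)" using y[of n] by auto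
  let ?j = "J m"
  have sj: "s ?j < \<rho> / (2 * A\<^sub>0)" using n[of ?j] m(1) J(1)[of m] by linarith
  have dy: "d (x ?j) y < s ?j" using m(2) Q(2)[of ?j] by (auto simp: in_B)
  have "Q ?j \<subseteq> B y (A\<^sub>0 * (d y (x ?j) + s ?j))" using Q(2)[of ?j] B_subset[OF Q(3)[of ?j] ys, of "s ?j"] by (rule order_trans)
  also have "... \<subseteq> B y \<rho>"
  proof (rule B_mono)
   have "A\<^sub>0 * (d y (x ?j) + s ?j) <= A\<^sub>0 * (\<rho> / (2 * A\<^sub>0) + \<rho> / (2 * A\<^sub>0))"
    using sj dy d_sym[OF ys Q(3)] A0_ge_1 by (intro mult_left_mono) auto
   also have "... = \<rho>" using A0_ge_1 by simp
   finally show "A\<^sub>0 * (d y (x ?j) + s ?j) <= \<rho>" .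
  qed
  finally have sub: "G \<inter> Q ?j \<subseteq> B y \<rho>" by auto
  have "measure N (G \<inter> Q ?j) <= measure N (B y \<rho>)"
   by (rule measure_mono_fmeasurable[OF sub _ fin[OF ys \<rho>]]) (use Gs Q(1) N in auto)
  then show ?thesis using J(2)[of m] by linarith
 qed
 let ?B = "%n. B y (inverse (real (Suc n)))"
 have fB: "?B n : fmeasurable N" for n by (rule fin[OF ys]) simp
 have "(%n. measure N (?B n)) \<longlonglongrightarrow> measure N (\<Inter>n. ?B n)"
 proof (rule Lim_measure_decseq)
  show "range ?B \<subseteq> sets N" using fB by auto
  show "emeasure N (?B n) ~= \<infinity>" for n using fmeasurableD2[OF fB] by simp
  show "decseq ?B" unfolding decseq_def by (intro allI impI B_mono le_imp_inverse_le) auto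
 qed
 moreover have "(\<Inter>n. ?B n) = {y}"
 proof (intro set_eqI iffI)
  fix z assume z: "z : (\<Inter>n. ?B n)"
  then have zs: "z : space M" and lt: "d y z < inverse (real (Suc n))" for n by (auto simp: in_B)
  have "d y z <= 0" using LIMSEQ_le_const[OF LIMSEQ_inverse_real_of_nat, of "d y z"] lt less_imp_le by blast
  then have "d y z = 0" using d_nonneg[OF ys zs] by simp
  then show "z : {y}" using d_eq_0_iff[OF ys zs] by simp
 qed (use center_in_B[OF ys] in auto)
 ultimately have "(%n. measure N (?B n)) \<longlonglongrightarrow> 0" using atom[OF ys] by simp
 moreover have "e <= measure N (?B n)" for n by (rule ball) simp
 ultimately have "e <= 0" by (intro LIMSEQ_le_const) auto
 then show False using e(1) by simp
qed

end

lemma powr_powr_inverse: "0 < t ==> 0 < a ==> (t powr a) powr (1 / a) = (t :: real)"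
 by (simp add: powr_powr)

context bloom_setting
begin

lemma inv_q_nonneg: "0 <= 1/q" using p by (intro divide_nonneg_nonneg) auto

lemma sig2_ball: assumes "x : space M" "0 < r" shows "set_integrable M (B x r) sig2" "0 < Iset M sig2 (B x r)"
 using Kap(3)[OF assms] Ap_on_pos(2)[OF W.dw2 Kap(3)[OF assms]] by (auto simp: Ap_on_def)

lemma sig2_compare:
 assumes "x : space M" "0 < r" "F : sets M" "F \<subseteq> B x r" "0 < \<eta>" "\<eta> * measure M (B x r) <= measure M F"
 shows "Iset M sig2 (B x r) powr (1/q) <= (Kap / \<eta>) * Iset M sig2 F powr (1/q)"
 by (rule Ap_on_sub_weight[OF dual_w_sym[OF W.dw2] Kap(1) Ap_on_sym[OF Kap(3)[OF assms(1,2)]] assms(3-6)])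

text \<open>
If the $\sigma$-measures of the balls were bounded, all but a small part of it would lie in one
ball. The rest of a much larger ball has at least half of its $\mu$-measure, and by the $A_p$
condition a fixed share of its $\sigma$-measure.
\<close>
lemma sig2_balls_at_top:
 assumes inf: "emeasure M (space M) = \<infinity>" and x0: "x\<^sub>0 : space M"
 shows "filterlim (%n. Iset M sig2 (B x\<^sub>0 (real (Suc n)))) at_top sequentially"
proof (rule ccontr)
 let ?B = "%n::nat. B x\<^sub>0 (real (Suc n))" let ?s = "%n. Iset M sig2 (?B n)"
 have Bs: "?B n : sets M" for n using qball_sets[OF x0] by simp
 have int: "set_integrable M (?B n) sig2" for n using sig2_ball(1)[OF x0] by simp
 have nn: "!!x. x : space M ==> 0 <= sig2 x" by simp
 have sub: "?B m \<subseteq> ?B n" if "m <= n" for m n using that by (intro B_mono) simp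
 have inc: "incseq ?s" unfolding incseq_def using I_mono[OF int nn Bs sub] by blast
 assume "~ filterlim ?s at_top sequentially"
 then obtain Z where Z: "~ eventually (%n. Z <= ?s n) sequentially" unfolding filterlim_at_top by blast
 have "?s n <= Z" for n
 proof (rule ccontr)
  assume "~ ?s n <= Z"
  then have "\<forall>m\<ge>n. Z <= ?s m" using inc unfolding incseq_def by (meson linear order_trans)
  then show False using Z unfolding eventually_sequentially by blast
 qed
 from incseq_convergent[OF inc] this obtain L where L: "?s \<longlonglongrightarrow> L" "!!n. ?s n <= L" by (metis)
 have s0: "0 < ?s 0" using sig2_ball(2)[OF x0, of "real (Suc 0)"] by simp
 \<comment> \<open>Small enough to contradict the $A_p$ comparison, whose constant is $2$ \<open>Kap\<close>.\<close>
 define \<eta> where "\<eta> = (?s 0 powr (1/q) / (4 * Kap)) powr q"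
 have q: "0 < q" using p by simp
 have t: "0 < ?s 0 powr (1/q) / (4 * Kap)" using s0 Kap(1) by simp
 have \<eta>: "0 < \<eta>" "\<eta> powr (1/q) = ?s 0 powr (1/q) / (4 * Kap)"
  unfolding \<eta>_def by (rule powr_gt_zero[THEN iffD2], use t in linarith) (rule powr_powr_inverse[OF t q])
 have "L - \<eta> < L" using \<eta>(1) by simp
 from order_tendstoD(1)[OF L(1) this] obtain n0 where n0: "L - \<eta> < ?s n0" unfolding eventually_sequentially by blast
 have "(%n. emeasure M (?B n)) \<longlonglongrightarrow> emeasure M (\<Union>n. ?B n)"
  using Bs sub by (intro Lim_emeasure_incseq) (auto simp: incseq_def)
 moreover have "(\<Union>n. ?B n) = space M"
 proof (intro equalityI subsetI)
  fix x assume x: "x : space M"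
  obtain n :: nat where "d x\<^sub>0 x < real n" using reals_Archimedean2 by blast
  then have "x : ?B n" using x by (simp add: in_B)
  then show "x : (\<Union>n. ?B n)" by blast
 qed (use B_space in auto)
 ultimately have "(%n. emeasure M (?B n)) \<longlonglongrightarrow> \<infinity>" using inf by simp
 then have "eventually (%n. ennreal (2 * measure M (?B n0)) < emeasure M (?B n)) sequentially"
  by (rule order_tendstoD(1)) simp
 then obtain n1 where n1: "!!n. n1 <= n ==> ennreal (2 * measure M (?B n0)) < emeasure M (?B n)"
  unfolding eventually_sequentially by blast
 define n where "n = max n0 n1"
 have n: "n0 <= n" "ennreal (2 * measure M (?B n0)) < emeasure M (?B n)" using n1[of n] by (auto simp: n_def)
 have fm: "?B n0 : fmeasurable M" "?B n : fmeasurable M" using B_fmeasurable[OF x0] by auto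
 have "2 * measure M (?B n0) < measure M (?B n)"
  using n(2) emeasure_B[OF x0, of "real (Suc n)"] by (simp add: ennreal_less_iff)
 moreover have "measure M (?B n - ?B n0) = measure M (?B n) - measure M (?B n0)"
  using fm sub[OF n(1)] by (intro measurable_measure_Diff) auto
 ultimately have half: "1/2 * measure M (?B n) <= measure M (?B n - ?B n0)" by linarith
 let ?F = "?B n - ?B n0"
 have Fs: "?F : sets M" using Bs by blast
 have intF: "set_integrable M ?F sig2" by (rule set_integrable_sub[OF int Fs]) blast
 have "?s n powr (1/q) <= (Kap / (1/2)) * Iset M sig2 ?F powr (1/q)"
  by (rule sig2_compare[OF x0 _ Fs _ _ half]) auto
 moreover have "Iset M sig2 ?F <= \<eta>"
 proof -
  have "?F \<union> ?B n0 = ?B n" using sub[OF n(1)] by blast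
  then have "?s n = Iset M sig2 (?F \<union> ?B n0)" by (simp only:)
  also have "... = Iset M sig2 ?F + ?s n0" by (rule set_integral_Un[OF _ intF int]) auto
  finally show ?thesis using L(2)[of n] n0 by linarith
 qed
 moreover have "0 <= Iset M sig2 ?F" by (rule nn_I(2)[OF intF nn])
 ultimately have "?s n powr (1/q) <= (Kap / (1/2)) * \<eta> powr (1/q)"
  using Kap(1) q powr_mono2[of "1/q" "Iset M sig2 ?F" \<eta>] by (smt (verit, best) divide_nonneg_nonneg mult_left_mono)
 also have "... = ?s 0 powr (1/q) / 2" unfolding \<eta>(2) using Kap(1) by simp
 also have "... < ?s 0 powr (1/q)" using s0 by simp
 also have "... <= ?s n powr (1/q)"
 proof (rule powr_mono2)
  show "0 <= 1/q" by (rule inv_q_nonneg)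
  show "0 <= ?s 0" using s0 by linarith
  show "?s 0 <= ?s n" using inc unfolding incseq_def by blast
 qed
 finally show False by simp
qed

end

section \<open>Failure of compactness\<close>

lemma set_integral_indicator_one:
 assumes "R : sets M" "Q : sets M" "emeasure M Q < \<infinity>"
 shows "avg M R (%x. (indicator Q x / a) *\<^sub>R (1 :: 'k::{real_normed_field, euclidean_space})) = (measure M (R \<inter> Q) / (measure M R * a)) *\<^sub>R 1"
proof -
 have RQ: "R \<inter> Q : sets M" "emeasure M (R \<inter> Q) < \<infinity>"
  using assms emeasure_mono[of "R \<inter> Q" Q M] by (auto intro: le_less_trans)
 have i: "integrable M (indicator (R \<inter> Q) :: _ => real)" using RQ by simp
 have "(LINT x:R|M. (indicator Q x / a) *\<^sub>R (1 :: 'k)) = (LINT x|M. indicator (R \<inter> Q) x *\<^sub>R ((1 / a) *\<^sub>R (1 :: 'k)))"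
  unfolding set_lebesgue_integral_def by (intro Bochner_Integration.integral_cong) (auto simp: indicator_def)
 also have "... = (LINT x|M. (indicator (R \<inter> Q) x :: real)) *\<^sub>R ((1 / a) *\<^sub>R (1 :: 'k))"
  by (rule integral_scaleR_left) (rule i)
 also have "(LINT x|M. (indicator (R \<inter> Q) x :: real)) = measure M (R \<inter> Q)"
  using RQ sets.sets_into_space[OF RQ(1)] by (simp add: Int_absorb2)
 finally show ?thesis by (simp add: avg_def)
qed

text \<open>
The integrals of $|g|^pw$ over disjoint sets are summable.
\<close>
lemma WL_restrict_vanish:
 fixes g :: "'a => real"
 assumes g: "WL M p w g A" and p: "0 < p" and w: "w : borel_measurable M" "!!x. x : space M ==> 0 <= w x"
  and E: "disjoint_family E" "!!n::nat. E n : sets M"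
 shows "\<exists>Y. (\<forall>n. WL M p w (%x. g x * indicator (E n) x) (Y n)) & Y \<longlonglongrightarrow> 0"
proof -
 have gm: "g : borel_measurable M" using g by (simp add: WL_def)
 let ?\<phi> = "%x. ennreal (\<bar>g x\<bar> powr p * w x)"
 have \<phi>: "?\<phi> : borel_measurable M" using gm w(1) by measurable
 define N where "N = density M ?\<phi>"
 have em: "emeasure N X = (\<integral>\<^sup>+x. ?\<phi> x * indicator X x \<partial>M)" if "X : sets M" for X
  unfolding N_def by (rule emeasure_density[OF \<phi> that])
 have sN: "sets N = sets M" "space N = space M" by (simp_all add: N_def)
 have "emeasure N (space N) <= (\<integral>\<^sup>+x. ?\<phi> x \<partial>M)"
  unfolding sN em[OF sets.top] by (intro nn_integral_mono) (auto simp: indicator_def)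
 also have "... <= ennreal (A powr p)" using g by (simp add: WL_def)
 finally have "emeasure N (space N) < \<infinity>" by (rule le_less_trans) simp
 then interpret N: finite_measure N by (intro finite_measureI) auto
 have "(%n. measure N (E n)) sums measure N (\<Union>n. E n)"
  by (rule N.finite_measure_UNION) (use E sN in auto)
 then have "(%n. measure N (E n)) \<longlonglongrightarrow> 0" using sums_summable summable_LIMSEQ_zero by blast
 then have "(%n. measure N (E n) powr (1/p)) \<longlonglongrightarrow> 0"
  by (rule tendsto_zero_powrI[OF _ tendsto_const]) (use p in auto)
 moreover have "WL M p w (%x. g x * indicator (E n) x) (measure N (E n) powr (1/p))" for n
  unfolding WL_def
 proof (intro conjI)
  show "(%x. g x * indicator (E n) x) : borel_measurable M" using gm E(2)[of n] by measurable
  have "(\<integral>\<^sup>+x. ennreal (\<bar>g x * indicator (E n) x\<bar> powr p * w x) \<partial>M) = (\<integral>\<^sup>+x. ?\<phi> x * indicator (E n) x \<partial>M)"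
   using p by (intro nn_integral_cong) (auto simp: indicator_def)
  also have "... = emeasure N (E n)" using em[OF E(2)] by simp
  also have "... = ennreal (measure N (E n))" by (rule N.emeasure_eq_measure)
  also have "measure N (E n) = (measure N (E n) powr (1/p)) powr p" using p by (simp add: powr_powr)
  finally show "(\<integral>\<^sup>+x. ennreal (\<bar>g x * indicator (E n) x\<bar> powr p * w x) \<partial>M) <= ennreal ((measure N (E n) powr (1/p)) powr p)" by simp
 qed simp
 ultimately show ?thesis by (intro exI[of _ "%n. measure N (E n) powr (1/p)"]) simp
qed

lemma ennreal_add_right_cancel: "a + ennreal h <= b + ennreal h ==> a <= b"
 by (simp add: add.commute[of _ "ennreal h"] ennreal_add_left_cancel_le)

context bloom_dyadic
begin

text \<open>
The $A_p$ condition bounds relative $\mu$-measure by a power of relative $\sigma$-measure.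
\<close>
lemma small_sig2_small_measure:
 assumes Q: "Q : D k" and F: "F : sets M" "F \<subseteq> Q"
  and \<theta>: "0 < \<theta>" "Kap * Ccb * \<theta> powr (1/q) <= 1/4" and le: "Iset M sig2 F <= \<theta> * Iset M sig2 Q"
 shows "measure M F <= measure M Q / 3"
proof (rule ccontr)
 have q: "0 < q" using p by simp
 have iQ: "set_integrable M Q sig2" using Ap_on_cube(2)[OF Q] by (simp add: Ap_on_def)
 have sQ: "0 < Iset M sig2 Q" using Ap_on_pos(2)[OF W.dw2 Ap_on_cube(2)[OF Q]] .
 have sF: "0 <= Iset M sig2 F" by (rule nn_I(2)[OF set_integrable_sub[OF iQ F]]) simp
 assume "~ ?thesis"
 then have m: "1/3 * measure M Q <= measure M F" by simp
 have "Iset M sig2 Q powr (1/q) <= (Kap * Ccb / (1/3)) * Iset M sig2 F powr (1/q)"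
  by (rule Ap_on_sub_weight[OF dual_w_sym[OF W.dw2] KC_pos Ap_on_sym[OF Ap_on_cube(2)[OF Q]] F _ m]) simp
 also have "... <= (Kap * Ccb / (1/3)) * (\<theta> * Iset M sig2 Q) powr (1/q)"
   proof (intro mult_left_mono powr_mono2)
  show "0 <= Kap * Ccb / (1/3)" using KC_pos by simp
 qed (fact inv_q_nonneg sF le)+
 also have "... = 3 * (Kap * Ccb * \<theta> powr (1/q)) * Iset M sig2 Q powr (1/q)" by (simp only: powr_mult) simp
 also have "... <= 3 * (1/4) * Iset M sig2 Q powr (1/q)" using \<theta>(2) by (intro mult_right_mono mult_left_mono) auto
 finally have "Iset M sig2 Q powr (1/q) <= 0" by simp
 then show False using sQ by simp
qed

text \<open>
The integral of $|b-b_Q|$ over all of $Q$ is at least $\varepsilon\nu(Q)$. Over $Q\setminus E$ it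
is at most half as large, by Hoelder with \<open>John_Nirenberg\<close>.
\<close>
lemma osc_mass_off_small_set:
 fixes b :: "'a => 'b::{banach, second_countable_topology}"
 assumes bl: "b : L1_loc M d" and C: "0 <= C" "!!Q. Q : L.cubes ==> osc M \<nu> b Q <= C"
  and Q: "Q : D k" and e: "eps <= osc M \<nu> b Q" "0 < eps" and E: "E : sets M" "E \<subseteq> Q"
  and \<theta>: "0 < \<theta>" "C * Kmain 1 1 * (Kap * Ccb)\<^sup>2 * \<theta> powr (1/q) <= eps / 2"
  and le: "Iset M sig2 (Q - E) <= \<theta> * Iset M sig2 Q"
 shows "ennreal (eps / (2 * (Kap * Ccb)\<^sup>2) * (Iset M lam1 Q powr (1/p) * Iset M sig2 Q powr (1/q))) <= (\<integral>\<^sup>+x. ennreal (dv b Q x * indicator E x) \<partial>M)"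
proof -
 let ?A = "Kap * Ccb" let ?l = "Iset M lam1 Q powr (1/p)" let ?s = "Iset M sig2 Q powr (1/q)" let ?K = "C * Kmain 1 1"
 have q: "0 < q" using p by simp
 have Qc: "Q : L.cubes" using Q by (auto simp: L.cubes_def)
 have Qs: "Q : sets M" using D_meas[OF Q] .
 have A: "0 < ?A" by (rule KC_pos)
 have iQ: "set_integrable M Q sig2" using Ap_on_cube(2)[OF Q] by (simp add: Ap_on_def)
 have Fs: "Q - E : sets M" using Qs E by blast
 have iF: "set_integrable M (Q - E) sig2" by (rule set_integrable_sub[OF iQ Fs]) blast
 have sF: "0 <= Iset M sig2 (Q - E)" by (rule nn_I(2)[OF iF]) simp
 have K: "0 <= ?K" using C(1) Kmain_nonneg[of 1 1] by simp
 have nu: "?l * ?s <= ?A\<^sup>2 * Iset M \<nu> Q" using W.nu_lower(1)[OF Ap_on_cube[OF Q] A A] by (simp add: power2_eq_square)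
 have nuQ: "0 < Iset M \<nu> Q" by (rule nu_pos[OF Q])
 have dvm: "dv b Q : borel_measurable M" by (rule dv_meas[OF bl Qc])
 have "WL M q sig2 (indicator (Q - E)) (Iset M sig2 (Q - E) powr (1/q))"
  by (rule WL_indicator[OF iF _ Fs q]) simp
 from Holder_weighted[OF W.dw2 John_Nirenberg[OF bl C Qc] this]
 have "(\<integral>\<^sup>+x. ennreal \<bar>dv b Q x * indicator (Q - E) x\<bar> \<partial>M) <= ennreal (?K * ?l * Iset M sig2 (Q - E) powr (1/q))" .
 also have "?K * ?l * Iset M sig2 (Q - E) powr (1/q) <= ?K * ?l * (\<theta> * Iset M sig2 Q) powr (1/q)"
 proof (rule mult_left_mono[OF powr_mono2])
  show "0 <= ?K * ?l" using K by (rule mult_nonneg_nonneg) simp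
 qed (fact inv_q_nonneg sF le)+
 also have "... = ?K * \<theta> powr (1/q) * (?l * ?s)" by (simp only: powr_mult mult_ac)
 also have "... <= ?K * \<theta> powr (1/q) * (?A\<^sup>2 * Iset M \<nu> Q)" using K nu by (intro mult_left_mono) auto
 also have "... = (?K * ?A\<^sup>2 * \<theta> powr (1/q)) * Iset M \<nu> Q" by (simp only: mult_ac)
 also have "... <= (eps / 2) * Iset M \<nu> Q" using \<theta>(2) nuQ by (intro mult_right_mono) auto
 finally have off: "(\<integral>\<^sup>+x. ennreal \<bar>dv b Q x * indicator (Q - E) x\<bar> \<partial>M) <= ennreal ((eps / 2) * Iset M \<nu> Q)"
  by (simp add: ennreal_leI)
 have bQ: "set_integrable M Q b" by (rule local_int[OF bl Q])
 have "set_integrable M Q (%x. b x - avg M Q b)"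
  using bQ Qs L.cubes_fin[OF Qc] by (intro set_integral_diff) (auto simp: set_integrable_def)
 then have i: "set_integrable M Q (%x. norm (b x - avg M Q b))" by (rule set_integrable_norm)
 have "ennreal (eps * Iset M \<nu> Q) <= ennreal (osc M \<nu> b Q * Iset M \<nu> Q)" using e nuQ by (intro ennreal_leI mult_right_mono) auto
 also have "... = ennreal (LINT x:Q|M. norm (b x - avg M Q b))" using nuQ by (simp add: osc_def)
 also have "... = (\<integral>\<^sup>+x\<in>Q. ennreal (norm (b x - avg M Q b)) \<partial>M)" by (rule nn_I(1)[OF i, symmetric]) simp
 also have "... = (\<integral>\<^sup>+x. ennreal (dv b Q x * indicator E x) + ennreal \<bar>dv b Q x * indicator (Q - E) x\<bar> \<partial>M)"
  using E(2) by (intro nn_integral_cong) (auto simp: indicator_def)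
 also have "... = (\<integral>\<^sup>+x. ennreal (dv b Q x * indicator E x) \<partial>M) + (\<integral>\<^sup>+x. ennreal \<bar>dv b Q x * indicator (Q - E) x\<bar> \<partial>M)"
  by (intro nn_integral_add measurable_compose[OF _ measurable_ennreal] borel_measurable_abs)
    (rule borel_measurable_times[OF dvm borel_measurable_indicator], fact)+
 also have "... <= (\<integral>\<^sup>+x. ennreal (dv b Q x * indicator E x) \<partial>M) + ennreal ((eps / 2) * Iset M \<nu> Q)"
  using off by (rule add_left_mono)
 finally have m: "ennreal (eps * Iset M \<nu> Q) <= (\<integral>\<^sup>+x. ennreal (dv b Q x * indicator E x) \<partial>M) + ennreal ((eps / 2) * Iset M \<nu> Q)" .
 have "ennreal (eps * Iset M \<nu> Q) = ennreal ((eps / 2) * Iset M \<nu> Q) + ennreal ((eps / 2) * Iset M \<nu> Q)"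
  using e nuQ by (subst ennreal_plus[symmetric]) auto
 with m have "ennreal ((eps / 2) * Iset M \<nu> Q) + ennreal ((eps / 2) * Iset M \<nu> Q) <= (\<integral>\<^sup>+x. ennreal (dv b Q x * indicator E x) \<partial>M) + ennreal ((eps / 2) * Iset M \<nu> Q)"
  by (simp only:)
 then have "ennreal ((eps / 2) * Iset M \<nu> Q) <= (\<integral>\<^sup>+x. ennreal (dv b Q x * indicator E x) \<partial>M)"
  by (rule ennreal_add_right_cancel)
 moreover have "eps / (2 * ?A\<^sup>2) * (?l * ?s) <= (eps / 2) * Iset M \<nu> Q"
 proof -
  have "eps / (2 * ?A\<^sup>2) * (?l * ?s) <= eps / (2 * ?A\<^sup>2) * (?A\<^sup>2 * Iset M \<nu> Q)"
   using nu e(2) by (intro mult_left_mono) auto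
  also have "... = (eps / 2) * Iset M \<nu> Q"
  proof -
   have "eps / (2 * X) * (X * v) = (eps / 2) * v" if "0 < X" for X v :: real using that by simp
   from this[OF zero_less_power[OF A]] show ?thesis .
  qed
  finally show ?thesis .
 qed
 ultimately show ?thesis by (meson ennreal_leI order_trans)
qed

text \<open>
All terms of the series are nonnegative multiples of $1$, and the one for $Q$ has mean $1/a$.
\<close>
lemma bloom_sparse_indicator_ge:
 fixes b :: "'a => 'k::{real_normed_field, euclidean_space}"
 assumes S: "S \<subseteq> L.cubes" "Q : S" and a: "0 < a"
  and f: "f = (%x. (indicator Q x / a) *\<^sub>R (1::'k))"
  and s: "(%R. norm (dv b R x *\<^sub>R avg M R f)) summable_on S"
 shows "dv b Q x / a <= norm (bloom_sparse M S b f x)"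
proof -
 let ?t = "%R. measure M (R \<inter> Q) / (measure M R * a)"
 have Qc: "Q : L.cubes" using S by blast
 have av: "avg M R f = ?t R *\<^sub>R 1" if "R : S" for R
  unfolding f using that S L.cubes_sets L.cubes_fin[OF Qc] by (intro set_integral_indicator_one) auto
 let ?s = "%R. dv b R x * ?t R"
 have s0: "0 <= ?s R" for R using a by (auto simp: indicator_def)
 have "(%R. norm (dv b R x *\<^sub>R avg M R f)) summable_on S \<longleftrightarrow> ?s summable_on S"
 proof (rule summable_on_cong)
  fix R assume "R : S"
  from av[OF this] have "norm (dv b R x *\<^sub>R avg M R f) = \<bar>?s R\<bar>" by (simp only: scaleR_scaleR norm_scaleR norm_one mult_1_right)
  then show "norm (dv b R x *\<^sub>R avg M R f) = ?s R" using s0[of R] by (simp only: abs_of_nonneg)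
 qed
 with s have sum: "?s summable_on S" by blast
 have "bloom_sparse M S b f x = (\<Sum>\<^sub>\<infinity>R\<in>S. ?s R *\<^sub>R (1::'k))"
  unfolding bloom_sparse_def by (intro infsum_cong) (simp only: av scaleR_scaleR)
 also have "... = infsum ?s S *\<^sub>R 1" by (rule infsum_scaleR_left) (rule sum)
 finally have n: "norm (bloom_sparse M S b f x) = \<bar>infsum ?s S\<bar>" by (simp only: norm_scaleR norm_one mult_1_right)
 have "sum ?s {Q} <= infsum ?s S" by (rule finite_sum_le_infsum[OF sum]) (use S s0 in auto)
 moreover have "?s Q = dv b Q x / a" using L.cubes_pos[OF Qc] by simp
 ultimately show ?thesis unfolding n by simp
qed

text \<open>
Let $h_j$ be the image of the normalised indicator of $Q_j$ and suppose that a subsequence tends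
to $g$. On $E_j$ the norm of $h_j$ is at least $c$, while the norms of $h_j-g$ and of $g$
restricted to the disjoint sets $E_j$ tend to zero.
\<close>
theorem not_compact_of_disjoint_major_parts:
 fixes b :: "'a => 'k::{real_normed_field, euclidean_space}"
 assumes bB: "b : BMO M d \<nu>" and C: "0 <= C" "!!Q. Q : L.cubes ==> osc M \<nu> b Q <= C" and e: "0 < eps"
  and Q: "!!j::nat. Q j : L.cubes" "!!j. eps <= osc M \<nu> b (Q j)"
  and E: "disjoint_family E" "!!j. E j : sets M" "!!j. E j \<subseteq> Q j" "!!j. Iset M sig2 (Q j - E j) <= \<theta> * Iset M sig2 (Q j)"
  and \<theta>: "0 < \<theta>" "C * Kmain 1 1 * (Kap * Ccb)\<^sup>2 * \<theta> powr (1/q) <= eps / 2" "Kap * Ccb * \<theta> powr (1/q) <= 1/4"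
 shows "\<exists>Es. L.sparse (range Q) Es (1/2) 1" "~ compact_Lp_op M p lam1 lam2 (bloom_sparse M (range Q) b :: ('a => 'k) => 'a => 'k)"
proof -
 have bl: "b : L1_loc M d" using bB by (simp add: BMO_def)
 have q: "0 < q" using p by simp
 have big: "2/3 * measure M (Q j) <= measure M (E j)" for j
 proof -
  obtain k where k: "Q j : D k" using cubes_level[OF Q(1)] by blast
  have "measure M (Q j - E j) <= measure M (Q j) / 3"
   by (rule small_sig2_small_measure[OF k _ _ \<theta>(1,3) E(4)]) (use E(2) D_meas[OF k] in auto)
  moreover have "measure M (Q j - E j) = measure M (Q j) - measure M (E j)"
   using D_fm[OF k] E(2,3) by (intro measurable_measure_Diff) auto
  ultimately show ?thesis by linarith
 qed
 \<comment> \<open>Two indices with the same cube would give disjoint parts, each of more than half its measure.\<close>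
 have inj: "inj Q"
 proof (rule injI, rule ccontr)
  fix i j assume ij: "Q i = Q j" "i ~= j"
  have dis: "E i \<inter> E j = {}" using E(1) ij(2) by (auto simp: disjoint_family_on_def)
  obtain k where k: "Q j : D k" using cubes_level[OF Q(1)] by blast
  have fm: "E i : fmeasurable M" "E j : fmeasurable M"
   using fmeasurableI2[OF D_fm[OF k]] E(2,3) ij(1) by metis+
  have "measure M (E i \<union> E j) = measure M (E i) + measure M (E j)"
   using fm dis by (intro measure_Un_AE) (auto intro!: always_eventually)
  moreover have "measure M (E i \<union> E j) <= measure M (Q j)"
  proof (rule measure_mono_fmeasurable[OF _ _ D_fm[OF k]])
   show "E i \<union> E j \<subseteq> Q j" using E(3)[of i] E(3)[of j] ij(1) by simp
   show "E i \<union> E j : sets M" using E(2) by blast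
  qed
  ultimately show False using big[of i] big[of j] ij(1) D_measure_pos[OF k] by simp
 qed
 let ?Es = "%R. E (inv Q R)"
 have inv: "inv Q (Q j) = j" for j using inj by simp
 have S: "L.sparse (range Q) ?Es (1/2) 1"
  unfolding L.sparse_def
 proof (intro conjI ballI)
  show "range Q \<subseteq> L.cubes" using Q(1) by blast
  fix R assume "R : range Q"
  then obtain j where R: "R = Q j" by blast
  show "?Es R : sets M" "?Es R \<subseteq> R" using E(2,3) unfolding R inv by auto
  show "1/2 * measure M R <= measure M (?Es R)" unfolding R inv using big[of j] measure_nonneg[of M "Q j"] by linarith
 next
  fix x
  have "\<exists>j0. {R : range Q. x : ?Es R} \<subseteq> {Q j0}"
  proof (cases "\<exists>j0. x : E j0")
   case True
   then obtain j0 where j0: "x : E j0" by blast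
   have "R = Q j0" if R: "R : range Q" "x : ?Es R" for R
   proof -
    obtain j where j: "R = Q j" using R(1) by blast
    have "x : E j" using R(2) unfolding j inv .
    then have "j = j0" using E(1) j0 by (auto simp: disjoint_family_on_def)
    then show ?thesis using j by simp
   qed
   then show ?thesis by blast
  next
   case False
   then have "{R : range Q. x : ?Es R} \<subseteq> {Q 0}" by blast
   then show ?thesis by (rule exI)
  qed
  then obtain j0 where j0: "{R : range Q. x : ?Es R} \<subseteq> {Q j0}" by blast
  show "finite {R : range Q. x : ?Es R}" by (rule finite_subset[OF j0]) simp
  show "card {R : range Q. x : ?Es R} <= 1" using card_mono[OF _ j0] by simp
 qed simp_all
 then show "\<exists>Es. L.sparse (range Q) Es (1/2) 1" by blast
 show "~ compact_Lp_op M p lam1 lam2 (bloom_sparse M (range Q) b :: ('a => 'k) => 'a => 'k)" (is "~ compact_Lp_op M p lam1 lam2 ?T")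
 proof
  assume comp: "compact_Lp_op M p lam1 lam2 ?T"
  define a where "a j = Iset M lam1 (Q j) powr (1/p)" for j
  define f where "f j = (%x. (indicator (Q j) x / a j) *\<^sub>R (1::'k))" for j
  have a: "0 < a j" for j
  proof -
   obtain k where k: "Q j : D k" using cubes_level[OF Q(1)] by blast
   show ?thesis unfolding a_def using Ap_on_pos(1)[OF W.dw1 Ap_on_cube(1)[OF k]] by simp
  qed
  have Qs: "Q j : sets M" for j using L.cubes_sets[OF Q(1)] .
  have fm: "f j : borel_measurable M" for j unfolding f_def using Qs[of j] by measurable
  have fW: "WL M p lam1 (%x. norm (f j x)) 1" for j
  proof -
   have "WL M p lam1 (indicator (Q j)) (a j)"
    unfolding a_def using L.muckD(10)[OF muck1 Q(1)] W.w_nonneg(1) Qs p by (intro WL_indicator) auto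
   from WL_scale[OF this, of "1 / a j"] have "WL M p lam1 (%x. 1 / a j * indicator (Q j) x) 1" using a[of j] W.meas(1) by simp
   moreover have "(%x. norm (f j x)) = (%x. 1 / a j * indicator (Q j) x)"
    using a[of j] by (auto simp: f_def indicator_def fun_eq_iff)
   ultimately show ?thesis by simp
  qed
  have fL: "f j : Lp M p lam1" "Lp_norm M p lam1 (f j) <= 1" for j
   using WL_Lp[OF W.meas(1) W.w_nonneg(1) p fm fW] by auto
  have "bounded (range (%j. Lp_norm M p lam1 (f j)))"
   using fL(2) by (intro boundedI[of _ 1]) (auto simp: Lp_norm_def)
  then obtain r g where rg: "strict_mono r" "g : Lp M p lam2" "(%n. Lp_norm M p lam2 (%x. ?T (f (r n)) x - g x)) \<longlonglongrightarrow> 0"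
   using comp fL(1) unfolding compact_Lp_op_def by blast
  have gW: "WL M p lam2 (%x. norm (g x)) (Lp_norm M p lam2 g)" by (rule Lp_WL[OF W.meas(3) W.w_nonneg(2) p rg(2)])
  obtain Y where Y: "!!n. WL M p lam2 (%x. norm (g x) * indicator (E n) x) (Y n)" "Y \<longlonglongrightarrow> 0"
   using WL_restrict_vanish[OF gW _ W.meas(3) W.w_nonneg(2) E(1,2)] p by (metis less_trans zero_less_one)
  define c where "c = eps / (2 * (Kap * Ccb)\<^sup>2)"
  have c: "0 < c" unfolding c_def by (intro divide_pos_pos mult_pos_pos[of 2] zero_less_power KC_pos e) simp
  define X where "X n = Lp_norm M p lam2 (%x. ?T (f (r n)) x - g x)" for n
  have "c <= X n + Y (r n)" for n
  proof -
   let ?j = "r n" let ?h = "?T (f (r n))" let ?s = "Iset M sig2 (Q (r n)) powr (1/q)"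
   obtain k where k: "Q ?j : D k" using cubes_level[OF Q(1)] by blast
   have iQ: "set_integrable M (Q ?j) sig2" using Ap_on_cube(2)[OF k] by (simp add: Ap_on_def)
   have s: "0 < ?s" using Ap_on_pos(2)[OF W.dw2 Ap_on_cube(2)[OF k]] by simp
   have hL: "?h : Lp M p lam2" using comp fL(1) unfolding compact_Lp_op_def by blast
   have hW: "WL M p lam2 (%x. norm (?h x)) (Lp_norm M p lam2 ?h)" by (rule Lp_WL[OF W.meas(3) W.w_nonneg(2) p hL])
   have m: "?h : borel_measurable M" "g : borel_measurable M" using hL rg(2) by (auto simp: Lp_def)
   have ind: "indicat_real (E ?j) : borel_measurable M" using E(2) by simp
   have m1: "(%x. ennreal \<bar>norm (?h x - g x) * indicator (E ?j) x\<bar>) : borel_measurable M"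
    using m ind by measurable
   have m2: "(%x. ennreal \<bar>norm (g x) * indicator (E ?j) x * indicator (E ?j) x\<bar>) : borel_measurable M"
    using m ind by measurable
   have dW: "WL M p lam2 (%x. norm (?h x - g x)) (X n)"
   proof -
    have "WL M p lam2 (%x. norm (?h x - g x)) (4 * (Lp_norm M p lam2 ?h + Lp_norm M p lam2 g))"
    proof (rule WL_mono[OF WL_add[OF hW gW _ W.meas(3) W.w_nonneg(2)]])
     show "AE x in M. \<bar>norm (?h x - g x)\<bar> <= \<bar>norm (?h x) + norm (g x)\<bar>"
      by (intro always_eventually allI) (simp add: norm_triangle_ineq4)
    qed (use m p W.meas W.w_nonneg in auto)
    then have "(%x. ?h x - g x) : Lp M p lam2" using m by (intro WL_Lp(1)[OF W.meas(3) W.w_nonneg(2) p]) auto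
    from Lp_WL[OF W.meas(3) W.w_nonneg(2) p this] show ?thesis unfolding X_def .
   qed
   have "WL M q sig2 (indicator (Q ?j)) ?s" by (rule WL_indicator[OF iQ _ Qs q]) simp
   then have indE: "WL M q sig2 (indicator (E ?j)) ?s"
    by (rule WL_mono) (use E(2,3) q in \<open>auto simp: indicator_def\<close>)
   have H1: "(\<integral>\<^sup>+x. ennreal \<bar>norm (?h x - g x) * indicator (E ?j) x\<bar> \<partial>M) <= ennreal (X n * ?s)"
    by (rule Holder_weighted[OF W.dw2 dW indE])
   have H2: "(\<integral>\<^sup>+x. ennreal \<bar>norm (g x) * indicator (E ?j) x * indicator (E ?j) x\<bar> \<partial>M) <= ennreal (Y ?j * ?s)"
    by (rule Holder_weighted[OF W.dw2 Y(1) indE])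
   have ge: "AE x in M. dv b (Q ?j) x / a ?j <= norm (?h x)"
    using sparse_ae_summable[OF bB S fL(1)[of ?j]]
   proof eventually_elim
    case (elim x)
    show ?case by (rule bloom_sparse_indicator_ge[OF _ _ a _ elim]) (use Q(1) in \<open>auto simp: f_def\<close>)
   qed
   have "ennreal (a ?j) * ennreal (c * ?s) = ennreal (c * (a ?j * ?s))"
    using a[of ?j] c s by (simp flip: ennreal_mult)
   also have "... <= (\<integral>\<^sup>+x. ennreal (dv b (Q ?j) x * indicator (E ?j) x) \<partial>M)"
    unfolding c_def a_def by (rule osc_mass_off_small_set[OF bl C k Q(2) e E(2,3) \<theta>(1,2) E(4)])
   also have "... <= (\<integral>\<^sup>+x. ennreal (a ?j) * (ennreal \<bar>norm (?h x - g x) * indicator (E ?j) x\<bar> + ennreal \<bar>norm (g x) * indicator (E ?j) x * indicator (E ?j) x\<bar>) \<partial>M)"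
    using ge
   proof (intro nn_integral_mono_AE, eventually_elim)
    case (elim x)
    have "dv b (Q ?j) x <= a ?j * norm (?h x)" using elim a[of ?j] by (simp add: pos_divide_le_eq mult.commute)
    also have "... <= a ?j * (norm (?h x - g x) + norm (g x))"
     using a[of ?j] norm_triangle_ineq[of "?h x - g x" "g x"] by (intro mult_left_mono) auto
    finally have 1: "dv b (Q ?j) x <= a ?j * (norm (?h x - g x) + norm (g x))" .
    show ?case
    proof (cases "x : E ?j")
     case True
     have "ennreal (dv b (Q ?j) x) <= ennreal (a ?j * (norm (?h x - g x) + norm (g x)))" using 1 by (rule ennreal_leI)
     then show ?thesis using True a[of ?j] by (simp add: ennreal_mult ennreal_plus)
    qed simp
   qed
   also have "... = ennreal (a ?j) * ((\<integral>\<^sup>+x. ennreal \<bar>norm (?h x - g x) * indicator (E ?j) x\<bar> \<partial>M) + (\<integral>\<^sup>+x. ennreal \<bar>norm (g x) * indicator (E ?j) x * indicator (E ?j) x\<bar> \<partial>M))"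
    unfolding nn_integral_cmult[OF borel_measurable_add[OF m1 m2]] nn_integral_add[OF m1 m2] ..
   also have "... <= ennreal (a ?j) * (ennreal (X n * ?s) + ennreal (Y ?j * ?s))"
    using H1 H2 by (intro mult_left_mono add_mono) auto
   finally have "ennreal (a ?j) * ennreal (c * ?s) <= ennreal (a ?j) * (ennreal (X n * ?s) + ennreal (Y ?j * ?s))" .
   moreover have XY: "0 <= X n" "0 <= Y ?j" using dW Y(1)[of ?j] by (auto simp: WL_def)
   ultimately have "ennreal (a ?j * (c * ?s)) <= ennreal (a ?j * ((X n + Y ?j) * ?s))"
    using a[of ?j] s c by (simp add: ennreal_mult ennreal_plus distrib_right)
   then have "a ?j * (c * ?s) <= a ?j * ((X n + Y ?j) * ?s)" using a[of ?j] s XY by (simp add: ennreal_le_iff)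
   then show ?thesis using a[of ?j] s by (simp add: mult_le_cancel_left_pos mult_le_cancel_right_pos)
  qed
  moreover have "(%n. X n + Y (r n)) \<longlonglongrightarrow> 0 + 0"
   using rg(3) LIMSEQ_subseq_LIMSEQ[OF Y(2) rg(1)] unfolding X_def comp_def by (intro tendsto_add)
  ultimately have "c <= 0 + 0" by (intro LIMSEQ_le_const) auto
  then show False using c by simp
 qed
qed

end

section \<open>Compactness implies vanishing mean oscillation\<close>

lemma powi_between:
 assumes "0 < dlt" "dlt < 1" "0 < t" shows "\<exists>k::int. dlt powi (k + 1) < t & t <= (dlt::real) powi k"
proof -
 define k where "k = \<lfloor>ln t / ln dlt\<rfloor>"
 have l: "ln dlt < 0" using assms by simp
 have k: "real_of_int k <= ln t / ln dlt" "ln t / ln dlt < real_of_int (k + 1)" unfolding k_def by linarith+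
 have pw: "dlt powi m = exp (real_of_int m * ln dlt)" for m
  using powr_real_of_int'[of dlt m] assms by (simp add: powr_def)
 have "ln t <= real_of_int k * ln dlt" using k(1) l by (simp add: le_divide_eq)
 moreover have "real_of_int (k + 1) * ln dlt < ln t" using k(2) l by (simp only: divide_less_eq)
 ultimately show ?thesis using assms unfolding pw
  by (intro exI[of _ k] conjI) (metis exp_less_cancel_iff exp_le_cancel_iff exp_ln)+
qed

lemma powr_inverse_powr: "0 < t ==> 0 < a ==> (t powr (1 / a)) powr a = (t :: real)"
 by (simp add: powr_powr)

context bloom_setting
begin

definition sig2_measure :: "'a measure" where "sig2_measure = density M (%x. ennreal (sig2 x))"

lemma sets_sig2_measure: "sets sig2_measure = sets M" by (simp add: sig2_measure_def)

lemma sig2_measure: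
 assumes A: "A : sets M" "set_integrable M A sig2"
 shows "A : fmeasurable sig2_measure" "measure sig2_measure A = Iset M sig2 A"
proof -
 have "emeasure sig2_measure A = (\<integral>\<^sup>+x\<in>A. ennreal (sig2 x) \<partial>M)"
  unfolding sig2_measure_def by (rule emeasure_density) (use A(1) W.meas in auto)
 also have "... = ennreal (Iset M sig2 A)" by (rule nn_I(1)[OF A(2)]) simp
 finally have e: "emeasure sig2_measure A = ennreal (Iset M sig2 A)" .
 moreover have "0 <= Iset M sig2 A" by (rule nn_I(2)[OF A(2)]) simp
 ultimately show "A : fmeasurable sig2_measure" "measure sig2_measure A = Iset M sig2 A"
  using A(1) sets_sig2_measure by (auto simp: fmeasurable_def measure_def)
qed

lemma sig2_measure_ball:
 assumes "x : space M" "0 < r"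
 shows "B x r : fmeasurable sig2_measure" "measure sig2_measure (B x r) = Iset M sig2 (B x r)"
 using sig2_measure[OF qball_sets[OF assms] sig2_ball(1)[OF assms]] .

lemma sig2_measure_atom:
 assumes "x : space M" "emeasure M {x} = 0" shows "measure sig2_measure {x} = 0"
proof (cases "{x} : sets M")
 case True
 then have "{x} : null_sets M" using assms by (simp add: null_setsI)
 then have "{x} : null_sets sig2_measure" unfolding sig2_measure_def
  using absolutely_continuousI_density[of "%x. ennreal (sig2 x)" M] W.meas by (auto simp: absolutely_continuous_def)
 then show ?thesis by (simp add: measure_eq_0_null_sets)
next
 case False
 then show ?thesis using sets_sig2_measure by (simp add: measure_notin_sets)
qed

end

context bloom_dyadic
begin

lemma sig2_measure_cube:
 assumes "Q : D k"
 shows "Q : fmeasurable sig2_measure" "measure sig2_measure Q = Iset M sig2 Q" "0 < measure sig2_measure Q"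
 using sig2_measure[OF D_meas[OF assms]] Ap_on_cube(2)[OF assms] Ap_on_pos(2)[OF W.dw2 Ap_on_cube(2)[OF assms]]
 by (auto simp: Ap_on_def)

lemma sparse_family_of_sparse:
 assumes S: "L.sparse S Es \<eta> K" shows "sparse_family M d \<eta> S"
 unfolding sparse_family_def
proof
 show "\<exists>dlt c1 C1 N c D. dyadic_system M d dlt c1 C1 N c D & S \<subseteq> (\<Union>k. D k)"
  by (intro exI conjI, rule ds) (use S in \<open>auto simp: L.sparse_def L.cubes_def\<close>)
 show "\<exists>E. (\<forall>Q\<in>S. E Q : sets M & E Q \<subseteq> Q & \<eta> * measure M Q <= measure M (E Q)) \<and>
  (\<exists>K. \<forall>x\<in>space M. finite {Q : S. x : E Q} & card {Q : S. x : E Q} <= K)"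
  using S unfolding L.sparse_def by blast
qed

text \<open>
The parameter $\theta$ is a $q$-th power, so that the two smallness conditions become linear in
$t=\theta^{1/q}$.
\<close>
theorem no_large_osc_sequence:
 fixes b :: "'a => 'k::{real_normed_field, euclidean_space}"
 assumes bB: "b : BMO M d \<nu>" and e: "0 < eps"
  and comp: "!!\<eta> S. 0 < \<eta> ==> \<eta> < 1 ==> sparse_family M d \<eta> S ==> compact_Lp_op M p lam1 lam2 (bloom_sparse M S b :: ('a => 'k) => 'a => 'k)"
  and Q: "!!j::nat. Q j : L.cubes" "!!j. eps <= osc M \<nu> b (Q j)"
  and AB: "(\<forall>i. (%j. measure sig2_measure (Q i \<inter> Q j)) \<longlonglongrightarrow> 0) | filterlim (%j. measure sig2_measure (Q j)) at_top sequentially"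
 shows False
proof -
 obtain C where C: "0 <= C" "!!Q. Q : L.cubes ==> osc M \<nu> b Q <= C" using osc_cube_bounded[OF bB] by metis
 let ?H = "C * Kmain 1 1 * (Kap * Ccb)\<^sup>2"
 have H: "0 <= ?H" using C(1) Kmain_nonneg[of 1 1] by (intro mult_nonneg_nonneg) auto
 define t where "t = min (1 / (4 * (Kap * Ccb))) (eps / (2 * (?H + 1)))"
 have t: "0 < t" unfolding t_def using KC_pos e H by (auto intro!: divide_pos_pos mult_pos_pos)
 have tA: "Kap * Ccb * t <= 1/4"
 proof -
  have "Kap * Ccb * t <= Kap * Ccb * (1 / (4 * (Kap * Ccb)))" using KC_pos by (intro mult_left_mono) (auto simp: t_def)
  also have "X * (1 / (4 * X)) = 1/4" if "0 < X" for X :: real using that by simp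
  note this[OF KC_pos]
  finally show ?thesis .
 qed
 have tH: "?H * t <= eps / 2"
 proof -
  have "?H * t <= (?H + 1) * (eps / (2 * (?H + 1)))" using H t by (intro mult_mono) (auto simp: t_def)
  also have "... = eps / 2" using H by (simp add: divide_simps)
  finally show ?thesis .
 qed
 have q: "0 < q" using p by simp
 define \<theta> where "\<theta> = t powr q"
 have \<theta>: "0 < \<theta>" "\<theta> powr (1/q) = t" unfolding \<theta>_def by (rule powr_gt_zero[THEN iffD2], use t in linarith) (rule powr_powr_inverse[OF t q])
 have fm: "Q j : fmeasurable sig2_measure" "0 < measure sig2_measure (Q j)" for j
  using cubes_level[OF Q(1)[of j]] sig2_measure_cube by blast+
 obtain r E where rE: "strict_mono (r :: nat => nat)" "disjoint_family E"
  "!!j. E j : sets sig2_measure" "!!j. E j \<subseteq> Q (r j)" "!!j. measure sig2_measure (Q (r j) - E j) <= \<theta> * measure sig2_measure (Q (r j))"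
  using sparse_selection[OF fm \<theta>(1) AB] by blast
 have Es: "E j : sets M" for j using rE(3) sets_sig2_measure by simp
 have small: "Iset M sig2 (Q (r j) - E j) <= \<theta> * Iset M sig2 (Q (r j))" for j
 proof -
  obtain k where k: "Q (r j) : D k" using cubes_level[OF Q(1)] by blast
  have F: "Q (r j) - E j : sets M" using D_meas[OF k] Es by blast
  have "set_integrable M (Q (r j)) sig2" using Ap_on_cube(2)[OF k] by (simp add: Ap_on_def)
  from set_integrable_sub[OF this F] have "set_integrable M (Q (r j) - E j) sig2" by blast
  from sig2_measure(2)[OF F this] show ?thesis using rE(5)[of j] sig2_measure_cube(2)[OF k] by simp
 qed
 have "?H * \<theta> powr (1/q) <= eps / 2" "Kap * Ccb * \<theta> powr (1/q) <= 1/4" unfolding \<theta>(2) by (rule tH, rule tA)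
 note nc = not_compact_of_disjoint_major_parts[where Q = "%j. Q (r j)" and E = E, OF bB C e Q(1) Q(2) rE(2) Es rE(4) small \<theta>(1) this]
 from nc(1) obtain Es' where "L.sparse (range (%j. Q (r j))) Es' (1/2) 1" by blast
 from sparse_family_of_sparse[OF this] have "compact_Lp_op M p lam1 lam2 (bloom_sparse M (range (%j. Q (r j))) b :: ('a => 'k) => 'a => 'k)"
  by (rule comp[rotated 2]) simp_all
 then show False using nc(2) by contradiction
qed

end

context bloom_setting
begin

text \<open>
The balls are assigned to generations by their radii. If the radii tend to zero, overlaps vanish
because there are no atoms. Otherwise, if overlaps with every fixed ball vanish, so do the
overlaps among the cubes; and if infinitely many cubes keep meeting a fixed ball, their sizes tend
to infinity, hence by doubling so do their $\sigma$-measures.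
\<close>
theorem compact_imp_VMO:
 fixes b :: "'a => 'k::{real_normed_field, euclidean_space}"
 assumes inf: "emeasure M (space M) = \<infinity>" and atoms: "!!x. x : space M ==> emeasure M {x} = 0"
  and x0: "x\<^sub>0 : space M" and b: "b : BMO M d \<nu>"
  and comp: "!!\<eta> S. 0 < \<eta> ==> \<eta> < 1 ==> sparse_family M d \<eta> S ==> compact_Lp_op M p lam1 lam2 (bloom_sparse M S b :: ('a => 'k) => 'a => 'k)"
 shows "b : VMO M d x\<^sub>0 \<nu>"
proof (rule VMO_of_no_bad_sequence[OF b W.nu_nonneg inf x0])
 fix eps and x0s :: "nat => 'a" and r0 :: "nat => real"
 assume e: "0 < eps" and x0s: "!!j. x0s j : space M" and r0: "!!j. 0 < r0 j" and osc0: "!!j. eps <= osc M \<nu> b (B (x0s j) (r0 j))"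
  and lim0: "r0 \<longlonglongrightarrow> 0 | filterlim (%j. r0 j + d (x0s j) x\<^sub>0) at_top sequentially"
 have bl: "b : L1_loc M d" using b by (simp add: BMO_def)
 have A: "1 <= A\<^sub>0" using A0_ge_1 .
 define dlt where "dlt = 1 / (16 * A\<^sub>0 ^ 4)"
 define c1 where "c1 = 1 / (4 * A\<^sub>0\<^sup>2)"
 define C1 where "C1 = 5 * A\<^sub>0\<^sup>2"
 have A4: "1 <= A\<^sub>0 ^ 4" using A by simp
 have dlt: "0 < dlt" "dlt < 1"
 proof -
  show "0 < dlt" unfolding dlt_def using A4 by (intro divide_pos_pos) linarith+
  show "dlt < 1" unfolding dlt_def using A4 by (subst divide_less_eq_1_pos) linarith+
 qed
 have dp: "0 < dlt powi k" for k using powi_pos[OF dlt(1)] .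
 have c1: "0 < c1" unfolding c1_def using A by simp
 \<comment> \<open>The generation in which the inner ball of a cube is just large enough to contain the given ball.\<close>
 have "\<exists>k::int. c1 * dlt powi (k + 1) < r0 j & r0 j <= c1 * dlt powi k" for j
 proof -
  have "0 < r0 j / c1" using r0 c1 by simp
  from powi_between[OF dlt this] obtain k where "dlt powi (k + 1) < r0 j / c1" "r0 j / c1 <= dlt powi k" by blast
  then show ?thesis using c1 by (intro exI[of _ k]) (simp add: pos_less_divide_eq pos_divide_le_eq mult.commute)
 qed
 then obtain k0 where k0: "!!j. c1 * dlt powi (k0 j + 1) < r0 j" "!!j. r0 j <= c1 * dlt powi (k0 j)" by metis
 have "eventually (%j. k0 j ~= k0 i | dlt powi (k0 i) <= d (x0s i) (x0s j)) sequentially" for i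
  using lim0
 proof
  assume "r0 \<longlonglongrightarrow> 0"
  then have "eventually (%j. r0 j < c1 * dlt powi (k0 i + 1)) sequentially"
   using c1 dp[of "k0 i + 1"] by (intro order_tendstoD(2)) auto
  then show ?thesis
  proof eventually_elim
   case (elim j)
   then show ?case using k0(1)[of j] by (cases "k0 j = k0 i") auto
  qed
 next
  assume "filterlim (%j. r0 j + d (x0s j) x\<^sub>0) at_top sequentially"
  then have "eventually (%j. c1 * dlt powi (k0 i) + A\<^sub>0 * (dlt powi (k0 i) + d (x0s i) x\<^sub>0) <= r0 j + d (x0s j) x\<^sub>0) sequentially"
   unfolding filterlim_at_top by blast
  then show ?thesis
  proof eventually_elim
   case (elim j)
   have "dlt powi (k0 i) <= d (x0s i) (x0s j)" if "k0 j = k0 i"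
   proof -
    have "r0 j <= c1 * dlt powi (k0 i)" using k0(2)[of j] that by simp
    then have "A\<^sub>0 * (dlt powi (k0 i) + d (x0s i) x\<^sub>0) <= d (x0s j) x\<^sub>0" using elim by linarith
    also have "... <= A\<^sub>0 * (d (x0s j) (x0s i) + d (x0s i) x\<^sub>0)" by (rule d_triangle[OF x0s x0 x0s])
    finally have "dlt powi (k0 i) + d (x0s i) x\<^sub>0 <= d (x0s j) (x0s i) + d (x0s i) x\<^sub>0" using A by (simp add: mult_le_cancel_left)
    then show ?thesis using d_sym[OF x0s[of i] x0s[of j]] by simp
   qed
   then show ?case by blast
  qed
 qed
 \<comment> \<open>Distinct members of one generation are now separated, as a net requires.\<close>
 from diagonal_subsequence_choice[of "%n i j. k0 j ~= k0 i | dlt powi (k0 i) <= d (x0s i) (x0s j)", OF this]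
 obtain u :: "nat => nat" where u0: "strict_mono u & (\<forall>i j. i < j --> k0 (u j) ~= k0 (u i) | dlt powi (k0 (u i)) <= d (x0s (u i)) (x0s (u j)))"
  by (elim exE) (rule that)
 have u: "strict_mono u" "!!i j. i < j ==> k0 (u j) ~= k0 (u i) | dlt powi (k0 (u i)) <= d (x0s (u i)) (x0s (u j))"
  using u0[THEN conjunct1] u0[THEN conjunct2, rule_format] by this
 define x where "x j = x0s (u j)" for j
 define r where "r j = r0 (u j)" for j
 define k where "k j = k0 (u j)" for j
 have x: "x j : space M" for j unfolding x_def by (rule x0s)
 have r: "0 < r j" for j unfolding r_def by (rule r0)
 have osc: "eps <= osc M \<nu> b (B (x j) (r j))" for j unfolding x_def r_def by (rule osc0)
 have k: "c1 * dlt powi (k j + 1) < r j" "r j <= c1 * dlt powi (k j)" for j unfolding r_def k_def by (rule k0)+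
 have lim: "r \<longlonglongrightarrow> 0 | filterlim (%j. r j + d (x j) x\<^sub>0) at_top sequentially"
  using lim0
 proof
  assume "r0 \<longlonglongrightarrow> 0"
  from LIMSEQ_subseq_LIMSEQ[OF this u(1)] show ?thesis unfolding r_def comp_def by blast
 next
  assume "filterlim (%j. r0 j + d (x0s j) x\<^sub>0) at_top sequentially"
  from filterlim_compose[OF this filterlim_subseq[OF u(1)]] show ?thesis unfolding r_def x_def by blast
 qed
 have sep: "separated (dlt powi K) {x j |j. k j = K}" for K
  unfolding separated_def
 proof (intro conjI ballI impI)
  show "{x j |j. k j = K} \<subseteq> space M" using x by blast
  fix y z assume y: "y : {x j |j. k j = K}" and z: "z : {x j |j. k j = K}" and ne: "y ~= z"
  obtain i j where ij: "y = x i" "k i = K" "z = x j" "k j = K" using y z by blast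
  have "i ~= j" using ne ij by blast
  then consider "i < j" | "j < i" by linarith
  then show "dlt powi K <= d y z"
  proof cases
   case 1 show ?thesis using u(2)[OF 1] ij by (simp add: x_def k_def)
  next
   case 2 show ?thesis using u(2)[OF 2] ij d_sym[OF x[of i] x[of j]] by (simp add: x_def k_def)
  qed
 qed
 obtain N c D where ds: "dyadic_system M d dlt c1 C1 N c D" and cen: "\<forall>K. \<forall>y\<in>{x j |j. k j = K}. \<exists>Q\<in>D K. c K Q = y"
  using dyadic_system_with_centers[OF dlt_def sep] unfolding c1_def C1_def by blast
 interpret bloom_dyadic M d A\<^sub>0 C\<^sub>\<mu> p lam1 lam2 \<nu> dlt c1 C1 N c D
  by unfold_locales (rule ds)
 have "\<forall>j. \<exists>Q. Q : D (k j) & c (k j) Q = x j" using cen by blast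
 from choice[OF this] obtain Q where Q: "!!j. Q j : D (k j)" "!!j. c (k j) (Q j) = x j" by blast
 have Qc: "Q j : L.cubes" for j using Q(1) by (auto simp: L.cubes_def)
 define s where "s j = C1 * dlt powi (k j)" for j
 have s: "0 < s j" for j unfolding s_def by (rule sc_pos)
 have inner: "B (x j) (c1 * dlt powi (k j)) \<subseteq> Q j" and outer: "Q j \<subseteq> B (x j) (s j)" for j
  using D_ball(2,3)[OF Q(1)[of j]] unfolding Q(2) s_def by auto
 define T where "T = C1 / (c1 * dlt)"
 have T: "0 < T" unfolding T_def using params by simp
 have sT: "s j <= T * r j" for j
 proof -
  have "c1 * dlt * dlt powi (k j) <= r j" using k(1)[of j] dlt(1) by (simp add: power_int_add mult_ac)
  then have "T * (c1 * dlt * dlt powi (k j)) <= T * r j" using T by (intro mult_left_mono) auto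
  moreover have "T * (c1 * dlt * dlt powi (k j)) = s j" unfolding T_def s_def using params by simp
  ultimately show ?thesis by simp
 qed
 have rs: "r j <= s j" for j
  using k(2)[of j] mult_right_mono[OF params(4), of "dlt powi (k j)"] dp[of "k j"] unfolding s_def by linarith
 obtain C2 where C2: "1 <= C2" "\<forall>x\<in>space M. \<forall>r>0. measure M (B x (T * r)) <= C2 * measure M (B x r)"
  using doubling_ratio[of T] by blast
 define K2 where "K2 = 2 * ((Kap * Ccb * C2)\<^sup>2 * (Kap * Ccb * C2)\<^sup>2)"
 have K2: "0 < K2" unfolding K2_def using Kap(1) Ccb(1) C2(1) by (intro mult_pos_pos zero_less_power) auto
 have oscQ: "eps / K2 <= osc M \<nu> b (Q j)" for j
 proof -
  have sub: "B (x j) (r j) \<subseteq> Q j" using B_mono[OF k(2)] inner by (rule order_trans)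
  have "measure M (Q j) <= measure M (B (x j) (T * r j))"
   using B_mono[OF sT] outer[of j] T r[of j] x D_meas[OF Q(1)] by (intro measure_B_mono) auto
  also have "... <= C2 * measure M (B (x j) (r j))" using C2(2) x r by blast
  finally have m: "measure M (Q j) <= C2 * measure M (B (x j) (r j))" .
  have "osc M \<nu> b (B (x j) (r j)) <= K2 * osc M \<nu> b (Q j)"
   unfolding K2_def by (rule W.osc_le[OF Ap_on_cube[OF Q(1)] qball_sets[OF x r] sub measure_B_pos[OF x r] KC_pos KC_pos C2(1) m local_int[OF bl Q(1)]])
  then have "eps <= K2 * osc M \<nu> b (Q j)" using osc[of j] by linarith
  then show ?thesis using K2 by (simp add: pos_divide_le_eq mult.commute)
 qed
 have e2: "0 < eps / K2" using e K2 by simp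
 let ?m = "measure sig2_measure"
 show False
 proof (cases "r \<longlonglongrightarrow> 0")
  case True
  have s0: "s \<longlonglongrightarrow> 0"
  proof (rule tendsto_sandwich[OF _ _ tendsto_const])
   show "(%j. T * r j) \<longlonglongrightarrow> 0" using tendsto_mult_right_zero[OF True, of T] .
   show "eventually (%j. s j <= T * r j) sequentially" using sT by simp
   show "eventually (%j. 0 <= s j) sequentially" using s by (simp add: less_imp_le)
  qed
  have "(%j. ?m (Q i \<inter> Q j)) \<longlonglongrightarrow> 0" for i
   by (rule shrinking_sets_vanish[OF sets_sig2_measure sig2_measure_cube(1)[OF Q(1)] sig2_measure_ball(1) sig2_measure_atom[OF _ atoms] D_meas[OF Q(1)] outer x s0])
  then have AB: "(\<forall>i. (%j. ?m (Q i \<inter> Q j)) \<longlonglongrightarrow> 0) | filterlim (%j. ?m (Q j)) at_top sequentially" by simp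
  show False by (rule no_large_osc_sequence[where Q = Q, OF b e2 _ Qc oscQ AB]) (rule comp)
 next
  case False
  then have far: "filterlim (%j. r j + d (x j) x\<^sub>0) at_top sequentially" using lim by blast
  show False
  proof (cases "\<forall>R>0. (%j. ?m (B x\<^sub>0 R \<inter> Q j)) \<longlonglongrightarrow> 0")
   case True
   have "(%j. ?m (Q i \<inter> Q j)) \<longlonglongrightarrow> 0" for i
   proof -
    let ?R = "A\<^sub>0 * (d x\<^sub>0 (x i) + s i)"
    have R: "0 < ?R" using A s[of i] d_nonneg[OF x0 x[of i]] by (intro mult_pos_pos) auto
    have sub: "Q i \<subseteq> B x\<^sub>0 ?R" using outer[of i] B_subset[OF x[of i] x0, of "s i"] by (rule order_trans)
    show ?thesis
    proof (rule tendsto_sandwich[OF _ _ tendsto_const True[rule_format, OF R]])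
     show "eventually (%j. ?m (Q i \<inter> Q j) <= ?m (B x\<^sub>0 ?R \<inter> Q j)) sequentially"
     proof (intro always_eventually allI)
      fix j
      show "?m (Q i \<inter> Q j) <= ?m (B x\<^sub>0 ?R \<inter> Q j)"
      proof (rule measure_mono_fmeasurable)
       show "Q i \<inter> Q j \<subseteq> B x\<^sub>0 ?R \<inter> Q j" using sub by blast
       show "Q i \<inter> Q j : sets sig2_measure" using D_meas[OF Q(1)] sets_sig2_measure by auto
       show "B x\<^sub>0 ?R \<inter> Q j : fmeasurable sig2_measure"
        using sig2_measure_ball(1)[OF x0 R] sig2_measure_cube(1)[OF Q(1)[of j]] by (intro fmeasurable_Int_fmeasurable) auto
      qed
     qed
    qed simp
   qed
   then have AB: "(\<forall>i. (%j. ?m (Q i \<inter> Q j)) \<longlonglongrightarrow> 0) | filterlim (%j. ?m (Q j)) at_top sequentially" by simp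
   show False by (rule no_large_osc_sequence[where Q = Q, OF b e2 _ Qc oscQ AB]) (rule comp)
  next
   case False
   then obtain R where R: "0 < R" "~ (%j. ?m (B x\<^sub>0 R \<inter> Q j)) \<longlonglongrightarrow> 0" by blast
   have inf_meet: "infinite {j. B x\<^sub>0 R \<inter> Q j ~= {}}"
   proof
    assume "finite {j. B x\<^sub>0 R \<inter> Q j ~= {}}"
    then have "eventually (%j. ~ (B x\<^sub>0 R \<inter> Q j ~= {})) sequentially"
     unfolding cofinite_eq_sequentially[symmetric] eventually_cofinite by simp
    then have "eventually (%j. ?m (B x\<^sub>0 R \<inter> Q j) = 0) sequentially" by eventually_elim simp
    then have "(%j. ?m (B x\<^sub>0 R \<inter> Q j)) \<longlonglongrightarrow> 0" by (rule tendsto_eventually)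
    then show False using R(2) by contradiction
   qed
   define v where "v = enumerate {j. B x\<^sub>0 R \<inter> Q j ~= {}}"
   have v: "strict_mono v" "!!j. B x\<^sub>0 R \<inter> Q (v j) ~= {}"
    unfolding v_def using strict_mono_enumerate[OF inf_meet] enumerate_in_set[OF inf_meet] by auto
   have dx: "d (x (v j)) x\<^sub>0 <= A\<^sub>0 * (s (v j) + R)" for j
   proof -
    obtain z where z: "z : B x\<^sub>0 R" "z : Q (v j)" using v(2)[of j] by blast
    have z': "z : space M" "d x\<^sub>0 z < R" "d (x (v j)) z < s (v j)" using z outer[of "v j"] by (auto simp: in_B)
    have "d (x (v j)) x\<^sub>0 <= A\<^sub>0 * (d (x (v j)) z + d z x\<^sub>0)" by (rule d_triangle[OF x x0 z'(1)])
    also have "... <= A\<^sub>0 * (s (v j) + R)" using z' d_sym[OF x0 z'(1)] A by (intro mult_left_mono) auto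
    finally show ?thesis .
   qed
   have far': "filterlim (%j. r (v j) + d (x (v j)) x\<^sub>0) at_top sequentially"
    by (rule filterlim_compose[OF far filterlim_subseq[OF v(1)]])
   have s_large: "eventually (%j. Z <= s (v j)) sequentially" for Z
   proof -
    have "eventually (%j. Z + A\<^sub>0 * (Z + R) <= r (v j) + d (x (v j)) x\<^sub>0) sequentially"
     using far' unfolding filterlim_at_top by blast
    then show ?thesis
    proof eventually_elim
     case (elim j)
     show ?case
     proof (rule ccontr)
      assume "~ Z <= s (v j)"
      then have lt: "s (v j) < Z" by simp
      then have "A\<^sub>0 * (s (v j) + R) <= A\<^sub>0 * (Z + R)" using A by (intro mult_left_mono) auto
      then show False using elim dx[of j] rs[of "v j"] lt by linarith
     qed
    qed
   qed
   define T3 where "T3 = 3 * A\<^sub>0\<^sup>2"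
   obtain C3 where C3: "1 <= C3" "\<forall>x\<in>space M. \<forall>r>0. measure M (B x (T3 * C1 / c1 * r)) <= C3 * measure M (B x r)"
    using doubling_ratio[of "T3 * C1 / c1"] by blast
   have q: "0 < q" "q ~= 0" using p by auto
   define K4 where "K4 = (Kap / (1 / C3)) powr q"
   have KC3: "0 < Kap / (1 / C3)" using Kap(1) C3(1) by simp
   have K4: "0 < K4" unfolding K4_def by (rule powr_gt_zero[THEN iffD2]) (use KC3 in linarith)
   have grow: "Iset M sig2 (B x\<^sub>0 (real (Suc n))) <= K4 * Iset M sig2 (Q (v j))" if big: "max R (real (Suc n)) <= s (v j)" for n j
   proof -
    let ?i = "v j" let ?B = "B (x ?i) (T3 * s ?i)"
    have T3s: "0 < T3 * s ?i" unfolding T3_def using A s[of ?i] by simp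
    have "B x\<^sub>0 (real (Suc n)) \<subseteq> B (x ?i) (A\<^sub>0 * (d (x ?i) x\<^sub>0 + real (Suc n)))" by (rule B_subset[OF x0 x])
    also have "... \<subseteq> ?B"
    proof (rule B_mono)
     have "d (x ?i) x\<^sub>0 <= A\<^sub>0 * (s ?i + s ?i)" using dx[of j] big A by (intro order_trans[OF dx] mult_left_mono add_left_mono) auto
     moreover have "real (Suc n) <= A\<^sub>0 * s ?i" using big mult_right_mono[OF A, of "s ?i"] s[of ?i] unfolding max.bounded_iff by linarith
     ultimately have "A\<^sub>0 * (d (x ?i) x\<^sub>0 + real (Suc n)) <= A\<^sub>0 * (A\<^sub>0 * (s ?i + s ?i) + A\<^sub>0 * s ?i)"
      using A by (intro mult_left_mono add_mono) auto
     also have "... = T3 * s ?i" unfolding T3_def power2_eq_square by (simp add: algebra_simps)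
     finally show "A\<^sub>0 * (d (x ?i) x\<^sub>0 + real (Suc n)) <= T3 * s ?i" .
    qed
    finally have sub: "B x\<^sub>0 (real (Suc n)) \<subseteq> ?B" .
    have iB: "set_integrable M ?B sig2" using sig2_ball(1)[OF x T3s] .
    have 1: "Iset M sig2 (B x\<^sub>0 (real (Suc n))) <= Iset M sig2 ?B"
     by (rule I_mono[OF iB _ qball_sets[OF x0] sub]) simp_all
    have QB: "Q ?i \<subseteq> ?B"
    proof (rule order_trans[OF outer B_mono])
     have "1 <= A\<^sub>0\<^sup>2" using A by simp
     then have "1 <= T3" unfolding T3_def by linarith
     then show "s ?i <= T3 * s ?i" using mult_right_mono[of 1 T3 "s ?i"] s[of ?i] by simp
    qed
    have e1: "T3 * s ?i = T3 * C1 / c1 * (c1 * dlt powi (k ?i))" unfolding s_def using c1 by simp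
    have "measure M ?B <= C3 * measure M (B (x ?i) (c1 * dlt powi (k ?i)))"
     unfolding e1 using C3(2) x sc_pos(1) by blast
    also have "... <= C3 * measure M (Q ?i)"
     using D_inner_le[OF Q(1)[of ?i]] C3(1) unfolding Q(2) by (intro mult_left_mono) auto
    finally have "1 / C3 * measure M ?B <= measure M (Q ?i)" using C3(1) by (simp add: pos_divide_le_eq mult.commute)
    from sig2_compare[OF x T3s D_meas[OF Q(1)] QB _ this] C3(1)
    have 2: "Iset M sig2 ?B powr (1/q) <= (Kap / (1 / C3)) * Iset M sig2 (Q ?i) powr (1/q)" by simp
    have pos: "0 < Iset M sig2 ?B" "0 < Iset M sig2 (Q ?i)"
     using sig2_ball(2)[OF x T3s] sig2_measure_cube(2,3)[OF Q(1)[of ?i]] by auto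
    have pq: "(t powr (1/q)) powr q = t" if "0 < t" for t :: real
     by (rule powr_inverse_powr[OF that q(1)])
    have "Iset M sig2 ?B = (Iset M sig2 ?B powr (1/q)) powr q" using pq[OF pos(1)] by simp
    also have "... <= ((Kap / (1 / C3)) * Iset M sig2 (Q ?i) powr (1/q)) powr q"
     by (rule powr_mono2[OF _ _ 2]) (use q in linarith, simp)
    also have "... = K4 * Iset M sig2 (Q ?i)" unfolding powr_mult K4_def pq[OF pos(2)] ..
    finally show ?thesis using 1 by linarith
   qed
   have "filterlim (%j. ?m (Q (v j))) at_top sequentially"
    unfolding filterlim_at_top
   proof
    fix Z
    have "eventually (%n. K4 * Z <= Iset M sig2 (B x\<^sub>0 (real (Suc n)))) sequentially"
     using sig2_balls_at_top[OF inf x0] unfolding filterlim_at_top by blast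
    then obtain n where n: "K4 * Z <= Iset M sig2 (B x\<^sub>0 (real (Suc n)))" unfolding eventually_sequentially by blast
    show "eventually (%j. Z <= ?m (Q (v j))) sequentially"
     using s_large[of "max R (real (Suc n))"]
    proof eventually_elim
     case (elim j)
     have "K4 * Z <= K4 * Iset M sig2 (Q (v j))" using n grow[OF elim] by linarith
     then show ?case using K4 sig2_measure_cube(2)[OF Q(1)[of "v j"]] by simp
    qed
   qed
   then have AB: "(\<forall>i. (%j. ?m (Q (v i) \<inter> Q (v j))) \<longlonglongrightarrow> 0) | filterlim (%j. ?m (Q (v j))) at_top sequentially" by simp
   show False by (rule no_large_osc_sequence[where Q = "%j. Q (v j)", OF b e2 _ Qc oscQ AB]) (rule comp)
  qed
 qed
qed

end

theorem theorem1p1: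
  fixes M :: "'a measure" and d :: "'a \<Rightarrow> 'a \<Rightarrow> real" and A\<^sub>0 C\<^sub>\<mu> p :: real and x\<^sub>0 :: 'a
    and lam1 lam2 \<nu> :: "'a \<Rightarrow> real"
    and b :: "'a \<Rightarrow> 'k::{real_normed_field, euclidean_space}"
  assumes "homogeneous_type M d A\<^sub>0 C\<^sub>\<mu>"
    and "emeasure M (space M) = \<infinity>"
    and "\<forall>x\<in>space M. emeasure M {x} = 0"
    and "x\<^sub>0 \<in> space M"
    and "1 < p"
    and "lam1 \<in> Ap M d p" and "lam2 \<in> Ap M d p"
    and "\<nu> = (\<lambda>x. lam1 x powr (1 / p) * lam2 x powr (- 1 / p))"
    and "b \<in> BMO M d \<nu>"
  shows "(b \<in> VMO M d x\<^sub>0 \<nu> \<longrightarrow>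
           (\<forall>\<eta> S. 0 < \<eta> \<and> \<eta> < 1 \<and> sparse_family M d \<eta> S \<longrightarrow>
              compact_Lp_op M p lam1 lam2 (bloom_sparse M S b :: ('a \<Rightarrow> 'k) \<Rightarrow> ('a \<Rightarrow> 'k)))) \<and>
         ((\<forall>\<eta> S. 0 < \<eta> \<and> \<eta> < 1 \<and> sparse_family M d \<eta> S \<longrightarrow>
              compact_Lp_op M p lam1 lam2 (bloom_sparse M S b :: ('a \<Rightarrow> 'k) \<Rightarrow> ('a \<Rightarrow> 'k))) \<longrightarrow>
           b \<in> VMO M d x\<^sub>0 \<nu>)"
proof -
 interpret homogeneous_type M d A\<^sub>0 C\<^sub>\<mu> by (rule assms(1))
 interpret bloom_setting M d A\<^sub>0 C\<^sub>\<mu> p lam1 lam2 \<nu>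
  by unfold_locales (fact assms)+
 show ?thesis
 proof (intro conjI impI allI)
  fix \<eta> S assume b: "b : VMO M d x\<^sub>0 \<nu>" and S: "0 < \<eta> & \<eta> < 1 & sparse_family M d \<eta> S"
  obtain dlt c\<^sub>1 C\<^sub>1 N c D where ds: "dyadic_system M d dlt c\<^sub>1 C\<^sub>1 N c D" and SD: "S \<subseteq> (\<Union>k. D k)"
   using S unfolding sparse_family_def by blast
  obtain E K where E: "\<forall>Q\<in>S. E Q : sets M & E Q \<subseteq> Q & \<eta> * measure M Q <= measure M (E Q)"
   and K: "\<forall>x\<in>space M. finite {Q : S. x : E Q} & card {Q : S. x : E Q} <= K"
   using S unfolding sparse_family_def by blast
  interpret bloom_dyadic M d A\<^sub>0 C\<^sub>\<mu> p lam1 lam2 \<nu> dlt c\<^sub>1 C\<^sub>1 N c D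
   by unfold_locales (rule ds)
  have "L.sparse S E \<eta> K" unfolding L.sparse_def L.cubes_def using S SD E K by simp
  from VMO_imp_compact[OF b assms(4) this]
  show "compact_Lp_op M p lam1 lam2 (bloom_sparse M S b :: ('a => 'k) => ('a => 'k))" .
 next
  assume "\<forall>\<eta> S. 0 < \<eta> & \<eta> < 1 & sparse_family M d \<eta> S -->
   compact_Lp_op M p lam1 lam2 (bloom_sparse M S b :: ('a => 'k) => ('a => 'k))"
  then show "b : VMO M d x\<^sub>0 \<nu>"
   using compact_imp_VMO[OF assms(2) _ assms(4) assms(9)] assms(3) by blast
 qed
qed

end
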